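(* Let $X$ be an $\mathsf{F}$-space. Then $C(X)$ is a $2$-coherent regular ring, and consequently $C(X)$ is $\mathsf{K}_0$-regular.
   Context: $C(X)$ is the ring of all continuous real-valued functions on $X$ with pointwise operations. A compactum (compact Hausdorff space) $X$ is an $\mathsf{F}$-space if $C(X)$ is a Bézout ring, i.e. every finitely generated ideal is principal. For a commutative ring $R$: an $R$-module $M$ is finitely $n$-presented if there is an exact sequence $F_n\to\cdots\to F_0\to M\to 0$ with all $F_i$ finitely generated projective, and finitely $\infty$-presented if it has a resolution by finitely generated projective modules. $R$ is $2$-coherent if every finitely $2$-presented $R$-module is finitely $3$-presented; $R$ is regular if every finitely $\infty$-presented $R$-module has finite projective dimension; $R$ is $2$-coherent regular if it is both. $R$ is $\mathsf{K}_0$-regular if for every integer $m\ge 1$ the natural homomorphism $\mathsf{K}_0(R)\to\mathsf{K}_0(R[x_1,\dots,x_m])$ induced by the inclusion is an isomorphism, where $\mathsf{K}_0$ is the Grothendieck group of finitely generated projective modules. *)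

theory Defs
  imports "HOL-Analysis.Analysis" "HOL-Algebra.Algebra" "HOL-Library.Extended_Nat"
begin

section \<open>The ring of continuous functions and F-spaces\<close>

definition cont_ring :: "'x topology \<Rightarrow> ('x \<Rightarrow> real) ring" where
  "cont_ring T =
     \<lparr>carrier = {f. continuous_map T euclideanreal f \<and> f \<in> extensional (topspace T)},
      monoid.mult = (\<lambda>f g. \<lambda>x\<in>topspace T. f x * g x),
      one = (\<lambda>x\<in>topspace T. 1),
      ring.zero = (\<lambda>x\<in>topspace T. 0),
      ring.add = (\<lambda>f g. \<lambda>x\<in>topspace T. f x + g x)\<rparr>"

definition bezout_ring :: "('r, 'k) ring_scheme \<Rightarrow> bool" where
  "bezout_ring R \<longleftrightarrow>
     cring R \<and> (\<forall>A. finite A \<longrightarrow> A \<subseteq> carrier R \<longrightarrow> principalideal (genideal R A) R)"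

definition F_space :: "'x topology \<Rightarrow> bool" where
  "F_space T \<longleftrightarrow> compact_space T \<and> Hausdorff_space T \<and> bezout_ring (cont_ring T)"


section \<open>Modules\<close>

text \<open>Module records inherit the fields \<open>mult\<close> and \<open>one\<close> from ring records.
  They carry no meaning for modules and are filled with dummy values below.\<close>

definition mod_hom ::
  "('r, 'k) ring_scheme \<Rightarrow> ('r, 'p) module \<Rightarrow> ('r, 'q) module \<Rightarrow> ('p \<Rightarrow> 'q) set" where
  "mod_hom R M N =
     {f \<in> carrier M \<rightarrow> carrier N.
        (\<forall>x\<in>carrier M. \<forall>y\<in>carrier M. f (x \<oplus>\<^bsub>M\<^esub> y) = f x \<oplus>\<^bsub>N\<^esub> f y) \<and>
        (\<forall>a\<in>carrier R. \<forall>x\<in>carrier M. f (a \<odot>\<^bsub>M\<^esub> x) = a \<odot>\<^bsub>N\<^esub> f x)}"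

definition mod_isomorphic ::
  "('r, 'k) ring_scheme \<Rightarrow> ('r, 'p) module \<Rightarrow> ('r, 'q) module \<Rightarrow> bool" where
  "mod_isomorphic R M N \<longleftrightarrow> (\<exists>f \<in> mod_hom R M N. bij_betw f (carrier M) (carrier N))"

definition dir_sum :: "('r, 'p) module \<Rightarrow> ('r, 'q) module \<Rightarrow> ('r, 'p \<times> 'q) module" where
  "dir_sum M N =
     \<lparr>carrier = carrier M \<times> carrier N,
      monoid.mult = (\<lambda>_ _. (\<zero>\<^bsub>M\<^esub>, \<zero>\<^bsub>N\<^esub>)),
      one = (\<zero>\<^bsub>M\<^esub>, \<zero>\<^bsub>N\<^esub>),
      ring.zero = (\<zero>\<^bsub>M\<^esub>, \<zero>\<^bsub>N\<^esub>),
      ring.add = (\<lambda>(x, y) (x', y'). (x \<oplus>\<^bsub>M\<^esub> x', y \<oplus>\<^bsub>N\<^esub> y')),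
      smult = (\<lambda>a (x, y). (a \<odot>\<^bsub>M\<^esub> x, a \<odot>\<^bsub>N\<^esub> y))\<rparr>"

definition free_module :: "('r, 'k) ring_scheme \<Rightarrow> 'i set \<Rightarrow> ('r, 'i \<Rightarrow> 'r) module" where
  "free_module R I =
     \<lparr>carrier = {f. (\<forall>i\<in>I. f i \<in> carrier R) \<and> (\<forall>i. i \<notin> I \<longrightarrow> f i = \<zero>\<^bsub>R\<^esub>) \<and>
                    finite {i. f i \<noteq> \<zero>\<^bsub>R\<^esub>}},
      monoid.mult = (\<lambda>_ _ _. \<zero>\<^bsub>R\<^esub>),
      one = (\<lambda>_. \<zero>\<^bsub>R\<^esub>),
      ring.zero = (\<lambda>_. \<zero>\<^bsub>R\<^esub>),
      ring.add = (\<lambda>f g i. f i \<oplus>\<^bsub>R\<^esub> g i),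
      smult = (\<lambda>a f i. a \<otimes>\<^bsub>R\<^esub> f i)\<rparr>"

text \<open>A module is projective if it is a direct summand of a free module. A module with
  carrier in \<open>'p\<close> is a quotient of the free module on its own carrier, so index sets
  \<open>I :: 'p set\<close> and complements with carrier in \<open>'p \<Rightarrow> 'r\<close> are no restriction.\<close>

definition projective_module :: "('r, 'k) ring_scheme \<Rightarrow> ('r, 'p) module \<Rightarrow> bool" where
  "projective_module R P \<longleftrightarrow>
     Module.module R P \<and>
     (\<exists>(I :: 'p set) (Q :: ('r, 'p \<Rightarrow> 'r) module).
        Module.module R Q \<and> mod_isomorphic R (dir_sum P Q) (free_module R I))"

definition fin_gen_module :: "('r, 'k) ring_scheme \<Rightarrow> ('r, 'p) module \<Rightarrow> bool" where
  "fin_gen_module R M \<longleftrightarrow>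
     Module.module R M \<and>
     (\<exists>A. finite A \<and> A \<subseteq> carrier M \<and> (\<forall>H. submodule H R M \<longrightarrow> A \<subseteq> H \<longrightarrow> H = carrier M))"

definition fgp_module :: "('r, 'k) ring_scheme \<Rightarrow> ('r, 'p) module \<Rightarrow> bool" where
  "fgp_module R P \<longleftrightarrow> fin_gen_module R P \<and> projective_module R P"


section \<open>Finite presentations, coherence and regularity\<close>

text \<open>Exactness of \<open>F\<^sub>n \<rightarrow> \<dots> \<rightarrow> F\<^sub>0 \<rightarrow> M \<rightarrow> 0\<close>, with \<open>e : F\<^sub>0 \<rightarrow> M\<close> and
  \<open>d i : F\<^sub>i\<^sub>+\<^sub>1 \<rightarrow> F\<^sub>i\<close>; no condition is imposed on the kernel of the leftmost map. For
  \<open>n = \<infinity>\<close> this is a full resolution of \<open>M\<close>.\<close>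

definition exact_upto ::
  "('r, 'k) ring_scheme \<Rightarrow> enat \<Rightarrow> (nat \<Rightarrow> ('r, 'p) module) \<Rightarrow> (nat \<Rightarrow> 'p \<Rightarrow> 'p)
     \<Rightarrow> ('p \<Rightarrow> 'm) \<Rightarrow> ('r, 'm) module \<Rightarrow> bool" where
  "exact_upto R n F d e M \<longleftrightarrow>
     e \<in> mod_hom R (F 0) M \<and> e ` carrier (F 0) = carrier M \<and>
     (\<forall>i. enat (Suc i) \<le> n \<longrightarrow> d i \<in> mod_hom R (F (Suc i)) (F i)) \<and>
     (1 \<le> n \<longrightarrow> d 0 ` carrier (F 1) = a_kernel (F 0) M e) \<and>
     (\<forall>i. enat (Suc (Suc i)) \<le> n \<longrightarrow>
        d (Suc i) ` carrier (F (Suc (Suc i))) = a_kernel (F (Suc i)) (F i) (d i))"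

text \<open>Every finitely generated projective module is isomorphic to a summand of some
  \<open>R\<^sup>k\<close>, hence to a module with carrier in \<open>nat \<Rightarrow> 'r\<close>; the terms \<open>F i\<close> are therefore
  taken in this type without loss of generality.\<close>

definition fin_presented :: "('r, 'k) ring_scheme \<Rightarrow> enat \<Rightarrow> ('r, 'm) module \<Rightarrow> bool" where
  "fin_presented R n M \<longleftrightarrow>
     Module.module R M \<and>
     (\<exists>(F :: nat \<Rightarrow> ('r, nat \<Rightarrow> 'r) module) d e.
        (\<forall>i. enat i \<le> n \<longrightarrow> fgp_module R (F i)) \<and> exact_upto R n F d e M)"

text \<open>A resolution \<open>0 \<rightarrow> P\<^sub>n \<rightarrow> \<dots> \<rightarrow> P\<^sub>0 \<rightarrow> M \<rightarrow> 0\<close> is a full resolution whose terms beyond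
  \<open>n\<close> vanish. The type \<open>'m \<times> nat \<Rightarrow> 'r\<close> of its terms is large enough: a free module on
  \<open>I\<close> has cardinality at most that of \<open>I\<close>, \<open>'r\<close> and \<open>nat\<close> combined, so
  a projective resolution of given finite length, if there is one, exists within cardinality
  \<open>max \<bar>'m\<bar> \<bar>'r\<bar> \<aleph>\<^sub>0\<close>. (If \<open>'r\<close> is a singleton, all modules are zero.)\<close>

definition finite_proj_dim :: "('r, 'k) ring_scheme \<Rightarrow> ('r, 'm) module \<Rightarrow> bool" where
  "finite_proj_dim R M \<longleftrightarrow>
     (\<exists>(n :: nat) (P :: nat \<Rightarrow> ('r, 'm \<times> nat \<Rightarrow> 'r) module) d e.
        (\<forall>i. projective_module R (P i)) \<and> exact_upto R \<infinity> P d e M \<and>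
        (\<forall>i>n. carrier (P i) = {\<zero>\<^bsub>P i\<^esub>}))"

text \<open>HOL cannot quantify over types inside a definition, so the carrier type \<open>'m\<close> of the
  modules under consideration is a parameter; a statement polymorphic in \<open>'m\<close> ranges over
  all modules.\<close>

definition two_coherent :: "'m itself \<Rightarrow> ('r, 'k) ring_scheme \<Rightarrow> bool" where
  "two_coherent ty R \<longleftrightarrow>
     cring R \<and> (\<forall>M :: ('r, 'm) module. fin_presented R 2 M \<longrightarrow> fin_presented R 3 M)"

definition regular_ring :: "'m itself \<Rightarrow> ('r, 'k) ring_scheme \<Rightarrow> bool" where
  "regular_ring ty R \<longleftrightarrow>
     cring R \<and> (\<forall>M :: ('r, 'm) module. fin_presented R \<infinity> M \<longrightarrow> finite_proj_dim R M)"

definition two_coherent_regular :: "'m itself \<Rightarrow> ('r, 'k) ring_scheme \<Rightarrow> bool" where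
  "two_coherent_regular ty R \<longleftrightarrow> two_coherent ty R \<and> regular_ring ty R"


section \<open>Extension of scalars\<close>

text \<open>\<open>S \<otimes>\<^sub>R P\<close> along \<open>h : R \<rightarrow> S\<close>, as the free abelian group on
  \<open>carrier S \<times> carrier P\<close> modulo the bilinearity relations.\<close>

definition tensor_relations ::
  "('r, 'k) ring_scheme \<Rightarrow> ('s, 'l) ring_scheme \<Rightarrow> ('r \<Rightarrow> 's) \<Rightarrow> ('r, 'p) module
     \<Rightarrow> ('s \<times> 'p \<Rightarrow>\<^sub>0 int) set" where
  "tensor_relations R S h P =
     generate (free_Abelian_group (carrier S \<times> carrier P))
       ({frag_of (s \<oplus>\<^bsub>S\<^esub> t, x) - frag_of (s, x) - frag_of (t, x) | s t x.
           s \<in> carrier S \<and> t \<in> carrier S \<and> x \<in> carrier P} \<union>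
        {frag_of (s, x \<oplus>\<^bsub>P\<^esub> y) - frag_of (s, x) - frag_of (s, y) | s x y.
           s \<in> carrier S \<and> x \<in> carrier P \<and> y \<in> carrier P} \<union>
        {frag_of (s \<otimes>\<^bsub>S\<^esub> h a, x) - frag_of (s, a \<odot>\<^bsub>P\<^esub> x) | s a x.
           s \<in> carrier S \<and> a \<in> carrier R \<and> x \<in> carrier P})"

text \<open>Scalars act by \<open>s \<cdot> [\<Sum>n\<^sub>j(t\<^sub>j,x\<^sub>j)] = [\<Sum>n\<^sub>j(st\<^sub>j,x\<^sub>j)]\<close>; the union runs
  over all representatives of a class, which all yield the same coset. The same device is used
  for \<open>K0_map\<close> below.\<close>

definition base_change ::
  "('r, 'k) ring_scheme \<Rightarrow> ('s, 'l) ring_scheme \<Rightarrow> ('r \<Rightarrow> 's) \<Rightarrow> ('r, 'p) module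
     \<Rightarrow> ('s, ('s \<times> 'p \<Rightarrow>\<^sub>0 int) set) module" where
  "base_change R S h P =
     (let F = free_Abelian_group (carrier S \<times> carrier P); N = tensor_relations R S h P in
      \<lparr>carrier = carrier (F Mod N),
       monoid.mult = (\<lambda>_ _. N),
       one = N,
       ring.zero = one (F Mod N),
       ring.add = monoid.mult (F Mod N),
       smult = (\<lambda>s C. \<Union>c\<in>C. N #>\<^bsub>F\<^esub> frag_extend (\<lambda>(t, x). frag_of (s \<otimes>\<^bsub>S\<^esub> t, x)) c)\<rparr>)"


section \<open>The Grothendieck group of finitely generated projective modules\<close>

text \<open>As above, carriers in \<open>nat \<Rightarrow> 'r\<close> suffice to represent all isomorphism classes.\<close>

definition fgp_modules :: "('r, 'k) ring_scheme \<Rightarrow> ('r, nat \<Rightarrow> 'r) module set" where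
  "fgp_modules R = {P. fgp_module R P}"

text \<open>The relations \<open>[P] = [P'] + [P'']\<close> for \<open>P \<cong> P' \<oplus> P''\<close> also identify isomorphic
  modules (take \<open>P'' = 0\<close>).\<close>

definition K0_relations ::
  "('r, 'k) ring_scheme \<Rightarrow> (('r, nat \<Rightarrow> 'r) module \<Rightarrow>\<^sub>0 int) set" where
  "K0_relations R =
     generate (free_Abelian_group (fgp_modules R))
       {frag_of P - frag_of P' - frag_of P'' | P P' P''.
          P \<in> fgp_modules R \<and> P' \<in> fgp_modules R \<and> P'' \<in> fgp_modules R \<and>
          mod_isomorphic R P (dir_sum P' P'')}"

definition K0 ::
  "('r, 'k) ring_scheme \<Rightarrow> (('r, nat \<Rightarrow> 'r) module \<Rightarrow>\<^sub>0 int) set monoid" where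
  "K0 R = free_Abelian_group (fgp_modules R) Mod K0_relations R"

text \<open>The homomorphism \<open>[P] \<mapsto> [S \<otimes>\<^sub>R P]\<close> induced by \<open>h : R \<rightarrow> S\<close>.\<close>

definition K0_map ::
  "('r, 'k) ring_scheme \<Rightarrow> ('s, 'l) ring_scheme \<Rightarrow> ('r \<Rightarrow> 's)
     \<Rightarrow> (('r, nat \<Rightarrow> 'r) module \<Rightarrow>\<^sub>0 int) set \<Rightarrow> (('s, nat \<Rightarrow> 's) module \<Rightarrow>\<^sub>0 int) set" where
  "K0_map R S h C =
     (\<Union>c\<in>C. K0_relations S #>\<^bsub>free_Abelian_group (fgp_modules S)\<^esub>
        frag_extend
          (\<lambda>P. frag_of (SOME Q. Q \<in> fgp_modules S \<and> mod_isomorphic S Q (base_change R S h P))) c)"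


section \<open>Polynomial rings and K0-regularity\<close>

text \<open>\<open>R[x\<^sub>0,\<dots>,x\<^sub>m\<^sub>-\<^sub>1]\<close>, on the carrier and with the addition and constants of
  \<^theory>\<open>HOL-Algebra.Indexed_Polynomials\<close>, which does not define the product of two
  polynomials. Monomials are multisets of variables.\<close>

definition mpoly_ring :: "('r, 'k) ring_scheme \<Rightarrow> nat \<Rightarrow> (nat multiset \<Rightarrow> 'r) ring" where
  "mpoly_ring R m =
     \<lparr>carrier = ring.indexed_pset R {..<m} (carrier R),
      monoid.mult = (\<lambda>p q u. \<Oplus>\<^bsub>R\<^esub>v\<in>{v. v \<subseteq># u}. p v \<otimes>\<^bsub>R\<^esub> q (u - v)),
      one = ring.indexed_const R \<one>\<^bsub>R\<^esub>,
      ring.zero = ring.indexed_const R \<zero>\<^bsub>R\<^esub>,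
      ring.add = ring.indexed_padd R\<rparr>"

definition K0_regular :: "('r, 'k) ring_scheme \<Rightarrow> bool" where
  "K0_regular R \<longleftrightarrow>
     (\<forall>m\<ge>1. K0_map R (mpoly_ring R m) (ring.indexed_const R)
              \<in> iso (K0 R) (K0 (mpoly_ring R m)))"

end

theory Submission
  imports Defs "HOL-Library.Multiset_Order"
begin

text \<open>Since \<open>C(X)\<close> is a Bezout ring, the germs of continuous functions at a point of \<open>X\<close> form a reduced
  ring with total divisibility, that is, a valuation domain \<open>V\<close>. Over \<open>V\<close> the kernel of a matrix is
  saturated and hence, by reduction to echelon form, a direct summand. The same echelon forms, taken
  degree by degree with degrees bounded by Dickson's lemma, show that a saturated module of vectors over
  \<open>V[x\<^sub>1,\<dots>,x\<^sub>m]\<close> has a finite free resolution, so that idempotent matrices over this ring are stably free.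

  Both facts extend from germs to neighbourhoods. A partition of unity glues the local projections onto
  the kernel of a matrix over \<open>C(X)\<close>, so a finitely generated kernel of a map of finitely generated
  projective modules is a direct summand; this gives 2-coherence and regularity. For an idempotent
  matrix \<open>e\<close> over \<open>C(X)[x\<^sub>1,\<dots>,x\<^sub>m]\<close>, let \<open>\<phi>\<close> move from \<open>0\<close> to \<open>1\<close> in steps, each supported where \<open>e\<close>
  is stably trivial. Each step changes \<open>e(\<phi>x)\<close> by a stable equivalence, so \<open>e\<close> and \<open>e(0)\<close> have the same
  class in the Grothendieck group, and evaluation at \<open>0\<close> inverts the map induced by the inclusion.\<close>

section \<open>Dual bases of finitely generated projective modules\<close>

text \<open>The rings of germs need not be Noetherian, so no basis theorem is at hand; saturation
  replaces it. A nonzero vector over \<open>V\<close> can be divided by a coordinate that divides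
  all the others, a saturated module keeps the quotient, and this has a unit coordinate: the source
  of all pivots. The two gluings differ. The conditions \<open>D P = 0\<close> and
  \<open>P w = w\<close> on a projection onto a kernel are affine in \<open>P\<close>, so local
  solutions can be averaged. Idempotents cannot. There the local data are
  \<open>\<alpha> \<beta> = e \<oplus> 1\<close> and \<open>\<beta> \<alpha> = 1\<close>, and
  \<open>\<alpha>(s x) \<beta>(t x)\<close> is an equivalence between the matrices
  \<open>e \<oplus> 1\<close> at \<open>s x\<close> and at \<open>t x\<close>. For
  \<open>s = t\<close> it is the matrix \<open>e \<oplus> 1\<close> at \<open>s x\<close> itself,
  hence can be interpolated with the latter wherever the path stands still. Projective modules enter
  only through the Gram matrix of a dual basis, an idempotent that determines the module up to
  isomorphism. Direct sums, base change and the relations of the Grothendieck group become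
  operations on matrices, which are indifferent to the carrier types fixed in the
  definitions.\<close>

context abelian_monoid
begin

lemma finsum_lessThan_Suc:
  assumes "f \<in> {..<Suc n} \<rightarrow> carrier G"
  shows "(\<Oplus>i\<in>{..<Suc n}. f i) = f n \<oplus> (\<Oplus>i\<in>{..<n}. f i)"
  unfolding lessThan_Suc using assms by (intro finsum_insert) auto

lemma finsum_swap:
  assumes "!!i j. i < n ==> j < m ==> f i j \<in> carrier G"
  shows "(\<Oplus>i\<in>{..<n::nat}. \<Oplus>j\<in>{..<m::nat}. f i j) = (\<Oplus>j\<in>{..<m}. \<Oplus>i\<in>{..<n}. f i j)"
  using assms
proof (induction n)
  case 0
  have "(\<Oplus>j\<in>{..<m}. \<zero>) = \<zero>" by (rule finsum_zero)
  then show ?case by simp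
next
  case (Suc n)
  have "(\<Oplus>j\<in>{..<m}. \<Oplus>i\<in>{..<Suc n}. f i j) = (\<Oplus>j\<in>{..<m}. f n j \<oplus> (\<Oplus>i\<in>{..<n}. f i j))"
    using Suc.prems by (intro finsum_cong') (auto intro!: finsum_lessThan_Suc finsum_closed)
  also have "\<dots> = (\<Oplus>j\<in>{..<m}. f n j) \<oplus> (\<Oplus>j\<in>{..<m}. \<Oplus>i\<in>{..<n}. f i j)"
    using Suc.prems by (intro finsum_addf) (auto intro!: finsum_closed)
  finally show ?case using Suc by (subst finsum_lessThan_Suc) (auto intro!: finsum_closed)
qed

lemma finsum_lessThan_add:
  assumes "!!i. i < n + m ==> f i \<in> carrier G"
  shows "(\<Oplus>i\<in>{..<n + m::nat}. f i) = (\<Oplus>i\<in>{..<n}. f i) \<oplus> (\<Oplus>i\<in>{..<m}. f (n + i))"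
  using assms
proof (induction m)
  case (Suc m)
  have "(\<Oplus>i\<in>{..<n + Suc m}. f i) = f (n + m) \<oplus> (\<Oplus>i\<in>{..<n + m}. f i)"
    using Suc.prems by (simp only: add_Suc_right) (intro finsum_lessThan_Suc, auto)
  also have "\<dots> = f (n + m) \<oplus> ((\<Oplus>i\<in>{..<n}. f i) \<oplus> (\<Oplus>i\<in>{..<m}. f (n + i)))"
    using Suc by simp
  also have "\<dots> = (\<Oplus>i\<in>{..<n}. f i) \<oplus> (f (n + m) \<oplus> (\<Oplus>i\<in>{..<m}. f (n + i)))"
    using Suc.prems by (intro a_lcomm) (auto intro!: finsum_closed)
  also have "f (n + m) \<oplus> (\<Oplus>i\<in>{..<m}. f (n + i)) = (\<Oplus>i\<in>{..<Suc m}. f (n + i))"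
    using Suc.prems by (intro finsum_lessThan_Suc[symmetric]) auto
  finally show ?case .
next
  case 0
  then have "(\<Oplus>i\<in>{..<n}. f i) \<in> carrier G" by (intro finsum_closed) auto
  then show ?case by simp
qed

lemma finsum_delta:
  assumes "k < n" "f k \<in> carrier G"
  shows "(\<Oplus>i\<in>{..<n::nat}. if i = k then f i else \<zero>) = f k"
proof -
  have "(\<Oplus>i\<in>{..<n}. if i = k then f i else \<zero>) = (\<Oplus>i\<in>{..<n}. if k = i then f k else \<zero>)"
    using assms by (intro finsum_cong') auto
  also have "\<dots> = f k" using finsum_singleton[of k "{..<n}" "%_. f k"] assms by simp
  finally show ?thesis .
qed

end

lemma finsum_hom:
  assumes "abelian_monoid G" "abelian_monoid H"
    and "!!x. x \<in> carrier G ==> h x \<in> carrier H"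
    and "!!x y. x \<in> carrier G ==> y \<in> carrier G ==> h (x \<oplus>\<^bsub>G\<^esub> y) = h x \<oplus>\<^bsub>H\<^esub> h y"
    and "h \<zero>\<^bsub>G\<^esub> = \<zero>\<^bsub>H\<^esub>"
    and "finite I" "!!i. i \<in> I ==> f i \<in> carrier G"
  shows "h (finsum G f I) = finsum H (%i. h (f i)) I"
  using assms(6,7)
proof (induction I)
  case empty
  then show ?case using assms(1,2,5) by (simp add: abelian_monoid.finsum_empty)
next
  case (insert i I)
  interpret G: abelian_monoid G by fact
  interpret H: abelian_monoid H by fact
  have "finsum G f I \<in> carrier G" using insert.prems by (intro G.finsum_closed) auto
  then show ?case using insert assms(3-5) by (simp add: Pi_def)
qed

section \<open>Linear combinations, linear forms and Gram matrices\<close>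

definition lin_comb :: "('r, 'p) module => nat => (nat => 'r) => (nat => 'p) => 'p" where
  "lin_comb M n c p = (\<Oplus>\<^bsub>M\<^esub>i\<in>{..<n}. c i \<odot>\<^bsub>M\<^esub> p i)"

text \<open>The target is the ring itself, a record without \<open>smult\<close>; hence a notion
  separate from \<open>mod_hom\<close>.\<close>

definition linear_form :: "('r, 'k) ring_scheme => ('r, 'p) module => ('p => 'r) => bool" where
  "linear_form R M \<phi> \<longleftrightarrow> (\<forall>x\<in>carrier M. \<phi> x \<in> carrier R) \<and>
     (\<forall>x\<in>carrier M. \<forall>y\<in>carrier M. \<phi> (x \<oplus>\<^bsub>M\<^esub> y) = \<phi> x \<oplus>\<^bsub>R\<^esub> \<phi> y) \<and>
     (\<forall>a\<in>carrier R. \<forall>x\<in>carrier M. \<phi> (a \<odot>\<^bsub>M\<^esub> x) = a \<otimes>\<^bsub>R\<^esub> \<phi> x)"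

text \<open>Generators and coordinate forms as in the dual basis lemma. Having such data amounts to
  being finitely generated projective, by \<open>fgp_has_gram\<close> and, for infinite carrier
  types, \<open>has_gram_fgp\<close>.\<close>

definition dual_basis ::
  "('r, 'k) ring_scheme => ('r, 'p) module => nat => (nat => 'p) => (nat => 'p => 'r) => bool" where
  "dual_basis R M n p \<iota> \<longleftrightarrow> Module.module R M \<and> (\<forall>i<n. p i \<in> carrier M) \<and>
     (\<forall>i<n. linear_form R M (\<iota> i)) \<and>
     (\<forall>x\<in>carrier M. lin_comb M n (%i. \<iota> i x) p = x)"

text \<open>The values of the forms at the generators make up an idempotent matrix with image
  isomorphic to \<open>M\<close>. Entries outside the \<open>n\<close> by \<open>n\<close> range are
  left unconstrained.\<close>

definition has_gram ::
  "('r, 'k) ring_scheme => ('r, 'p) module => nat => (nat => nat => 'r) => bool" where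
  "has_gram R M n e \<longleftrightarrow> (\<exists>p \<iota>. dual_basis R M n p \<iota> \<and> (\<forall>i<n. \<forall>j<n. e i j = \<iota> i (p j)))"

lemma linear_formD:
  assumes "linear_form R M \<phi>"
  shows "x \<in> carrier M ==> \<phi> x \<in> carrier R"
    "x \<in> carrier M ==> y \<in> carrier M ==> \<phi> (x \<oplus>\<^bsub>M\<^esub> y) = \<phi> x \<oplus>\<^bsub>R\<^esub> \<phi> y"
    "a \<in> carrier R ==> x \<in> carrier M ==> \<phi> (a \<odot>\<^bsub>M\<^esub> x) = a \<otimes>\<^bsub>R\<^esub> \<phi> x"
  using assms by (auto simp: linear_form_def)

lemma mod_homD:
  assumes "f \<in> mod_hom R M N"
  shows "x \<in> carrier M ==> f x \<in> carrier N"
    "x \<in> carrier M ==> y \<in> carrier M ==> f (x \<oplus>\<^bsub>M\<^esub> y) = f x \<oplus>\<^bsub>N\<^esub> f y"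
    "a \<in> carrier R ==> x \<in> carrier M ==> f (a \<odot>\<^bsub>M\<^esub> x) = a \<odot>\<^bsub>N\<^esub> f x"
  using assms by (auto simp: mod_hom_def)

lemma mod_homI:
  assumes "!!x. x \<in> carrier M ==> f x \<in> carrier N"
    "!!x y. x \<in> carrier M ==> y \<in> carrier M ==> f (x \<oplus>\<^bsub>M\<^esub> y) = f x \<oplus>\<^bsub>N\<^esub> f y"
    "!!a x. a \<in> carrier R ==> x \<in> carrier M ==> f (a \<odot>\<^bsub>M\<^esub> x) = a \<odot>\<^bsub>N\<^esub> f x"
  shows "f \<in> mod_hom R M N"
  using assms by (auto simp: mod_hom_def)

lemma mod_isoE:
  assumes "mod_isomorphic R M N"
  obtains f where "f \<in> mod_hom R M N" "bij_betw f (carrier M) (carrier N)"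
  using assms by (auto simp: mod_isomorphic_def)

lemma mod_hom_comp:
  "f \<in> mod_hom R M N ==> g \<in> mod_hom R N L ==> (%x. g (f x)) \<in> mod_hom R M L"
  by (rule mod_homI) (simp_all add: mod_homD[of f R M N] mod_homD[of g R N L])

lemma linear_form_comp:
  "linear_form R N \<phi> ==> f \<in> mod_hom R M N ==> linear_form R M (%x. \<phi> (f x))"
  unfolding linear_form_def by (simp add: mod_homD[of f R M N])

locale fmodule = Module.module R M
  for R :: "('r, 'k) ring_scheme" (structure) and M :: "('r, 'p) module" (structure)
begin

lemma linear_form_zero: "linear_form R M \<phi> ==> \<phi> \<zero>\<^bsub>M\<^esub> = \<zero>"
  using linear_formD(3)[of R M \<phi> "\<zero>" "\<zero>\<^bsub>M\<^esub>"] linear_formD(1)[of R M \<phi> "\<zero>\<^bsub>M\<^esub>"] by simp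

lemma mod_hom_zero: "f \<in> mod_hom R M N ==> Module.module R N ==> f \<zero>\<^bsub>M\<^esub> = \<zero>\<^bsub>N\<^esub>"
  using mod_homD(3)[of f R M N "\<zero>" "\<zero>\<^bsub>M\<^esub>"] mod_homD(1)[of f R M N "\<zero>\<^bsub>M\<^esub>"]
  by (simp add: module.smult_l_null)

lemma lin_comb_closed:
  "(!!i. i < n ==> c i \<in> carrier R) ==> (!!i. i < n ==> p i \<in> carrier M) ==> lin_comb M n c p \<in> carrier M"
  unfolding lin_comb_def by (intro M.finsum_closed) auto

lemma lin_comb_cong:
  "(!!i. i < n ==> c i = d i) ==> (!!i. i < n ==> p i = q i) ==> (!!i. i < n ==> d i \<in> carrier R) ==>
    (!!i. i < n ==> q i \<in> carrier M) ==> lin_comb M n c p = lin_comb M n d q"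
  unfolding lin_comb_def by (intro M.finsum_cong') auto

lemma lin_comb_add:
  assumes "!!i. i < n ==> c i \<in> carrier R" "!!i. i < n ==> d i \<in> carrier R" "!!i. i < n ==> p i \<in> carrier M"
  shows "lin_comb M n (%i. c i \<oplus> d i) p = lin_comb M n c p \<oplus>\<^bsub>M\<^esub> lin_comb M n d p"
proof -
  have "lin_comb M n (%i. c i \<oplus> d i) p = (\<Oplus>\<^bsub>M\<^esub>i\<in>{..<n}. c i \<odot>\<^bsub>M\<^esub> p i \<oplus>\<^bsub>M\<^esub> d i \<odot>\<^bsub>M\<^esub> p i)"
    unfolding lin_comb_def using assms by (intro M.finsum_cong') (auto simp: smult_l_distr)
  then show ?thesis unfolding lin_comb_def using assms by (subst (asm) M.finsum_addf) auto
qed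

lemma lin_comb_smult:
  assumes "a \<in> carrier R" "!!i. i < n ==> c i \<in> carrier R" "!!i. i < n ==> p i \<in> carrier M"
  shows "lin_comb M n (%i. a \<otimes> c i) p = a \<odot>\<^bsub>M\<^esub> lin_comb M n c p"
  unfolding lin_comb_def using assms
  by (subst finsum_smult_ldistr) (auto intro!: M.finsum_cong' simp: smult_assoc1)

lemma linear_form_lin_comb:
  assumes "linear_form R M \<phi>" "!!i. i < n ==> c i \<in> carrier R" "!!i. i < n ==> p i \<in> carrier M"
  shows "\<phi> (lin_comb M n c p) = (\<Oplus>i\<in>{..<n}. c i \<otimes> \<phi> (p i))"
proof -
  have "\<phi> (lin_comb M n c p) = (\<Oplus>i\<in>{..<n}. \<phi> (c i \<odot>\<^bsub>M\<^esub> p i))"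
    unfolding lin_comb_def using assms linear_form_zero[OF assms(1)]
    by (intro finsum_hom M.abelian_monoid_axioms R.abelian_monoid_axioms) (auto simp: linear_formD[OF assms(1)])
  then show ?thesis
    using assms by (auto simp: linear_formD[OF assms(1)] cong: R.finsum_cong intro!: R.finsum_cong')
qed

lemma mod_hom_lin_comb:
  assumes "f \<in> mod_hom R M N" "Module.module R N" "!!i. i < n ==> c i \<in> carrier R" "!!i. i < n ==> p i \<in> carrier M"
  shows "f (lin_comb M n c p) = lin_comb N n c (%i. f (p i))"
proof -
  interpret N: fmodule R N by (rule fmodule.intro) fact
  have "f (lin_comb M n c p) = (\<Oplus>\<^bsub>N\<^esub>i\<in>{..<n}. f (c i \<odot>\<^bsub>M\<^esub> p i))"
    unfolding lin_comb_def using assms mod_hom_zero[OF assms(1,2)]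
    by (intro finsum_hom M.abelian_monoid_axioms N.M.abelian_monoid_axioms) (auto simp: mod_homD[OF assms(1)])
  also have "\<dots> = lin_comb N n c (%i. f (p i))"
    unfolding lin_comb_def using assms(3,4) by (intro N.M.finsum_cong') (auto simp: mod_homD[OF assms(1)])
  finally show ?thesis .
qed

lemma lin_comb_lin_comb:
  assumes "!!i. i < n ==> c i \<in> carrier R" "!!i j. i < n ==> j < m ==> a i j \<in> carrier R"
    "!!j. j < m ==> p j \<in> carrier M"
  shows "lin_comb M n c (%i. lin_comb M m (a i) p) = lin_comb M m (%j. \<Oplus>i\<in>{..<n}. c i \<otimes> a i j) p"
proof -
  have "lin_comb M n c (%i. lin_comb M m (a i) p)
      = (\<Oplus>\<^bsub>M\<^esub>i\<in>{..<n}. \<Oplus>\<^bsub>M\<^esub>j\<in>{..<m}. (c i \<otimes> a i j) \<odot>\<^bsub>M\<^esub> p j)"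
    unfolding lin_comb_def using assms
    by (intro M.finsum_cong' refl) (auto simp: finsum_smult_ldistr smult_assoc1 intro!: M.finsum_cong' M.finsum_closed)
  also have "\<dots> = (\<Oplus>\<^bsub>M\<^esub>j\<in>{..<m}. \<Oplus>\<^bsub>M\<^esub>i\<in>{..<n}. (c i \<otimes> a i j) \<odot>\<^bsub>M\<^esub> p j)"
    using assms by (intro M.finsum_swap) auto
  also have "\<dots> = (\<Oplus>\<^bsub>M\<^esub>j\<in>{..<m}. (\<Oplus>i\<in>{..<n}. c i \<otimes> a i j) \<odot>\<^bsub>M\<^esub> p j)"
  proof (intro M.finsum_cong' refl)
    fix j assume j: "j \<in> {..<m}"
    then have pj: "p j \<in> carrier M" using assms by auto
    have "(\<Oplus>i\<in>{..<n}. c i \<otimes> a i j) \<odot>\<^bsub>M\<^esub> p j = (\<Oplus>\<^bsub>M\<^esub>i\<in>{..<n}. (c i \<otimes> a i j) \<odot>\<^bsub>M\<^esub> p j)"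
      using pj j assms
      by (intro finsum_hom[where h = "%x. x \<odot>\<^bsub>M\<^esub> p j"] R.abelian_monoid_axioms M.abelian_monoid_axioms)
        (auto simp: smult_l_distr)
    then show "(\<Oplus>\<^bsub>M\<^esub>i\<in>{..<n}. (c i \<otimes> a i j) \<odot>\<^bsub>M\<^esub> p j) = (\<Oplus>i\<in>{..<n}. c i \<otimes> a i j) \<odot>\<^bsub>M\<^esub> p j" ..
  qed (use assms in \<open>auto intro!: R.finsum_closed\<close>)
  finally show ?thesis by (simp add: lin_comb_def)
qed

lemma mod_hom_lin_comb_form:
  assumes "!!i. i < n ==> linear_form R N (\<phi> i)" "!!i. i < n ==> p i \<in> carrier M"
  shows "(%x. lin_comb M n (%i. \<phi> i x) p) \<in> mod_hom R N M"
proof (rule mod_homI)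
  note \<phi> = linear_formD[OF assms(1)]
  fix x assume x: "x \<in> carrier N"
  then show "lin_comb M n (%i. \<phi> i x) p \<in> carrier M" using assms(2) \<phi> by (intro lin_comb_closed) auto
  fix y assume y: "y \<in> carrier N"
  have "lin_comb M n (%i. \<phi> i (x \<oplus>\<^bsub>N\<^esub> y)) p = lin_comb M n (%i. \<phi> i x \<oplus> \<phi> i y) p"
    using assms(2) \<phi> x y by (intro lin_comb_cong) auto
  then show "lin_comb M n (%i. \<phi> i (x \<oplus>\<^bsub>N\<^esub> y)) p = lin_comb M n (%i. \<phi> i x) p \<oplus>\<^bsub>M\<^esub> lin_comb M n (%i. \<phi> i y) p"
    using assms(2) \<phi> x y by (subst lin_comb_add[symmetric]) auto
next
  note \<phi> = linear_formD[OF assms(1)]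
  fix a x assume a: "a \<in> carrier R" and x: "x \<in> carrier N"
  have "lin_comb M n (%i. \<phi> i (a \<odot>\<^bsub>N\<^esub> x)) p = lin_comb M n (%i. a \<otimes> \<phi> i x) p"
    using assms(2) \<phi> x a by (intro lin_comb_cong) auto
  then show "lin_comb M n (%i. \<phi> i (a \<odot>\<^bsub>N\<^esub> x)) p = a \<odot>\<^bsub>M\<^esub> lin_comb M n (%i. \<phi> i x) p"
    using assms(2) \<phi> x a by (subst lin_comb_smult[symmetric]) auto
qed

end

lemma dual_basisD:
  assumes "dual_basis R M n p \<iota>"
  shows "Module.module R M" "i < n ==> p i \<in> carrier M" "i < n ==> linear_form R M (\<iota> i)"
    "x \<in> carrier M ==> lin_comb M n (%i. \<iota> i x) p = x"
    "i < n ==> x \<in> carrier M ==> \<iota> i x \<in> carrier R"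
  using assms linear_formD(1)[of R M "\<iota> i" x] by (auto simp: dual_basis_def)

lemma mod_hom_inv:
  assumes M: "Module.module R M" and f: "f \<in> mod_hom R M N" "bij_betw f (carrier M) (carrier N)"
  shows "inv_into (carrier M) f \<in> mod_hom R N M"
proof -
  interpret M: fmodule R M by (rule fmodule.intro) fact
  let ?g = "inv_into (carrier M) f"
  have gM: "?g y \<in> carrier M" and fg: "f (?g y) = y" if "y \<in> carrier N" for y
    using f(2) that by (auto simp: bij_betw_def inv_into_into f_inv_into_f)
  have gf: "?g (f x) = x" if "x \<in> carrier M" for x using f(2) that by (auto simp: bij_betw_def)
  show ?thesis
  proof (rule mod_homI)
    fix x y assume xy: "x \<in> carrier N" "y \<in> carrier N"
    have "?g (x \<oplus>\<^bsub>N\<^esub> y) = ?g (f (?g x \<oplus>\<^bsub>M\<^esub> ?g y))" using xy by (simp add: mod_homD[OF f(1)] gM fg)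
    also have "\<dots> = ?g x \<oplus>\<^bsub>M\<^esub> ?g y" using xy gM by (intro gf) auto
    finally show "?g (x \<oplus>\<^bsub>N\<^esub> y) = ?g x \<oplus>\<^bsub>M\<^esub> ?g y" .
  next
    fix a x assume ax: "a \<in> carrier R" "x \<in> carrier N"
    have "?g (a \<odot>\<^bsub>N\<^esub> x) = ?g (f (a \<odot>\<^bsub>M\<^esub> ?g x))" using ax by (simp add: mod_homD[OF f(1)] gM fg)
    also have "\<dots> = a \<odot>\<^bsub>M\<^esub> ?g x" using ax gM by (intro gf) auto
    finally show "?g (a \<odot>\<^bsub>N\<^esub> x) = a \<odot>\<^bsub>M\<^esub> ?g x" .
  qed (use gM in auto)
qed

lemma mod_isomorphic_sym:
  assumes "Module.module R M" "mod_isomorphic R M N"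
  shows "mod_isomorphic R N M"
proof -
  obtain f where f: "f \<in> mod_hom R M N" "bij_betw f (carrier M) (carrier N)"
    using assms(2) by (rule mod_isoE)
  then show ?thesis using mod_hom_inv[OF assms(1) f] bij_betw_inv_into[OF f(2)]
    unfolding mod_isomorphic_def by blast
qed

text \<open>\<open>f\<close> and \<open>g\<close> exhibit \<open>N\<close> as a retract of
  \<open>M\<close>, and retracts inherit dual bases.\<close>

lemma dual_basis_transport:
  assumes db: "dual_basis R M n p \<iota>" and N: "Module.module R N"
    and f: "f \<in> mod_hom R M N" and g: "g \<in> mod_hom R N M"
    and fg: "!!y. y \<in> carrier N ==> f (g y) = y"
  shows "dual_basis R N n (%i. f (p i)) (%i y. \<iota> i (g y))"
proof -
  interpret M: fmodule R M by (rule fmodule.intro[OF dual_basisD(1)[OF db]])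
  have "lin_comb N n (%i. \<iota> i (g y)) (%i. f (p i)) = y" if y: "y \<in> carrier N" for y
  proof -
    have gy: "g y \<in> carrier M" using y mod_homD(1)[OF g] by auto
    have "lin_comb N n (%i. \<iota> i (g y)) (%i. f (p i)) = f (lin_comb M n (%i. \<iota> i (g y)) p)"
      using dual_basisD[OF db] gy by (intro M.mod_hom_lin_comb[OF f N, symmetric]) auto
    also have "\<dots> = y" using dual_basisD(4)[OF db gy] fg[OF y] by simp
    finally show ?thesis .
  qed
  then show ?thesis unfolding dual_basis_def
    using N linear_form_comp[OF _ g] dual_basisD[OF db] mod_homD(1)[OF f] by auto
qed

lemma has_gram_iso:
  assumes "has_gram R M n e" "Module.module R N" "mod_isomorphic R M N"
  shows "has_gram R N n e"
proof -
  obtain p \<iota> where db: "dual_basis R M n p \<iota>" and e: "\<forall>i<n. \<forall>j<n. e i j = \<iota> i (p j)"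
    using assms(1) by (auto simp: has_gram_def)
  obtain f where f: "f \<in> mod_hom R M N" "bij_betw f (carrier M) (carrier N)"
    using assms(3) by (rule mod_isoE)
  let ?g = "inv_into (carrier M) f"
  have "dual_basis R N n (%i. f (p i)) (%i y. \<iota> i (?g y))"
    by (rule dual_basis_transport[OF db assms(2) f(1) mod_hom_inv[OF dual_basisD(1)[OF db] f]])
      (use f(2) in \<open>auto simp: bij_betw_def f_inv_into_f\<close>)
  moreover have "?g (f (p j)) = p j" if "j < n" for j
    using f(2) dual_basisD(2)[OF db that] by (auto simp: bij_betw_def)
  ultimately show ?thesis unfolding has_gram_def using e
    by (intro exI[of _ "%i. f (p i)"] exI[of _ "%i y. \<iota> i (?g y)"]) simp
qed

text \<open>Coordinates with respect to one dual basis, used with the generators of the other, give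
  maps in both directions. The forms of the target turn the coordinates of \<open>x\<close> into the
  product of the Gram matrix with them; as this matrix is shared, the result is again the
  coordinates of \<open>x\<close>, and the maps are mutually inverse.\<close>

lemma gram_isomorphic:
  assumes "has_gram R M n e" "has_gram R N n e"
  shows "mod_isomorphic R M N"
proof -
  obtain p \<iota> where db: "dual_basis R M n p \<iota>" and e: "\<forall>i<n. \<forall>j<n. e i j = \<iota> i (p j)"
    using assms(1) by (auto simp: has_gram_def)
  obtain q \<kappa> where db': "dual_basis R N n q \<kappa>" and e': "\<forall>i<n. \<forall>j<n. e i j = \<kappa> i (q j)"
    using assms(2) by (auto simp: has_gram_def)
  interpret M: fmodule R M by (rule fmodule.intro[OF dual_basisD(1)[OF db]])
  interpret N: fmodule R N by (rule fmodule.intro[OF dual_basisD(1)[OF db']])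
  \<comment> \<open>One computation for both composites; the second use exchanges the two
    modules.\<close>
  have round_trip: "lin_comb M' n (%i. \<kappa>' i (lin_comb N' n (%i. \<iota>' i x) q')) p' = x"
    if d: "dual_basis R M' n p' \<iota>'" and d': "dual_basis R N' n q' \<kappa>'"
      and eq: "!!i j. i < n ==> j < n ==> \<iota>' i (p' j) = \<kappa>' i (q' j)" and x: "x \<in> carrier M'"
    for M' :: "('a, 'v) module" and p' \<iota>' and N' :: "('a, 'x) module" and q' \<kappa>' x
  proof -
    interpret M': fmodule R M' by (rule fmodule.intro[OF dual_basisD(1)[OF d]])
    interpret N': fmodule R N' by (rule fmodule.intro[OF dual_basisD(1)[OF d']])
    have "\<kappa>' i (lin_comb N' n (%i. \<iota>' i x) q') = \<iota>' i x" if i: "i < n" for i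
    proof -
      have "\<kappa>' i (lin_comb N' n (%i. \<iota>' i x) q') = (\<Oplus>\<^bsub>R\<^esub>j\<in>{..<n}. \<iota>' j x \<otimes>\<^bsub>R\<^esub> \<kappa>' i (q' j))"
        using dual_basisD[OF d] dual_basisD[OF d'] x i by (intro N'.linear_form_lin_comb) auto
      also have "\<dots> = (\<Oplus>\<^bsub>R\<^esub>j\<in>{..<n}. \<iota>' j x \<otimes>\<^bsub>R\<^esub> \<iota>' i (p' j))"
        using eq i dual_basisD[OF d] dual_basisD[OF d'] x by (intro M.R.finsum_cong') auto
      also have "\<dots> = \<iota>' i (lin_comb M' n (%i. \<iota>' i x) p')"
        using dual_basisD[OF d] x i by (intro M'.linear_form_lin_comb[symmetric]) auto
      also have "\<dots> = \<iota>' i x" using dual_basisD(4)[OF d x] by simp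
      finally show ?thesis .
    qed
    then have "lin_comb M' n (%i. \<kappa>' i (lin_comb N' n (%i. \<iota>' i x) q')) p' = lin_comb M' n (%i. \<iota>' i x) p'"
      using dual_basisD[OF d] x by (intro M'.lin_comb_cong) auto
    then show ?thesis using dual_basisD(4)[OF d x] by simp
  qed
  have f: "(%x. lin_comb N n (%i. \<iota> i x) q) \<in> mod_hom R M N"
    by (rule N.mod_hom_lin_comb_form) (use dual_basisD[OF db] dual_basisD[OF db'] in auto)
  have g: "(%x. lin_comb M n (%i. \<kappa> i x) p) \<in> mod_hom R N M"
    by (rule M.mod_hom_lin_comb_form) (use dual_basisD[OF db] dual_basisD[OF db'] in auto)
  have "bij_betw (%x. lin_comb N n (%i. \<iota> i x) q) (carrier M) (carrier N)"
  proof (rule bij_betwI[where g = "%x. lin_comb M n (%i. \<kappa> i x) p"])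
    show "lin_comb M n (%i. \<kappa> i (lin_comb N n (%i. \<iota> i x) q)) p = x" if "x \<in> carrier M" for x
      using e e' by (intro round_trip[OF db db' _ that]) auto
    show "lin_comb N n (%i. \<iota> i (lin_comb M n (%i. \<kappa> i y) p)) q = y" if "y \<in> carrier N" for y
      using e e' by (intro round_trip[OF db' db _ that]) auto
  qed (use mod_homD(1)[OF f] mod_homD(1)[OF g] in auto)
  with f show ?thesis unfolding mod_isomorphic_def by blast
qed

section \<open>Free modules and direct sums\<close>

lemma free_module_module:
  fixes R (structure)
  assumes "cring R"
  shows "Module.module R (free_module R I)"
proof -
  interpret R: cring R by fact
  show ?thesis
  proof (rule moduleI)
    have fin: "finite {i. f i \<oplus> g i \<noteq> \<zero>}" if "finite {i. f i \<noteq> \<zero>}" "finite {i. g i \<noteq> \<zero>}" for f g :: "'c => 'a"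
    proof (rule finite_subset[OF _ finite_UnI[OF that]])
      show "{i. f i \<oplus> g i \<noteq> \<zero>} \<subseteq> {i. f i \<noteq> \<zero>} \<union> {i. g i \<noteq> \<zero>}" by auto
    qed
    have mem: "f i \<in> carrier R" if "f \<in> carrier (free_module R I)" for f i
      using that by (cases "i \<in> I") (auto simp: free_module_def)
    show "abelian_group (free_module R I)"
    proof (rule abelian_groupI)
      fix f g h assume f: "f \<in> carrier (free_module R I)"
      show "\<zero>\<^bsub>free_module R I\<^esub> \<oplus>\<^bsub>free_module R I\<^esub> f = f"
        using mem[OF f] by (simp add: free_module_def)
      show "\<exists>y\<in>carrier (free_module R I). y \<oplus>\<^bsub>free_module R I\<^esub> f = \<zero>\<^bsub>free_module R I\<^esub>"
      proof (rule bexI[of _ "%i. \<ominus> f i"])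
        show "(%i. \<ominus> f i) \<oplus>\<^bsub>free_module R I\<^esub> f = \<zero>\<^bsub>free_module R I\<^esub>"
          using mem[OF f] by (simp add: free_module_def R.l_neg)
        have "{i. \<ominus> f i \<noteq> \<zero>} \<subseteq> {i. f i \<noteq> \<zero>}" by auto
        moreover have "finite {i. f i \<noteq> \<zero>}" using f by (simp add: free_module_def)
        ultimately have "finite {i. \<ominus> f i \<noteq> \<zero>}" by (rule finite_subset)
        then show "(%i. \<ominus> f i) \<in> carrier (free_module R I)" using f mem[OF f] by (simp add: free_module_def)
      qed
      assume g: "g \<in> carrier (free_module R I)"
      show "f \<oplus>\<^bsub>free_module R I\<^esub> g \<in> carrier (free_module R I)"
        using f g fin[of f g] by (auto simp: free_module_def)
      show "f \<oplus>\<^bsub>free_module R I\<^esub> g = g \<oplus>\<^bsub>free_module R I\<^esub> f"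
        using mem[OF f] mem[OF g] by (auto simp: free_module_def R.a_comm)
      assume h: "h \<in> carrier (free_module R I)"
      show "f \<oplus>\<^bsub>free_module R I\<^esub> g \<oplus>\<^bsub>free_module R I\<^esub> h = f \<oplus>\<^bsub>free_module R I\<^esub> (g \<oplus>\<^bsub>free_module R I\<^esub> h)"
        using mem[OF f] mem[OF g] mem[OF h] by (auto simp: free_module_def R.a_assoc)
    qed (simp add: free_module_def)
    fix a b f g assume a: "a \<in> carrier R" and f: "f \<in> carrier (free_module R I)"
    have "{i. a \<otimes> f i \<noteq> \<zero>} \<subseteq> {i. f i \<noteq> \<zero>}" using a by auto
    moreover have "finite {i. f i \<noteq> \<zero>}" using f by (simp add: free_module_def)
    ultimately have "finite {i. a \<otimes> f i \<noteq> \<zero>}" by (rule finite_subset)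
    then show "a \<odot>\<^bsub>free_module R I\<^esub> f \<in> carrier (free_module R I)"
      using a f by (auto simp: free_module_def)
    show "(a \<oplus> b) \<odot>\<^bsub>free_module R I\<^esub> f = a \<odot>\<^bsub>free_module R I\<^esub> f \<oplus>\<^bsub>free_module R I\<^esub> b \<odot>\<^bsub>free_module R I\<^esub> f"
      if "b \<in> carrier R" using a that mem[OF f] by (auto simp: free_module_def R.l_distr)
    show "a \<odot>\<^bsub>free_module R I\<^esub> (f \<oplus>\<^bsub>free_module R I\<^esub> g) = a \<odot>\<^bsub>free_module R I\<^esub> f \<oplus>\<^bsub>free_module R I\<^esub> a \<odot>\<^bsub>free_module R I\<^esub> g"
      if "g \<in> carrier (free_module R I)" using a mem[OF f] mem[OF that] by (auto simp: free_module_def R.r_distr)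
    show "(a \<otimes> b) \<odot>\<^bsub>free_module R I\<^esub> f = a \<odot>\<^bsub>free_module R I\<^esub> (b \<odot>\<^bsub>free_module R I\<^esub> f)"
      if "b \<in> carrier R" using a that mem[OF f] by (auto simp: free_module_def R.m_assoc)
  next
    fix f assume f: "f \<in> carrier (free_module R I)"
    have mem: "f i \<in> carrier R" for i using f by (cases "i \<in> I") (auto simp: free_module_def)
    show "\<one> \<odot>\<^bsub>free_module R I\<^esub> f = f" using mem by (auto simp: free_module_def)
  qed fact
qed

lemma free_module_simps:
  "f \<oplus>\<^bsub>free_module R I\<^esub> g = (%i. f i \<oplus>\<^bsub>R\<^esub> g i)" "a \<odot>\<^bsub>free_module R I\<^esub> f = (%i. a \<otimes>\<^bsub>R\<^esub> f i)"
  "\<zero>\<^bsub>free_module R I\<^esub> = (%_. \<zero>\<^bsub>R\<^esub>)"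
  by (simp_all add: free_module_def)

lemma (in cring) free_module_mem: "f \<in> carrier (free_module R I) ==> f i \<in> carrier R"
  by (cases "i \<in> I") (auto simp: free_module_def)

lemma dir_sum_simps:
  "carrier (dir_sum M N) = carrier M \<times> carrier N"
  "(x, y) \<oplus>\<^bsub>dir_sum M N\<^esub> (x', y') = (x \<oplus>\<^bsub>M\<^esub> x', y \<oplus>\<^bsub>N\<^esub> y')"
  "a \<odot>\<^bsub>dir_sum M N\<^esub> (x, y) = (a \<odot>\<^bsub>M\<^esub> x, a \<odot>\<^bsub>N\<^esub> y)"
  "\<zero>\<^bsub>dir_sum M N\<^esub> = (\<zero>\<^bsub>M\<^esub>, \<zero>\<^bsub>N\<^esub>)"
  by (simp_all add: dir_sum_def)

lemma dir_sum_module: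
  assumes "Module.module R M" "Module.module R N"
  shows "Module.module R (dir_sum M N)"
proof -
  interpret M: fmodule R M by (rule fmodule.intro) fact
  interpret N: fmodule R N by (rule fmodule.intro) fact
  show ?thesis
  proof (rule moduleI)
    show "abelian_group (dir_sum M N)"
    proof (rule abelian_groupI)
      fix x assume x: "x \<in> carrier (dir_sum M N)"
      show "\<exists>y\<in>carrier (dir_sum M N). y \<oplus>\<^bsub>dir_sum M N\<^esub> x = \<zero>\<^bsub>dir_sum M N\<^esub>"
        using x by (intro bexI[of _ "(\<ominus>\<^bsub>M\<^esub> fst x, \<ominus>\<^bsub>N\<^esub> snd x)"])
          (auto simp: dir_sum_simps M.M.l_neg N.M.l_neg)
    qed (auto simp: dir_sum_simps M.M.a_ac N.M.a_ac)
  qed (auto simp: dir_sum_simps M.smult_l_distr N.smult_l_distr M.smult_r_distr N.smult_r_distr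
      M.smult_assoc1 N.smult_assoc1 M.R.cring_axioms)
qed

definition gram_sum :: "('r, 'k) ring_scheme => nat => (nat => nat => 'r) => (nat => nat => 'r) => nat => nat => 'r" where
  "gram_sum R n e f = (%i j. if i < n \<and> j < n then e i j else
     if n \<le> i \<and> n \<le> j then f (i - n) (j - n) else \<zero>\<^bsub>R\<^esub>)"

text \<open>Generators and forms of the two summands are listed one after the other; the
  off-diagonal blocks are values of forms at zero.\<close>

lemma has_gram_dir_sum:
  assumes "has_gram R M n e" "has_gram R N k f"
  shows "has_gram R (dir_sum M N) (n + k) (gram_sum R n e f)"
proof -
  obtain p \<iota> where db: "dual_basis R M n p \<iota>" and e: "\<forall>i<n. \<forall>j<n. e i j = \<iota> i (p j)"
    using assms(1) by (auto simp: has_gram_def)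
  obtain q \<kappa> where db': "dual_basis R N k q \<kappa>" and f: "\<forall>i<k. \<forall>j<k. f i j = \<kappa> i (q j)"
    using assms(2) by (auto simp: has_gram_def)
  interpret M: fmodule R M by (rule fmodule.intro[OF dual_basisD(1)[OF db]])
  interpret N: fmodule R N by (rule fmodule.intro[OF dual_basisD(1)[OF db']])
  interpret MN: fmodule R "dir_sum M N"
    by (rule fmodule.intro[OF dir_sum_module[OF M.module_axioms N.module_axioms]])
  define P where "P i = (if i < n then (p i, \<zero>\<^bsub>N\<^esub>) else (\<zero>\<^bsub>M\<^esub>, q (i - n)))" for i
  define J where "J i = (if i < n then (%z. \<iota> i (fst z)) else (%z. \<kappa> (i - n) (snd z)))" for i
  have fst_hom: "fst \<in> mod_hom R (dir_sum M N) M" and snd_hom: "snd \<in> mod_hom R (dir_sum M N) N"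
    by (auto simp: mod_hom_def dir_sum_simps)
  have PM: "P i \<in> carrier (dir_sum M N)" if "i < n + k" for i
    using that dual_basisD(2)[OF db, of i] dual_basisD(2)[OF db', of "i - n"] by (auto simp: P_def dir_sum_simps)
  have JL: "linear_form R (dir_sum M N) (J i)" if "i < n + k" for i
    using that linear_form_comp[OF dual_basisD(3)[OF db] fst_hom, of i]
      linear_form_comp[OF dual_basisD(3)[OF db'] snd_hom, of "i - n"] by (auto simp: J_def)
  have "lin_comb (dir_sum M N) (n + k) (%i. J i z) P = z" if z: "z \<in> carrier (dir_sum M N)" for z
  proof -
    have xz: "fst z \<in> carrier M" and yz: "snd z \<in> carrier N" using z by (auto simp: dir_sum_simps)
    \<comment> \<open>The last \<open>k\<close> generators have first component zero, so only
      \<open>n\<close> terms survive in \<open>M\<close>; \<open>sn\<close> is the mirror statement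
      for \<open>N\<close>.\<close>
    have fn: "lin_comb M (n + k) c r = lin_comb M n c r"
      if "!!i. i < n ==> c i \<in> carrier R \<and> r i \<in> carrier M" "!!i. i \<ge> n ==> i < n + k ==> c i \<in> carrier R \<and> r i = \<zero>\<^bsub>M\<^esub>" for c r
    proof -
      have cl: "c i \<odot>\<^bsub>M\<^esub> r i \<in> carrier M" if "i < n + k" for i
        using \<open>!!i. i < n ==> c i \<in> carrier R \<and> r i \<in> carrier M\<close>[of i]
          \<open>!!i. i \<ge> n ==> i < n + k ==> c i \<in> carrier R \<and> r i = \<zero>\<^bsub>M\<^esub>\<close>[of i] that by (cases "i < n") auto
      have "(\<Oplus>\<^bsub>M\<^esub>i\<in>{..<k}. c (n + i) \<odot>\<^bsub>M\<^esub> r (n + i)) = (\<Oplus>\<^bsub>M\<^esub>i\<in>{..<k}. \<zero>\<^bsub>M\<^esub>)"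
        using that(2) by (intro M.M.finsum_cong') auto
      also have "\<dots> = \<zero>\<^bsub>M\<^esub>" by (rule M.M.finsum_zero)
      finally show ?thesis unfolding lin_comb_def
        using cl by (subst M.M.finsum_lessThan_add) (auto intro!: M.M.finsum_closed M.M.r_zero)
    qed
    have sn: "lin_comb N (n + k) c r = lin_comb N k (%i. c (n + i)) (%i. r (n + i))"
      if "!!i. i < k ==> c (n + i) \<in> carrier R \<and> r (n + i) \<in> carrier N" "!!i. i < n ==> c i \<in> carrier R \<and> r i = \<zero>\<^bsub>N\<^esub>" for c r
    proof -
      have cl: "c i \<odot>\<^bsub>N\<^esub> r i \<in> carrier N" if "i < n + k" for i
        using \<open>!!i. i < k ==> c (n + i) \<in> carrier R \<and> r (n + i) \<in> carrier N\<close>[of "i - n"]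
          \<open>!!i. i < n ==> c i \<in> carrier R \<and> r i = \<zero>\<^bsub>N\<^esub>\<close>[of i] that by (cases "i < n") auto
      have "(\<Oplus>\<^bsub>N\<^esub>i\<in>{..<n}. c i \<odot>\<^bsub>N\<^esub> r i) = (\<Oplus>\<^bsub>N\<^esub>i\<in>{..<n}. \<zero>\<^bsub>N\<^esub>)"
        using that(2) by (intro N.M.finsum_cong') auto
      also have "\<dots> = \<zero>\<^bsub>N\<^esub>" by (rule N.M.finsum_zero)
      finally show ?thesis unfolding lin_comb_def
        using cl by (subst N.M.finsum_lessThan_add) (auto intro!: N.M.finsum_closed N.M.l_zero)
    qed
    have Jz: "J i z \<in> carrier R" if "i < n + k" for i using linear_formD(1)[OF JL[OF that] z] .
    have "fst (lin_comb (dir_sum M N) (n + k) (%i. J i z) P) = lin_comb M (n + k) (%i. J i z) (%i. fst (P i))"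
      by (rule MN.mod_hom_lin_comb[OF fst_hom M.module_axioms]) (auto intro: Jz PM)
    also have "\<dots> = lin_comb M n (%i. J i z) (%i. fst (P i))"
      using Jz dual_basisD(2)[OF db] by (intro fn) (auto simp: P_def)
    also have "\<dots> = lin_comb M n (%i. \<iota> i (fst z)) p"
      using dual_basisD[OF db] xz by (intro M.lin_comb_cong) (auto simp: P_def J_def)
    also have "\<dots> = fst z" using dual_basisD(4)[OF db xz] .
    finally have 1: "fst (lin_comb (dir_sum M N) (n + k) (%i. J i z) P) = fst z" .
    have "snd (lin_comb (dir_sum M N) (n + k) (%i. J i z) P) = lin_comb N (n + k) (%i. J i z) (%i. snd (P i))"
      by (rule MN.mod_hom_lin_comb[OF snd_hom N.module_axioms]) (auto intro: Jz PM)
    also have "\<dots> = lin_comb N k (%i. J (n + i) z) (%i. snd (P (n + i)))"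
      using Jz dual_basisD(2)[OF db'] by (intro sn) (auto simp: P_def)
    also have "\<dots> = lin_comb N k (%i. \<kappa> i (snd z)) q"
      using dual_basisD[OF db'] yz by (intro N.lin_comb_cong) (auto simp: P_def J_def)
    also have "\<dots> = snd z" using dual_basisD(4)[OF db' yz] .
    finally show ?thesis using 1 by (simp add: prod_eq_iff)
  qed
  then have "dual_basis R (dir_sum M N) (n + k) P J"
    unfolding dual_basis_def using MN.module_axioms PM JL by blast
  moreover have "gram_sum R n e f i j = J i (P j)" if "i < n + k" "j < n + k" for i j
    using that e f M.linear_form_zero[OF dual_basisD(3)[OF db, of i]] N.linear_form_zero[OF dual_basisD(3)[OF db', of "i - n"]]
    by (auto simp: gram_sum_def J_def P_def)
  ultimately show ?thesis unfolding has_gram_def by blast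
qed

definition mat_mult :: "('r, 'k) ring_scheme => nat => (nat => nat => 'r) => (nat => nat => 'r) => nat => nat => 'r" where
  "mat_mult R n a b = (%i j. \<Oplus>\<^bsub>R\<^esub>k\<in>{..<n}. a i k \<otimes>\<^bsub>R\<^esub> b k j)"

text \<open>Equivalence of idempotents: \<open>e = a b\<close> and \<open>f = b a\<close> make
  \<open>b\<close> and \<open>a\<close> inverse isomorphisms between the images of \<open>e\<close>
  and \<open>f\<close>.\<close>

definition mat_equiv :: "('r, 'k) ring_scheme => nat => (nat => nat => 'r) => nat => (nat => nat => 'r) => bool" where
  "mat_equiv R n e k f \<longleftrightarrow> (\<exists>a b. (\<forall>i<n. \<forall>j<k. a i j \<in> carrier R) \<and> (\<forall>i<k. \<forall>j<n. b i j \<in> carrier R) \<and>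
     (\<forall>i<n. \<forall>j<n. mat_mult R k a b i j = e i j) \<and> (\<forall>i<k. \<forall>j<k. mat_mult R n b a i j = f i j))"

text \<open>The generators are combined along the columns of \<open>a\<close>, the forms along the
  rows of \<open>b\<close>. Reassembling \<open>x\<close> involves \<open>a b = e\<close>, which
  fixes the coordinate vector of \<open>x\<close>. The new Gram matrix is
  \<open>b e a = b a b a = f f\<close>, which is where idempotence of \<open>f\<close>
  enters.\<close>

lemma has_gram_equiv:
  assumes "has_gram R M n e" and eq: "mat_equiv R n e k f"
    and ff: "!!i j. i < k ==> j < k ==> mat_mult R k f f i j = f i j"
  shows "has_gram R M k f"
proof -
  obtain p \<iota> where db: "dual_basis R M n p \<iota>" and e: "\<forall>i<n. \<forall>j<n. e i j = \<iota> i (p j)"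
    using assms(1) by (auto simp: has_gram_def)
  interpret M: fmodule R M by (rule fmodule.intro[OF dual_basisD(1)[OF db]])
  note dbD = dual_basisD[OF db]
  obtain a b where a0: "\<forall>i<n. \<forall>j<k. a i j \<in> carrier R" and b0: "\<forall>i<k. \<forall>j<n. b i j \<in> carrier R"
    and ab0: "\<forall>i<n. \<forall>j<n. mat_mult R k a b i j = e i j" and ba0: "\<forall>i<k. \<forall>j<k. mat_mult R n b a i j = f i j"
    using eq unfolding mat_equiv_def by (elim exE conjE) (rule that)
  have a: "!!i j. i < n ==> j < k ==> a i j \<in> carrier R" using a0 by simp
  have b: "!!i j. i < k ==> j < n ==> b i j \<in> carrier R" using b0 by simp
  have ab: "!!i j. i < n ==> j < n ==> mat_mult R k a b i j = e i j" using ab0 by simp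
  have ba: "!!i j. i < k ==> j < k ==> mat_mult R n b a i j = f i j" using ba0 by simp
  define q where "q l = lin_comb M n (%i. a i l) p" for l
  define \<kappa> where "\<kappa> l x = (\<Oplus>\<^bsub>R\<^esub>i\<in>{..<n}. b l i \<otimes>\<^bsub>R\<^esub> \<iota> i x)" for l x
  have q: "q l \<in> carrier M" if "l < k" for l unfolding q_def using that a dbD by (intro M.lin_comb_closed) auto
  have \<kappa>R: "\<kappa> l x \<in> carrier R" if "l < k" "x \<in> carrier M" for l x
    unfolding \<kappa>_def using that b dbD(5) by (intro M.R.finsum_closed) auto
  have \<kappa>: "linear_form R M (\<kappa> l)" if l: "l < k" for l
    unfolding linear_form_def
  proof (intro conjI ballI)
    fix x y assume x: "x \<in> carrier M" and y: "y \<in> carrier M"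
    have "\<kappa> l (x \<oplus>\<^bsub>M\<^esub> y) = (\<Oplus>\<^bsub>R\<^esub>i\<in>{..<n}. b l i \<otimes>\<^bsub>R\<^esub> \<iota> i x \<oplus>\<^bsub>R\<^esub> b l i \<otimes>\<^bsub>R\<^esub> \<iota> i y)"
      unfolding \<kappa>_def using l x y b dbD(5) linear_formD(2)[OF dbD(3)]
      by (intro M.R.finsum_cong') (auto simp: M.R.r_distr)
    then show "\<kappa> l (x \<oplus>\<^bsub>M\<^esub> y) = \<kappa> l x \<oplus>\<^bsub>R\<^esub> \<kappa> l y"
      unfolding \<kappa>_def using l x y b dbD(5) by (subst (asm) M.R.finsum_addf) auto
  next
    fix c x assume c: "c \<in> carrier R" and x: "x \<in> carrier M"
    have "\<kappa> l (c \<odot>\<^bsub>M\<^esub> x) = (\<Oplus>\<^bsub>R\<^esub>i\<in>{..<n}. c \<otimes>\<^bsub>R\<^esub> (b l i \<otimes>\<^bsub>R\<^esub> \<iota> i x))"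
      unfolding \<kappa>_def using l x c b dbD(5) linear_formD(3)[OF dbD(3)]
      by (intro M.R.finsum_cong') (auto simp: M.R.m_lcomm)
    also have "\<dots> = c \<otimes>\<^bsub>R\<^esub> \<kappa> l x"
      unfolding \<kappa>_def using l x c b dbD(5) by (subst M.R.finsum_rdistr) auto
    finally show "\<kappa> l (c \<odot>\<^bsub>M\<^esub> x) = c \<otimes>\<^bsub>R\<^esub> \<kappa> l x" .
  qed (use \<kappa>R[OF l] in auto)
  have \<iota>p: "\<iota> i (lin_comb M n c p) = (\<Oplus>\<^bsub>R\<^esub>j\<in>{..<n}. c j \<otimes>\<^bsub>R\<^esub> e i j)" if "i < n" "!!j. j < n ==> c j \<in> carrier R" for i c
  proof -
    have "\<iota> i (lin_comb M n c p) = (\<Oplus>\<^bsub>R\<^esub>j\<in>{..<n}. c j \<otimes>\<^bsub>R\<^esub> \<iota> i (p j))"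
      using that dbD by (intro M.linear_form_lin_comb) auto
    also have "\<dots> = (\<Oplus>\<^bsub>R\<^esub>j\<in>{..<n}. c j \<otimes>\<^bsub>R\<^esub> e i j)"
      using that e dbD by (intro M.R.finsum_cong') auto
    finally show ?thesis .
  qed
  have eR: "e i j \<in> carrier R" if "i < n" "j < n" for i j using e that dbD by auto
  have "lin_comb M k (%l. \<kappa> l x) q = x" if x: "x \<in> carrier M" for x
  proof -
    have "lin_comb M k (%l. \<kappa> l x) q = lin_comb M n (%i. \<Oplus>\<^bsub>R\<^esub>l\<in>{..<k}. \<kappa> l x \<otimes>\<^bsub>R\<^esub> a i l) p"
      unfolding q_def using \<kappa>R x a dbD by (intro M.lin_comb_lin_comb) auto
    also have "\<dots> = lin_comb M n (%i. \<iota> i x) p"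
    proof (rule M.lin_comb_cong)
      fix i assume i: "i < n"
      have "(\<Oplus>\<^bsub>R\<^esub>l\<in>{..<k}. \<kappa> l x \<otimes>\<^bsub>R\<^esub> a i l) = (\<Oplus>\<^bsub>R\<^esub>l\<in>{..<k}. \<Oplus>\<^bsub>R\<^esub>j\<in>{..<n}. \<iota> j x \<otimes>\<^bsub>R\<^esub> (a i l \<otimes>\<^bsub>R\<^esub> b l j))"
      proof (intro M.R.finsum_cong' refl)
        fix l assume "l \<in> {..<k}"
        then have l: "l < k" by simp
        have "\<kappa> l x \<otimes>\<^bsub>R\<^esub> a i l = (\<Oplus>\<^bsub>R\<^esub>j\<in>{..<n}. (b l j \<otimes>\<^bsub>R\<^esub> \<iota> j x) \<otimes>\<^bsub>R\<^esub> a i l)"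
          unfolding \<kappa>_def using i l x a b dbD(5) by (intro M.R.finsum_ldistr) auto
        also have "\<dots> = (\<Oplus>\<^bsub>R\<^esub>j\<in>{..<n}. \<iota> j x \<otimes>\<^bsub>R\<^esub> (a i l \<otimes>\<^bsub>R\<^esub> b l j))"
          using i l x a b dbD(5) by (intro M.R.finsum_cong' refl) (auto simp: M.R.m_ac)
        finally show "\<kappa> l x \<otimes>\<^bsub>R\<^esub> a i l = (\<Oplus>\<^bsub>R\<^esub>j\<in>{..<n}. \<iota> j x \<otimes>\<^bsub>R\<^esub> (a i l \<otimes>\<^bsub>R\<^esub> b l j))" .
      qed (use i x a b dbD(5) in \<open>auto intro!: M.R.finsum_closed\<close>)
      also have "\<dots> = (\<Oplus>\<^bsub>R\<^esub>j\<in>{..<n}. \<Oplus>\<^bsub>R\<^esub>l\<in>{..<k}. \<iota> j x \<otimes>\<^bsub>R\<^esub> (a i l \<otimes>\<^bsub>R\<^esub> b l j))"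
        using i x a b dbD(5) by (intro M.R.finsum_swap) auto
      also have "\<dots> = (\<Oplus>\<^bsub>R\<^esub>j\<in>{..<n}. \<iota> j x \<otimes>\<^bsub>R\<^esub> e i j)"
        using i x a b dbD(5) eR
        by (intro M.R.finsum_cong' refl) (auto simp: M.R.finsum_rdistr[symmetric] ab[symmetric] mat_mult_def)
      also have "\<dots> = \<iota> i (lin_comb M n (%i. \<iota> i x) p)" using i x dbD by (intro \<iota>p[symmetric]) auto
      also have "\<dots> = \<iota> i x" using dbD(4)[OF x] by simp
      finally show "(\<Oplus>\<^bsub>R\<^esub>l\<in>{..<k}. \<kappa> l x \<otimes>\<^bsub>R\<^esub> a i l) = \<iota> i x" .
    qed (use x dbD in auto)
    also have "\<dots> = x" using dbD(4)[OF x] .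
    finally show ?thesis .
  qed
  then have "dual_basis R M k q \<kappa>" unfolding dual_basis_def using M.module_axioms q \<kappa> by blast
  moreover have "f l m = \<kappa> l (q m)" if l: "l < k" and m: "m < k" for l m
  proof -
    have bam: "mat_mult R n b a i j \<in> carrier R" if "i < k" "j < k" for i j
      unfolding mat_mult_def using that a b by (intro M.R.finsum_closed) auto
    have fR: "f i j \<in> carrier R" if "i < k" "j < k" for i j using bam[OF that] ba[OF that] by simp
    have "\<kappa> l (q m) = (\<Oplus>\<^bsub>R\<^esub>i\<in>{..<n}. b l i \<otimes>\<^bsub>R\<^esub> (\<Oplus>\<^bsub>R\<^esub>j\<in>{..<n}. a j m \<otimes>\<^bsub>R\<^esub> e i j))"
      unfolding \<kappa>_def q_def using l m a b eR
      by (intro M.R.finsum_cong' refl) (auto simp: \<iota>p intro!: M.R.finsum_closed)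
    also have "\<dots> = (\<Oplus>\<^bsub>R\<^esub>i\<in>{..<n}. \<Oplus>\<^bsub>R\<^esub>j\<in>{..<n}. b l i \<otimes>\<^bsub>R\<^esub> (a j m \<otimes>\<^bsub>R\<^esub> e i j))"
      using l m a b eR by (intro M.R.finsum_cong' refl) (auto simp: M.R.finsum_rdistr intro!: M.R.finsum_closed)
    also have "\<dots> = (\<Oplus>\<^bsub>R\<^esub>i\<in>{..<n}. \<Oplus>\<^bsub>R\<^esub>j\<in>{..<n}. \<Oplus>\<^bsub>R\<^esub>s\<in>{..<k}. (b l i \<otimes>\<^bsub>R\<^esub> a i s) \<otimes>\<^bsub>R\<^esub> (b s j \<otimes>\<^bsub>R\<^esub> a j m))"
    proof (intro M.R.finsum_cong' refl)
      fix i j assume "i \<in> {..<n}" "j \<in> {..<n}"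
      then have ij: "i < n" "j < n" by auto
      have "b l i \<otimes>\<^bsub>R\<^esub> (a j m \<otimes>\<^bsub>R\<^esub> e i j) = (b l i \<otimes>\<^bsub>R\<^esub> a j m) \<otimes>\<^bsub>R\<^esub> (\<Oplus>\<^bsub>R\<^esub>s\<in>{..<k}. a i s \<otimes>\<^bsub>R\<^esub> b s j)"
        using ij l m a b eR ab[of i j] by (simp add: mat_mult_def M.R.m_assoc)
      also have "\<dots> = (\<Oplus>\<^bsub>R\<^esub>s\<in>{..<k}. (b l i \<otimes>\<^bsub>R\<^esub> a j m) \<otimes>\<^bsub>R\<^esub> (a i s \<otimes>\<^bsub>R\<^esub> b s j))"
        using ij l m a b by (subst M.R.finsum_rdistr) auto
      also have "\<dots> = (\<Oplus>\<^bsub>R\<^esub>s\<in>{..<k}. (b l i \<otimes>\<^bsub>R\<^esub> a i s) \<otimes>\<^bsub>R\<^esub> (b s j \<otimes>\<^bsub>R\<^esub> a j m))"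
        using ij l m a b by (intro M.R.finsum_cong' refl) (auto simp: M.R.m_ac)
      finally show "b l i \<otimes>\<^bsub>R\<^esub> (a j m \<otimes>\<^bsub>R\<^esub> e i j) = (\<Oplus>\<^bsub>R\<^esub>s\<in>{..<k}. (b l i \<otimes>\<^bsub>R\<^esub> a i s) \<otimes>\<^bsub>R\<^esub> (b s j \<otimes>\<^bsub>R\<^esub> a j m))" .
    qed (use l m a b in \<open>auto intro!: M.R.finsum_closed\<close>)
    also have "\<dots> = (\<Oplus>\<^bsub>R\<^esub>i\<in>{..<n}. \<Oplus>\<^bsub>R\<^esub>s\<in>{..<k}. \<Oplus>\<^bsub>R\<^esub>j\<in>{..<n}. (b l i \<otimes>\<^bsub>R\<^esub> a i s) \<otimes>\<^bsub>R\<^esub> (b s j \<otimes>\<^bsub>R\<^esub> a j m))"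
      using l m a b by (intro M.R.finsum_cong' refl M.R.finsum_swap) (auto intro!: M.R.finsum_closed)
    also have "\<dots> = (\<Oplus>\<^bsub>R\<^esub>i\<in>{..<n}. \<Oplus>\<^bsub>R\<^esub>s\<in>{..<k}. (b l i \<otimes>\<^bsub>R\<^esub> a i s) \<otimes>\<^bsub>R\<^esub> f s m)"
      using l m a b
      by (intro M.R.finsum_cong' refl)
        (auto simp: M.R.finsum_rdistr[symmetric] ba[symmetric] mat_mult_def intro!: M.R.finsum_closed)
    also have "\<dots> = (\<Oplus>\<^bsub>R\<^esub>s\<in>{..<k}. \<Oplus>\<^bsub>R\<^esub>i\<in>{..<n}. (b l i \<otimes>\<^bsub>R\<^esub> a i s) \<otimes>\<^bsub>R\<^esub> f s m)"
      using l m a b fR by (intro M.R.finsum_swap) auto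
    also have "\<dots> = (\<Oplus>\<^bsub>R\<^esub>s\<in>{..<k}. f l s \<otimes>\<^bsub>R\<^esub> f s m)"
    proof (intro M.R.finsum_cong' refl)
      fix s assume "s \<in> {..<k}"
      then have s: "s < k" by simp
      have "f s m \<in> carrier R" using bam[OF s m] ba[OF s m] by simp
      then have "(\<Oplus>\<^bsub>R\<^esub>i\<in>{..<n}. (b l i \<otimes>\<^bsub>R\<^esub> a i s) \<otimes>\<^bsub>R\<^esub> f s m) = (\<Oplus>\<^bsub>R\<^esub>i\<in>{..<n}. b l i \<otimes>\<^bsub>R\<^esub> a i s) \<otimes>\<^bsub>R\<^esub> f s m"
        using l s a b by (intro M.R.finsum_ldistr[symmetric]) auto
      then show "(\<Oplus>\<^bsub>R\<^esub>i\<in>{..<n}. (b l i \<otimes>\<^bsub>R\<^esub> a i s) \<otimes>\<^bsub>R\<^esub> f s m) = f l s \<otimes>\<^bsub>R\<^esub> f s m"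
        using ba[OF l s] by (simp add: mat_mult_def)
    qed (use l m fR in auto)
    also have "\<dots> = f l m" using ff[OF l m] by (simp add: mat_mult_def)
    finally show ?thesis ..
  qed
  ultimately show ?thesis unfolding has_gram_def by blast
qed

text \<open>Expanding \<open>p j\<close> in the dual basis and applying \<open>\<iota> i\<close>
  produces the matrix product.\<close>

lemma gram_idempotent:
  assumes "has_gram R M n e" "i < n" "j < n"
  shows "e i j \<in> carrier R" "mat_mult R n e e i j = e i j"
proof -
  obtain p \<iota> where db: "dual_basis R M n p \<iota>" and e: "\<forall>i<n. \<forall>j<n. e i j = \<iota> i (p j)"
    using assms(1) by (auto simp: has_gram_def)
  interpret M: fmodule R M by (rule fmodule.intro[OF dual_basisD(1)[OF db]])
  note dbD = dual_basisD[OF db]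
  have eR: "e i j \<in> carrier R" if "i < n" "j < n" for i j using e that dbD by auto
  then show "e i j \<in> carrier R" using assms by blast
  have "e i j = \<iota> i (lin_comb M n (%k. \<iota> k (p j)) p)" using assms e dbD(2,4) by simp
  also have "\<dots> = (\<Oplus>\<^bsub>R\<^esub>k\<in>{..<n}. \<iota> k (p j) \<otimes>\<^bsub>R\<^esub> \<iota> i (p k))"
    using assms dbD by (intro M.linear_form_lin_comb) auto
  also have "\<dots> = mat_mult R n e e i j"
    unfolding mat_mult_def using assms e eR dbD by (intro M.R.finsum_cong') (auto simp: M.R.m_comm)
  finally show "mat_mult R n e e i j = e i j" ..
qed

section \<open>Finitely generated projective modules as images of idempotents\<close>

lemma (in fmodule) submodule_lin_comb:
  assumes H: "submodule H R M" and "!!i. i < n ==> c i \<in> carrier R" "!!i. i < n ==> p i \<in> H"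
  shows "lin_comb M n c p \<in> H"
  using assms(2,3)
proof (induction n)
  case 0
  have "\<zero>\<^bsub>M\<^esub> \<in> H" using submoduleE(4)[OF H, of \<zero>] submoduleE(1,2)[OF H] by (metis R.zero_closed ex_in_conv smult_l_null subsetD)
  then show ?case by (simp add: lin_comb_def)
next
  case (Suc n)
  have sub: "H \<subseteq> carrier M" using submoduleE(1)[OF H] .
  have "lin_comb M (Suc n) c p = c n \<odot>\<^bsub>M\<^esub> p n \<oplus>\<^bsub>M\<^esub> lin_comb M n c p"
    unfolding lin_comb_def using Suc.prems sub by (intro M.finsum_lessThan_Suc) auto
  then show ?case using Suc submoduleE(4,5)[OF H] by simp
qed

lemma submodule_fmodule:
  assumes "Module.module R M" "submodule H R M"
  shows "Module.module R (M\<lparr>carrier := H\<rparr>)"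
  using submodule.submodule_is_module[OF assms(2,1)] .

text \<open>The image of an idempotent is encoded as the set of its fixed vectors in
  \<open>R^n\<close>. Its elements are functions on \<open>nat\<close>, the carrier type that
  \<open>fgp_modules\<close> prescribes.\<close>

definition image_module :: "('r, 'k) ring_scheme => nat => (nat => nat => 'r) => ('r, nat => 'r) module" where
  "image_module R n e = (free_module R {..<n})\<lparr>carrier := {v \<in> carrier (free_module R {..<n}).
     \<forall>i<n. (\<Oplus>\<^bsub>R\<^esub>j\<in>{..<n}. e i j \<otimes>\<^bsub>R\<^esub> v j) = v i}\<rparr>"

text \<open>The columns of \<open>e\<close> generate and the coordinate functions are the forms, so
  the Gram matrix is \<open>e\<close> itself.\<close>

lemma has_gram_image_module:
  assumes "cring R" and eR: "!!i j. i < n ==> j < n ==> e i j \<in> carrier R"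
    and ee: "!!i j. i < n ==> j < n ==> mat_mult R n e e i j = e i j"
  shows "has_gram R (image_module R n e) n e"
proof -
  interpret R: cring R by fact
  let ?F = "free_module R {..<n} :: ('a, nat => 'a) module"
  interpret F: fmodule R ?F by (rule fmodule.intro[OF free_module_module[OF assms(1)]])
  let ?H = "{v \<in> carrier ?F. \<forall>i<n. (\<Oplus>\<^bsub>R\<^esub>j\<in>{..<n}. e i j \<otimes>\<^bsub>R\<^esub> v j) = v i}"
  note mem = R.free_module_mem[where I = "{..<n}"]
  have add: "(\<Oplus>\<^bsub>R\<^esub>j\<in>{..<n}. e i j \<otimes>\<^bsub>R\<^esub> (v j \<oplus>\<^bsub>R\<^esub> w j)) =
      (\<Oplus>\<^bsub>R\<^esub>j\<in>{..<n}. e i j \<otimes>\<^bsub>R\<^esub> v j) \<oplus>\<^bsub>R\<^esub> (\<Oplus>\<^bsub>R\<^esub>j\<in>{..<n}. e i j \<otimes>\<^bsub>R\<^esub> w j)"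
    if "v \<in> carrier ?F" "w \<in> carrier ?F" "i < n" for v w i
  proof -
    have "(\<Oplus>\<^bsub>R\<^esub>j\<in>{..<n}. e i j \<otimes>\<^bsub>R\<^esub> (v j \<oplus>\<^bsub>R\<^esub> w j)) = (\<Oplus>\<^bsub>R\<^esub>j\<in>{..<n}. e i j \<otimes>\<^bsub>R\<^esub> v j \<oplus>\<^bsub>R\<^esub> e i j \<otimes>\<^bsub>R\<^esub> w j)"
      using that eR mem[OF that(1)] mem[OF that(2)] by (intro R.finsum_cong') (auto simp: R.r_distr)
    also have "\<dots> = (\<Oplus>\<^bsub>R\<^esub>j\<in>{..<n}. e i j \<otimes>\<^bsub>R\<^esub> v j) \<oplus>\<^bsub>R\<^esub> (\<Oplus>\<^bsub>R\<^esub>j\<in>{..<n}. e i j \<otimes>\<^bsub>R\<^esub> w j)"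
      using that eR mem[OF that(1)] mem[OF that(2)] by (intro R.finsum_addf) auto
    finally show ?thesis .
  qed
  have smul: "(\<Oplus>\<^bsub>R\<^esub>j\<in>{..<n}. e i j \<otimes>\<^bsub>R\<^esub> (a \<otimes>\<^bsub>R\<^esub> v j)) = a \<otimes>\<^bsub>R\<^esub> (\<Oplus>\<^bsub>R\<^esub>j\<in>{..<n}. e i j \<otimes>\<^bsub>R\<^esub> v j)"
    if "v \<in> carrier ?F" "a \<in> carrier R" "i < n" for v a i
  proof -
    have "(\<Oplus>\<^bsub>R\<^esub>j\<in>{..<n}. e i j \<otimes>\<^bsub>R\<^esub> (a \<otimes>\<^bsub>R\<^esub> v j)) = (\<Oplus>\<^bsub>R\<^esub>j\<in>{..<n}. a \<otimes>\<^bsub>R\<^esub> (e i j \<otimes>\<^bsub>R\<^esub> v j))"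
      using that eR mem[OF that(1)] by (intro R.finsum_cong') (auto simp: R.m_lcomm)
    also have "\<dots> = a \<otimes>\<^bsub>R\<^esub> (\<Oplus>\<^bsub>R\<^esub>j\<in>{..<n}. e i j \<otimes>\<^bsub>R\<^esub> v j)"
      using that eR mem[OF that(1)] by (intro R.finsum_rdistr[symmetric]) auto
    finally show ?thesis .
  qed
  have smH: "a \<odot>\<^bsub>?F\<^esub> v \<in> ?H" if a: "a \<in> carrier R" and v: "v \<in> ?H" for a v
  proof -
    have "a \<odot>\<^bsub>?F\<^esub> v \<in> carrier ?F" using a v by auto
    moreover have "(\<Oplus>\<^bsub>R\<^esub>j\<in>{..<n}. e i j \<otimes>\<^bsub>R\<^esub> (a \<odot>\<^bsub>?F\<^esub> v) j) = (a \<odot>\<^bsub>?F\<^esub> v) i" if "i < n" for i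
      using smul[of v a i] a v that by (simp add: free_module_simps)
    ultimately show ?thesis by simp
  qed
  have H: "submodule ?H R ?F"
  proof (rule F.submoduleI)
    show "\<zero>\<^bsub>?F\<^esub> \<in> ?H"
    proof -
      have "(\<Oplus>\<^bsub>R\<^esub>j\<in>{..<n}. e i j \<otimes>\<^bsub>R\<^esub> \<zero>\<^bsub>R\<^esub>) = (\<Oplus>\<^bsub>R\<^esub>j\<in>{..<n}. \<zero>\<^bsub>R\<^esub>)" if "i < n" for i
        using that eR by (intro R.finsum_cong') auto
      moreover have "(\<Oplus>\<^bsub>R\<^esub>j\<in>{..<n}. \<zero>\<^bsub>R\<^esub>) = \<zero>\<^bsub>R\<^esub>" by (rule R.finsum_zero)
      ultimately show ?thesis using F.M.zero_closed by (simp add: free_module_simps)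
    qed
    show "\<ominus>\<^bsub>?F\<^esub> v \<in> ?H" if v: "v \<in> ?H" for v
    proof -
      have "(\<ominus>\<^bsub>R\<^esub> \<one>\<^bsub>R\<^esub>) \<odot>\<^bsub>?F\<^esub> v = \<ominus>\<^bsub>?F\<^esub> v"
        using F.smult_l_minus[of "\<one>\<^bsub>R\<^esub>" v] v by simp
      then show ?thesis using smH[OF _ v, of "\<ominus>\<^bsub>R\<^esub> \<one>\<^bsub>R\<^esub>"] by simp
    qed
    show "v \<oplus>\<^bsub>?F\<^esub> w \<in> ?H" if v: "v \<in> ?H" and w: "w \<in> ?H" for v w
    proof -
      have "v \<oplus>\<^bsub>?F\<^esub> w \<in> carrier ?F" using v w by auto
      moreover have "(\<Oplus>\<^bsub>R\<^esub>j\<in>{..<n}. e i j \<otimes>\<^bsub>R\<^esub> (v \<oplus>\<^bsub>?F\<^esub> w) j) = (v \<oplus>\<^bsub>?F\<^esub> w) i" if "i < n" for i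
        using add[of v w i] v w that by (simp add: free_module_simps)
      ultimately show ?thesis by simp
    qed
  qed (use smH in auto)
  let ?P = "image_module R n e"
  have P: "Module.module R ?P" unfolding image_module_def
    by (rule submodule_fmodule[OF F.module_axioms H])
  interpret P: fmodule R ?P by (rule fmodule.intro[OF P])
  have simps: "carrier ?P = ?H" "!!v w. v \<oplus>\<^bsub>?P\<^esub> w = (%i. v i \<oplus>\<^bsub>R\<^esub> w i)"
    "!!a v. a \<odot>\<^bsub>?P\<^esub> v = (%i. a \<otimes>\<^bsub>R\<^esub> v i)" by (simp_all add: image_module_def free_module_def)
  define p where "p j = (%i. if i < n then e i j else \<zero>\<^bsub>R\<^esub>)" for j
  have p: "p j \<in> carrier ?P" if j: "j < n" for j
  proof -
    have "p j \<in> carrier ?F" using eR j by (auto simp: free_module_def p_def intro: finite_subset[of _ "{..<n}"])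
    moreover have "(\<Oplus>\<^bsub>R\<^esub>k\<in>{..<n}. e i k \<otimes>\<^bsub>R\<^esub> p j k) = p j i" if i: "i < n" for i
    proof -
      have "(\<Oplus>\<^bsub>R\<^esub>k\<in>{..<n}. e i k \<otimes>\<^bsub>R\<^esub> p j k) = (\<Oplus>\<^bsub>R\<^esub>k\<in>{..<n}. e i k \<otimes>\<^bsub>R\<^esub> e k j)"
        using i j eR by (intro R.finsum_cong') (auto simp: p_def)
      then show ?thesis using ee[OF i j] i by (simp add: mat_mult_def p_def)
    qed
    ultimately show ?thesis by (simp add: simps)
  qed
  have lf: "linear_form R ?P (%v. v i)" for i
    using mem by (auto simp: linear_form_def simps)
  have "lin_comb ?P n (%i. v i) p = v" if v: "v \<in> carrier ?P" for v
  proof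
    fix i
    have vF: "v \<in> carrier ?F" using v by (simp add: simps)
    have vR: "v j \<in> carrier R" for j using mem[OF vF] .
    have "lin_comb ?P n (%i. v i) p i = (\<Oplus>\<^bsub>R\<^esub>j\<in>{..<n}. v j \<otimes>\<^bsub>R\<^esub> p j i)"
      using p vR by (intro P.linear_form_lin_comb[OF lf]) auto
    also have "\<dots> = v i"
    proof (cases "i < n")
      case True
      have "(\<Oplus>\<^bsub>R\<^esub>j\<in>{..<n}. v j \<otimes>\<^bsub>R\<^esub> p j i) = (\<Oplus>\<^bsub>R\<^esub>j\<in>{..<n}. e i j \<otimes>\<^bsub>R\<^esub> v j)"
        using True eR vR by (intro R.finsum_cong') (auto simp: p_def R.m_comm)
      then show ?thesis using v True by (simp add: simps)
    next
      case False
      have "(\<Oplus>\<^bsub>R\<^esub>j\<in>{..<n}. v j \<otimes>\<^bsub>R\<^esub> p j i) = (\<Oplus>\<^bsub>R\<^esub>j\<in>{..<n}. \<zero>\<^bsub>R\<^esub>)"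
        using False vR by (intro R.finsum_cong') (auto simp: p_def)
      also have "\<dots> = \<zero>\<^bsub>R\<^esub>" by (rule R.finsum_zero)
      finally show ?thesis using vF False by (simp add: free_module_def)
    qed
    finally show "lin_comb ?P n (%i. v i) p i = v i" .
  qed
  then have "dual_basis R ?P n p (%i v. v i)" unfolding dual_basis_def using P p lf by auto
  then show ?thesis unfolding has_gram_def by (intro exI[of _ p] exI[of _ "%i v. v i"]) (simp add: p_def)
qed

lemma finite_enumeration: "finite S ==> \<exists>g n. bij_betw g {..<n::nat} S"
  using ex_bij_betw_nat_finite[of S] by (auto simp: atLeast0LessThan)

text \<open>\<open>P\<close> is a direct summand of a free module, and finitely many generators
  involve finitely many basis elements only. The coordinates at these are the forms; the projections
  of these basis elements to \<open>P\<close> are the generators.\<close>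

lemma fgp_has_gram:
  assumes "fgp_module R P"
  shows "\<exists>n e. has_gram R P n e"
proof -
  have P: "Module.module R P" using assms by (simp add: fgp_module_def fin_gen_module_def)
  interpret P: fmodule R P by (rule fmodule.intro[OF P])
  obtain A where A: "finite A" "A \<subseteq> carrier P" "!!H. submodule H R P ==> A \<subseteq> H ==> H = carrier P"
    using assms unfolding fgp_module_def fin_gen_module_def by blast
  obtain I :: "'c set" and Q :: "('a, 'c => 'a) module" where Q: "Module.module R Q"
    and iso: "mod_isomorphic R (dir_sum P Q) (free_module R I)"
    using assms unfolding fgp_module_def projective_module_def by blast
  obtain f where f: "f \<in> mod_hom R (dir_sum P Q) (free_module R I)"
    and fb: "bij_betw f (carrier (dir_sum P Q)) (carrier (free_module R I))" using iso by (rule mod_isoE)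
  interpret Q: fmodule R Q by (rule fmodule.intro[OF Q])
  have PQ: "Module.module R (dir_sum P Q)" by (rule dir_sum_module[OF P Q])
  interpret F: fmodule R "free_module R I" by (rule fmodule.intro[OF free_module_module[OF P.R.cring_axioms]])
  define g where "g x = f (x, \<zero>\<^bsub>Q\<^esub>)" for x
  have inj: "(%x. (x, \<zero>\<^bsub>Q\<^esub>)) \<in> mod_hom R P (dir_sum P Q)"
    by (rule mod_homI) (auto simp: dir_sum_simps)
  have g: "g \<in> mod_hom R P (free_module R I)" unfolding g_def by (rule mod_hom_comp[OF inj f])
  note mem = P.R.free_module_mem[where I = I]
  have gR: "g x i \<in> carrier R" if "x \<in> carrier P" for x i by (rule mem[OF mod_homD(1)[OF g that]])
  define S where "S = (\<Union>a\<in>A. {i. g a i \<noteq> \<zero>\<^bsub>R\<^esub>})"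
  have "finite S" unfolding S_def
  proof (rule finite_UN_I[OF A(1)])
    fix a assume "a \<in> A"
    then have "g a \<in> carrier (free_module R I)" using A(2) mod_homD(1)[OF g] by blast
    then show "finite {i. g a i \<noteq> \<zero>\<^bsub>R\<^esub>}" by (simp add: free_module_def)
  qed
  then obtain b n where b: "bij_betw b {..<n::nat} S" using finite_enumeration by metis
  \<comment> \<open>The elements supported in \<open>S\<close> form a submodule that contains the
    generating set \<open>A\<close>.\<close>
  have supp: "g x i = \<zero>\<^bsub>R\<^esub>" if x: "x \<in> carrier P" and i: "i \<notin> S" for x i
  proof -
    let ?H = "{x \<in> carrier P. \<forall>i. i \<notin> S \<longrightarrow> g x i = \<zero>\<^bsub>R\<^esub>}"
    have sm: "a \<odot>\<^bsub>P\<^esub> x \<in> ?H" if "a \<in> carrier R" "x \<in> ?H" for a x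
      using that by (simp add: mod_homD[OF g] free_module_simps)
    have "submodule ?H R P"
    proof (rule P.submoduleI)
      show "\<zero>\<^bsub>P\<^esub> \<in> ?H"
        using P.mod_hom_zero[OF g F.module_axioms] by (simp add: free_module_simps)
      show "\<ominus>\<^bsub>P\<^esub> x \<in> ?H" if "x \<in> ?H" for x
        using sm[of "\<ominus>\<^bsub>R\<^esub> \<one>\<^bsub>R\<^esub>" x] P.smult_l_minus[of "\<one>\<^bsub>R\<^esub>" x] that by simp
      show "x \<oplus>\<^bsub>P\<^esub> y \<in> ?H" if "x \<in> ?H" "y \<in> ?H" for x y
        using that by (simp add: mod_homD[OF g] free_module_simps)
    qed (use sm in auto)
    moreover have "A \<subseteq> ?H" using A(2) by (auto simp: S_def)
    ultimately have "?H = carrier P" by (rule A(3))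
    then show ?thesis using x i by blast
  qed
  have SI: "S \<subseteq> I"
  proof
    fix i assume "i \<in> S"
    then obtain a where a: "a \<in> A" "g a i \<noteq> \<zero>\<^bsub>R\<^esub>" by (auto simp: S_def)
    then have "g a \<in> carrier (free_module R I)" using A(2) mod_homD(1)[OF g] by blast
    then show "i \<in> I" using a(2) by (auto simp: free_module_def)
  qed
  have bS: "b k \<in> S" if "k < n" for k using b that by (auto simp: bij_betw_def)
  have binj: "b k = b l \<longleftrightarrow> k = l" if "k < n" "l < n" for k l using b that by (auto simp: bij_betw_def inj_on_def)
  let ?f' = "inv_into (carrier (dir_sum P Q)) f"
  have f': "?f' \<in> mod_hom R (free_module R I) (dir_sum P Q)" by (rule mod_hom_inv[OF PQ f fb])
  define \<delta> where "\<delta> k = (%i. if i = b k then \<one>\<^bsub>R\<^esub> else \<zero>\<^bsub>R\<^esub>)" for k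
  have \<delta>: "\<delta> k \<in> carrier (free_module R I)" if "k < n" for k
    using bS[OF that] SI by (auto simp: \<delta>_def free_module_def intro: finite_subset[of _ "{b k}"])
  have fst_hom: "fst \<in> mod_hom R (dir_sum P Q) P" by (auto simp: mod_hom_def dir_sum_simps)
  have h: "(%w. fst (?f' w)) \<in> mod_hom R (free_module R I) P" by (rule mod_hom_comp[OF f' fst_hom])
  define p where "p k = fst (?f' (\<delta> k))" for k
  have p: "p k \<in> carrier P" if "k < n" for k unfolding p_def by (rule mod_homD(1)[OF h \<delta>[OF that]])
  have ev: "linear_form R (free_module R I) (%v. v i)" for i
    using mem by (auto simp: linear_form_def free_module_simps)
  have lf: "linear_form R P (%x. g x i)" for i by (rule linear_form_comp[OF ev g])
  have "lin_comb P n (%k. g x (b k)) p = x" if x: "x \<in> carrier P" for x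
  proof -
    have "lin_comb (free_module R I) n (%k. g x (b k)) \<delta> = g x"
    proof
      fix i
      have "lin_comb (free_module R I) n (%k. g x (b k)) \<delta> i = (\<Oplus>\<^bsub>R\<^esub>k\<in>{..<n}. g x (b k) \<otimes>\<^bsub>R\<^esub> \<delta> k i)"
        using gR[OF x] \<delta> by (intro F.linear_form_lin_comb[OF ev]) auto
      also have "\<dots> = g x i"
      proof (cases "i \<in> S")
        case True
        then obtain l where l: "l < n" "i = b l" using b by (auto simp: bij_betw_def)
        have "(\<Oplus>\<^bsub>R\<^esub>k\<in>{..<n}. g x (b k) \<otimes>\<^bsub>R\<^esub> \<delta> k i) = (\<Oplus>\<^bsub>R\<^esub>k\<in>{..<n}. if k = l then g x (b k) else \<zero>\<^bsub>R\<^esub>)"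
          using l binj gR[OF x] by (intro P.R.finsum_cong') (auto simp: \<delta>_def)
        also have "\<dots> = g x (b l)" using l gR[OF x] by (intro P.R.finsum_delta) auto
        finally show ?thesis using l by simp
      next
        case False
        have "(\<Oplus>\<^bsub>R\<^esub>k\<in>{..<n}. g x (b k) \<otimes>\<^bsub>R\<^esub> \<delta> k i) = (\<Oplus>\<^bsub>R\<^esub>k\<in>{..<n}. \<zero>\<^bsub>R\<^esub>)"
          using False bS gR[OF x] by (intro P.R.finsum_cong') (auto simp: \<delta>_def)
        also have "\<dots> = \<zero>\<^bsub>R\<^esub>" by (rule P.R.finsum_zero)
        finally show ?thesis using supp[OF x False] by simp
      qed
      finally show "lin_comb (free_module R I) n (%k. g x (b k)) \<delta> i = g x i" .
    qed
    then have "fst (?f' (g x)) = fst (?f' (lin_comb (free_module R I) n (%k. g x (b k)) \<delta>))" by simp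
    also have "\<dots> = lin_comb P n (%k. g x (b k)) p"
      unfolding p_def using gR[OF x] \<delta> by (intro F.mod_hom_lin_comb[OF h P]) auto
    also have "fst (?f' (g x)) = x"
      unfolding g_def using fb x by (simp add: bij_betw_def dir_sum_simps)
    finally show ?thesis ..
  qed
  then have "dual_basis R P n p (%k x. g x (b k))" unfolding dual_basis_def using P p lf by blast
  then show ?thesis unfolding has_gram_def
    by (intro exI[of _ n] exI[of _ "%i j. g (p j) (b i)"] exI[of _ p] exI[of _ "%k x. g x (b k)"]) simp
qed

text \<open>The coordinate map \<open>em\<close> is a section of a map \<open>\<pi>\<close> from a
  free module of rank \<open>n\<close>, so \<open>P\<close> together with the kernel of
  \<open>\<pi>\<close> is free. In \<open>projective_module\<close> the index set consists of
  elements of the carrier type; \<open>inf\<close> supplies \<open>n\<close> of them.\<close>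

lemma has_gram_fgp:
  fixes P :: "('r, 'p) module"
  assumes "has_gram R P n e" and inf: "infinite (UNIV :: 'p set)"
  shows "fgp_module R P"
proof -
  obtain p \<iota> where db: "dual_basis R P n p \<iota>" using assms(1) by (auto simp: has_gram_def)
  note dbD = dual_basisD[OF db]
  interpret P: fmodule R P by (rule fmodule.intro[OF dbD(1)])
  have fg: "fin_gen_module R P"
    unfolding fin_gen_module_def
  proof (intro conjI exI allI impI)
    show "finite (p ` {..<n})" by simp
    show "p ` {..<n} \<subseteq> carrier P" using dbD(2) by auto
    fix H assume H: "submodule H R P" and sub: "p ` {..<n} \<subseteq> H"
    have "x \<in> H" if x: "x \<in> carrier P" for x
    proof -
      have "lin_comb P n (%i. \<iota> i x) p \<in> H" using sub dbD(5) x by (intro P.submodule_lin_comb[OF H]) auto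
      then show ?thesis using dbD(4)[OF x] by simp
    qed
    then show "H = carrier P" using P.submoduleE(1)[OF H] by blast
  qed (rule P.module_axioms)
  obtain I :: "'p set" where I: "finite I" "card I = n"
    using infinite_arbitrarily_large[OF inf, of n] by blast
  obtain g where g: "bij_betw g {..<n} I"
    using ex_bij_betw_nat_finite[OF I(1)] I(2) by (auto simp: atLeast0LessThan)
  let ?g' = "inv_into {..<n} g"
  have g'g: "?g' (g k) = k" and gI: "g k \<in> I" if "k < n" for k using g that by (auto simp: bij_betw_def)
  have gg': "g (?g' i) = i" and g'n: "?g' i < n" if "i \<in> I" for i
    using g that by (auto simp: bij_betw_def f_inv_into_f)
  let ?F = "free_module R I"
  interpret F: fmodule R ?F by (rule fmodule.intro[OF free_module_module[OF P.R.cring_axioms]])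
  note mem = P.R.free_module_mem[where I = I]
  have ev: "linear_form R ?F (%v. v i)" for i using mem by (auto simp: linear_form_def free_module_simps)
  define \<pi> where "\<pi> v = lin_comb P n (%k. v (g k)) p" for v
  have \<pi>: "\<pi> \<in> mod_hom R ?F P" unfolding \<pi>_def by (rule P.mod_hom_lin_comb_form) (use ev dbD in auto)
  define em where "em x = (%i. if i \<in> I then \<iota> (?g' i) x else \<zero>\<^bsub>R\<^esub>)" for x
  have em: "em \<in> mod_hom R P ?F"
  proof (rule mod_homI)
    show "em x \<in> carrier ?F" if "x \<in> carrier P" for x
      using that dbD(5) g'n I(1) by (auto simp: em_def free_module_def intro: finite_subset[of _ I])
    show "em (x \<oplus>\<^bsub>P\<^esub> y) = em x \<oplus>\<^bsub>?F\<^esub> em y" if "x \<in> carrier P" "y \<in> carrier P" for x y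
      using that g'n linear_formD(2)[OF dbD(3)] by (auto simp: em_def free_module_simps)
    show "em (a \<odot>\<^bsub>P\<^esub> x) = a \<odot>\<^bsub>?F\<^esub> em x" if "a \<in> carrier R" "x \<in> carrier P" for a x
      using that g'n linear_formD(3)[OF dbD(3)] by (auto simp: em_def free_module_simps)
  qed
  have \<pi>em: "\<pi> (em x) = x" if x: "x \<in> carrier P" for x
  proof -
    have "\<pi> (em x) = lin_comb P n (%k. \<iota> k x) p"
      unfolding \<pi>_def using x dbD gI g'g by (intro P.lin_comb_cong) (auto simp: em_def)
    then show ?thesis using dbD(4)[OF x] by simp
  qed
  have \<pi>0: "\<pi> \<zero>\<^bsub>?F\<^esub> = \<zero>\<^bsub>P\<^esub>" by (rule F.mod_hom_zero[OF \<pi> P.module_axioms])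
  let ?K = "{v \<in> carrier ?F. \<pi> v = \<zero>\<^bsub>P\<^esub>}"
  have sm: "a \<odot>\<^bsub>?F\<^esub> v \<in> ?K" if "a \<in> carrier R" "v \<in> ?K" for a v using that by (simp add: mod_homD[OF \<pi>])
  have K: "submodule ?K R ?F"
  proof (rule F.submoduleI)
    show "\<zero>\<^bsub>?F\<^esub> \<in> ?K" using \<pi>0 by simp
    show "\<ominus>\<^bsub>?F\<^esub> v \<in> ?K" if "v \<in> ?K" for v
      using sm[of "\<ominus>\<^bsub>R\<^esub> \<one>\<^bsub>R\<^esub>" v] F.smult_l_minus[of "\<one>\<^bsub>R\<^esub>" v] that by simp
    show "v \<oplus>\<^bsub>?F\<^esub> w \<in> ?K" if "v \<in> ?K" "w \<in> ?K" for v w using that by (simp add: mod_homD[OF \<pi>])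
  qed (use sm in auto)
  define Q where "Q = ?F\<lparr>carrier := ?K\<rparr>"
  have Q: "Module.module R Q" unfolding Q_def by (rule submodule_fmodule[OF F.module_axioms K])
  have Qs: "carrier Q = ?K" "!!v w. v \<oplus>\<^bsub>Q\<^esub> w = v \<oplus>\<^bsub>?F\<^esub> w" "!!a v. a \<odot>\<^bsub>Q\<^esub> v = a \<odot>\<^bsub>?F\<^esub> v"
    by (simp_all add: Q_def)
  define h where "h = (%(x, v). em x \<oplus>\<^bsub>?F\<^esub> v)"
  have emF: "em x \<in> carrier ?F" if "x \<in> carrier P" for x by (rule mod_homD(1)[OF em that])
  have \<pi>P: "\<pi> v \<in> carrier P" if "v \<in> carrier ?F" for v by (rule mod_homD(1)[OF \<pi> that])
  have hm: "h \<in> mod_hom R (dir_sum P Q) ?F"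
  proof (rule mod_homI)
    fix z assume z: "z \<in> carrier (dir_sum P Q)"
    then obtain x v where zx: "z = (x, v)" "x \<in> carrier P" "v \<in> carrier ?F" by (auto simp: dir_sum_simps Qs)
    show "h z \<in> carrier ?F" using zx emF by (simp add: h_def)
    show "h (a \<odot>\<^bsub>dir_sum P Q\<^esub> z) = a \<odot>\<^bsub>?F\<^esub> h z" if "a \<in> carrier R" for a
      using zx emF that by (simp add: h_def dir_sum_simps Qs mod_homD[OF em] F.smult_r_distr)
    fix z' assume "z' \<in> carrier (dir_sum P Q)"
    then obtain x' v' where zx': "z' = (x', v')" "x' \<in> carrier P" "v' \<in> carrier ?F" by (auto simp: dir_sum_simps Qs)
    show "h (z \<oplus>\<^bsub>dir_sum P Q\<^esub> z') = h z \<oplus>\<^bsub>?F\<^esub> h z'"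
      using zx zx' emF by (simp add: h_def dir_sum_simps Qs mod_homD[OF em] F.M.a_ac)
  qed
  have "bij_betw h (carrier (dir_sum P Q)) (carrier ?F)"
  proof (rule bij_betwI[where g = "%w. (\<pi> w, w \<ominus>\<^bsub>?F\<^esub> em (\<pi> w))"])
    show "h \<in> carrier (dir_sum P Q) \<rightarrow> carrier ?F" using mod_homD(1)[OF hm] by blast
    have \<pi>minus: "\<pi> (v \<ominus>\<^bsub>?F\<^esub> w) = \<pi> v \<ominus>\<^bsub>P\<^esub> \<pi> w" if "v \<in> carrier ?F" "w \<in> carrier ?F" for v w
    proof -
      have "\<pi> (\<ominus>\<^bsub>?F\<^esub> w) = \<ominus>\<^bsub>P\<^esub> \<pi> w"
        using mod_homD(3)[OF \<pi>, of "\<ominus>\<^bsub>R\<^esub> \<one>\<^bsub>R\<^esub>" w] F.smult_l_minus[of "\<one>\<^bsub>R\<^esub>" w] P.smult_l_minus[of "\<one>\<^bsub>R\<^esub>" "\<pi> w"]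
          that \<pi>P by simp
      then show ?thesis using that by (simp add: a_minus_def mod_homD(2)[OF \<pi>])
    qed
    show "(%w. (\<pi> w, w \<ominus>\<^bsub>?F\<^esub> em (\<pi> w))) \<in> carrier ?F \<rightarrow> carrier (dir_sum P Q)"
      using \<pi>P emF by (auto simp: dir_sum_simps Qs \<pi>minus \<pi>em P.M.minus_eq P.M.r_neg)
    show "(\<pi> (h z), h z \<ominus>\<^bsub>?F\<^esub> em (\<pi> (h z))) = z" if z: "z \<in> carrier (dir_sum P Q)" for z
    proof -
      obtain x v where zx: "z = (x, v)" "x \<in> carrier P" "v \<in> carrier ?F" "\<pi> v = \<zero>\<^bsub>P\<^esub>" using z by (auto simp: dir_sum_simps Qs)
      have "\<pi> (h z) = x" using zx emF by (simp add: h_def mod_homD(2)[OF \<pi>] \<pi>em)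
      moreover have "em x \<oplus>\<^bsub>?F\<^esub> v \<ominus>\<^bsub>?F\<^esub> em x = v"
      proof -
        have "em x \<oplus>\<^bsub>?F\<^esub> v \<ominus>\<^bsub>?F\<^esub> em x = v \<oplus>\<^bsub>?F\<^esub> em x \<oplus>\<^bsub>?F\<^esub> (\<ominus>\<^bsub>?F\<^esub> em x)"
          using zx emF by (simp add: a_minus_def F.M.a_comm)
        also have "\<dots> = v" using zx emF by (simp only: F.M.a_assoc F.M.r_neg F.M.a_inv_closed F.M.r_zero)
        finally show ?thesis .
      qed
      ultimately show ?thesis using zx by (simp add: h_def)
    qed
    show "h (\<pi> w, w \<ominus>\<^bsub>?F\<^esub> em (\<pi> w)) = w" if w: "w \<in> carrier ?F" for w
    proof -
      have e: "em (\<pi> w) \<in> carrier ?F" using emF[OF \<pi>P[OF w]] .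
      have "em (\<pi> w) \<oplus>\<^bsub>?F\<^esub> (w \<oplus>\<^bsub>?F\<^esub> \<ominus>\<^bsub>?F\<^esub> em (\<pi> w)) = w \<oplus>\<^bsub>?F\<^esub> (em (\<pi> w) \<oplus>\<^bsub>?F\<^esub> \<ominus>\<^bsub>?F\<^esub> em (\<pi> w))"
        using w e by (intro F.M.a_lcomm) auto
      also have "\<dots> = w" using w e by (simp only: F.M.r_neg F.M.r_zero)
      finally show ?thesis by (simp add: h_def a_minus_def)
    qed
  qed
  with hm have "mod_isomorphic R (dir_sum P Q) ?F" unfolding mod_isomorphic_def by blast
  then have "projective_module R P" unfolding projective_module_def using P.module_axioms Q by blast
  with fg show ?thesis by (simp add: fgp_module_def)
qed

section \<open>Extension of scalars\<close>

lemma generate_frag_induct: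
  assumes "c \<in> generate (free_Abelian_group U) G" "!!g. g \<in> G ==> Poly_Mapping.keys g \<subseteq> U"
    and "Q 0" "!!g. g \<in> G ==> Q g" "!!a b. Q a ==> Q b ==> Q (a - b)"
  shows "Q c"
  using assms(1)
proof (induction rule: generate.induct)
  case one
  then show ?case using assms(3) by simp
next
  case (incl h)
  then show ?case by (rule assms(4))
next
  case (inv h)
  \<comment> \<open>The inverse in the free abelian group on \<open>U\<close> is the negative for
    elements supported in \<open>U\<close>; this is what the support hypothesis is for.\<close>
  have "Q (0 - h)" using assms(3) assms(4)[OF inv] by (rule assms(5))
  then show ?case using assms(2)[OF inv] by simp
next
  case (eng h1 h2)
  have "Q (h1 - (0 - h2))" by (rule assms(5)[OF eng(3) assms(5)[OF assms(3) eng(4)]])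
  then show ?case by simp
qed

text \<open>Common setting of the tensor product and of \<open>K0\<close>, both quotients of a free
  abelian group. A coset \<open>cls c\<close> makes sense for every \<open>c\<close>, but only those
  of elements supported in \<open>U\<close> belong to the factor group.\<close>

locale frag_quotient =
  fixes U :: "'a set" and N :: "('a \<Rightarrow>\<^sub>0 int) set"
  assumes subgroup: "subgroup N (free_Abelian_group U)"
begin

abbreviation "FX \<equiv> free_Abelian_group U"

definition cls :: "('a \<Rightarrow>\<^sub>0 int) => ('a \<Rightarrow>\<^sub>0 int) set" where
  "cls c = N #>\<^bsub>FX\<^esub> c"

lemma N_keys: "c \<in> N ==> Poly_Mapping.keys c \<subseteq> U"
  using subsetD[OF subgroup.subset[OF subgroup], of c] by simp

lemma N_zero: "0 \<in> N"
  using subgroup.one_closed[OF subgroup] by simp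

lemma N_add: "c \<in> N ==> d \<in> N ==> c + d \<in> N"
  using subgroup.m_closed[OF subgroup, of c d] by simp

lemma N_minus: "c \<in> N ==> - c \<in> N"
  using subgroup.m_inv_closed[OF subgroup, of c] N_keys[of c] by simp

lemma N_diff: "c \<in> N ==> d \<in> N ==> c - d \<in> N"
  using N_add[of c "- d"] N_minus[of d] by simp

lemma mem_cls: "c \<in> cls d \<longleftrightarrow> c - d \<in> N"
  by (auto simp: cls_def r_coset_def) (metis diff_add_cancel)

lemma self_cls: "c \<in> cls c"
  by (simp add: mem_cls N_zero)

lemma cls_eq: "cls c = cls d \<longleftrightarrow> c - d \<in> N"
proof
  assume "c - d \<in> N"
  then show "cls c = cls d"
    using N_add[of "_ - c" "c - d"] N_diff[of "_ - d" "c - d"] by (auto simp: mem_cls)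
qed (use self_cls[of c] mem_cls in blast)

lemma cls_eqI: "c - d \<in> N ==> cls c = cls d"
  by (simp add: cls_eq)

lemma cls_zero: "cls 0 = N"
  by (auto simp: mem_cls)

lemma cls_mult: "cls c <#>\<^bsub>FX\<^esub> cls d = cls (c + d)"
proof (intro Set.set_eqI iffI)
  fix z assume "z \<in> cls c <#>\<^bsub>FX\<^esub> cls d"
  then obtain x y where "x - c \<in> N" "y - d \<in> N" "z = x + y" by (auto simp: set_mult_def mem_cls)
  then show "z \<in> cls (c + d)" using N_add[of "x - c" "y - d"] by (simp add: mem_cls algebra_simps)
next
  fix z assume "z \<in> cls (c + d)"
  then have "z - c \<in> cls d" by (simp add: mem_cls algebra_simps)
  then show "z \<in> cls c <#>\<^bsub>FX\<^esub> cls d" using self_cls[of c]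
    unfolding set_mult_def by (intro UN_I[of c] UN_I[of "z - c"]) simp_all
qed

lemma carrier_Mod: "carrier (FX Mod N) = cls ` {c. Poly_Mapping.keys c \<subseteq> U}"
proof -
  have "carrier FX = {c. Poly_Mapping.keys c \<subseteq> U}" by auto
  moreover have "cls = (%c. N #>\<^bsub>FX\<^esub> c)" by (auto simp: cls_def)
  ultimately show ?thesis by (simp only: carrier_FactGroup)
qed

text \<open>Well-definedness of the operations that \<open>base_change\<close> and
  \<open>K0_map\<close> define as unions over representatives: an additive map respecting the
  relations sends all representatives to one coset.\<close>

lemma Union_cls:
  assumes "!!c d. \<theta> (c - d) = \<theta> c - \<theta> d" "!!c. c \<in> N ==> \<theta> c \<in> N'" "frag_quotient U' N'"
  shows "(\<Union>c\<in>cls d. frag_quotient.cls U' N' (\<theta> c)) = frag_quotient.cls U' N' (\<theta> d)"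
proof -
  have "frag_quotient.cls U' N' (\<theta> c) = frag_quotient.cls U' N' (\<theta> d)" if "c \<in> cls d" for c
    using assms(2)[of "c - d"] that by (simp add: frag_quotient.cls_eq[OF assms(3)] assms(1) mem_cls)
  then show ?thesis using self_cls[of d] by blast
qed

end

lemma generate_frag_quotient:
  assumes "!!g. g \<in> G ==> Poly_Mapping.keys g \<subseteq> U"
  shows "frag_quotient U (generate (free_Abelian_group U) G)"
proof (rule frag_quotient.intro, rule group.generate_is_subgroup[OF group_free_Abelian_group])
  show "G \<subseteq> carrier (free_Abelian_group U)"
  proof
    fix g assume "g \<in> G"
    then show "g \<in> carrier (free_Abelian_group U)" using assms by simp
  qed
qed

lemma keys_frag_of_diff: "a \<in> U ==> b \<in> U ==> Poly_Mapping.keys (frag_of a - frag_of b) \<subseteq> U"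
  using keys_diff[of "frag_of a" "frag_of b"] by auto

lemma keys_frag_of_diff2:
  "a \<in> U ==> b \<in> U ==> c \<in> U ==> Poly_Mapping.keys (frag_of a - frag_of b - frag_of c) \<subseteq> U"
  using keys_diff[of "frag_of a - frag_of b" "frag_of c"] keys_frag_of_diff[of a U b] by auto

section \<open>Scalar action and induced forms on the tensor product\<close>

locale scalar_extension = R: cring R + S: cring S + P: fmodule R P
  for R :: "('r, 'k) ring_scheme" and S :: "('s, 'l) ring_scheme" and P :: "('r, 'p) module" +
  fixes h :: "'r => 's"
  assumes h: "h \<in> ring_hom R S"
begin

abbreviation "U \<equiv> carrier S \<times> carrier P"
abbreviation "N \<equiv> tensor_relations R S h P"

lemmas h_simps = ring_hom_closed[OF h] ring_hom_mult[OF h] ring_hom_add[OF h] ring_hom_one[OF h]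

definition gens where
  "gens = {frag_of (s \<oplus>\<^bsub>S\<^esub> t, x) - frag_of (s, x) - frag_of (t, x) | s t x.
           s \<in> carrier S \<and> t \<in> carrier S \<and> x \<in> carrier P} \<union>
        {frag_of (s, x \<oplus>\<^bsub>P\<^esub> y) - frag_of (s, x) - frag_of (s, y) | s x y.
           s \<in> carrier S \<and> x \<in> carrier P \<and> y \<in> carrier P} \<union>
        {frag_of (s \<otimes>\<^bsub>S\<^esub> h a, x) - frag_of (s, a \<odot>\<^bsub>P\<^esub> x) | s a x.
           s \<in> carrier S \<and> a \<in> carrier R \<and> x \<in> carrier P}"

lemma N_def: "N = generate (free_Abelian_group U) gens"
  by (simp add: tensor_relations_def gens_def)

lemma gens1: "s \<in> carrier S ==> t \<in> carrier S ==> x \<in> carrier P ==>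
    frag_of (s \<oplus>\<^bsub>S\<^esub> t, x) - frag_of (s, x) - frag_of (t, x) \<in> gens"
  unfolding gens_def by (intro UnI1 CollectI exI conjI) (rule refl)

lemma gens2: "s \<in> carrier S ==> x \<in> carrier P ==> y \<in> carrier P ==>
    frag_of (s, x \<oplus>\<^bsub>P\<^esub> y) - frag_of (s, x) - frag_of (s, y) \<in> gens"
  unfolding gens_def by (rule UnI1, rule UnI2, intro CollectI exI conjI) (rule refl)

lemma gens3: "s \<in> carrier S ==> a \<in> carrier R ==> x \<in> carrier P ==>
    frag_of (s \<otimes>\<^bsub>S\<^esub> h a, x) - frag_of (s, a \<odot>\<^bsub>P\<^esub> x) \<in> gens"
  unfolding gens_def by (rule UnI2, intro CollectI exI conjI) (rule refl)

lemma gens_cases: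
  assumes "g \<in> gens"
  obtains (1) s t x where "g = frag_of (s \<oplus>\<^bsub>S\<^esub> t, x) - frag_of (s, x) - frag_of (t, x)"
      "s \<in> carrier S" "t \<in> carrier S" "x \<in> carrier P"
    | (2) s x y where "g = frag_of (s, x \<oplus>\<^bsub>P\<^esub> y) - frag_of (s, x) - frag_of (s, y)"
      "s \<in> carrier S" "x \<in> carrier P" "y \<in> carrier P"
    | (3) s a x where "g = frag_of (s \<otimes>\<^bsub>S\<^esub> h a, x) - frag_of (s, a \<odot>\<^bsub>P\<^esub> x)"
      "s \<in> carrier S" "a \<in> carrier R" "x \<in> carrier P"
  using assms unfolding gens_def by (elim UnE CollectE exE conjE) (rule 1 2 3; assumption)+

lemma gens_keys: "g \<in> gens ==> Poly_Mapping.keys g \<subseteq> U"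
proof (erule gens_cases)
  fix s t x assume g: "g = frag_of (s \<oplus>\<^bsub>S\<^esub> t, x) - frag_of (s, x) - frag_of (t, x)"
    and m: "s \<in> carrier S" "t \<in> carrier S" "x \<in> carrier P"
  show "Poly_Mapping.keys g \<subseteq> U" unfolding g by (rule keys_frag_of_diff2) (use m in auto)
next
  fix s x y assume g: "g = frag_of (s, x \<oplus>\<^bsub>P\<^esub> y) - frag_of (s, x) - frag_of (s, y)"
    and m: "s \<in> carrier S" "x \<in> carrier P" "y \<in> carrier P"
  show "Poly_Mapping.keys g \<subseteq> U" unfolding g by (rule keys_frag_of_diff2) (use m in auto)
next
  fix s a x assume g: "g = frag_of (s \<otimes>\<^bsub>S\<^esub> h a, x) - frag_of (s, a \<odot>\<^bsub>P\<^esub> x)"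
    and m: "s \<in> carrier S" "a \<in> carrier R" "x \<in> carrier P"
  show "Poly_Mapping.keys g \<subseteq> U" unfolding g by (rule keys_frag_of_diff) (use m in \<open>auto simp: h_simps\<close>)
qed

sublocale T: frag_quotient U N
  unfolding N_def by (rule generate_frag_quotient) (rule gens_keys)

lemma gens_N: "g \<in> gens ==> g \<in> N"
  unfolding N_def by (rule generate.incl)

definition ten :: "'s => 'p => ('s \<times> 'p \<Rightarrow>\<^sub>0 int) set" where
  "ten s x = T.cls (frag_of (s, x))"

abbreviation "B \<equiv> base_change R S h P"

lemma B_simps:
  "carrier B = T.cls ` {c. Poly_Mapping.keys c \<subseteq> U}" "\<zero>\<^bsub>B\<^esub> = T.cls 0"
  "T.cls c \<oplus>\<^bsub>B\<^esub> T.cls d = T.cls (c + d)"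
  by (simp_all add: base_change_def Let_def T.carrier_Mod T.cls_zero T.cls_mult)

lemma keys_U_add: "Poly_Mapping.keys c \<subseteq> U ==> Poly_Mapping.keys d \<subseteq> U ==> Poly_Mapping.keys (c + d) \<subseteq> U"
  using keys_add[of c d] by blast

lemma B_cases: "x \<in> carrier B ==> (!!c. x = T.cls c ==> Poly_Mapping.keys c \<subseteq> U ==> thesis) ==> thesis"
  unfolding B_simps by blast

lemma B_mem: "Poly_Mapping.keys c \<subseteq> U ==> T.cls c \<in> carrier B"
  unfolding B_simps by blast

lemma B_group: "abelian_group B"
proof (rule abelian_groupI)
  fix x y z assume x: "x \<in> carrier B" and y: "y \<in> carrier B"
  then obtain c d where c: "x = T.cls c" "Poly_Mapping.keys c \<subseteq> U" and d: "y = T.cls d" "Poly_Mapping.keys d \<subseteq> U"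
    by (elim B_cases) blast
  show "x \<oplus>\<^bsub>B\<^esub> y \<in> carrier B" using c d by (simp add: B_simps(3) B_mem keys_U_add)
  show "x \<oplus>\<^bsub>B\<^esub> y = y \<oplus>\<^bsub>B\<^esub> x" using c d by (simp add: B_simps(3) add.commute)
  assume "z \<in> carrier B"
  then obtain e where "z = T.cls e" by (elim B_cases) blast
  then show "x \<oplus>\<^bsub>B\<^esub> y \<oplus>\<^bsub>B\<^esub> z = x \<oplus>\<^bsub>B\<^esub> (y \<oplus>\<^bsub>B\<^esub> z)" using c d by (simp add: B_simps(3) add.assoc)
next
  fix x assume "x \<in> carrier B"
  then obtain c where c: "x = T.cls c" "Poly_Mapping.keys c \<subseteq> U" by (elim B_cases) blast
  then show "\<zero>\<^bsub>B\<^esub> \<oplus>\<^bsub>B\<^esub> x = x" by (simp add: B_simps(2,3))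
  show "\<exists>y\<in>carrier B. y \<oplus>\<^bsub>B\<^esub> x = \<zero>\<^bsub>B\<^esub>"
    by (rule bexI[of _ "T.cls (- c)"]) (use c in \<open>simp_all add: B_simps(2,3) B_mem\<close>)
qed (simp add: B_simps(2) B_mem)

definition act :: "'s => ('s \<times> 'p \<Rightarrow>\<^sub>0 int) => ('s \<times> 'p \<Rightarrow>\<^sub>0 int)" where
  "act s = frag_extend (%(t, x). frag_of (s \<otimes>\<^bsub>S\<^esub> t, x))"

lemma act_simps: "act s (c - d) = act s c - act s d" "act s (c + d) = act s c + act s d" "act s 0 = 0"
  "act s (frag_of (t, x)) = frag_of (s \<otimes>\<^bsub>S\<^esub> t, x)"
  by (simp_all add: act_def frag_extend_diff frag_extend_add)

lemma act_keys: "s \<in> carrier S ==> Poly_Mapping.keys c \<subseteq> U ==> Poly_Mapping.keys (act s c) \<subseteq> U"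
  unfolding act_def using keys_frag_extend[of "%(t, x). frag_of (s \<otimes>\<^bsub>S\<^esub> t, x)" c] by fastforce

text \<open>Each of the three kinds of relations is stable by itself: the first by distributivity in
  \<open>S\<close>, the third by associativity.\<close>

lemma act_gens: "s \<in> carrier S ==> g \<in> gens ==> act s g \<in> gens"
proof (erule gens_cases)
  fix t t' x assume s: "s \<in> carrier S" and g: "g = frag_of (t \<oplus>\<^bsub>S\<^esub> t', x) - frag_of (t, x) - frag_of (t', x)"
    and m: "t \<in> carrier S" "t' \<in> carrier S" "x \<in> carrier P"
  show "act s g \<in> gens" using gens1[of "s \<otimes>\<^bsub>S\<^esub> t" "s \<otimes>\<^bsub>S\<^esub> t'" x] s m by (simp add: g act_simps S.r_distr)
next
  fix t x y assume s: "s \<in> carrier S" and g: "g = frag_of (t, x \<oplus>\<^bsub>P\<^esub> y) - frag_of (t, x) - frag_of (t, y)"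
    and m: "t \<in> carrier S" "x \<in> carrier P" "y \<in> carrier P"
  show "act s g \<in> gens" using gens2[of "s \<otimes>\<^bsub>S\<^esub> t" x y] s m by (simp add: g act_simps)
next
  fix t a x assume s: "s \<in> carrier S" and g: "g = frag_of (t \<otimes>\<^bsub>S\<^esub> h a, x) - frag_of (t, a \<odot>\<^bsub>P\<^esub> x)"
    and m: "t \<in> carrier S" "a \<in> carrier R" "x \<in> carrier P"
  show "act s g \<in> gens" using gens3[of "s \<otimes>\<^bsub>S\<^esub> t" a x] s m by (simp add: g act_simps S.m_assoc h_simps)
qed

lemma N_induct:
  assumes "c \<in> N" "Q 0" "!!g. g \<in> gens ==> Q g" "!!a b. Q a ==> Q b ==> Q (a - b)"
  shows "Q c"
  using assms(1) unfolding N_def by (rule generate_frag_induct) (fact gens_keys assms(2-4))+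

lemma act_N: "s \<in> carrier S ==> c \<in> N ==> act s c \<in> N"
  by (erule N_induct) (simp_all add: act_simps T.N_zero T.N_diff gens_N act_gens)

lemma B_smult: "s \<in> carrier S ==> s \<odot>\<^bsub>B\<^esub> T.cls c = T.cls (act s c)"
  using T.Union_cls[of "act s" N U c] act_N[of s] T.frag_quotient_axioms
  by (simp add: base_change_def Let_def act_simps act_def[symmetric] T.cls_def[symmetric])

lemma frag_cls_induct:
  assumes "Poly_Mapping.keys c \<subseteq> U" "!!s x. s \<in> carrier S ==> x \<in> carrier P ==> Q (frag_of (s, x))"
    "Q 0" "!!c d. Q c ==> Q d ==> Q (c - d)"
  shows "Q c"
  using assms(1) by (rule frag_induction) (use assms in auto)

text \<open>Additivity in the scalar is itself one of the relations and so holds modulo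
  \<open>N\<close>; the other laws of the action hold already on representatives.\<close>

lemma act_add_N: "s \<in> carrier S ==> t \<in> carrier S ==> Poly_Mapping.keys c \<subseteq> U ==>
  act (s \<oplus>\<^bsub>S\<^esub> t) c - (act s c + act t c) \<in> N"
proof (erule frag_cls_induct)
  fix r x assume a: "s \<in> carrier S" "t \<in> carrier S" "r \<in> carrier S" "x \<in> carrier P"
  then have "frag_of (s \<otimes>\<^bsub>S\<^esub> r \<oplus>\<^bsub>S\<^esub> t \<otimes>\<^bsub>S\<^esub> r, x) - frag_of (s \<otimes>\<^bsub>S\<^esub> r, x) - frag_of (t \<otimes>\<^bsub>S\<^esub> r, x) \<in> gens"
    by (intro gens1) auto
  then show "act (s \<oplus>\<^bsub>S\<^esub> t) (frag_of (r, x)) - (act s (frag_of (r, x)) + act t (frag_of (r, x))) \<in> N"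
    using a gens_N by (simp add: act_simps S.l_distr diff_diff_eq)
next
  fix c d assume "act (s \<oplus>\<^bsub>S\<^esub> t) c - (act s c + act t c) \<in> N" "act (s \<oplus>\<^bsub>S\<^esub> t) d - (act s d + act t d) \<in> N"
  from T.N_diff[OF this] show "act (s \<oplus>\<^bsub>S\<^esub> t) (c - d) - (act s (c - d) + act t (c - d)) \<in> N"
    by (simp add: act_simps algebra_simps)
qed (simp add: act_simps T.N_zero)

lemma act_mult: "s \<in> carrier S ==> t \<in> carrier S ==> Poly_Mapping.keys c \<subseteq> U ==>
  act (s \<otimes>\<^bsub>S\<^esub> t) c = act s (act t c)"
  by (erule frag_cls_induct) (simp_all add: act_simps S.m_assoc)

lemma act_one: "Poly_Mapping.keys c \<subseteq> U ==> act \<one>\<^bsub>S\<^esub> c = c"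
  by (erule frag_cls_induct) (simp_all add: act_simps)

lemma B_module: "Module.module S B"
proof (rule moduleI)
  show "cring S" by (rule S.cring_axioms)
  show "abelian_group B" by (rule B_group)
  fix s x assume s: "s \<in> carrier S" and "x \<in> carrier B"
  then obtain c where c: "Poly_Mapping.keys c \<subseteq> U" "x = T.cls c" by (elim B_cases) blast
  show "s \<odot>\<^bsub>B\<^esub> x \<in> carrier B" using act_keys[OF s c(1)] s c by (simp add: B_smult B_simps)
  show "(s \<oplus>\<^bsub>S\<^esub> t) \<odot>\<^bsub>B\<^esub> x = s \<odot>\<^bsub>B\<^esub> x \<oplus>\<^bsub>B\<^esub> t \<odot>\<^bsub>B\<^esub> x" if t: "t \<in> carrier S" for t
    using s t c act_add_N[OF s t c(1)] by (simp add: B_smult B_simps T.cls_eqI)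
  show "(s \<otimes>\<^bsub>S\<^esub> t) \<odot>\<^bsub>B\<^esub> x = s \<odot>\<^bsub>B\<^esub> (t \<odot>\<^bsub>B\<^esub> x)" if t: "t \<in> carrier S" for t
    using s t c act_mult[OF s t c(1)] by (simp add: B_smult)
  show "s \<odot>\<^bsub>B\<^esub> (x \<oplus>\<^bsub>B\<^esub> y) = s \<odot>\<^bsub>B\<^esub> x \<oplus>\<^bsub>B\<^esub> s \<odot>\<^bsub>B\<^esub> y" if "y \<in> carrier B" for y
  proof -
    obtain d where "Poly_Mapping.keys d \<subseteq> U" "y = T.cls d" using \<open>y \<in> carrier B\<close> by (auto simp: B_simps)
    with s c show ?thesis by (simp add: B_smult B_simps act_simps)
  qed
next
  fix x assume "x \<in> carrier B"
  then obtain c where c: "Poly_Mapping.keys c \<subseteq> U" "x = T.cls c" by (elim B_cases) blast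
  then show "\<one>\<^bsub>S\<^esub> \<odot>\<^bsub>B\<^esub> x = x" by (simp add: B_smult act_one)
qed

lemma ten_in: "s \<in> carrier S ==> x \<in> carrier P ==> ten s x \<in> carrier B"
  by (auto simp: ten_def B_simps)

lemma ten_add_right: "s \<in> carrier S ==> x \<in> carrier P ==> y \<in> carrier P ==> ten s (x \<oplus>\<^bsub>P\<^esub> y) = ten s x \<oplus>\<^bsub>B\<^esub> ten s y"
proof -
  assume a: "s \<in> carrier S" "x \<in> carrier P" "y \<in> carrier P"
  then have "frag_of (s, x \<oplus>\<^bsub>P\<^esub> y) - frag_of (s, x) - frag_of (s, y) \<in> gens" by (rule gens2)
  then show ?thesis unfolding ten_def B_simps using gens_N by (intro T.cls_eqI) (simp add: diff_diff_eq)
qed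

lemma ten_scalar: "s \<in> carrier S ==> a \<in> carrier R ==> x \<in> carrier P ==> ten (s \<otimes>\<^bsub>S\<^esub> h a) x = ten s (a \<odot>\<^bsub>P\<^esub> x)"
proof -
  assume a: "s \<in> carrier S" "a \<in> carrier R" "x \<in> carrier P"
  then have "frag_of (s \<otimes>\<^bsub>S\<^esub> h a, x) - frag_of (s, a \<odot>\<^bsub>P\<^esub> x) \<in> gens" by (rule gens3)
  then show ?thesis unfolding ten_def using gens_N by (intro T.cls_eqI)
qed

lemma ten_smult: "s \<in> carrier S ==> s \<odot>\<^bsub>B\<^esub> ten t x = ten (s \<otimes>\<^bsub>S\<^esub> t) x"
  by (simp add: ten_def B_smult act_simps)

text \<open>The universal property: the pair \<open>(s, x)\<close> is sent to \<open>s\<close> times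
  \<open>h (\<phi> x)\<close>, extended to the free abelian group, where every relation goes to
  zero.\<close>

lemma induced_form:
  assumes \<phi>: "linear_form R P \<phi>"
  obtains \<psi> where "linear_form S B \<psi>" "!!s x. s \<in> carrier S ==> x \<in> carrier P ==> \<psi> (ten s x) = s \<otimes>\<^bsub>S\<^esub> h (\<phi> x)"
proof -
  note \<phi>D = linear_formD[OF \<phi>]
  define f where "f = (%(s, x). s \<otimes>\<^bsub>S\<^esub> h (\<phi> x))"
  have "f ` U \<subseteq> carrier (add_monoid S)" using \<phi>D(1) by (auto simp: f_def h_simps)
  then obtain \<Psi> where \<Psi>: "\<Psi> \<in> hom (free_Abelian_group U) (add_monoid S)"
    and \<Psi>f: "!!z. z \<in> U ==> \<Psi> (frag_of z) = f z"
    by (rule comm_group.free_Abelian_group_universal[OF S.a_comm_group]) blast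
  have \<Psi>add: "\<Psi> (c + d) = \<Psi> c \<oplus>\<^bsub>S\<^esub> \<Psi> d" if "Poly_Mapping.keys c \<subseteq> U" "Poly_Mapping.keys d \<subseteq> U" for c d
    using \<Psi> that by (auto simp: hom_def)
  have \<Psi>S: "\<Psi> c \<in> carrier S" if "Poly_Mapping.keys c \<subseteq> U" for c
    using \<Psi> that by (auto simp: hom_def)
  have \<Psi>diff: "\<Psi> (c - d) = \<Psi> c \<ominus>\<^bsub>S\<^esub> \<Psi> d" if c: "Poly_Mapping.keys c \<subseteq> U" and d: "Poly_Mapping.keys d \<subseteq> U" for c d
  proof -
    have cd: "Poly_Mapping.keys (c - d) \<subseteq> U" using keys_diff[of c d] c d by blast
    have "\<Psi> c = \<Psi> (c - d) \<oplus>\<^bsub>S\<^esub> \<Psi> d" using \<Psi>add[OF cd d] by simp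
    then show ?thesis using \<Psi>S[OF cd] \<Psi>S[OF d]
      by (simp add: a_minus_def S.a_assoc S.r_neg)
  qed
  have \<Psi>0: "\<Psi> 0 = \<zero>\<^bsub>S\<^esub>" using \<Psi>diff[of 0 0] \<Psi>S[of 0] by (simp add: a_minus_def S.r_neg)
  have mem: "(s, x) \<in> U \<longleftrightarrow> s \<in> carrier S \<and> x \<in> carrier P" for s x by simp
  have cancel: "a \<oplus>\<^bsub>S\<^esub> b \<ominus>\<^bsub>S\<^esub> a \<ominus>\<^bsub>S\<^esub> b = \<zero>\<^bsub>S\<^esub>" if a: "a \<in> carrier S" and b: "b \<in> carrier S" for a b
  proof -
    have "a \<oplus>\<^bsub>S\<^esub> b \<oplus>\<^bsub>S\<^esub> \<ominus>\<^bsub>S\<^esub> a = b \<oplus>\<^bsub>S\<^esub> a \<oplus>\<^bsub>S\<^esub> \<ominus>\<^bsub>S\<^esub> a" using a b by (simp only: S.a_comm)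
    also have "\<dots> = b" using a b by (simp only: S.a_assoc S.r_neg S.a_inv_closed S.r_zero)
    finally show ?thesis using b by (simp only: a_minus_def S.r_neg)
  qed
  have \<Psi>g: "\<Psi> g = \<zero>\<^bsub>S\<^esub>" if "g \<in> gens" for g
    using that
  proof (rule gens_cases)
    fix s t x assume "g = frag_of (s \<oplus>\<^bsub>S\<^esub> t, x) - frag_of (s, x) - frag_of (t, x)"
      "s \<in> carrier S" "t \<in> carrier S" "x \<in> carrier P"
    then show ?thesis
      using \<phi>D(1)[of x] keys_frag_of_diff[of "(s \<oplus>\<^bsub>S\<^esub> t, x)" U "(s, x)"]
      by (simp add: \<Psi>diff \<Psi>f f_def S.l_distr h_simps cancel)
  next
    fix s x y assume "g = frag_of (s, x \<oplus>\<^bsub>P\<^esub> y) - frag_of (s, x) - frag_of (s, y)"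
      "s \<in> carrier S" "x \<in> carrier P" "y \<in> carrier P"
    then show ?thesis
      using \<phi>D(1)[of x] \<phi>D(1)[of y] keys_frag_of_diff[of "(s, x \<oplus>\<^bsub>P\<^esub> y)" U "(s, x)"]
      by (simp add: \<Psi>diff \<Psi>f f_def S.r_distr h_simps \<phi>D(2) cancel)
  next
    fix s a x assume "g = frag_of (s \<otimes>\<^bsub>S\<^esub> h a, x) - frag_of (s, a \<odot>\<^bsub>P\<^esub> x)"
      "s \<in> carrier S" "a \<in> carrier R" "x \<in> carrier P"
    then show ?thesis
      using \<phi>D(1)[of x] by (simp add: \<Psi>diff \<Psi>f f_def h_simps \<phi>D(3) S.m_assoc)
  qed
  have \<Psi>N: "\<Psi> c = \<zero>\<^bsub>S\<^esub> \<and> Poly_Mapping.keys c \<subseteq> U" if "c \<in> N" for c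
    using that
  proof (rule N_induct[where Q = "%c. \<Psi> c = \<zero>\<^bsub>S\<^esub> \<and> Poly_Mapping.keys c \<subseteq> U"])
    show "\<Psi> (a - b) = \<zero>\<^bsub>S\<^esub> \<and> Poly_Mapping.keys (a - b) \<subseteq> U"
      if "\<Psi> a = \<zero>\<^bsub>S\<^esub> \<and> Poly_Mapping.keys a \<subseteq> U" "\<Psi> b = \<zero>\<^bsub>S\<^esub> \<and> Poly_Mapping.keys b \<subseteq> U" for a b
      using that keys_diff[of a b] by (auto simp: \<Psi>diff a_minus_def)
  qed (auto simp: \<Psi>0 \<Psi>g dest: gens_keys)
  \<comment> \<open>A supported representative is chosen because \<open>\<Psi>\<close> is additive
    on elements supported in \<open>U\<close>; since it vanishes on \<open>N\<close>, the choice
    does not matter.\<close>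
  define \<psi> where "\<psi> C = \<Psi> (SOME c. Poly_Mapping.keys c \<subseteq> U \<and> C = T.cls c)" for C
  have \<psi>: "\<psi> (T.cls c) = \<Psi> c" if c: "Poly_Mapping.keys c \<subseteq> U" for c
  proof -
    let ?d = "SOME d. Poly_Mapping.keys d \<subseteq> U \<and> T.cls c = T.cls d"
    have d: "Poly_Mapping.keys ?d \<subseteq> U \<and> T.cls c = T.cls ?d" by (rule someI[of _ c]) (use c in simp)
    then have "c - ?d \<in> N" using T.cls_eq by blast
    then have "\<Psi> (c - ?d) = \<zero>\<^bsub>S\<^esub>" using \<Psi>N by blast
    then have "\<Psi> ?d = \<Psi> (c - ?d) \<oplus>\<^bsub>S\<^esub> \<Psi> ?d" using \<Psi>S d by simp
    also have "\<dots> = \<Psi> ((c - ?d) + ?d)" using d \<Psi>N[OF \<open>c - ?d \<in> N\<close>] by (intro \<Psi>add[symmetric]) auto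
    finally have "\<Psi> c = \<Psi> ?d" by simp
    then show ?thesis by (simp add: \<psi>_def)
  qed
  have \<Psi>act: "Poly_Mapping.keys (act s c) \<subseteq> U \<and> \<Psi> (act s c) = s \<otimes>\<^bsub>S\<^esub> \<Psi> c \<and> Poly_Mapping.keys c \<subseteq> U"
    if s: "s \<in> carrier S" and "Poly_Mapping.keys c \<subseteq> U" for s c
    using that(2)
  proof (rule frag_cls_induct)
    fix t x assume a: "t \<in> carrier S" "x \<in> carrier P"
    then show "Poly_Mapping.keys (act s (frag_of (t, x))) \<subseteq> U \<and> \<Psi> (act s (frag_of (t, x))) = s \<otimes>\<^bsub>S\<^esub> \<Psi> (frag_of (t, x))
        \<and> Poly_Mapping.keys (frag_of (t, x)) \<subseteq> U"
      using s \<phi>D(1)[of x] by (simp add: act_simps \<Psi>f f_def S.m_assoc h_simps)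
  next
    fix c d assume cd: "Poly_Mapping.keys (act s c) \<subseteq> U \<and> \<Psi> (act s c) = s \<otimes>\<^bsub>S\<^esub> \<Psi> c \<and> Poly_Mapping.keys c \<subseteq> U"
      "Poly_Mapping.keys (act s d) \<subseteq> U \<and> \<Psi> (act s d) = s \<otimes>\<^bsub>S\<^esub> \<Psi> d \<and> Poly_Mapping.keys d \<subseteq> U"
    have "s \<otimes>\<^bsub>S\<^esub> (\<Psi> c \<ominus>\<^bsub>S\<^esub> \<Psi> d) = s \<otimes>\<^bsub>S\<^esub> \<Psi> c \<ominus>\<^bsub>S\<^esub> s \<otimes>\<^bsub>S\<^esub> \<Psi> d"
      using s \<Psi>S cd by (simp add: a_minus_def S.r_distr S.r_minus)
    then show "Poly_Mapping.keys (act s (c - d)) \<subseteq> U \<and> \<Psi> (act s (c - d)) = s \<otimes>\<^bsub>S\<^esub> \<Psi> (c - d) \<and> Poly_Mapping.keys (c - d) \<subseteq> U"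
      using cd keys_diff[of "act s c" "act s d"] keys_diff[of c d] by (simp add: act_simps \<Psi>diff) blast
  qed (use s in \<open>simp add: act_simps \<Psi>0\<close>)
  show ?thesis
  proof (rule that)
    show "linear_form S B \<psi>"
      unfolding linear_form_def
    proof (intro conjI ballI)
      fix x assume "x \<in> carrier B"
      then obtain c where c: "Poly_Mapping.keys c \<subseteq> U" "x = T.cls c" by (elim B_cases) blast
      show "\<psi> x \<in> carrier S" using c by (simp add: \<psi> \<Psi>S)
      fix y assume "y \<in> carrier B"
      then obtain d where d: "Poly_Mapping.keys d \<subseteq> U" "y = T.cls d" by (auto simp: B_simps)
      have "Poly_Mapping.keys (c + d) \<subseteq> U" using keys_add[of c d] c d by blast
      then show "\<psi> (x \<oplus>\<^bsub>B\<^esub> y) = \<psi> x \<oplus>\<^bsub>S\<^esub> \<psi> y" using c d by (simp add: B_simps \<psi> \<Psi>add)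
    next
      fix s x assume s: "s \<in> carrier S" and "x \<in> carrier B"
      then obtain c where c: "Poly_Mapping.keys c \<subseteq> U" "x = T.cls c" by (elim B_cases) blast
      then show "\<psi> (s \<odot>\<^bsub>B\<^esub> x) = s \<otimes>\<^bsub>S\<^esub> \<psi> x" using \<Psi>act[OF s c(1)] s by (simp add: B_smult \<psi>)
    qed
    show "\<psi> (ten s x) = s \<otimes>\<^bsub>S\<^esub> h (\<phi> x)" if "s \<in> carrier S" "x \<in> carrier P" for s x
      using that by (simp add: ten_def \<psi> \<Psi>f f_def)
  qed
qed

text \<open>The generators are the tensors of one with \<open>p i\<close>, the forms are the induced
  ones. The reassembling map \<open>\<Lambda>\<close> is linear and fixes pure tensors, which
  additively generate everything.\<close>

lemma has_gram_base_change:
  assumes "has_gram R P n e"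
  shows "has_gram S B n (%i j. h (e i j))"
proof -
  obtain p \<iota> where db: "dual_basis R P n p \<iota>" and e: "\<forall>i<n. \<forall>j<n. e i j = \<iota> i (p j)"
    using assms by (auto simp: has_gram_def)
  note dbD = dual_basisD[OF db]
  interpret B: fmodule S B by (rule fmodule.intro[OF B_module])
  have "\<forall>i. \<exists>\<psi>. i < n \<longrightarrow> linear_form S B \<psi> \<and> (\<forall>s\<in>carrier S. \<forall>x\<in>carrier P. \<psi> (ten s x) = s \<otimes>\<^bsub>S\<^esub> h (\<iota> i x))"
  proof
    fix i
    show "\<exists>\<psi>. i < n \<longrightarrow> linear_form S B \<psi> \<and> (\<forall>s\<in>carrier S. \<forall>x\<in>carrier P. \<psi> (ten s x) = s \<otimes>\<^bsub>S\<^esub> h (\<iota> i x))"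
    proof (cases "i < n")
      case True
      from induced_form[OF dbD(3)[OF True]] show ?thesis by metis
    qed simp
  qed
  then obtain \<psi> where "\<forall>i. i < n \<longrightarrow> linear_form S B (\<psi> i) \<and> (\<forall>s\<in>carrier S. \<forall>x\<in>carrier P. \<psi> i (ten s x) = s \<otimes>\<^bsub>S\<^esub> h (\<iota> i x))"
    by (rule choice[THEN exE])
  then have \<psi>: "!!i. i < n ==> linear_form S B (\<psi> i)"
    and \<psi>t: "!!i s x. i < n ==> s \<in> carrier S ==> x \<in> carrier P ==> \<psi> i (ten s x) = s \<otimes>\<^bsub>S\<^esub> h (\<iota> i x)" by auto
  define q where "q i = ten \<one>\<^bsub>S\<^esub> (p i)" for i
  have q: "q i \<in> carrier B" if "i < n" for i unfolding q_def using that dbD(2) by (intro ten_in) auto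
  define \<Lambda> where "\<Lambda> y = lin_comb B n (%i. \<psi> i y) q" for y
  have \<Lambda>: "\<Lambda> \<in> mod_hom S B B" unfolding \<Lambda>_def by (rule B.mod_hom_lin_comb_form) (use \<psi> q in auto)
  have \<Lambda>t: "\<Lambda> (ten s x) = ten s x" if s: "s \<in> carrier S" and x: "x \<in> carrier P" for s x
  proof -
    have ts: "ten s \<in> carrier P \<rightarrow> carrier B" using ten_in[OF s] by blast
    have t0: "ten s \<zero>\<^bsub>P\<^esub> = \<zero>\<^bsub>B\<^esub>"
    proof -
      have "ten s \<zero>\<^bsub>P\<^esub> = ten s \<zero>\<^bsub>P\<^esub> \<oplus>\<^bsub>B\<^esub> ten s \<zero>\<^bsub>P\<^esub>" using ten_add_right[OF s, of "\<zero>\<^bsub>P\<^esub>" "\<zero>\<^bsub>P\<^esub>"] by simp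
      then show ?thesis using ten_in[OF s P.M.zero_closed] B.M.add.r_cancel_one' by metis
    qed
    have "\<Lambda> (ten s x) = (\<Oplus>\<^bsub>B\<^esub>i\<in>{..<n}. ten s (\<iota> i x \<odot>\<^bsub>P\<^esub> p i))"
      unfolding \<Lambda>_def lin_comb_def
    proof (intro B.M.finsum_cong' refl)
      fix i assume "i \<in> {..<n}"
      then have i: "i < n" by simp
      have hi: "h (\<iota> i x) \<in> carrier S" using dbD(5)[OF i x] by (rule h_simps)
      have "\<psi> i (ten s x) \<odot>\<^bsub>B\<^esub> q i = ten (s \<otimes>\<^bsub>S\<^esub> h (\<iota> i x)) (p i)"
        using i s x hi by (simp add: \<psi>t q_def ten_smult)
      also have "\<dots> = ten s (\<iota> i x \<odot>\<^bsub>P\<^esub> p i)" using i s x dbD by (intro ten_scalar) auto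
      finally show "\<psi> i (ten s x) \<odot>\<^bsub>B\<^esub> q i = ten s (\<iota> i x \<odot>\<^bsub>P\<^esub> p i)" .
    qed (use s x dbD ten_in in auto)
    also have "\<dots> = ten s (lin_comb P n (%i. \<iota> i x) p)"
      unfolding lin_comb_def using x dbD ten_in[OF s] ten_add_right[OF s] t0
      by (intro finsum_hom[symmetric] P.M.abelian_monoid_axioms B.M.abelian_monoid_axioms) auto
    finally show ?thesis using dbD(4)[OF x] by simp
  qed
  \<comment> \<open>Membership of the class is part of the claim because the induction predicate
    would otherwise forget the support of \<open>c\<close>.\<close>
  have "\<Lambda> (T.cls c) = T.cls c \<and> T.cls c \<in> carrier B" if "Poly_Mapping.keys c \<subseteq> U" for c
    using that
  proof (rule frag_cls_induct)
    show "\<Lambda> (T.cls (frag_of (s, x))) = T.cls (frag_of (s, x)) \<and> T.cls (frag_of (s, x)) \<in> carrier B"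
      if "s \<in> carrier S" "x \<in> carrier P" for s x using \<Lambda>t[OF that] ten_in[OF that] by (simp add: ten_def)
    show "\<Lambda> (T.cls 0) = T.cls 0 \<and> T.cls 0 \<in> carrier B"
      using B.mod_hom_zero[OF \<Lambda> B_module] B.M.zero_closed by (simp add: B_simps)
    fix c d assume c: "\<Lambda> (T.cls c) = T.cls c \<and> T.cls c \<in> carrier B" and d: "\<Lambda> (T.cls d) = T.cls d \<and> T.cls d \<in> carrier B"
    have "T.cls (c - d) \<oplus>\<^bsub>B\<^esub> T.cls d = T.cls c" by (simp add: B_simps)
    moreover obtain d' where "Poly_Mapping.keys d' \<subseteq> U" "T.cls d = T.cls d'" using d by (auto simp: B_simps)
    moreover obtain c' where "Poly_Mapping.keys c' \<subseteq> U" "T.cls c = T.cls c'" using c by (auto simp: B_simps)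
    ultimately have mem: "T.cls (c - d) \<in> carrier B"
    proof -
      have N: "c - c' \<in> N" "d - d' \<in> N" using \<open>T.cls c = T.cls c'\<close> \<open>T.cls d = T.cls d'\<close> T.cls_eq by auto
      have "(c - d) - (c' - d') \<in> N" using T.N_diff[OF N] by (simp add: algebra_simps)
      then have "T.cls (c - d) = T.cls (c' - d')" by (rule T.cls_eqI)
      moreover have "Poly_Mapping.keys (c' - d') \<subseteq> U"
        using keys_diff[of c' d'] \<open>Poly_Mapping.keys c' \<subseteq> U\<close> \<open>Poly_Mapping.keys d' \<subseteq> U\<close> by blast
      ultimately show ?thesis by (auto simp: B_simps)
    qed
    have "\<Lambda> (T.cls (c - d)) \<oplus>\<^bsub>B\<^esub> T.cls d = \<Lambda> (T.cls (c - d) \<oplus>\<^bsub>B\<^esub> T.cls d)"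
      using mod_homD(2)[OF \<Lambda> mem, of "T.cls d"] d by simp
    also have "\<dots> = T.cls (c - d) \<oplus>\<^bsub>B\<^esub> T.cls d" using c by (simp add: B_simps)
    finally show "\<Lambda> (T.cls (c - d)) = T.cls (c - d) \<and> T.cls (c - d) \<in> carrier B"
      using mem d mod_homD(1)[OF \<Lambda> mem] by (simp add: B.M.add.r_cancel)
  qed
  then have "\<Lambda> y = y" if "y \<in> carrier B" for y using that by (auto simp: B_simps)
  then have "dual_basis S B n q \<psi>" unfolding dual_basis_def using B_module q \<psi> by (simp add: \<Lambda>_def)
  moreover have "h (e i j) = \<psi> i (q j)" if "i < n" "j < n" for i j
    using that e dbD by (simp add: q_def \<psi>t h_simps)
  ultimately show ?thesis unfolding has_gram_def by blast
qed

end

section \<open>The Grothendieck group and Gram matrices\<close>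

abbreviation "kcls R \<equiv> frag_quotient.cls (fgp_modules R) (K0_relations R)"

lemma K0_generator:
  "P \<in> fgp_modules R ==> P' \<in> fgp_modules R ==> P'' \<in> fgp_modules R ==> mod_isomorphic R P (dir_sum P' P'') ==>
    frag_of P - frag_of P' - frag_of P'' \<in> K0_relations R"
  unfolding K0_relations_def by (rule generate.incl) blast

lemma K0_frag_quotient: "frag_quotient (fgp_modules R) (K0_relations R)"
  unfolding K0_relations_def
proof (rule generate_frag_quotient)
  fix g assume "g \<in> {frag_of P - frag_of P' - frag_of P'' | P P' P''.
          P \<in> fgp_modules R \<and> P' \<in> fgp_modules R \<and> P'' \<in> fgp_modules R \<and> mod_isomorphic R P (dir_sum P' P'')}"
  then obtain P P' P'' where g: "g = frag_of P - frag_of P' - frag_of P''"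
    and "P \<in> fgp_modules R" "P' \<in> fgp_modules R" "P'' \<in> fgp_modules R" by (elim CollectE exE conjE) (rule that)
  then show "Poly_Mapping.keys g \<subseteq> fgp_modules R" unfolding g by (intro keys_frag_of_diff2)
qed

lemma has_gram_cong:
  assumes "has_gram R M n e" and eq: "!!i j. i < n ==> j < n ==> e i j = f i j"
  shows "has_gram R M n f"
proof -
  obtain p \<iota> where "dual_basis R M n p \<iota>" "\<forall>i<n. \<forall>j<n. e i j = \<iota> i (p j)"
    using assms(1) unfolding has_gram_def by (elim exE conjE)
  then show ?thesis unfolding has_gram_def using eq by (intro exI[of _ p] exI[of _ \<iota>]) simp
qed

lemma has_gram_module: "has_gram R M n e ==> Module.module R M"
  unfolding has_gram_def dual_basis_def by blast

lemma fgp_modulesD: "P \<in> fgp_modules R ==> \<exists>n e. has_gram R P n e"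
  unfolding fgp_modules_def by (simp add: fgp_has_gram)

text \<open>The form in which relations of \<open>K0\<close> are produced from here on: only Gram
  matrices are compared.\<close>

lemma gram_relation:
  assumes "has_gram R P (n + k) (gram_sum R n e f)" "has_gram R P' n e" "has_gram R P'' k f"
    and "P \<in> fgp_modules R" "P' \<in> fgp_modules R" "P'' \<in> fgp_modules R"
  shows "frag_of P - frag_of P' - frag_of P'' \<in> K0_relations R"
  using assms by (intro K0_generator gram_isomorphic[OF assms(1) has_gram_dir_sum])

text \<open>The condition on the type makes \<open>has_gram_fgp\<close> applicable, so that every
  idempotent matrix over \<open>R\<close> yields an element of \<open>fgp_modules R\<close>.\<close>

locale large_cring = R: cring R for R :: "('r, 'k) ring_scheme" +
  assumes inf: "infinite (UNIV :: (nat => 'r) set)"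
begin

sublocale K: frag_quotient "fgp_modules R" "K0_relations R"
  by (rule K0_frag_quotient)

lemma gram_fgp: "has_gram R P n e ==> P \<in> fgp_modules R" for P :: "('r, nat => 'r) module"
  unfolding fgp_modules_def using has_gram_fgp[OF _ inf] by blast

lemma K0_carrierD: "x \<in> carrier (K0 R) ==> \<exists>c. x = kcls R c \<and> Poly_Mapping.keys c \<subseteq> fgp_modules R"
  unfolding K0_def K.carrier_Mod by auto

lemma K0_carrierI: "Poly_Mapping.keys c \<subseteq> fgp_modules R ==> kcls R c \<in> carrier (K0 R)"
  unfolding K0_def K.carrier_Mod by auto

lemma K0_mult: "kcls R c \<otimes>\<^bsub>K0 R\<^esub> kcls R d = kcls R (c + d)"
  by (simp only: K0_def mult_FactGroup K.cls_mult)

lemma image_gram: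
  assumes "!!i j. i < n ==> j < n ==> e i j \<in> carrier R" "!!i j. i < n ==> j < n ==> mat_mult R n e e i j = e i j"
  shows "has_gram R (image_module R n e) n e" "image_module R n e \<in> fgp_modules R"
proof -
  show 1: "has_gram R (image_module R n e) n e" by (rule has_gram_image_module[OF R.cring_axioms assms])
  show "image_module R n e \<in> fgp_modules R" by (rule gram_fgp[OF 1])
qed

text \<open>Both modules are isomorphic to \<open>Q\<close> plus the zero module, the image of the
  empty matrix; the two resulting relations differ by \<open>frag_of P - frag_of Q\<close>.\<close>

lemma same_gram_relation:
  assumes P: "has_gram R P n e" and Q: "has_gram R Q n e"
  shows "frag_of P - frag_of Q \<in> K0_relations R"
proof -
  let ?z = "%i j :: nat. \<zero>\<^bsub>R\<^esub>"
  note Z = image_gram[of 0 ?z, simplified]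
  have g: "has_gram R L (n + 0) (gram_sum R n e ?z)" if "has_gram R L n e" for L :: "('r, nat => 'r) module"
    unfolding add_0_right using that by (rule has_gram_cong) (simp add: gram_sum_def)
  have r: "frag_of L - frag_of Q - frag_of (image_module R 0 ?z) \<in> K0_relations R"
    if "has_gram R L n e" for L
    using gram_relation[OF g[OF that] Q Z(1) gram_fgp[OF that] gram_fgp[OF Q] Z(2)] .
  have "(frag_of P - frag_of Q - frag_of (image_module R 0 ?z)) - (frag_of Q - frag_of Q - frag_of (image_module R 0 ?z))
      \<in> K0_relations R" by (rule K.N_diff[OF r[OF P] r[OF Q]])
  then show ?thesis by simp
qed

end

section \<open>Base change as a homomorphism of Grothendieck groups\<close>

locale K0_change = R: large_cring R + S: large_cring S
  for R :: "('r, 'k) ring_scheme" and S :: "('s, 'l) ring_scheme" +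
  fixes h :: "'r => 's"
  assumes h: "h \<in> ring_hom R S"
begin

text \<open>The representative chosen inside \<open>K0_map\<close>. All that is ever used of it is
  its Gram matrix, found in \<open>gram_bc\<close>.\<close>

definition bc :: "('r, nat => 'r) module => ('s, nat => 's) module" where
  "bc P = (SOME Q. Q \<in> fgp_modules S \<and> mod_isomorphic S Q (base_change R S h P))"

definition \<Theta> :: "(('r, nat => 'r) module \<Rightarrow>\<^sub>0 int) => (('s, nat => 's) module \<Rightarrow>\<^sub>0 int)" where
  "\<Theta> = frag_extend (%P. frag_of (bc P))"

lemma h_zero: "h \<zero>\<^bsub>R\<^esub> = \<zero>\<^bsub>S\<^esub>"
  by (rule ring_hom_zero[OF h R.R.ring_axioms S.R.ring_axioms])

text \<open>The choice is not vacuous: the image of the matrix \<open>h e\<close> has the Gram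
  matrix of the base change and a carrier of the right type. Whatever is chosen is isomorphic to the
  base change and so shares its Gram matrix.\<close>

lemma gram_bc:
  assumes P: "has_gram R P n e"
  shows "has_gram S (bc P) n (%i j. h (e i j))" "bc P \<in> fgp_modules S"
proof -
  interpret scalar_extension R S P h
    by (intro scalar_extension.intro scalar_extension_axioms.intro fmodule.intro has_gram_module[OF P] h
        R.R.cring_axioms S.R.cring_axioms)
  have B: "has_gram S B n (%i j. h (e i j))" by (rule has_gram_base_change[OF P])
  let ?I = "image_module S n (%i j. h (e i j))"
  have I: "has_gram S ?I n (%i j. h (e i j))" "?I \<in> fgp_modules S"
    using gram_idempotent[OF B] by (intro S.image_gram; simp)+
  have "\<exists>Q. Q \<in> fgp_modules S \<and> mod_isomorphic S Q B" using I gram_isomorphic[OF I(1) B] by blast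
  from someI_ex[OF this] have bc: "bc P \<in> fgp_modules S" "mod_isomorphic S (bc P) B" unfolding bc_def by blast+
  obtain k f where g: "has_gram S (bc P) k f" using fgp_modulesD[OF bc(1)] by blast
  show "has_gram S (bc P) n (%i j. h (e i j))"
    by (rule has_gram_iso[OF B has_gram_module[OF g] mod_isomorphic_sym[OF has_gram_module[OF g] bc(2)]])
  show "bc P \<in> fgp_modules S" by (rule bc(1))
qed

lemma bc_fgp: "P \<in> fgp_modules R ==> bc P \<in> fgp_modules S"
  using fgp_modulesD gram_bc(2) by blast

lemma \<Theta>_simps: "\<Theta> (c - d) = \<Theta> c - \<Theta> d" "\<Theta> (c + d) = \<Theta> c + \<Theta> d" "\<Theta> 0 = 0" "\<Theta> (frag_of P) = frag_of (bc P)"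
  by (simp_all add: \<Theta>_def frag_extend_diff frag_extend_add)

lemma \<Theta>_keys: "Poly_Mapping.keys c \<subseteq> fgp_modules R ==> Poly_Mapping.keys (\<Theta> c) \<subseteq> fgp_modules S"
  unfolding \<Theta>_def using keys_frag_extend[of "%P. frag_of (bc P)" c] bc_fgp by fastforce

text \<open>A relation comes from a block diagonal Gram matrix, and \<open>h\<close> keeps it block
  diagonal because it maps zero to zero.\<close>

lemma \<Theta>_relations: "c \<in> K0_relations R ==> \<Theta> c \<in> K0_relations S"
  unfolding K0_relations_def[of R]
proof (erule generate_frag_induct[where Q = "%c. \<Theta> c \<in> K0_relations S"])
  fix g assume "g \<in> {frag_of P - frag_of P' - frag_of P'' | P P' P''.
          P \<in> fgp_modules R \<and> P' \<in> fgp_modules R \<and> P'' \<in> fgp_modules R \<and> mod_isomorphic R P (dir_sum P' P'')}"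
  then obtain P P' P'' where g: "g = frag_of P - frag_of P' - frag_of P''" and fg: "P \<in> fgp_modules R" "P' \<in> fgp_modules R"
    "P'' \<in> fgp_modules R" and iso: "mod_isomorphic R P (dir_sum P' P'')" by blast
  show "Poly_Mapping.keys g \<subseteq> fgp_modules R" unfolding g by (rule keys_frag_of_diff2[OF fg])
  obtain l d where "has_gram R P l d" using fgp_modulesD[OF fg(1)] by blast
  note mP = has_gram_module[OF this]
  obtain n e where P': "has_gram R P' n e" using fgp_modulesD[OF fg(2)] by blast
  obtain k f where P'': "has_gram R P'' k f" using fgp_modulesD[OF fg(3)] by blast
  have P: "has_gram R P (n + k) (gram_sum R n e f)"
    by (rule has_gram_iso[OF has_gram_dir_sum[OF P' P''] mP mod_isomorphic_sym[OF mP iso]])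
  have "has_gram S (bc P) (n + k) (gram_sum S n (%i j. h (e i j)) (%i j. h (f i j)))"
    using gram_bc(1)[OF P] by (rule has_gram_cong) (simp add: gram_sum_def h_zero)
  then show "\<Theta> g \<in> K0_relations S"
    unfolding g \<Theta>_simps by (rule gram_relation[OF _ gram_bc(1)[OF P'] gram_bc(1)[OF P'']]) (use fg bc_fgp in auto)
next
  show "\<Theta> 0 \<in> K0_relations S" by (simp add: \<Theta>_simps S.K.N_zero)
  show "\<Theta> (a - b) \<in> K0_relations S" if "\<Theta> a \<in> K0_relations S" "\<Theta> b \<in> K0_relations S" for a b
    using that by (simp add: \<Theta>_simps S.K.N_diff)
qed

lemma K0_map_cls: "K0_map R S h (kcls R c) = kcls S (\<Theta> c)"
proof -
  have "K0_map R S h (kcls R c) = (\<Union>d\<in>kcls R c. kcls S (\<Theta> d))"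
    unfolding K0_map_def \<Theta>_def bc_def S.K.cls_def by simp
  also have "\<dots> = kcls S (\<Theta> c)"
    by (rule R.K.Union_cls[OF \<Theta>_simps(1) \<Theta>_relations S.K.frag_quotient_axioms])
  finally show ?thesis .
qed

lemma K0_map_hom: "K0_map R S h \<in> hom (K0 R) (K0 S)"
proof (rule homI)
  fix x assume "x \<in> carrier (K0 R)"
  then obtain c where c: "x = kcls R c" "Poly_Mapping.keys c \<subseteq> fgp_modules R" using R.K0_carrierD by blast
  show "K0_map R S h x \<in> carrier (K0 S)"
    unfolding c(1) K0_map_cls by (rule S.K0_carrierI[OF \<Theta>_keys[OF c(2)]])
  fix y assume "y \<in> carrier (K0 R)"
  then obtain d where d: "y = kcls R d" using R.K0_carrierD by blast
  show "K0_map R S h (x \<otimes>\<^bsub>K0 R\<^esub> y) = K0_map R S h x \<otimes>\<^bsub>K0 S\<^esub> K0_map R S h y"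
    by (simp only: c(1) d R.K0_mult S.K0_mult K0_map_cls \<Theta>_simps)
qed

text \<open>Cancelling the free summand turns each stable equivalence into an equality of classes.\<close>

lemma K0_map_iso:
  assumes g: "g \<in> ring_hom S R" and gh: "!!a. a \<in> carrier R ==> g (h a) = a"
    and path: "!!n e. \<forall>i j. e i j \<in> carrier S ==> \<forall>i<n. \<forall>j<n. mat_mult S n e e i j = e i j ==>
      \<exists>K \<epsilon> b. (\<forall>a i j. \<epsilon> a i j \<in> carrier S) \<and> (\<forall>a. \<forall>i<n. \<forall>j<n. mat_mult S n (\<epsilon> a) (\<epsilon> a) i j = \<epsilon> a i j) \<and>
        (\<forall>i j. \<epsilon> (0::nat) i j = h (g (e i j))) \<and> (\<forall>i j. \<epsilon> K i j = e i j) \<and>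
        (\<forall>a<K. mat_equiv S (n + b a) (gram_sum S n (\<epsilon> (Suc a)) (%i j. if i = j then \<one>\<^bsub>S\<^esub> else \<zero>\<^bsub>S\<^esub>))
           (n + b a) (gram_sum S n (\<epsilon> a) (%i j. if i = j then \<one>\<^bsub>S\<^esub> else \<zero>\<^bsub>S\<^esub>)))"
  shows "K0_map R S h \<in> iso (K0 R) (K0 S)"
proof -
  have G: "K0_change S R g"
    by (rule K0_change.intro[OF S.large_cring_axioms R.large_cring_axioms K0_change_axioms.intro[OF g]])
  note GS = K0_change.\<Theta>_simps[OF G] and Gbc = K0_change.gram_bc(1)[OF G]
  let ?G = "K0_change.\<Theta> S R g"
  \<comment> \<open>Base change along \<open>g\<close> is a left inverse: by
    \<open>g (h a) = a\<close> it returns the original Gram matrix.\<close>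
  have inj: "inj_on (K0_map R S h) (carrier (K0 R))"
  proof (rule inj_onI)
    fix x y assume x: "x \<in> carrier (K0 R)" and y: "y \<in> carrier (K0 R)" and eq: "K0_map R S h x = K0_map R S h y"
    obtain c where c: "x = kcls R c" "Poly_Mapping.keys c \<subseteq> fgp_modules R" using R.K0_carrierD[OF x] by blast
    obtain d where d: "y = kcls R d" "Poly_Mapping.keys d \<subseteq> fgp_modules R" using R.K0_carrierD[OF y] by blast
    have k: "Poly_Mapping.keys (c - d) \<subseteq> fgp_modules R" using keys_diff[of c d] c d by blast
    have "\<Theta> (c - d) \<in> K0_relations S" using eq unfolding c d K0_map_cls S.K.cls_eq by (simp add: \<Theta>_simps)
    then have z: "?G (\<Theta> (c - d)) \<in> K0_relations R" by (rule K0_change.\<Theta>_relations[OF G])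
    have "?G (\<Theta> u) - u \<in> K0_relations R" if "Poly_Mapping.keys u \<subseteq> fgp_modules R" for u
      using that
    proof (rule frag_induction)
      fix P assume "P \<in> fgp_modules R"
      then obtain n e where P: "has_gram R P n e" using fgp_modulesD by blast
      have "has_gram R (K0_change.bc S R g (bc P)) n e"
        using Gbc[OF gram_bc(1)[OF P]] by (rule has_gram_cong) (simp add: gh gram_idempotent(1)[OF P])
      then show "?G (\<Theta> (frag_of P)) - frag_of P \<in> K0_relations R"
        using R.same_gram_relation[OF _ P] by (simp add: \<Theta>_simps GS)
    next
      fix a b assume "?G (\<Theta> a) - a \<in> K0_relations R" "?G (\<Theta> b) - b \<in> K0_relations R"
      from R.K.N_diff[OF this] show "?G (\<Theta> (a - b)) - (a - b) \<in> K0_relations R"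
        by (simp add: \<Theta>_simps GS algebra_simps)
    qed (simp add: \<Theta>_simps GS R.K.N_zero)
    from R.K.N_diff[OF z this[OF k]] show "x = y" unfolding c d by (simp add: R.K.cls_eq)
  qed
  have gens: "\<exists>P\<in>fgp_modules R. frag_of Q - frag_of (bc P) \<in> K0_relations S" if Q: "Q \<in> fgp_modules S" for Q
  proof -
    obtain n e0 where Q0: "has_gram S Q n e0" using fgp_modulesD[OF Q] by blast
    \<comment> \<open>Entries outside the \<open>n\<close> by \<open>n\<close> block are set to
      zero, as \<open>path\<close> asks for all entries to lie in \<open>S\<close>.\<close>
    define e where "e i j = (if i < n \<and> j < n then e0 i j else \<zero>\<^bsub>S\<^esub>)" for i j
    have Qe: "has_gram S Q n e" using Q0 by (rule has_gram_cong) (simp add: e_def)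
    note ge = gram_idempotent[OF Qe]
    have eS: "e i j \<in> carrier S" for i j using ge(1) by (simp add: e_def)
    have e1: "\<forall>i j. e i j \<in> carrier S" and e2: "\<forall>i<n. \<forall>j<n. mat_mult S n e e i j = e i j" using eS ge(2) by blast+
    let ?u = "%i j :: nat. if i = j then \<one>\<^bsub>S\<^esub> else \<zero>\<^bsub>S\<^esub>"
    obtain K \<epsilon> b where \<epsilon>S: "\<forall>a i j. \<epsilon> a i j \<in> carrier S"
      and \<epsilon>\<epsilon>: "\<forall>a. \<forall>i<n. \<forall>j<n. mat_mult S n (\<epsilon> a) (\<epsilon> a) i j = \<epsilon> a i j"
      and \<epsilon>0: "\<forall>i j. \<epsilon> (0::nat) i j = h (g (e i j))" and \<epsilon>K: "\<forall>i j. \<epsilon> K i j = e i j"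
      and eq: "\<forall>a<K. mat_equiv S (n + b a) (gram_sum S n (\<epsilon> (Suc a)) ?u) (n + b a) (gram_sum S n (\<epsilon> a) ?u)"
      using path[OF e1 e2] by (elim exE conjE) (rule that)
    \<comment> \<open>These modules link the base change of the image of \<open>g e\<close>, at
      \<open>a = 0\<close>, with \<open>Q\<close>, at \<open>a = K\<close>.\<close>
    define M where "M a = image_module S n (\<epsilon> a)" for a
    have M: "has_gram S (M a) n (\<epsilon> a)" "M a \<in> fgp_modules S" for a
      unfolding M_def using \<epsilon>S \<epsilon>\<epsilon> by (intro S.image_gram; simp)+
    \<comment> \<open>The free module of rank \<open>k\<close>, as the image of the identity
      matrix.\<close>
    have F: "has_gram S (image_module S k ?u) k ?u" "image_module S k ?u \<in> fgp_modules S" for k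
    proof -
      have "mat_mult S k ?u ?u i j = ?u i j" if "i < k" "j < k" for i j
      proof -
        have "mat_mult S k ?u ?u i j = (\<Oplus>\<^bsub>S\<^esub>l\<in>{..<k}. if l = i then ?u i j else \<zero>\<^bsub>S\<^esub>)"
          unfolding mat_mult_def by (intro S.R.finsum_cong' refl) auto
        also have "\<dots> = ?u i j" using that by (intro S.R.finsum_delta) auto
        finally show ?thesis .
      qed
      then show "has_gram S (image_module S k ?u) k ?u" "image_module S k ?u \<in> fgp_modules S"
        by (intro S.image_gram; simp)+
    qed
    have step: "frag_of (M (Suc a)) - frag_of (M a) \<in> K0_relations S" if a: "a < K" for a
    proof -
      let ?e1 = "gram_sum S n (\<epsilon> (Suc a)) ?u" and ?e0 = "gram_sum S n (\<epsilon> a) ?u"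
      let ?L = "image_module S (n + b a) ?e1"
      note g1 = gram_idempotent[OF has_gram_dir_sum[OF M(1)[of "Suc a"] F(1)[of "b a"]]]
      note g0 = gram_idempotent[OF has_gram_dir_sum[OF M(1)[of a] F(1)[of "b a"]]]
      have L: "has_gram S ?L (n + b a) ?e1" "?L \<in> fgp_modules S"
        using g1 by (intro S.image_gram; simp)+
      have L0: "has_gram S ?L (n + b a) ?e0"
        by (rule has_gram_equiv[OF L(1)]) (use eq a g0(2) in auto)
      \<comment> \<open>One module \<open>?L\<close> decomposes in two ways with the same free
        summand, which drops out of the difference.\<close>
      have "(frag_of ?L - frag_of (M a) - frag_of (image_module S (b a) ?u)) -
          (frag_of ?L - frag_of (M (Suc a)) - frag_of (image_module S (b a) ?u)) \<in> K0_relations S"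
        by (rule S.K.N_diff[OF gram_relation[OF L0 M(1) F(1) L(2) M(2) F(2)] gram_relation[OF L(1) M(1) F(1) L(2) M(2) F(2)]])
      then show ?thesis by simp
    qed
    have "frag_of (M a) - frag_of (M 0) \<in> K0_relations S" if "a \<le> K" for a
      using that
    proof (induction a)
      case (Suc a)
      have "(frag_of (M (Suc a)) - frag_of (M a)) + (frag_of (M a) - frag_of (M 0)) \<in> K0_relations S"
        using Suc step[of a] by (intro S.K.N_add) auto
      then show ?case by simp
    qed (simp add: S.K.N_zero)
    from this[of K] have MK: "frag_of (M K) - frag_of (M 0) \<in> K0_relations S" by simp
    have "has_gram S (M K) n e" using M(1)[of K] by (rule has_gram_cong) (simp add: \<epsilon>K)
    then have QM: "frag_of Q - frag_of (M K) \<in> K0_relations S" by (rule S.same_gram_relation[OF Qe])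
    let ?f = "%i j. g (e i j)"
    have gS: "g a \<in> carrier R" if "a \<in> carrier S" for a by (rule ring_hom_closed[OF g that])
    have "mat_mult R n ?f ?f i j = ?f i j" if "i < n" "j < n" for i j
    proof -
      have "g (mat_mult S n e e i j) = mat_mult R n ?f ?f i j"
        unfolding mat_mult_def using eS ring_hom_mult[OF g] gS
        by (subst finsum_hom[OF S.R.abelian_monoid_axioms R.R.abelian_monoid_axioms, of g])
          (auto simp: ring_hom_add[OF g] K0_change.h_zero[OF G] intro!: R.R.finsum_cong')
      then show ?thesis using ge(2)[OF that] by simp
    qed
    note P = R.image_gram[of n ?f, OF gS[OF eS] this]
    have "has_gram S (M 0) n (%i j. h (g (e i j)))" using M(1)[of 0] by (rule has_gram_cong) (simp add: \<epsilon>0)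
    then have MP: "frag_of (M 0) - frag_of (bc (image_module R n ?f)) \<in> K0_relations S"
      by (rule S.same_gram_relation[OF _ gram_bc(1)[OF P(1)]])
    have "frag_of Q - frag_of (bc (image_module R n ?f)) =
      (frag_of Q - frag_of (M K)) + ((frag_of (M K) - frag_of (M 0)) + (frag_of (M 0) - frag_of (bc (image_module R n ?f))))" by simp
    also have "\<dots> \<in> K0_relations S" by (intro S.K.N_add QM MK MP)
    finally show ?thesis using P(2) by blast
  qed
  have "\<exists>c. Poly_Mapping.keys c \<subseteq> fgp_modules R \<and> d - \<Theta> c \<in> K0_relations S"
    if "Poly_Mapping.keys d \<subseteq> fgp_modules S" for d
    using that
  proof (rule frag_induction)
    fix Q assume "Q \<in> fgp_modules S"
    then obtain P where "P \<in> fgp_modules R" "frag_of Q - frag_of (bc P) \<in> K0_relations S" using gens by blast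
    then show "\<exists>c. Poly_Mapping.keys c \<subseteq> fgp_modules R \<and> frag_of Q - \<Theta> c \<in> K0_relations S"
      by (intro exI[of _ "frag_of P"]) (simp add: \<Theta>_simps)
  next
    fix a b assume "\<exists>c. Poly_Mapping.keys c \<subseteq> fgp_modules R \<and> a - \<Theta> c \<in> K0_relations S"
      "\<exists>c. Poly_Mapping.keys c \<subseteq> fgp_modules R \<and> b - \<Theta> c \<in> K0_relations S"
    then obtain c d where cd: "Poly_Mapping.keys c \<subseteq> fgp_modules R" "a - \<Theta> c \<in> K0_relations S"
      "Poly_Mapping.keys d \<subseteq> fgp_modules R" "b - \<Theta> d \<in> K0_relations S" by blast
    have "(a - b) - \<Theta> (c - d) \<in> K0_relations S" using S.K.N_diff[OF cd(2,4)] by (simp add: \<Theta>_simps algebra_simps)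
    moreover have "Poly_Mapping.keys (c - d) \<subseteq> fgp_modules R" using keys_diff[of c d] cd by blast
    ultimately show "\<exists>c. Poly_Mapping.keys c \<subseteq> fgp_modules R \<and> a - b - \<Theta> c \<in> K0_relations S" by blast
  qed (intro exI[of _ 0], simp add: \<Theta>_simps S.K.N_zero)
  note onto = this
  have "K0_map R S h ` carrier (K0 R) = carrier (K0 S)"
  proof (intro equalityI subsetI)
    fix y assume "y \<in> carrier (K0 S)"
    then obtain d where d: "y = kcls S d" "Poly_Mapping.keys d \<subseteq> fgp_modules S" using S.K0_carrierD by blast
    obtain c where c: "Poly_Mapping.keys c \<subseteq> fgp_modules R" "d - \<Theta> c \<in> K0_relations S" using onto[OF d(2)] by blast
    have "y = K0_map R S h (kcls R c)" unfolding K0_map_cls d(1) using c(2) by (rule S.K.cls_eqI)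
    moreover have "kcls R c \<in> carrier (K0 R)" by (rule R.K0_carrierI[OF c(1)])
    ultimately show "y \<in> K0_map R S h ` carrier (K0 R)" by blast
  qed (use K0_map_hom in \<open>auto simp: hom_def\<close>)
  then show ?thesis unfolding iso_def bij_betw_def using K0_map_hom inj by blast
qed

end

section \<open>Resolutions over rings in which kernels split off\<close>

text \<open>A weak form of the kernel of \<open>D\<close> being a direct summand: \<open>Pm\<close>
  maps into the kernel and fixes a given finite family \<open>w\<close> in it. If \<open>w\<close>
  generates the kernel, \<open>Pm\<close> is a projection onto it. In this form the property can be
  checked pointwise and glued.\<close>

definition split_kernels :: "('r, 'k) ring_scheme => bool" where
  "split_kernels R \<longleftrightarrow> (\<forall>(n::nat) (k::nat) (q::nat) D w.
     (\<forall>i j. D i j \<in> carrier R) \<longrightarrow> (\<forall>l j. w l j \<in> carrier R) \<longrightarrow>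
     (\<forall>l<q. \<forall>i<n. (\<Oplus>\<^bsub>R\<^esub>j\<in>{..<k}. D i j \<otimes>\<^bsub>R\<^esub> w l j) = \<zero>\<^bsub>R\<^esub>) \<longrightarrow>
     (\<exists>Pm. (\<forall>i j. Pm i j \<in> carrier R) \<and> (\<forall>i<n. \<forall>j<k. mat_mult R k D Pm i j = \<zero>\<^bsub>R\<^esub>) \<and>
        (\<forall>l<q. \<forall>i<k. (\<Oplus>\<^bsub>R\<^esub>j\<in>{..<k}. Pm i j \<otimes>\<^bsub>R\<^esub> w l j) = w l i)))"

section \<open>Kernels of maps between projective modules\<close>

lemma a_kernel_iff: "x \<in> a_kernel M N f \<longleftrightarrow> x \<in> carrier M \<and> f x = \<zero>\<^bsub>N\<^esub>"
  by (simp add: a_kernel_def')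

lemma mod_hom_kernel:
  assumes M: "Module.module R M" and N: "Module.module R N" and f: "f \<in> mod_hom R M N"
  shows "submodule (a_kernel M N f) R M"
proof -
  interpret M: fmodule R M by (rule fmodule.intro[OF M])
  interpret N: fmodule R N by (rule fmodule.intro[OF N])
  note fD = mod_homD[OF f]
  have neg: "f (\<ominus>\<^bsub>M\<^esub> x) = \<zero>\<^bsub>N\<^esub>" if "x \<in> carrier M" "f x = \<zero>\<^bsub>N\<^esub>" for x
  proof -
    have "f (\<ominus>\<^bsub>M\<^esub> x \<oplus>\<^bsub>M\<^esub> x) = \<zero>\<^bsub>N\<^esub>" using that M.mod_hom_zero[OF f N] by (simp add: M.M.l_neg)
    then show ?thesis using that fD(1)[of "\<ominus>\<^bsub>M\<^esub> x"] by (simp add: fD(2))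
  qed
  show ?thesis
  proof (rule M.submoduleI)
    show "\<zero>\<^bsub>M\<^esub> \<in> a_kernel M N f" using M.mod_hom_zero[OF f N] by (simp add: a_kernel_iff)
  qed (use neg in \<open>auto simp: a_kernel_iff fD\<close>)
qed

lemma mod_hom_inclusion: "H \<subseteq> carrier M ==> (%x. x) \<in> mod_hom R (M\<lparr>carrier := H\<rparr>) M"
  by (rule mod_homI) auto

lemma lin_comb_submodule:
  assumes M: "Module.module R M" and H: "submodule H R M"
    and c: "!!i. i < n ==> c i \<in> carrier R" and p: "!!i. i < n ==> p i \<in> H"
  shows "lin_comb (M\<lparr>carrier := H\<rparr>) n c p = lin_comb M n c p"
proof -
  interpret M: fmodule R M by (rule fmodule.intro[OF M])
  interpret H: fmodule R "M\<lparr>carrier := H\<rparr>" by (rule fmodule.intro[OF submodule_fmodule[OF M H]])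
  show ?thesis
    using H.mod_hom_lin_comb[OF mod_hom_inclusion[OF M.submoduleE(1)[OF H]] M, of n c p] c p by simp
qed

lemma linear_form_submodule:
  "linear_form R M \<phi> ==> H \<subseteq> carrier M ==> linear_form R (M\<lparr>carrier := H\<rparr>) \<phi>"
  unfolding linear_form_def by (simp add: subset_iff)

text \<open>The matrix \<open>Pm\<close>, read in coordinates, projects \<open>F\<close> onto the
  kernel of \<open>d\<close> because the \<open>g l\<close> generate this kernel. Its columns give
  the generators \<open>r\<close>, and the forms \<open>\<iota>\<close> are restricted to the
  kernel.\<close>

lemma dual_basis_kernel:
  assumes cR: "split_kernels R" and F: "dual_basis R F n p \<iota>" and G: "dual_basis R G k v \<kappa>"
    and d: "d \<in> mod_hom R F G" and g: "!!l. l < q ==> g l \<in> a_kernel F G d"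
    and gen: "!!x. x \<in> a_kernel F G d ==> \<exists>c. (\<forall>l<q. c l \<in> carrier R) \<and> x = lin_comb F q c g"
  shows "\<exists>r. dual_basis R (F\<lparr>carrier := a_kernel F G d\<rparr>) n r \<iota>"
proof -
  note FD = dual_basisD[OF F] and GD = dual_basisD[OF G] and dD = mod_homD[OF d]
  interpret F: fmodule R F by (rule fmodule.intro[OF FD(1)])
  interpret G: fmodule R G by (rule fmodule.intro[OF GD(1)])
  let ?K = "a_kernel F G d"
  have K: "submodule ?K R F" by (rule mod_hom_kernel[OF FD(1) GD(1) d])
  have gF: "g l \<in> carrier F" "d (g l) = \<zero>\<^bsub>G\<^esub>" if "l < q" for l using g[OF that] by (simp_all add: a_kernel_iff)
  \<comment> \<open>The matrix of \<open>d\<close> in the two dual bases; like the coordinates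
    \<open>w\<close> of the generators it is set to zero where the indices leave their
    range.\<close>
  define D where "D i j = (if i < k \<and> j < n then \<kappa> i (d (p j)) else \<zero>\<^bsub>R\<^esub>)" for i j
  define w where "w l j = (if l < q \<and> j < n then \<iota> j (g l) else \<zero>\<^bsub>R\<^esub>)" for l j
  have DR: "D i j \<in> carrier R" for i j using GD(5) dD(1) FD(2) by (simp add: D_def)
  have wR: "w l j \<in> carrier R" for l j using FD(5) gF by (simp add: w_def)
  have "(\<Oplus>\<^bsub>R\<^esub>j\<in>{..<n}. D i j \<otimes>\<^bsub>R\<^esub> w l j) = \<zero>\<^bsub>R\<^esub>" if l: "l < q" and i: "i < k" for l i
  proof -
    have lf: "linear_form R F (%x. \<kappa> i (d x))" by (rule linear_form_comp[OF GD(3)[OF i] d])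
    have "(\<Oplus>\<^bsub>R\<^esub>j\<in>{..<n}. D i j \<otimes>\<^bsub>R\<^esub> w l j) = (\<Oplus>\<^bsub>R\<^esub>j\<in>{..<n}. \<iota> j (g l) \<otimes>\<^bsub>R\<^esub> \<kappa> i (d (p j)))"
      using l i FD gF GD(5) dD(1) by (intro F.R.finsum_cong' refl) (auto simp: D_def w_def F.R.m_comm)
    also have "\<dots> = \<kappa> i (d (lin_comb F n (%j. \<iota> j (g l)) p))"
      using F.linear_form_lin_comb[OF lf, of n "%j. \<iota> j (g l)" p] FD gF l by simp
    also have "\<dots> = \<kappa> i \<zero>\<^bsub>G\<^esub>" using gF[OF l] FD(4) by simp
    also have "\<dots> = \<zero>\<^bsub>R\<^esub>" by (rule G.linear_form_zero[OF GD(3)[OF i]])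
    finally show ?thesis .
  qed
  then have "\<exists>Pm. (\<forall>i j. Pm i j \<in> carrier R) \<and> (\<forall>i<k. \<forall>j<n. mat_mult R n D Pm i j = \<zero>\<^bsub>R\<^esub>) \<and>
      (\<forall>l<q. \<forall>i<n. (\<Oplus>\<^bsub>R\<^esub>j\<in>{..<n}. Pm i j \<otimes>\<^bsub>R\<^esub> w l j) = w l i)"
    using cR DR wR unfolding split_kernels_def by simp
  then obtain Pm where "(\<forall>i j. Pm i j \<in> carrier R) \<and> (\<forall>i<k. \<forall>j<n. mat_mult R n D Pm i j = \<zero>\<^bsub>R\<^esub>) \<and>
      (\<forall>l<q. \<forall>i<n. (\<Oplus>\<^bsub>R\<^esub>j\<in>{..<n}. Pm i j \<otimes>\<^bsub>R\<^esub> w l j) = w l i)" by (elim exE)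
  then have PR: "!!i j. Pm i j \<in> carrier R"
    and DP: "!!i j. i < k ==> j < n ==> mat_mult R n D Pm i j = \<zero>\<^bsub>R\<^esub>"
    and Pw: "!!l i. l < q ==> i < n ==> (\<Oplus>\<^bsub>R\<^esub>j\<in>{..<n}. Pm i j \<otimes>\<^bsub>R\<^esub> w l j) = w l i" by simp_all
  define r where "r i = lin_comb F n (%j. Pm j i) p" for i
  have rF: "r i \<in> carrier F" for i unfolding r_def using PR FD(2) by (intro F.lin_comb_closed) auto
  have rK: "r i \<in> ?K" if i: "i < n" for i
  proof -
    have "\<kappa> a (d (r i)) = \<zero>\<^bsub>R\<^esub>" if a: "a < k" for a
    proof -
      have lf: "linear_form R F (%x. \<kappa> a (d x))" by (rule linear_form_comp[OF GD(3)[OF a] d])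
      have "\<kappa> a (d (r i)) = (\<Oplus>\<^bsub>R\<^esub>j\<in>{..<n}. Pm j i \<otimes>\<^bsub>R\<^esub> \<kappa> a (d (p j)))"
        unfolding r_def using F.linear_form_lin_comb[OF lf, of n "%j. Pm j i" p] PR FD(2) by simp
      also have "\<dots> = mat_mult R n D Pm a i"
        unfolding mat_mult_def using a i FD GD(5) dD(1) PR
        by (intro F.R.finsum_cong' refl) (auto simp: D_def F.R.m_comm)
      finally show ?thesis using DP[OF a i] by simp
    qed
    then have "lin_comb G k (%a. \<kappa> a (d (r i))) v = lin_comb G k (%a. \<zero>\<^bsub>R\<^esub>) v"
      using GD(2) by (intro G.lin_comb_cong) auto
    also have "\<dots> = \<zero>\<^bsub>G\<^esub>" unfolding lin_comb_def using GD(2) by (intro G.M.add.finprod_one_eqI) (auto simp: G.smult_l_null)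
    finally have "d (r i) = \<zero>\<^bsub>G\<^esub>" using GD(4)[OF dD(1)[OF rF]] by simp
    with rF show ?thesis by (simp add: a_kernel_iff)
  qed
  have "lin_comb F n (%i. \<iota> i x) r = x" if x: "x \<in> ?K" for x
  proof -
    obtain c where c: "!!l. l < q ==> c l \<in> carrier R" "x = lin_comb F q c g" using gen[OF x] by blast
    have xF: "x \<in> carrier F" using x by (simp add: a_kernel_iff)
    have \<iota>x: "\<iota> j x = (\<Oplus>\<^bsub>R\<^esub>l\<in>{..<q}. c l \<otimes>\<^bsub>R\<^esub> w l j)" if j: "j < n" for j
    proof -
      have "\<iota> j x = (\<Oplus>\<^bsub>R\<^esub>l\<in>{..<q}. c l \<otimes>\<^bsub>R\<^esub> \<iota> j (g l))"
        unfolding c(2) by (rule F.linear_form_lin_comb[OF FD(3)[OF j]]) (use c gF in auto)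
      also have "\<dots> = (\<Oplus>\<^bsub>R\<^esub>l\<in>{..<q}. c l \<otimes>\<^bsub>R\<^esub> w l j)"
        using c(1) j FD(5) gF by (intro F.R.finsum_cong' refl) (auto simp: w_def)
      finally show ?thesis .
    qed
    have P\<iota>: "(\<Oplus>\<^bsub>R\<^esub>i\<in>{..<n}. \<iota> i x \<otimes>\<^bsub>R\<^esub> Pm j i) = \<iota> j x" if j: "j < n" for j
    proof -
      have "(\<Oplus>\<^bsub>R\<^esub>i\<in>{..<n}. \<iota> i x \<otimes>\<^bsub>R\<^esub> Pm j i) = (\<Oplus>\<^bsub>R\<^esub>i\<in>{..<n}. \<Oplus>\<^bsub>R\<^esub>l\<in>{..<q}. c l \<otimes>\<^bsub>R\<^esub> (Pm j i \<otimes>\<^bsub>R\<^esub> w l i))"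
      proof (intro F.R.finsum_cong' refl)
        fix i assume "i \<in> {..<n}"
        then have "\<iota> i x \<otimes>\<^bsub>R\<^esub> Pm j i = (\<Oplus>\<^bsub>R\<^esub>l\<in>{..<q}. c l \<otimes>\<^bsub>R\<^esub> w l i \<otimes>\<^bsub>R\<^esub> Pm j i)"
          using \<iota>x c(1) wR PR by (simp add: F.R.finsum_ldistr Pi_def)
        also have "\<dots> = (\<Oplus>\<^bsub>R\<^esub>l\<in>{..<q}. c l \<otimes>\<^bsub>R\<^esub> (Pm j i \<otimes>\<^bsub>R\<^esub> w l i))"
          using c(1) wR PR by (intro F.R.finsum_cong' refl) (auto simp: F.R.m_ac)
        finally show "\<iota> i x \<otimes>\<^bsub>R\<^esub> Pm j i = (\<Oplus>\<^bsub>R\<^esub>l\<in>{..<q}. c l \<otimes>\<^bsub>R\<^esub> (Pm j i \<otimes>\<^bsub>R\<^esub> w l i))" .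
      qed (use c(1) wR PR in auto)
      also have "\<dots> = (\<Oplus>\<^bsub>R\<^esub>l\<in>{..<q}. \<Oplus>\<^bsub>R\<^esub>i\<in>{..<n}. c l \<otimes>\<^bsub>R\<^esub> (Pm j i \<otimes>\<^bsub>R\<^esub> w l i))"
        using c(1) wR PR by (intro F.R.finsum_swap) auto
      also have "\<dots> = (\<Oplus>\<^bsub>R\<^esub>l\<in>{..<q}. c l \<otimes>\<^bsub>R\<^esub> w l j)"
      proof (intro F.R.finsum_cong' refl)
        fix l assume "l \<in> {..<q}"
        then show "(\<Oplus>\<^bsub>R\<^esub>i\<in>{..<n}. c l \<otimes>\<^bsub>R\<^esub> (Pm j i \<otimes>\<^bsub>R\<^esub> w l i)) = c l \<otimes>\<^bsub>R\<^esub> w l j"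
          using c(1) wR PR Pw[of l j] j by (simp add: F.R.finsum_rdistr[symmetric] Pi_def)
      qed (use c(1) wR in auto)
      finally show ?thesis using \<iota>x[OF j] by simp
    qed
    have "lin_comb F n (%i. \<iota> i x) r = lin_comb F n (%j. \<Oplus>\<^bsub>R\<^esub>i\<in>{..<n}. \<iota> i x \<otimes>\<^bsub>R\<^esub> Pm j i) p"
      unfolding r_def using FD PR xF by (intro F.lin_comb_lin_comb) auto
    also have "\<dots> = lin_comb F n (%j. \<iota> j x) p" using P\<iota> FD xF by (intro F.lin_comb_cong) auto
    finally show ?thesis using FD(4)[OF xF] by simp
  qed
  moreover have "linear_form R (F\<lparr>carrier := ?K\<rparr>) (\<iota> i)" if "i < n" for i
    by (rule linear_form_submodule[OF FD(3)[OF that] F.submoduleE(1)[OF K]])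
  ultimately have "dual_basis R (F\<lparr>carrier := ?K\<rparr>) n r \<iota>"
    unfolding dual_basis_def
    using submodule_fmodule[OF FD(1) K] rK
      lin_comb_submodule[OF FD(1) K, of n _ r] FD(5) F.submoduleE(1)[OF K] by (simp add: subset_iff)
  then show ?thesis by blast
qed

text \<open>By exactness at \<open>F 1\<close>, the images of the generators of \<open>F 2\<close>
  are a finite generating family of the kernel of \<open>d 0\<close>, as
  \<open>dual_basis_kernel\<close> demands.\<close>

lemma resolution_kernel:
  assumes cR: "split_kernels R" and F: "!!i. i \<le> 2 ==> fgp_module R (F i)"
    and ex: "exact_upto R m F d e M" and m: "2 \<le> m"
  shows "\<exists>n r \<iota>. dual_basis R ((F 1)\<lparr>carrier := a_kernel (F 1) (F 0) (d 0)\<rparr>) n r \<iota>"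
proof -
  obtain n0 e0 n1 e1 n2 e2 where "has_gram R (F 0) n0 e0" "has_gram R (F 1) n1 e1" "has_gram R (F 2) n2 e2"
    using fgp_has_gram[OF F[of 0]] fgp_has_gram[OF F[of 1]] fgp_has_gram[OF F[of 2]] by auto
  then obtain p0 \<kappa> p1 \<iota> p2 \<nu> where b0: "dual_basis R (F 0) n0 p0 \<kappa>" and b1: "dual_basis R (F 1) n1 p1 \<iota>"
    and b2: "dual_basis R (F 2) n2 p2 \<nu>" unfolding has_gram_def by blast
  have m12: "enat (Suc 0) \<le> m" "enat (Suc (Suc 0)) \<le> m"
    using m order_trans[of "1::enat" 2 m] by (simp_all add: one_enat_def numeral_eq_enat numeral_2_eq_2)
  have d0: "d 0 \<in> mod_hom R (F 1) (F 0)" using ex m12 unfolding exact_upto_def by auto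
  have d1: "d 1 \<in> mod_hom R (F 2) (F 1)" using ex m12 unfolding exact_upto_def by (auto simp: numeral_2_eq_2)
  have im: "d 1 ` carrier (F 2) = a_kernel (F 1) (F 0) (d 0)"
    using ex m12 unfolding exact_upto_def by (auto simp: numeral_2_eq_2)
  interpret F2: fmodule R "F 2" by (rule fmodule.intro[OF dual_basisD(1)[OF b2]])
  have "\<exists>r. dual_basis R ((F 1)\<lparr>carrier := a_kernel (F 1) (F 0) (d 0)\<rparr>) n1 r \<iota>"
  proof (rule dual_basis_kernel[OF cR b1 b0 d0])
    show "d 1 (p2 l) \<in> a_kernel (F 1) (F 0) (d 0)" if "l < n2" for l
      using dual_basisD(2)[OF b2 that] unfolding im[symmetric] by blast
    fix x assume "x \<in> a_kernel (F 1) (F 0) (d 0)"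
    then obtain y where y: "y \<in> carrier (F 2)" "x = d 1 y" unfolding im[symmetric] by blast
    have "x = lin_comb (F 1) n2 (%l. \<nu> l y) (%l. d 1 (p2 l))"
      using F2.mod_hom_lin_comb[OF d1 dual_basisD(1)[OF b1], of n2 "%l. \<nu> l y" p2] dual_basisD[OF b2] y by simp
    then show "\<exists>c. (\<forall>l<n2. c l \<in> carrier R) \<and> x = lin_comb (F 1) n2 c (%l. d 1 (p2 l))"
      by (intro exI[of _ "%l. \<nu> l y"] conjI allI impI dual_basisD(5)[OF b2 _ y(1)])
  qed
  then show ?thesis by blast
qed

text \<open>The kernel of \<open>d 0\<close> is projective, so \<open>d 1\<close>, which maps onto
  it, has a section \<open>s\<close>. Then \<open>\<rho> = 1 - s d 1\<close> is idempotent with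
  image the kernel of \<open>d 1\<close>, and a second copy of \<open>F 2\<close>, mapped by
  \<open>\<rho>\<close>, is the missing term of the presentation.\<close>

lemma split_kernels_two_coherent:
  fixes R :: "('r, 'k) ring_scheme"
  assumes R: "cring R" and cR: "split_kernels R"
  shows "two_coherent TYPE('m) R"
  unfolding two_coherent_def
proof (intro conjI R allI impI)
  fix M :: "('r, 'm) module" assume "fin_presented R 2 M"
  then obtain F :: "nat => ('r, nat => 'r) module" and d e where M: "Module.module R M"
    and F: "!!i. enat i \<le> 2 ==> fgp_module R (F i)" and ex: "exact_upto R 2 F d e M"
    unfolding fin_presented_def by blast
  have F': "fgp_module R (F i)" if "i \<le> 2" for i using F[of i] that by (simp add: numeral_eq_enat)
  obtain n r \<iota> where K: "dual_basis R ((F 1)\<lparr>carrier := a_kernel (F 1) (F 0) (d 0)\<rparr>) n r \<iota>"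
    using resolution_kernel[OF cR F' ex] by auto
  let ?K = "(F 1)\<lparr>carrier := a_kernel (F 1) (F 0) (d 0)\<rparr>"
  have F2: "Module.module R (F 2)" and F1: "Module.module R (F 1)" and F0: "Module.module R (F 0)"
    using F'[of 2] F'[of 1] F'[of 0] by (simp_all add: fgp_module_def fin_gen_module_def)
  interpret F2: fmodule R "F 2" by (rule fmodule.intro[OF F2])
  interpret F1: fmodule R "F 1" by (rule fmodule.intro[OF F1])
  interpret K: fmodule R ?K by (rule fmodule.intro[OF dual_basisD(1)[OF K]])
  have m12: "enat (Suc 0) \<le> 2" "enat (Suc (Suc 0)) \<le> 2" by (simp_all add: numeral_eq_enat)
  have d0: "d 0 \<in> mod_hom R (F 1) (F 0)" using ex m12 unfolding exact_upto_def by auto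
  have d1: "d 1 \<in> mod_hom R (F 2) (F 1)" using ex m12 unfolding exact_upto_def by (auto simp: numeral_2_eq_2)
  have im: "d 1 ` carrier (F 2) = a_kernel (F 1) (F 0) (d 0)"
    using ex m12 unfolding exact_upto_def by (auto simp: numeral_2_eq_2)
  have d1K: "d 1 \<in> mod_hom R (F 2) ?K"
    using d1 im by (auto simp: mod_hom_def)
  \<comment> \<open>Lifts of the generators of the kernel along \<open>d 1\<close>; they determine
    the section \<open>s\<close>.\<close>
  have "\<forall>i. \<exists>u. i < n \<longrightarrow> u \<in> carrier (F 2) \<and> d 1 u = r i"
    using dual_basisD(2)[OF K] unfolding im[symmetric] by fastforce
  then obtain u where "\<forall>i. i < n \<longrightarrow> u i \<in> carrier (F 2) \<and> d 1 (u i) = r i" by (rule choice[THEN exE])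
  then have u: "!!i. i < n ==> u i \<in> carrier (F 2)" "!!i. i < n ==> d 1 (u i) = r i" by auto
  define s where "s y = lin_comb (F 2) n (%i. \<iota> i y) u" for y
  have s: "s \<in> mod_hom R ?K (F 2)"
    unfolding s_def by (rule F2.mod_hom_lin_comb_form) (use dual_basisD(3)[OF K] u in auto)
  have ds: "d 1 (s y) = y" if y: "y \<in> carrier ?K" for y
  proof -
    have "d 1 (s y) = lin_comb ?K n (%i. \<iota> i y) (%i. d 1 (u i))"
      unfolding s_def by (rule F2.mod_hom_lin_comb[OF d1K K.module_axioms])
        (use u dual_basisD(5)[OF K _ y] in auto)
    also have "\<dots> = lin_comb ?K n (%i. \<iota> i y) r"
      using u dual_basisD(2)[OF K] dual_basisD(5)[OF K _ y] by (intro K.lin_comb_cong) auto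
    finally show ?thesis using dual_basisD(4)[OF K y] by simp
  qed
  define \<rho> where "\<rho> x = x \<oplus>\<^bsub>F 2\<^esub> (\<ominus>\<^bsub>R\<^esub> \<one>\<^bsub>R\<^esub>) \<odot>\<^bsub>F 2\<^esub> s (d 1 x)" for x
  note d1D = mod_homD[OF d1K] and sD = mod_homD[OF s] and d1D' = mod_homD[OF d1]
  have sd: "s (d 1 x) \<in> carrier (F 2)" if "x \<in> carrier (F 2)" for x using d1D(1)[OF that] sD(1) by blast
  have m1: "(\<ominus>\<^bsub>R\<^esub> \<one>\<^bsub>R\<^esub>) \<odot>\<^bsub>L\<^esub> x = \<ominus>\<^bsub>L\<^esub> x" if "Module.module R L" "x \<in> carrier L" for L :: "('r, nat => 'r) module" and x
    using that Module.module.smult_l_minus[OF that(1) _ that(2), of "\<one>\<^bsub>R\<^esub>"] Module.module.smult_one[OF that] by simp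
  have \<rho>: "\<rho> \<in> mod_hom R (F 2) (F 2)"
  proof (rule mod_homI)
    fix x assume x: "x \<in> carrier (F 2)"
    show "\<rho> x \<in> carrier (F 2)" using x sd by (simp add: \<rho>_def)
    show "\<rho> (x \<oplus>\<^bsub>F 2\<^esub> y) = \<rho> x \<oplus>\<^bsub>F 2\<^esub> \<rho> y" if y: "y \<in> carrier (F 2)" for y
    proof -
      have "s (d 1 (x \<oplus>\<^bsub>F 2\<^esub> y)) = s (d 1 x) \<oplus>\<^bsub>F 2\<^esub> s (d 1 y)"
        using d1D(2)[OF x y] sD(2)[OF d1D(1)[OF x] d1D(1)[OF y]] by simp
      then show ?thesis using x y sd by (simp add: \<rho>_def F2.smult_r_distr F2.M.a_ac)
    qed
    show "\<rho> (a \<odot>\<^bsub>F 2\<^esub> x) = a \<odot>\<^bsub>F 2\<^esub> \<rho> x" if a: "a \<in> carrier R" for a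
    proof -
      have "s (d 1 (a \<odot>\<^bsub>F 2\<^esub> x)) = a \<odot>\<^bsub>F 2\<^esub> s (d 1 x)"
        using d1D(3)[OF a x] sD(3)[OF a d1D(1)[OF x]] by simp
      then show ?thesis using x a sd by (simp add: \<rho>_def F2.smult_r_distr F2.smult_assoc1[symmetric] F2.R.m_comm)
    qed
  qed
  have "\<rho> ` carrier (F 2) = a_kernel (F 2) (F 1) (d 1)"
  proof (intro Set.set_eqI iffI)
    fix z assume "z \<in> \<rho> ` carrier (F 2)"
    then obtain x where x: "x \<in> carrier (F 2)" "z = \<rho> x" by blast
    have "d 1 z = d 1 x \<oplus>\<^bsub>F 1\<^esub> (\<ominus>\<^bsub>R\<^esub> \<one>\<^bsub>R\<^esub>) \<odot>\<^bsub>F 1\<^esub> d 1 (s (d 1 x))"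
      using x sd d1D' by (simp add: \<rho>_def)
    also have "\<dots> = \<zero>\<^bsub>F 1\<^esub>" using x ds[OF d1D(1)[OF x(1)]] d1D'(1)[OF x(1)] m1[OF F1] by (simp add: F1.M.r_neg del: One_nat_def)
    finally show "z \<in> a_kernel (F 2) (F 1) (d 1)" using mod_homD(1)[OF \<rho> x(1)] x(2) by (simp add: a_kernel_iff)
  next
    fix z assume "z \<in> a_kernel (F 2) (F 1) (d 1)"
    then have z: "z \<in> carrier (F 2)" "d 1 z = \<zero>\<^bsub>F 1\<^esub>" by (simp_all add: a_kernel_iff)
    have "s \<zero>\<^bsub>F 1\<^esub> = \<zero>\<^bsub>F 2\<^esub>" using K.mod_hom_zero[OF s F2] by simp
    then have "\<rho> z = z" using z by (simp add: \<rho>_def)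
    then show "z \<in> \<rho> ` carrier (F 2)" using z by (metis imageI)
  qed
  note \<rho>im = this
  let ?F = "%i. if i = 3 then F 2 else F i" and ?d = "%i. if i = 2 then \<rho> else d i"
  have ex3: "exact_upto R 3 ?F ?d e M"
    unfolding exact_upto_def
  proof (intro conjI allI impI)
    show "e \<in> mod_hom R (?F 0) M" "e ` carrier (?F 0) = carrier M" "?d 0 ` carrier (?F 1) = a_kernel (?F 0) M e"
      using ex unfolding exact_upto_def by (auto simp: numeral_eq_enat one_enat_def)
    fix i :: nat
    assume "enat (Suc i) \<le> 3"
    then consider "i = 0" | "i = 1" | "i = 2" by (auto simp: numeral_eq_enat) linarith
    then show "?d i \<in> mod_hom R (?F (Suc i)) (?F i)"
      by cases (use d0 d1 \<rho> in \<open>auto simp: numeral_2_eq_2 numeral_3_eq_3\<close>)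
  next
    fix i :: nat assume "enat (Suc (Suc i)) \<le> 3"
    then consider "i = 0" | "i = 1" by (auto simp: numeral_eq_enat) linarith
    then show "?d (Suc i) ` carrier (?F (Suc (Suc i))) = a_kernel (?F (Suc i)) (?F i) (?d i)"
      by cases (use im \<rho>im in \<open>auto simp: numeral_2_eq_2 numeral_3_eq_3\<close>)
  qed
  have fgp: "fgp_module R (?F i)" if "enat i \<le> 3" for i
  proof -
    have "i \<le> 2 \<or> i = 3" using that by (auto simp: numeral_eq_enat)
    then show ?thesis using F' by auto
  qed
  show "fin_presented R 3 M"
    unfolding fin_presented_def
    by (intro conjI M, rule exI[of _ ?F], rule exI[of _ ?d], rule exI[of _ e], intro conjI allI impI fgp ex3)
qed

text \<open>A copy of the module along an injection \<open>j\<close> with left inverse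
  \<open>k\<close>. It bridges the carrier type of the terms in \<open>fin_presented\<close> and the
  one prescribed by \<open>finite_proj_dim\<close>.\<close>

definition transport_module :: "('p => 'q) => ('q => 'p) => ('r, 'p) module => ('r, 'q) module" where
  "transport_module j k M = \<lparr>carrier = j ` carrier M, monoid.mult = (%x y. j \<zero>\<^bsub>M\<^esub>), one = j \<zero>\<^bsub>M\<^esub>,
     ring.zero = j \<zero>\<^bsub>M\<^esub>, ring.add = (%x y. j (k x \<oplus>\<^bsub>M\<^esub> k y)), smult = (%a x. j (a \<odot>\<^bsub>M\<^esub> k x))\<rparr>"

lemma transport_simps:
  "carrier (transport_module j k M) = j ` carrier M" "\<zero>\<^bsub>transport_module j k M\<^esub> = j \<zero>\<^bsub>M\<^esub>"
  "x \<oplus>\<^bsub>transport_module j k M\<^esub> y = j (k x \<oplus>\<^bsub>M\<^esub> k y)" "a \<odot>\<^bsub>transport_module j k M\<^esub> x = j (a \<odot>\<^bsub>M\<^esub> k x)"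
  by (simp_all add: transport_module_def)

lemma transport_module_module:
  assumes M: "Module.module R M" and kj: "!!x. k (j x) = x"
  shows "Module.module R (transport_module j k M)"
proof -
  interpret M: fmodule R M by (rule fmodule.intro[OF M])
  let ?N = "transport_module j k M"
  have ag: "abelian_group ?N"
  proof (rule abelian_groupI)
    fix x assume "x \<in> carrier ?N"
    then obtain u where u: "u \<in> carrier M" "x = j u" by (auto simp: transport_simps)
    show "\<exists>y\<in>carrier ?N. y \<oplus>\<^bsub>?N\<^esub> x = \<zero>\<^bsub>?N\<^esub>"
      by (rule bexI[of _ "j (\<ominus>\<^bsub>M\<^esub> u)"]) (use u in \<open>auto simp: transport_simps kj M.M.l_neg\<close>)
  qed (auto simp: transport_simps kj M.M.a_ac)
  show ?thesis
    by (rule moduleI) (use ag M.R.cring_axioms in \<open>auto simp: transport_simps kj M.smult_l_distr M.smult_r_distr M.smult_assoc1\<close>)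
qed

lemma transport_module_iso:
  assumes kj: "!!x. k (j x) = x"
  shows "mod_isomorphic R M (transport_module j k M)"
  unfolding mod_isomorphic_def
proof (rule bexI[of _ j])
  show "bij_betw j (carrier M) (carrier (transport_module j k M))"
    unfolding bij_betw_def by (metis inj_on_inverseI kj transport_simps(1))
qed (rule mod_homI; simp add: transport_simps kj)

lemma exact_upto_transport:
  fixes R :: "('r, 'k) ring_scheme" and F :: "nat => ('r, 'p) module" and M :: "('r, 'm) module" and j :: "'p => 'q"
  assumes "exact_upto R n F d e M" and kj: "!!x. k (j x) = x"
  shows "exact_upto R n (%i. transport_module j k (F i)) (%i x. j (d i (k x))) (%x. e (k x)) M"
proof -
  have hom: "(%x. j (f (k x))) \<in> mod_hom R (transport_module j k A) (transport_module j k B)"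
    if "f \<in> mod_hom R A B" for f and A B :: "('r, 'p) module"
    using mod_homD[OF that] by (intro mod_homI) (auto simp: transport_simps kj)
  have hom': "(%x. f (k x)) \<in> mod_hom R (transport_module j k A) B"
    if "f \<in> mod_hom R A B" for f and A :: "('r, 'p) module" and B :: "('r, 'm) module"
    using mod_homD[OF that] by (intro mod_homI) (auto simp: transport_simps kj)
  have im: "(%x. j (f (k x))) ` carrier (transport_module j k A) = j ` f ` carrier A" for f and A :: "('r, 'p) module"
    by (simp add: transport_simps kj image_image)
  have im': "(%x. f (k x)) ` carrier (transport_module j k A) = f ` carrier A" for f and A :: "('r, 'p) module"
    by (simp add: transport_simps kj image_image)
  have jinj: "j x = j y \<longleftrightarrow> x = y" for x y by (metis kj)
  have ker: "a_kernel (transport_module j k A) (transport_module j k B) (%x. j (f (k x))) = j ` a_kernel A B f"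
    for f and A B :: "('r, 'p) module"
    by (auto simp: a_kernel_iff transport_simps kj jinj)
  have ker': "a_kernel (transport_module j k A) B (%x. f (k x)) = j ` a_kernel A B f"
    for f and A :: "('r, 'p) module" and B :: "('r, 'm) module"
    by (auto simp: a_kernel_iff transport_simps kj)
  show ?thesis
    using assms(1) unfolding exact_upto_def im im' ker ker' by (auto intro!: hom hom')
qed

text \<open>As the kernel of \<open>d 0\<close> is projective, \<open>0 \<rightarrow> ker (d 0)
  \<rightarrow> F 1 \<rightarrow> F 0 \<rightarrow> M \<rightarrow> 0\<close> is a resolution of
  length two. What remains is to move it into the prescribed carrier type.\<close>

lemma split_kernels_regular:
  fixes R :: "('r, 'k) ring_scheme"
  assumes R: "cring R" and cR: "split_kernels R" and inf: "infinite (UNIV :: 'r set)"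
  shows "regular_ring TYPE('m) R"
  unfolding regular_ring_def
proof (intro conjI R allI impI)
  fix M :: "('r, 'm) module" assume "fin_presented R \<infinity> M"
  then obtain F :: "nat => ('r, nat => 'r) module" and d e
    where F: "!!i. fgp_module R (F i)" and ex: "exact_upto R \<infinity> F d e M"
    unfolding fin_presented_def by auto
  obtain n r \<iota> where K: "dual_basis R ((F 1)\<lparr>carrier := a_kernel (F 1) (F 0) (d 0)\<rparr>) n r \<iota>"
    using resolution_kernel[OF cR F ex] by auto
  define A where "A = F 1"
  note K = K[folded A_def]
  let ?K = "A\<lparr>carrier := a_kernel A (F 0) (d 0)\<rparr>"
  \<comment> \<open>The zero module is taken inside \<open>A\<close>, so that all maps from index
    one on can be inclusions.\<close>
  let ?Z = "A\<lparr>carrier := {\<zero>\<^bsub>A\<^esub>}\<rparr>"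
  have F1: "Module.module R A" and F0: "Module.module R (F 0)"
    using F[of 1] F[of 0] by (simp_all add: fgp_module_def fin_gen_module_def A_def)
  interpret F1: fmodule R A by (rule fmodule.intro[OF F1])
  have Zs: "submodule {\<zero>\<^bsub>A\<^esub>} R A"
    by (rule F1.submoduleI) (auto simp: F1.smult_r_null simp del: One_nat_def)
  have Z: "has_gram R ?Z 0 (%i j. \<zero>\<^bsub>R\<^esub>)"
  proof -
    have mZ: "Module.module R ?Z" by (rule submodule_fmodule[OF F1 Zs])
    have am: "abelian_monoid ?Z"
      by (rule abelian_group.axioms(1)[OF Module.module.axioms(2)[OF mZ]])
    have "lin_comb ?Z 0 c q = \<zero>\<^bsub>?Z\<^esub>" for c q
      unfolding lin_comb_def lessThan_0 by (rule abelian_monoid.finsum_empty[OF am])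
    then have "dual_basis R ?Z 0 p \<iota>" for p \<iota>
      unfolding dual_basis_def using mZ by (simp del: One_nat_def)
    then show ?thesis unfolding has_gram_def by blast
  qed
  have Kg: "has_gram R ?K n (%i j. \<iota> i (r j))" unfolding has_gram_def using K by blast
  have d0: "d 0 \<in> mod_hom R A (F 0)" using ex unfolding exact_upto_def A_def by auto
  have Kz: "\<zero>\<^bsub>A\<^esub> \<in> a_kernel A (F 0) (d 0)"
    using F1.mod_hom_zero[OF d0 F0] by (simp add: a_kernel_iff)
  define G where "G i = (if i = 0 then F 0 else if i = 1 then A else if i = 2 then ?K else ?Z)" for i :: nat
  define D where "D i = (if i = 0 then d 0 else (%x. x))" for i :: nat
  have Ggram: "\<exists>n e. has_gram R (G i) n e" for i
    using fgp_has_gram[OF F[of 0]] fgp_has_gram[OF F[of 1], folded A_def] Kg Z unfolding G_def by auto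
  have exG: "exact_upto R \<infinity> G D e M"
    unfolding exact_upto_def
  proof (intro conjI allI impI)
    show "e \<in> mod_hom R (G 0) M" "e ` carrier (G 0) = carrier M" "D 0 ` carrier (G 1) = a_kernel (G 0) M e"
      using ex unfolding exact_upto_def G_def D_def A_def by auto
    fix i :: nat
    consider "i = 0" | "i = 1" | "i = 2" | "i > 2" by linarith
    then show "D i \<in> mod_hom R (G (Suc i)) (G i)"
      by cases (use d0 Kz in \<open>auto simp: G_def D_def a_kernel_iff F1.smult_r_null intro!: mod_homI\<close>)
    consider "i = 0" | "i = 1" | "i = 2" | "i > 2" by linarith
    then show "D (Suc i) ` carrier (G (Suc (Suc i))) = a_kernel (G (Suc i)) (G i) (D i)"
      by cases (use Kz in \<open>auto simp: G_def D_def a_kernel_iff\<close>)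
  qed
  \<comment> \<open>Sequences become functions on pairs that ignore the \<open>'m\<close> component;
    \<open>k\<close> restricts to the slice at \<open>undefined\<close>.\<close>
  define j where "j = (%(f :: nat => 'r) (z :: 'm \<times> nat). f (snd z))"
  define k where "k = (%(g :: 'm \<times> nat => 'r) n. g (undefined, n))"
  let ?P = "%i. transport_module j k (G i)"
  have kj: "k (j f) = f" for f by (simp add: j_def k_def)
  have inf': "infinite (UNIV :: ('m \<times> nat => 'r) set)"
    using finite_fun_UNIVD2[where 'a = "'m \<times> nat" and 'b = 'r] inf by blast
  have "projective_module R (?P i)" for i
  proof -
    obtain n f where g: "has_gram R (G i) n f" using Ggram by blast
    then have "Module.module R (G i)" unfolding has_gram_def dual_basis_def by blast
    from has_gram_iso[OF g transport_module_module[where j = j and k = k, OF this kj] transport_module_iso[where j = j and k = k, OF kj]]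
    have "has_gram R (?P i) n f" .
    then show ?thesis using has_gram_fgp[OF _ inf'] unfolding fgp_module_def by blast
  qed
  note proj = this
  have res: "exact_upto R \<infinity> ?P (%i x. j (D i (k x))) (%x. e (k x)) M"
    by (rule exact_upto_transport[where j = j and k = k, OF exG kj])
  have triv: "\<forall>i>2. carrier (?P i) = {\<zero>\<^bsub>?P i\<^esub>}"
    by (auto simp: transport_simps G_def)
  show "finite_proj_dim R M"
    unfolding finite_proj_dim_def
    by (rule exI[of _ "2 :: nat"], rule exI[of _ ?P], rule exI[of _ "%i x. j (D i (k x))"], rule exI[of _ "%x. e (k x)"])
      (intro conjI allI proj res triv)
qed

section \<open>Finite free resolutions\<close>

text \<open>Rings are subsets of one type, so that a chain of polynomial rings shares its operations
  and the laws of the type class.\<close>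

locale unital_subring =
  fixes A :: "'b::comm_ring_1 set"
  assumes zero_mem [simp]: "0 \<in> A"
    and one_mem [simp]: "1 \<in> A"
    and add_mem [simp]: "a \<in> A ==> b \<in> A ==> a + b \<in> A"
    and mult_mem [simp]: "a \<in> A ==> b \<in> A ==> a * b \<in> A"
    and uminus_mem [simp]: "a \<in> A ==> - a \<in> A"
begin

lemma diff_mem [simp]: "a \<in> A ==> b \<in> A ==> a - b \<in> A"
  using add_mem[of a "- b"] by simp

lemma sum_mem [simp]: "(!!i. i \<in> I ==> f i \<in> A) ==> (\<Sum>i\<in>I. f i) \<in> A"
  by (induction I rule: infinite_finite_induct) auto

lemma power_mem [simp]: "a \<in> A ==> a ^ n \<in> A"
  by (induction n) auto

end

section \<open>Relation modules and resolutions\<close>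

definition lincomb :: "nat => (nat => 'b::comm_ring_1) => (nat => nat => 'b) => nat => 'b" where
  "lincomb r c g = (%i. \<Sum>k<r. c k * g k i)"

definition vecs :: "'b::comm_ring_1 set => nat => (nat => 'b) set" where
  "vecs A r = {c. (\<forall>k. c k \<in> A) \<and> (\<forall>k\<ge>r. c k = 0)}"

definition rels :: "'b::comm_ring_1 set => nat => (nat => nat => 'b) => (nat => 'b) set" where
  "rels A r g = {c \<in> vecs A r. lincomb r c g = (%_. 0)}"

text \<open>Finite free resolutions by recursion on the length: the relations of some finite
  generating family again have one. Modules are sets of sequences, and a relation among
  \<open>r\<close> generators is a sequence that vanishes from \<open>r\<close> on.\<close>

inductive ffr :: "'b::comm_ring_1 set => (nat => 'b) set => bool" for A where
  zero: "ffr A {%_. 0}"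
| step: "N = (%c. lincomb r c g) ` vecs A r ==> ffr A (rels A r g) ==> ffr A N"

lemma lincomb_add: "lincomb r (%k. c k + d k) g = (%i. lincomb r c g i + lincomb r d g i)"
  by (simp add: lincomb_def algebra_simps sum.distrib)

lemma lincomb_diff: "lincomb r (%k. c k - d k) g = (%i. lincomb r c g i - lincomb r d g i)"
  by (simp add: lincomb_def algebra_simps sum_subtractf)

lemma lincomb_uminus: "lincomb r (%k. - c k) g = (%i. - lincomb r c g i)"
  by (simp add: lincomb_def sum_negf)

lemma lincomb_smult: "lincomb r (%k. a * c k) g = (%i. a * lincomb r c g i)"
  by (simp add: lincomb_def sum_distrib_left mult.assoc)

lemma lincomb_zero [simp]: "lincomb r (%k. 0) g = (%i. 0)"
  by (simp add: lincomb_def)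

lemma lincomb_0 [simp]: "lincomb 0 c g = (%i. 0)"
  by (simp add: lincomb_def)

lemma lincomb_cong: "(!!k. k < r ==> c k = d k) ==> (!!k. k < r ==> g k = h k) ==> lincomb r c g = lincomb r d h"
  by (simp add: lincomb_def)

lemma lincomb_lincomb:
  "lincomb r (lincomb q c s) g = lincomb q c (%k. lincomb r (s k) g)"
proof
  fix i
  have "lincomb r (lincomb q c s) g i = (\<Sum>k<r. \<Sum>l<q. c l * (s l k * g k i))"
    by (simp add: lincomb_def sum_distrib_right mult.assoc)
  also have "\<dots> = (\<Sum>l<q. \<Sum>k<r. c l * (s l k * g k i))" by (rule sum.swap)
  finally show "lincomb r (lincomb q c s) g i = lincomb q c (%k. lincomb r (s k) g) i"
    by (simp add: lincomb_def sum_distrib_left)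
qed

lemma sum_lessThan_add:
  fixes f :: "nat => 'c::comm_monoid_add"
  shows "(\<Sum>k<r + b. f k) = (\<Sum>k<r. f k) + (\<Sum>k<b. f (r + k))"
  by (induction b) (simp_all add: add.assoc)

lemma lincomb_append:
  "lincomb (l + q) v (%k. if k < l then z k else s (k - l))
    = (%i. lincomb l v z i + lincomb q (%k. v (l + k)) s i)"
  by (simp add: lincomb_def sum_lessThan_add)

lemma (in unital_subring) zero_vecs [simp]: "(%_. 0) \<in> vecs A r"
  by (simp add: vecs_def)

lemma (in unital_subring) vecs_0: "vecs A 0 = {%_. 0}"
  by (auto simp: vecs_def)

lemma (in unital_subring) zero_rels [simp]: "(%_. 0) \<in> rels A r g"
  by (simp add: rels_def)

lemma (in unital_subring) lincomb_vecs: "c \<in> vecs A q ==> (!!k. k < q ==> s k \<in> vecs A r) ==> lincomb q c s \<in> vecs A r"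
  unfolding vecs_def lincomb_def mem_Collect_eq
  by (intro conjI allI impI sum_mem mult_mem sum.neutral ballI) auto

text \<open>The zero module counts as generated by the empty family, which spares case
  distinctions.\<close>

lemma (in unital_subring) ffr_generators:
  assumes "ffr A N"
  obtains r g where "N = (%c. lincomb r c g) ` vecs A r" "ffr A (rels A r g)"
  using assms
proof cases
  case zero
  have "rels A 0 (%_ _. 0) = {%_. 0}" by (auto simp: rels_def vecs_0)
  with zero show ?thesis using that[of 0 "%_ _. 0"] ffr.zero[of A] by (simp add: vecs_0)
next
  case (step r g)
  then show ?thesis using that by blast
qed

text \<open>In a joint relation of \<open>z\<close> and \<open>s\<close> the part in
  \<open>z\<close> lies in \<open>Z\<close>, so the rest is a relation of \<open>s\<close> modulo
  \<open>Z\<close>.\<close>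

lemma (in unital_subring) rels_append:
  assumes Z: "Z = (%c. lincomb l c z) ` vecs A l"
    and v: "v \<in> rels A (l + q) (%k. if k < l then z k else s (k - l))"
  shows "(%k. v (l + k)) \<in> {c \<in> vecs A q. lincomb q c s \<in> Z}"
proof -
  have vm: "v \<in> vecs A (l + q)" and eq: "(%i. lincomb l v z i + lincomb q (%k. v (l + k)) s i) = (%_. 0)"
    using v by (auto simp: rels_def lincomb_append)
  let ?a = "%k. if k < l then - v k else 0"
  have "?a \<in> vecs A l" using vm by (auto simp: vecs_def)
  moreover have "lincomb l ?a z = lincomb q (%k. v (l + k)) s"
  proof -
    have "lincomb l ?a z = lincomb l (%k. - v k) z" by (intro lincomb_cong) auto
    also have "\<dots> = lincomb q (%k. v (l + k)) s"
      using eq by (auto simp: lincomb_uminus fun_eq_iff minus_equation_iff add_eq_0_iff)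
    finally show ?thesis .
  qed
  ultimately have "lincomb q (%k. v (l + k)) s \<in> Z" unfolding Z by (intro image_eqI[of _ _ ?a]) simp_all
  then show ?thesis using vm by (auto simp: vecs_def)
qed

lemma (in unital_subring) lincomb_append_image:
  assumes Z: "Z = (%c. lincomb l c z) ` vecs A l"
    and Y: "Y = {(%i. y i + lincomb q c s i) | y c. y \<in> Z \<and> c \<in> vecs A q}"
  shows "Y = (%c. lincomb (l + q) c (%k. if k < l then z k else s (k - l))) ` vecs A (l + q)"
    (is "_ = (%c. lincomb _ c ?g) ` _")
proof (intro Set.set_eqI iffI)
  fix y assume "y \<in> Y"
  then obtain a c where a: "a \<in> vecs A l" and c: "c \<in> vecs A q"
    and y: "y = (%i. lincomb l a z i + lincomb q c s i)" using Y Z by auto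
  let ?v = "%k. if k < l then a k else c (k - l)"
  have "?v \<in> vecs A (l + q)" using a c by (auto simp: vecs_def)
  moreover have "lincomb (l + q) ?v ?g = y"
    unfolding lincomb_append y by (intro ext arg_cong2[where f = "(+)"]) (auto simp: lincomb_def)
  ultimately show "y \<in> (%c. lincomb (l + q) c ?g) ` vecs A (l + q)" by blast
next
  fix y assume "y \<in> (%c. lincomb (l + q) c ?g) ` vecs A (l + q)"
  then obtain v where v: "v \<in> vecs A (l + q)" and y: "y = lincomb (l + q) v ?g" by auto
  have "(%k. if k < l then v k else 0) \<in> vecs A l" using v by (auto simp: vecs_def)
  moreover have "lincomb l v z = lincomb l (%k. if k < l then v k else 0) z" by (intro lincomb_cong) auto
  ultimately have "lincomb l v z \<in> Z"
    unfolding Z by (intro image_eqI[of _ _ "%k. if k < l then v k else 0"]) simp_all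
  moreover have "(%k. v (l + k)) \<in> vecs A q" using v by (auto simp: vecs_def)
  ultimately show "y \<in> Y" unfolding y lincomb_append Y by blast
qed

text \<open>The module \<open>Q\<close> of relations of \<open>s\<close> modulo \<open>Z\<close> presents \<open>(Z + \<langle>s\<rangle>) / Z\<close>; so this is
  the closure of modules with finite free resolutions under extensions.\<close>

lemma (in unital_subring) ffr_extension:
  assumes "ffr A Q"
  shows "ffr A Z ==> Q = {c \<in> vecs A q. lincomb q c s \<in> Z} ==>
    Y = {(%i. y i + lincomb q c s i) | y c. y \<in> Z \<and> c \<in> vecs A q} ==> ffr A Y"
  using assms
proof (induction arbitrary: Z q s Y rule: ffr.induct)
  case zero
  obtain l z where Z: "Z = (%c. lincomb l c z) ` vecs A l" and rz: "ffr A (rels A l z)"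
    using ffr_generators[OF zero(1)] .
  let ?g = "%k. if k < l then z k else s (k - l)"
  have Y: "Y = (%c. lincomb (l + q) c ?g) ` vecs A (l + q)"
    using lincomb_append_image[OF Z zero(3)] .
  \<comment> \<open>\<open>Q = 0\<close> says that \<open>s\<close> is free modulo \<open>Z\<close>,
    so the joint relations are those of \<open>z\<close>, padded by zeros.\<close>
  have "rels A (l + q) ?g = rels A l z"
  proof
    show "rels A (l + q) ?g \<subseteq> rels A l z"
    proof
      fix v assume v: "v \<in> rels A (l + q) ?g"
      have 0: "(%k. v (l + k)) = (%_. 0)" using rels_append[OF Z v] zero(2) by auto
      then have "v k = 0" if "k \<ge> l" for k using fun_cong[OF 0, of "k - l"] that by simp
      then show "v \<in> rels A l z" using v 0 by (auto simp: rels_def vecs_def lincomb_append)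
    qed
    show "rels A l z \<subseteq> rels A (l + q) ?g"
      by (auto simp: rels_def vecs_def lincomb_append)
  qed
  with rz Y show ?case by (metis ffr.step)
next
  case (step Q' u w)
  obtain l z where Z: "Z = (%c. lincomb l c z) ` vecs A l" and rz: "ffr A (rels A l z)"
    using ffr_generators[OF step.prems(1)] .
  let ?g = "%k. if k < l then z k else s (k - l)"
  have Y: "Y = (%c. lincomb (l + q) c ?g) ` vecs A (l + q)"
    using lincomb_append_image[OF Z step.prems(3)] .
  have wQ: "w k \<in> Q'" if "k < u" for k
  proof -
    have "(%i. if i = k then 1 else 0) \<in> vecs A u" using that by (auto simp: vecs_def)
    moreover have "lincomb u (%i. if i = k then 1 else 0) w = w k"
      using that by (simp add: lincomb_def if_distrib[where f = "%x. x * _"] cong: if_cong)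
    ultimately show ?thesis
      unfolding step.hyps(1) by (intro image_eqI[of _ _ "%i. if i = k then 1 else 0"]) simp_all
  qed
  \<comment> \<open>A relation of \<open>s\<close> modulo \<open>Z\<close> lifts to a joint
    relation: its value in \<open>Z\<close> is expressed by the generators \<open>z\<close> and
    enters with the opposite sign.\<close>
  have "\<exists>v. v \<in> rels A (l + q) ?g \<and> (%j. v (l + j)) = w k" if "k < u" for k
  proof -
    have wk: "w k \<in> vecs A q" "lincomb q (w k) s \<in> Z" using wQ[OF that] step.prems(2) by auto
    then obtain a where a: "a \<in> vecs A l" "lincomb q (w k) s = lincomb l a z" using Z by auto
    let ?v = "%j. if j < l then - a j else w k (j - l)"
    have "?v \<in> vecs A (l + q)" using a wk by (auto simp: vecs_def)
    moreover have "lincomb (l + q) ?v ?g = (%_. 0)"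
    proof -
      have "lincomb l ?v z = lincomb l (%j. - a j) z" by (intro lincomb_cong) auto
      then show ?thesis using a by (simp add: lincomb_append lincomb_uminus)
    qed
    ultimately show ?thesis by (intro exI[of _ ?v]) (auto simp: rels_def)
  qed
  then obtain t where t: "!!k. k < u ==> t k \<in> rels A (l + q) ?g"
      "!!k. k < u ==> (%j. t k (l + j)) = w k" by metis
  have tsh: "(%j. lincomb u c t (l + j)) = lincomb u c w" for c
    using t(2) by (auto simp: lincomb_def fun_eq_iff intro!: sum.cong)
  have trel: "lincomb u c t \<in> rels A (l + q) ?g" if "c \<in> vecs A u" for c
  proof -
    have "lincomb u c t \<in> vecs A (l + q)"
      by (rule lincomb_vecs[OF that]) (use t(1) in \<open>auto simp: rels_def\<close>)
    moreover have "lincomb (l + q) (lincomb u c t) ?g = (%_. 0)"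
    proof -
      have "lincomb u c (%k. lincomb (l + q) (t k) ?g) = lincomb u c (%k _. 0)"
        by (intro lincomb_cong) (use t(1) in \<open>auto simp: rels_def\<close>)
      also have "\<dots> = (%_. 0)" by (simp add: lincomb_def)
      finally show ?thesis by (simp only: lincomb_lincomb)
    qed
    ultimately show ?thesis by (simp add: rels_def)
  qed
  have low: "v \<in> rels A l z" if "v \<in> rels A (l + q) ?g" "(%k. v (l + k)) = (%_. 0)" for v
  proof -
    have "v k = 0" if "k \<ge> l" for k using fun_cong[OF \<open>(%k. v (l + k)) = (%_. 0)\<close>, of "k - l"] that by simp
    then show ?thesis using that by (auto simp: rels_def vecs_def lincomb_append)
  qed
  have lowsub: "rels A l z \<subseteq> rels A (l + q) ?g"
    by (auto simp: rels_def vecs_def lincomb_append)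
  \<comment> \<open>The same situation one place further along the resolution: the relations of
    \<open>z\<close> play the role of \<open>Z\<close>, the lifts \<open>t\<close> that of
    \<open>s\<close>.\<close>
  have "ffr A (rels A (l + q) ?g)"
  proof (rule step.IH[OF rz])
    show "rels A u w = {c \<in> vecs A u. lincomb u c t \<in> rels A l z}"
    proof (intro Set.set_eqI iffI)
      fix c assume c: "c \<in> rels A u w"
      then have "lincomb u c t \<in> rels A l z"
        by (intro low trel) (auto simp: rels_def tsh)
      with c show "c \<in> {c \<in> vecs A u. lincomb u c t \<in> rels A l z}" by (auto simp: rels_def)
    next
      fix c assume c: "c \<in> {c \<in> vecs A u. lincomb u c t \<in> rels A l z}"
      then have "(%j. lincomb u c t (l + j)) = (%_. 0)" by (auto simp: rels_def vecs_def)
      with c show "c \<in> rels A u w" unfolding tsh by (auto simp: rels_def)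
    qed
    show "rels A (l + q) ?g = {(%i. y i + lincomb u c t i) | y c. y \<in> rels A l z \<and> c \<in> vecs A u}"
    proof (intro Set.set_eqI iffI)
      fix v assume v: "v \<in> rels A (l + q) ?g"
      have "(%k. v (l + k)) \<in> Q'" using rels_append[OF Z v] step.prems(2) by simp
      then obtain c where c: "c \<in> vecs A u" "(%k. v (l + k)) = lincomb u c w"
        using step.hyps(1) by auto
      let ?y = "%i. v i - lincomb u c t i"
      have "?y \<in> rels A l z"
      proof (rule low)
        show "?y \<in> rels A (l + q) ?g"
          using v trel[OF c(1)] by (auto simp: rels_def vecs_def lincomb_diff)
        show "(%k. ?y (l + k)) = (%_. 0)" using c(2) tsh[of c] by (metis diff_self)
      qed
      then show "v \<in> {(%i. y i + lincomb u c t i) | y c. y \<in> rels A l z \<and> c \<in> vecs A u}"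
        using c(1) by (intro CollectI exI[of _ ?y] exI[of _ c]) auto
    next
      fix v assume "v \<in> {(%i. y i + lincomb u c t i) | y c. y \<in> rels A l z \<and> c \<in> vecs A u}"
      then obtain y c where "y \<in> rels A (l + q) ?g" "c \<in> vecs A u" "v = (%i. y i + lincomb u c t i)"
        using lowsub by auto
      then show "v \<in> rels A (l + q) ?g"
        using trel[of c] by (auto simp: rels_def vecs_def lincomb_add)
    qed
  qed
  with Y show ?case by (metis ffr.step)
qed

text \<open>An abstract polynomial ring \<open>A = A'[x]\<close>, with \<open>cf a i\<close> the
  coefficient of \<open>x^i\<close>. Later \<open>x\<close> is the indeterminate with number
  \<open>j\<close> and \<open>A'\<close> consists of the polynomials in those with smaller
  numbers.\<close>

locale polynomial_extension = base: unital_subring A' + top: unital_subring A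
  for A' A :: "'b::comm_ring_1 set" +
  fixes x :: 'b and cf :: "'b => nat => 'b"
  assumes sub: "A' \<subseteq> A"
    and x_mem: "x \<in> A"
    and cf_in: "a \<in> A ==> cf a i \<in> A'"
    and cf_add: "cf (a + b) i = cf a i + cf b i"
    and cf_smult: "a \<in> A' ==> cf (a * b) i = a * cf b i"
    and cf_x: "cf (x * b) i = (case i of 0 => 0 | Suc j => cf b j)"
    and cf_const: "a \<in> A' ==> cf a i = (if i = 0 then a else 0)"
    and cf_fin: "\<exists>d. \<forall>i\<ge>d. cf a i = 0"
    and cf_sum: "a \<in> A ==> (!!i. i \<ge> d ==> cf a i = 0) ==> a = (\<Sum>i<d. x ^ i * cf a i)"
begin

lemma sub_mem: "a \<in> A' ==> a \<in> A"
  using sub by blast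

lemma cf_0 [simp]: "cf 0 i = 0"
  using cf_const[of 0 i] by simp

lemma cf_uminus: "cf (- a) i = - cf a i"
  using cf_smult[of "-1" a i] by simp

lemma cf_diff: "cf (a - b) i = cf a i - cf b i"
  using cf_add[of a "- b" i] by (simp add: cf_uminus)

lemma cf_lincomb:
  assumes "!!k. k < r ==> g k j \<in> A'"
  shows "cf (lincomb r c g j) i = lincomb r (%k. cf (c k) i) g j"
proof -
  have "cf (\<Sum>k<r. c k * g k j) i = (\<Sum>k<r. cf (c k) i * g k j)"
    using assms
  proof (induction r)
    case (Suc r)
    then show ?case using cf_smult[of "g r j" "c r" i] by (simp add: cf_add mult.commute)
  qed simp
  then show ?thesis by (simp add: lincomb_def)
qed

lemma cf_power: "cf (x ^ n * b) i = (if i < n then 0 else cf b (i - n))"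
proof (induction n arbitrary: i)
  case (Suc n)
  have "cf (x ^ Suc n * b) i = (case i of 0 => 0 | Suc j => cf (x ^ n * b) j)"
    using cf_x[of "x ^ n * b" i] by (simp add: mult.assoc)
  then show ?case using Suc by (cases i) auto
qed simp

lemma cf_poly:
  assumes "!!i. f i \<in> A'"
  shows "cf (\<Sum>i<d. x ^ i * f i) j = (if j < d then f j else 0)"
proof (induction d)
  case (Suc d)
  have "cf (x ^ d * f d) j = (if j = d then f d else 0)"
    using assms by (auto simp: cf_power cf_const)
  then show ?case using Suc by (auto simp: cf_add less_Suc_eq)
qed simp

lemma cf_fin_fun: "\<exists>d. \<forall>k<r::nat. \<forall>i\<ge>d. cf (c k) i = 0"
proof (induction r)
  case (Suc r)
  then obtain d where d: "\<forall>k<r. \<forall>i\<ge>d. cf (c k) i = 0" by blast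
  obtain e where "\<forall>i\<ge>e. cf (c r) i = 0" using cf_fin by blast
  with d show ?case by (intro exI[of _ "max d e"]) (auto simp: less_Suc_eq)
qed simp

lemma vecs_fin:
  assumes "c \<in> vecs A r"
  obtains d where "!!k i. i \<ge> d ==> cf (c k) i = 0"
proof -
  obtain d where "\<forall>k<r. \<forall>i\<ge>d. cf (c k) i = 0" using cf_fin_fun by blast
  moreover have "c k = 0" if "k \<ge> r" for k using assms that by (simp add: vecs_def)
  ultimately show ?thesis using that[of d] by (metis cf_0 not_less)
qed

lemma vecs_cf: "c \<in> vecs A r ==> (%k. cf (c k) i) \<in> vecs A' r"
  by (auto simp: vecs_def cf_in)

lemma vecs_poly: "(!!i. f i \<in> vecs A' r) ==> (%k. \<Sum>i<d. x ^ i * f i k) \<in> vecs A r"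
  using sub_mem by (auto simp: vecs_def x_mem intro!: top.sum_mem top.mult_mem)

lemma lincomb_poly:
  "lincomb r (%k. \<Sum>i<d. x ^ i * f i k) g = (%j. \<Sum>i<d. x ^ i * lincomb r (f i) g j)"
proof
  fix j
  have "lincomb r (%k. \<Sum>i<d. x ^ i * f i k) g j = (\<Sum>k<r. \<Sum>i<d. x ^ i * (f i k * g k j))"
    by (simp add: lincomb_def sum_distrib_right mult.assoc)
  also have "\<dots> = (\<Sum>i<d. \<Sum>k<r. x ^ i * (f i k * g k j))" by (rule sum.swap)
  finally show "lincomb r (%k. \<Sum>i<d. x ^ i * f i k) g j = (\<Sum>i<d. x ^ i * lincomb r (f i) g j)"
    by (simp add: lincomb_def sum_distrib_left)
qed

lemma vecs_expand:
  assumes "c \<in> vecs A r" "!!k i. i \<ge> d ==> cf (c k) i = 0"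
  shows "c = (%k. \<Sum>i<d. x ^ i * cf (c k) i)"
proof
  fix k
  have "c k \<in> A" using assms(1) by (simp add: vecs_def)
  then show "c k = (\<Sum>i<d. x ^ i * cf (c k) i)" by (rule cf_sum) (use assms(2) in auto)
qed

text \<open>The module \<open>A \<otimes> N\<close>, realised as the vectors all of whose
  coefficient vectors lie in \<open>N\<close>.\<close>

definition extend :: "(nat => 'b) set => (nat => 'b) set" where
  "extend N = {c. (\<forall>k. c k \<in> A) \<and> (\<forall>i. (%k. cf (c k) i) \<in> N)}"

text \<open>\<open>A\<close> is free over \<open>A'\<close> on the powers of \<open>x\<close>, and
  \<open>g\<close> has entries in \<open>A'\<close>; so a relation over \<open>A\<close> means one
  relation over \<open>A'\<close> for each power.\<close>

lemma rels_extend: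
  assumes "!!k j. k < r ==> g k j \<in> A'"
  shows "rels A r g = extend (rels A' r g)"
proof (intro Set.set_eqI iffI)
  fix c assume c: "c \<in> rels A r g"
  then have cv: "c \<in> vecs A r" and c0: "lincomb r c g = (%_. 0)" by (auto simp: rels_def)
  have "lincomb r (%k. cf (c k) i) g = (%_. 0)" for i
    using cf_lincomb[of r g _ c i] assms c0 by (auto simp: fun_eq_iff)
  then show "c \<in> extend (rels A' r g)"
    using vecs_cf[OF cv] cv by (auto simp: extend_def rels_def vecs_def)
next
  fix c assume c: "c \<in> extend (rels A' r g)"
  have cA: "c k \<in> A" for k using c by (auto simp: extend_def)
  have ci: "(%k. cf (c k) i) \<in> vecs A' r" "lincomb r (%k. cf (c k) i) g = (%_. 0)" for i
    using c by (auto simp: extend_def rels_def)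
  have "c k = 0" if "k \<ge> r" for k
    using cf_sum[of "c k" 0] ci(1) that cA by (simp add: vecs_def)
  then have cv: "c \<in> vecs A r" using cA by (auto simp: vecs_def)
  obtain d where "!!k i. i \<ge> d ==> cf (c k) i = 0" using vecs_fin[OF cv] by blast
  then have "lincomb r c g = lincomb r (%k. \<Sum>i<d. x ^ i * cf (c k) i) g"
    using vecs_expand[OF cv] by metis
  also have "\<dots> = (%_. 0)" by (simp add: lincomb_poly ci(2))
  finally show "c \<in> rels A r g" using cv by (simp add: rels_def)
qed

text \<open>Combinations found for each coefficient are collected into polynomials. The common bound
  \<open>n\<close> on the support of the generators leaves finitely many nonzero entries in a
  vector, and thereby a common degree bound.\<close>

lemma extend_span:
  "extend ((%c. lincomb r c g) ` vecs A' r) = (%c. lincomb r c g) ` vecs A r"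
  if g: "!!k j. k < r ==> g k j \<in> A'" and gn: "!!k j. k < r ==> j \<ge> n ==> g k j = 0"
proof (intro Set.set_eqI iffI)
  fix v assume v: "v \<in> extend ((%c. lincomb r c g) ` vecs A' r)"
  then have "\<forall>i. \<exists>c. c \<in> vecs A' r \<and> (%k. cf (v k) i) = lincomb r c g" by (auto simp: extend_def)
  then obtain c where c: "!!i. c i \<in> vecs A' r" "!!i. (%k. cf (v k) i) = lincomb r (c i) g" by metis
  have "v k = 0" if "k \<ge> n" for k
  proof -
    have "cf (v k) i = 0" for i
      using fun_cong[OF c(2)[of i], of k] gn that by (simp add: lincomb_def)
    then show ?thesis using cf_sum[of "v k" 0] v by (simp add: extend_def)
  qed
  then have vv: "v \<in> vecs A n" using v by (auto simp: extend_def vecs_def)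
  obtain d where d: "!!k i. i \<ge> d ==> cf (v k) i = 0" using vecs_fin[OF vv] by blast
  have "v = (%k. \<Sum>i<d. x ^ i * cf (v k) i)" by (rule vecs_expand[OF vv d])
  also have "\<dots> = lincomb r (%k. \<Sum>i<d. x ^ i * c i k) g"
    proof -
    have "cf (v k) i = lincomb r (c i) g k" for i k using fun_cong[OF c(2)] .
    then show ?thesis unfolding lincomb_poly by simp
  qed
  finally show "v \<in> (%c. lincomb r c g) ` vecs A r"
    using vecs_poly[of c r d] c(1) by blast
next
  fix v assume "v \<in> (%c. lincomb r c g) ` vecs A r"
  then obtain c where c: "c \<in> vecs A r" "v = lincomb r c g" by blast
  have "v k \<in> A" for k
    unfolding c(2) lincomb_def using c(1) g sub_mem by (intro top.sum_mem top.mult_mem) (auto simp: vecs_def)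
  moreover have "(%k. cf (v k) i) = lincomb r (%k. cf (c k) i) g" for i
    using cf_lincomb[of r g _ c i] g c(2) by auto
  ultimately show "v \<in> extend ((%c. lincomb r c g) ` vecs A' r)"
    using vecs_cf[OF c(1)] by (auto simp: extend_def)
qed

lemma mem_span:
  assumes "k < r"
  shows "g k \<in> (%c. lincomb r c g) ` vecs A' r"
proof (rule image_eqI)
  show "(%i. if i = k then 1 else 0) \<in> vecs A' r" using assms by (auto simp: vecs_def)
  show "g k = lincomb r (%i. if i = k then 1 else 0) g"
    using assms by (simp add: lincomb_def if_distrib[where f = "%x. x * _"] cong: if_cong)
qed

text \<open>Flat base change: the same generators serve over \<open>A\<close>, and their relations
  are extended likewise.\<close>

lemma ffr_extend:
  assumes "ffr A' N" "N \<subseteq> vecs A' n"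
  shows "ffr A (extend N)"
  using assms
proof (induction arbitrary: n rule: ffr.induct)
  case zero
  have "c = (%_. 0)" if "c \<in> extend {%_. 0}" for c
  proof
    fix k
    have "(%k. cf (c k) i) = (%_. 0)" for i using that by (simp add: extend_def)
    then have "cf (c k) i = 0" for i by (rule fun_cong)
    then show "c k = 0" using cf_sum[of "c k" 0] that by (simp add: extend_def)
  qed
  moreover have "(%_. 0) \<in> extend {%_. 0}" by (simp add: extend_def)
  ultimately have "extend {%_. 0} = {%_. 0}" by blast
  then show ?case by (simp add: ffr.zero)
next
  case (step N r g)
  have g: "g k \<in> vecs A' n" if "k < r" for k
    using mem_span[OF that, of g] step.hyps(1) step.prems by blast
  have "ffr A (extend (rels A' r g))" by (rule step.IH[of r]) (auto simp: rels_def)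
  then have "ffr A (rels A r g)" using g by (subst rels_extend) (auto simp: vecs_def)
  moreover have "extend N = (%c. lincomb r c g) ` vecs A r"
    unfolding step.hyps(1) using g by (intro extend_span[of r g n]) (auto simp: vecs_def)
  ultimately show ?case by (metis ffr.step)
qed

text \<open>The resolution comes from the exact sequence
  \<open>0 \<rightarrow> A \<otimes> N0 \<rightarrow> A \<otimes> N1 \<rightarrow> N \<rightarrow> 0\<close> over \<open>A = A'[x]\<close>, in which \<open>1 \<otimes> v\<close> is sent to
  \<open>1 \<otimes> x v - x \<otimes> v\<close>; exactness in the middle is the last assumption.\<close>

lemma ffr_step:
  assumes N1: "ffr A' N1" and N0: "ffr A' N0"
    and N01: "N0 \<subseteq> N1" and xN0: "!!v. v \<in> N0 ==> (%i. x * v i) \<in> N1"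
    and gen: "!!v. v \<in> N ==> \<exists>d G. (\<forall>i. G i \<in> N1) \<and> v = (%k. \<Sum>i<d. x ^ i * G i k)"
    and sub_N: "!!d G. (!!i. G i \<in> N1) ==> (%k. \<Sum>i<d. x ^ i * G i k) \<in> N"
    and mid: "!!d G. (!!i. G i \<in> N1) ==> (!!i. i \<ge> d ==> G i = (%_. 0)) ==>
      (%k. \<Sum>i<d. x ^ i * G i k) = (%_. 0) ==>
      \<exists>H. (\<forall>i. H i \<in> N0) \<and> (\<forall>i\<ge>d. H i = (%_. 0)) \<and>
        (\<forall>i. G i = (%k. x * H i k - (case i of 0 => 0 | Suc j => H j k)))"
  shows "ffr A N"
proof -
  obtain r g where g: "N1 = (%c. lincomb r c g) ` vecs A' r" and rg: "ffr A' (rels A' r g)"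
    using base.ffr_generators[OF N1] .
  obtain s h where h: "N0 = (%c. lincomb s c h) ` vecs A' s" and rh: "ffr A' (rels A' s h)"
    using base.ffr_generators[OF N0] .
  have hN: "h k \<in> N0" if "k < s" for k using mem_span[OF that] h by blast
  have "\<exists>\<alpha> \<beta>. \<alpha> \<in> vecs A' r \<and> \<beta> \<in> vecs A' r \<and> (%i. x * h k i) = lincomb r \<alpha> g \<and> h k = lincomb r \<beta> g"
    if "k < s" for k using xN0[OF hN[OF that]] hN[OF that] N01 g by blast
  then obtain \<alpha> \<beta> where ab: "!!k. k < s ==> \<alpha> k \<in> vecs A' r" "!!k. k < s ==> \<beta> k \<in> vecs A' r"
    "!!k. k < s ==> (%i. x * h k i) = lincomb r (\<alpha> k) g" "!!k. k < s ==> h k = lincomb r (\<beta> k) g" by metis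
  \<comment> \<open>With \<open>x h_k\<close> and \<open>h_k\<close> expressed by the generators
    \<open>g\<close> through \<open>\<alpha> k\<close> and \<open>\<beta> k\<close>, the vector
    \<open>t k\<close> represents \<open>1 \<otimes> x h_k - x \<otimes> h_k\<close>.\<close>
  define t where "t = (%k i. \<alpha> k i - x * \<beta> k i)"
  define Z where "Z = extend (rels A' r g)"
  define Q where "Q = extend (rels A' s h)"
  have Zf: "ffr A Z" unfolding Z_def by (rule ffr_extend[OF rg, of r]) (auto simp: rels_def)
  have Qf: "ffr A Q" unfolding Q_def by (rule ffr_extend[OF rh, of s]) (auto simp: rels_def)
  have tv: "t k \<in> vecs A r" if "k < s" for k
    using ab(1,2)[OF that] sub_mem x_mem by (auto simp: t_def vecs_def)
  have Zv: "c \<in> vecs A r" if "c \<in> Z" for c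
  proof -
    have cA: "c k \<in> A" for k using that by (auto simp: Z_def extend_def)
    have "(%k. cf (c k) i) \<in> vecs A' r" for i using that by (auto simp: Z_def extend_def rels_def)
    then have "c k = 0" if "k \<ge> r" for k
      using cf_sum[of "c k" 0] that cA by (simp add: vecs_def)
    with cA show ?thesis by (simp add: vecs_def)
  qed
  have ZI: "c \<in> Z \<longleftrightarrow> c \<in> vecs A r \<and> (\<forall>i. lincomb r (%k. cf (c k) i) g = (%_. 0))" for c
    using Zv[of c] vecs_cf[of c r] by (auto simp: Z_def extend_def rels_def) (auto simp: vecs_def)
  have Qv: "c \<in> vecs A s" if "c \<in> Q" for c
  proof -
    have cA: "c k \<in> A" for k using that by (auto simp: Q_def extend_def)
    have "(%k. cf (c k) i) \<in> vecs A' s" for i using that by (auto simp: Q_def extend_def rels_def)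
    then have "c k = 0" if "k \<ge> s" for k
      using cf_sum[of "c k" 0] that cA by (simp add: vecs_def)
    with cA show ?thesis by (simp add: vecs_def)
  qed
  have QI: "c \<in> Q \<longleftrightarrow> c \<in> vecs A s \<and> (\<forall>i. lincomb s (%k. cf (c k) i) h = (%_. 0))" for c
    using Qv[of c] vecs_cf[of c s] by (auto simp: Q_def extend_def rels_def) (auto simp: vecs_def)
  \<comment> \<open>Write \<open>H_i\<close> for the combination of the \<open>h k\<close> with the
    coefficients of \<open>x^i\<close> in \<open>c\<close>. Coefficient \<open>i\<close> of the
    image of the combined \<open>t k\<close> is then \<open>x H_i - H_(i-1)\<close>.\<close>
  have cft: "lincomb r (%k. cf (lincomb s c t k) i) g
      = (%l. x * lincomb s (%k. cf (c k) i) h l -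
             (case i of 0 => 0 | Suc j => lincomb s (%k. cf (c k) j) h l))" for c i
  proof -
    have 1: "cf (lincomb s c t k) i = lincomb s (%k. cf (c k) i) \<alpha> k -
        (case i of 0 => 0 | Suc j => lincomb s (%k. cf (c k) j) \<beta> k)" for k
    proof -
      have "lincomb s c t k = lincomb s c \<alpha> k - x * lincomb s c \<beta> k"
        by (simp add: lincomb_def t_def right_diff_distrib sum_subtractf sum_distrib_left mult.left_commute)
      moreover have "cf (lincomb s c \<alpha> k) i = lincomb s (%k. cf (c k) i) \<alpha> k"
        using ab(1) by (intro cf_lincomb) (auto simp: vecs_def)
      moreover have "cf (lincomb s c \<beta> k) j = lincomb s (%k. cf (c k) j) \<beta> k" for j
        using ab(2) by (intro cf_lincomb) (auto simp: vecs_def)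
      ultimately show ?thesis by (simp add: cf_diff cf_x split: nat.split)
    qed
    have 2: "lincomb r (lincomb s (%k. cf (c k) i) \<alpha>) g = (%l. x * lincomb s (%k. cf (c k) i) h l)" for i
    proof -
      have "lincomb r (lincomb s (%k. cf (c k) i) \<alpha>) g = lincomb s (%k. cf (c k) i) (%k i. x * h k i)"
        unfolding lincomb_lincomb by (intro lincomb_cong) (simp_all add: ab(3))
      then show ?thesis by (simp add: lincomb_def sum_distrib_left mult.left_commute)
    qed
    have 3: "lincomb r (lincomb s (%k. cf (c k) i) \<beta>) g = lincomb s (%k. cf (c k) i) h" for i
      unfolding lincomb_lincomb by (intro lincomb_cong) (simp_all add: ab(4)[symmetric])
    show ?thesis
    proof (cases i)
      case 0
      then show ?thesis using 1 2[of 0] by simp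
    next
      case (Suc j)
      then show ?thesis using 1 2[of i] 3[of j] by (simp add: lincomb_diff)
    qed
  qed
  have "ffr A (rels A r g)"
  proof (rule top.ffr_extension[OF Qf Zf])
    show "Q = {c \<in> vecs A s. lincomb s c t \<in> Z}"
    proof (intro Set.set_eqI iffI)
      fix c assume "c \<in> Q"
      then have cv: "c \<in> vecs A s" and c0: "!!i. lincomb s (%k. cf (c k) i) h = (%_. 0)" by (auto simp: QI)
      have "lincomb r (%k. cf (lincomb s c t k) i) g = (%_. 0)" for i
        unfolding cft by (cases i) (simp_all add: c0)
      then have "lincomb s c t \<in> Z" using cv tv by (auto simp: ZI intro!: top.lincomb_vecs)
      with cv show "c \<in> {c \<in> vecs A s. lincomb s c t \<in> Z}" by simp
    next
      fix c assume "c \<in> {c \<in> vecs A s. lincomb s c t \<in> Z}"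
      then have cv: "c \<in> vecs A s"
        and c0: "!!i l. x * lincomb s (%k. cf (c k) i) h l =
             (case i of 0 => 0 | Suc j => lincomb s (%k. cf (c k) j) h l)"
        unfolding ZI cft by (auto simp: fun_eq_iff)
      obtain d where d: "!!k i. i \<ge> d ==> cf (c k) i = 0" using vecs_fin[OF cv] by blast
      \<comment> \<open>Injectivity of the left map: \<open>H_(i-1) = x H_i\<close> for all
        \<open>i\<close>, so descending induction from the degree bound makes every
        \<open>H_i\<close> zero.\<close>
      have "lincomb s (%k. cf (c k) (d - i)) h = (%_. 0)" for i
      proof (induction i)
        case 0
        then show ?case by (simp add: d)
      next
        case (Suc i)
        show ?case
        proof (cases "i < d")
          case True
          then have "d - i = Suc (d - Suc i)" by simp
          then show ?thesis using Suc c0[of "d - i"] by (auto simp: fun_eq_iff)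
        next
          case False
          with Suc show ?thesis by simp
        qed
      qed
      then have "lincomb s (%k. cf (c k) i) h = (%_. 0)" for i
        by (cases "i \<le> d") (metis diff_diff_cancel, simp add: d)
      with cv show "c \<in> Q" by (simp add: QI)
    qed
    show "rels A r g = {(%i. y i + lincomb s c t i) | y c. y \<in> Z \<and> c \<in> vecs A s}"
    proof (intro Set.set_eqI iffI)
      fix c assume c: "c \<in> rels A r g"
      then have cv: "c \<in> vecs A r" and c0: "lincomb r c g = (%_. 0)" by (auto simp: rels_def)
      obtain d where d: "!!k i. i \<ge> d ==> cf (c k) i = 0" using vecs_fin[OF cv] by blast
      \<comment> \<open>The coefficient vectors of the relation, evaluated in \<open>N1\<close>;
        \<open>mid\<close> shows that they come from \<open>N0\<close>.\<close>
      define G where "G = (%i. lincomb r (%k. cf (c k) i) g)"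
      have "\<exists>H. (\<forall>i. H i \<in> N0) \<and> (\<forall>i\<ge>d. H i = (%_. 0)) \<and>
        (\<forall>i. G i = (%k. x * H i k - (case i of 0 => 0 | Suc j => H j k)))"
      proof (rule mid)
        show "G i \<in> N1" for i unfolding g G_def using vecs_cf[OF cv] by blast
        show "G i = (%_. 0)" if "i \<ge> d" for i using d[OF that] by (simp add: G_def)
        show "(%k. \<Sum>i<d. x ^ i * G i k) = (%_. 0)"
          unfolding G_def lincomb_poly[symmetric]
          using arg_cong[where f = "%w. lincomb r w g", OF vecs_expand[OF cv d]] c0 by simp
      qed
      then obtain H where H: "!!i. H i \<in> N0" "!!i. i \<ge> d ==> H i = (%_. 0)"
        "!!i. G i = (%k. x * H i k - (case i of 0 => 0 | Suc j => H j k))" by metis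
      have "\<exists>\<eta>. \<eta> \<in> vecs A' s \<and> H i = lincomb s \<eta> h \<and> (i \<ge> d \<longrightarrow> \<eta> = (%_. 0))" for i
      proof (cases "i \<ge> d")
        case True
        then show ?thesis using H(2)[of i] by (intro exI[of _ "%_. 0"]) simp
      next
        case False
        then show ?thesis using H(1)[of i] h by auto
      qed
      then obtain \<eta> where e: "!!i. \<eta> i \<in> vecs A' s" "!!i. H i = lincomb s (\<eta> i) h"
        "!!i. i \<ge> d ==> \<eta> i = (%_. 0)" by metis
      define \<theta> where "\<theta> = (%k. \<Sum>i<d. x ^ i * \<eta> i k)"
      have cf\<theta>: "(%k. cf (\<theta> k) i) = \<eta> i" for i
      proof
        fix k
        have "!!i. \<eta> i k \<in> A'" using e(1) by (simp add: vecs_def)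
        then show "cf (\<theta> k) i = \<eta> i k"
          unfolding \<theta>_def using e(3)[of i] by (subst cf_poly) auto
      qed
      have \<theta>v: "\<theta> \<in> vecs A s" unfolding \<theta>_def by (rule vecs_poly[OF e(1)])
      let ?y = "%i. c i - lincomb s \<theta> t i"
      have "lincomb r (%k. cf (?y k) i) g = (%_. 0)" for i
      proof -
        have "lincomb r (%k. cf (?y k) i) g = (%l. G i l - lincomb r (%k. cf (lincomb s \<theta> t k) i) g l)"
          by (simp add: cf_diff lincomb_diff G_def)
        also have "\<dots> = (%_. 0)"
          unfolding cft cf\<theta> e(2)[symmetric] H(3)[of i] by simp
        finally show ?thesis .
      qed
      moreover have "?y \<in> vecs A r"
        using cv top.lincomb_vecs[OF \<theta>v, of t r] tv by (auto simp: vecs_def)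
      ultimately have "?y \<in> Z" by (simp add: ZI)
      then show "c \<in> {(%i. y i + lincomb s c t i) | y c. y \<in> Z \<and> c \<in> vecs A s}"
        using \<theta>v by (intro CollectI exI[of _ ?y] exI[of _ \<theta>]) auto
    next
      fix c assume "c \<in> {(%i. y i + lincomb s c t i) | y c. y \<in> Z \<and> c \<in> vecs A s}"
      then obtain y \<theta> where y: "y \<in> Z" and \<theta>: "\<theta> \<in> vecs A s" and c: "c = (%i. y i + lincomb s \<theta> t i)" by blast
      have yv: "y \<in> vecs A r" using y ZI by blast
      have Lv: "lincomb s \<theta> t \<in> vecs A r" using top.lincomb_vecs[OF \<theta>, of t r] tv by blast
      obtain d where d: "!!k i. i \<ge> d ==> cf (y k) i = 0" using vecs_fin[OF yv] by blast
      have "lincomb r y g = lincomb r (%k. \<Sum>i<d. x ^ i * cf (y k) i) g"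
        by (rule arg_cong[where f = "%w. lincomb r w g", OF vecs_expand[OF yv d]])
      also have "\<dots> = (%_. 0)" using y by (simp add: lincomb_poly ZI)
      finally have 1: "lincomb r y g = (%_. 0)" .
      have "lincomb r (lincomb s \<theta> t) g = lincomb s \<theta> (%k _. 0)"
        unfolding lincomb_lincomb
      proof (intro lincomb_cong)
        fix k assume "k < s"
        have "lincomb r (t k) g = (%l. lincomb r (\<alpha> k) g l - x * lincomb r (\<beta> k) g l)"
          unfolding t_def by (simp add: lincomb_diff lincomb_smult)
        then show "lincomb r (t k) g = (%_. 0)"
          using ab(3,4)[OF \<open>k < s\<close>] by (metis diff_self)
      qed simp
      then have 2: "lincomb r (lincomb s \<theta> t) g = (%_. 0)" by (simp add: lincomb_def)
      have "lincomb r c g = (%_. 0)" unfolding c lincomb_add 1 2 by simp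
      moreover have "c \<in> vecs A r" unfolding c using yv Lv by (auto simp: vecs_def)
      ultimately show "c \<in> rels A r g" by (simp add: rels_def)
    qed
  qed
  moreover have "N = (%c. lincomb r c g) ` vecs A r"
  proof (intro Set.set_eqI iffI)
    fix v assume "v \<in> N"
    then obtain d G where G: "!!i. G i \<in> N1" "v = (%k. \<Sum>i<d. x ^ i * G i k)" using gen by metis
    then obtain f where f: "!!i. f i \<in> vecs A' r" "!!i. G i = lincomb r (f i) g"
      unfolding g image_iff by metis
    have "v = lincomb r (%k. \<Sum>i<d. x ^ i * f i k) g" unfolding lincomb_poly G(2) f(2) ..
    then show "v \<in> (%c. lincomb r c g) ` vecs A r" using vecs_poly[of f r d] f(1) by blast
  next
    fix v assume "v \<in> (%c. lincomb r c g) ` vecs A r"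
    then obtain c where c: "c \<in> vecs A r" "v = lincomb r c g" by blast
    obtain d where d: "!!k i. i \<ge> d ==> cf (c k) i = 0" using vecs_fin[OF c(1)] by blast
    have "v = lincomb r (%k. \<Sum>i<d. x ^ i * cf (c k) i) g"
      unfolding c(2) by (rule arg_cong[where f = "%w. lincomb r w g", OF vecs_expand[OF c(1) d]])
    also have "\<dots> = (%k. \<Sum>i<d. x ^ i * lincomb r (%k. cf (c k) i) g k)" by (rule lincomb_poly)
    also have "\<dots> \<in> N" by (rule sub_N) (use g vecs_cf[OF c(1)] in blast)
    finally show "v \<in> N" .
  qed
  ultimately show ?thesis by (metis ffr.step)
qed

end

section \<open>Saturated modules over a valuation domain\<close>

text \<open>Total divisibility makes the nonunits an ideal; the maximal ideal appears below only as
  the set of nonunits.\<close>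

class valuation_domain = idom +
  assumes dvd_total: "a dvd b \<or> b dvd a"
begin

lemma nonunit_add: "\<not> a dvd 1 ==> \<not> b dvd 1 ==> \<not> (a + b) dvd 1"
  using dvd_total[of a b] by (metis dvd_add dvd_trans dvd_refl)

lemma nonunit_diff: "\<not> a dvd 1 ==> \<not> b dvd 1 ==> \<not> (a - b) dvd 1"
  using nonunit_add[of a "- b"] by simp

lemma unit_diff: "a dvd 1 ==> \<not> b dvd 1 ==> (a - b) dvd 1"
  using nonunit_add[of "a - b" b] by auto

lemma nonunit_mult: "\<not> a dvd 1 ==> \<not> (a * b) dvd 1"
  by (metis dvd_triv_left dvd_trans)

text \<open>Divisibility is a total preorder, so a nonempty finite set has a least element.\<close>

lemma dvd_least:
  assumes "finite B" "B \<noteq> {}"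
  shows "\<exists>b\<in>B. \<forall>a\<in>B. b dvd a"
  using assms
proof (induction rule: finite_ne_induct)
  case (insert x F)
  then obtain b where b: "b \<in> F" "\<forall>a\<in>F. b dvd a" by blast
  show ?case
  proof (cases "x dvd b")
    case True
    then have "x dvd a" if "a \<in> insert x F" for a using b(2) dvd_trans[OF True, of a] that by auto
    then show ?thesis by blast
  next
    case False
    then have "b dvd x" using dvd_total by blast
    with b show ?thesis by blast
  qed
qed simp

end

section \<open>Echelon forms modulo the maximal ideal\<close>

definition linear_space :: "('i => 'v::comm_ring_1) set => bool" where
  "linear_space W \<longleftrightarrow> (%_. 0) \<in> W \<and> (\<forall>v\<in>W. \<forall>w\<in>W. (%i. v i + w i) \<in> W) \<and>
     (\<forall>c. \<forall>v\<in>W. (%i. c * v i) \<in> W)"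

lemma linear_spaceD:
  assumes "linear_space W"
  shows "(%_. 0) \<in> W" "v \<in> W ==> w \<in> W ==> (%i. v i + w i) \<in> W"
    "v \<in> W ==> (%i. c * v i) \<in> W"
    "v \<in> W ==> w \<in> W ==> (%i. v i - w i) \<in> W"
    "(!!b. b \<in> L ==> f b \<in> W) ==> (%i. \<Sum>b\<in>L. f b i) \<in> W"
proof -
  show 1: "(%_. 0) \<in> W" and 2: "!!v w. v \<in> W ==> w \<in> W ==> (%i. v i + w i) \<in> W"
    and 3: "!!v c. v \<in> W ==> (%i. c * v i) \<in> W"
    using assms by (auto simp: linear_space_def)
  show "v \<in> W ==> w \<in> W ==> (%i. v i - w i) \<in> W"
    using 2[of v "%i. -1 * w i"] 3[of w "-1"] by simp
  show "(!!b. b \<in> L ==> f b \<in> W) ==> (%i. \<Sum>b\<in>L. f b i) \<in> W"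
    by (induction L rule: infinite_finite_induct) (auto intro: 1 2)
qed

text \<open>Modulo the maximal ideal the matrix \<open>g b b'\<close> is triangular with unit
  diagonal, hence invertible over the ring. The elimination removes the index of largest rank.
  Membership of \<open>h\<close> is asserted for every space containing the \<open>g b\<close>,
  because one and the same \<open>h\<close> must lie in several spaces.\<close>

lemma unitriangular_reduce:
  fixes g :: "'i => 'i => 'v::valuation_domain" and rk :: "'i => 'o::linorder"
  assumes "finite L"
    and "!!b. b \<in> L ==> g b b dvd 1"
    and "!!b b'. b \<in> L ==> b' \<in> L ==> rk b < rk b' ==> \<not> g b b' dvd 1"
    and "inj_on rk L"
  shows "\<exists>h. (\<forall>b\<in>L. \<forall>b'\<in>L. h b b' = (if b = b' then 1 else 0)) \<and>
    (\<forall>W. linear_space W \<longrightarrow> (\<forall>b\<in>L. g b \<in> W) \<longrightarrow> (\<forall>b\<in>L. h b \<in> W))"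
  using assms
proof (induction L arbitrary: g rule: finite_ranking_induct[where f = rk])
  case empty
  then show ?case by simp
next
  case (insert x S)
  show ?case
  proof (cases "x \<in> S")
    case True
    then have "insert x S = S" by blast
    then show ?thesis using insert.IH[of g] insert.prems by simp
  next
    case False
    have lt: "rk b < rk x" if "b \<in> S" for b
      using insert.hyps(2)[OF that] insert.prems(3) that False by (metis inj_on_def insert_iff less_le)
    obtain u where u: "g x x * u = 1" using insert.prems(1)[of x] by (metis dvdE insertI1)
    \<comment> \<open>Clears coordinate \<open>x\<close> from the other rows. The correction is a
      multiple of the nonunit \<open>g b x\<close>, so it disturbs neither the units on the diagonal
      nor the nonunits beyond it.\<close>
    define g' where "g' = (%b i. g b i - g b x * u * g x i)"
    have nu: "\<not> g b x * u * c dvd 1" if "b \<in> S" for b c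
      using insert.prems(2)[of b x] lt[OF that] that nonunit_mult by (metis insertI1 insertI2)
    have "\<exists>h. (\<forall>b\<in>S. \<forall>b'\<in>S. h b b' = (if b = b' then 1 else 0)) \<and>
      (\<forall>W. linear_space W \<longrightarrow> (\<forall>b\<in>S. g' b \<in> W) \<longrightarrow> (\<forall>b\<in>S. h b \<in> W))"
    proof (rule insert.IH)
      show "g' b b dvd 1" if "b \<in> S" for b
        unfolding g'_def using insert.prems(1)[of b] nu[OF that] that by (intro unit_diff) auto
      show "\<not> g' b b' dvd 1" if "b \<in> S" "b' \<in> S" "rk b < rk b'" for b b'
        unfolding g'_def using insert.prems(2)[of b b'] nu[of b] that by (intro nonunit_diff) auto
      show "inj_on rk S" using insert.prems(3) by (simp add: inj_on_insert)
    qed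
    then obtain h where h0: "\<forall>b\<in>S. \<forall>b'\<in>S. h b b' = (if b = b' then 1 else 0)"
      and hW0: "\<forall>W. linear_space W \<longrightarrow> (\<forall>b\<in>S. g' b \<in> W) \<longrightarrow> (\<forall>b\<in>S. h b \<in> W)" by blast
    have h: "h b b' = (if b = b' then 1 else 0)" if "b \<in> S" "b' \<in> S" for b b'
      using h0 that by blast
    have hW: "h b \<in> W" if "linear_space W" "!!b. b \<in> S ==> g' b \<in> W" "b \<in> S" for W b
      using hW0 that by blast
    have hx: "h b x = 0" if "b \<in> S" for b
    proof -
      \<comment> \<open>Vanishing at \<open>x\<close> defines a linear space that contains all
        \<open>g' b\<close>, hence also \<open>h b\<close>.\<close>
      have "h b \<in> {w. w x = 0}"
      proof (rule hW[OF _ _ that])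
        show "linear_space {w. w x = (0::'v)}" by (simp add: linear_space_def)
        show "g' b \<in> {w. w x = 0}" for b
          using u by (simp add: g'_def mult.assoc mult.commute[of u])
      qed
      then show ?thesis by simp
    qed
    define hh where "hh = (%b. if b = x then (%i. u * g x i - (\<Sum>c\<in>S. (u * g x c) * h c i)) else h b)"
    show ?thesis
    proof (intro exI[of _ hh] conjI ballI allI impI)
      fix b b' assume bb: "b \<in> insert x S" "b' \<in> insert x S"
      consider "b = x" "b' = x" | "b = x" "b' \<in> S" "b' \<noteq> x" | "b \<in> S" "b \<noteq> x" "b' = x" | "b \<in> S" "b' \<in> S" "b \<noteq> x"
        using bb False by blast
      then show "hh b b' = (if b = b' then 1 else 0)"
      proof cases
        case 1
        then show ?thesis using u hx by (simp add: hh_def mult.commute)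
      next
        case 2
        have "(\<Sum>c\<in>S. (u * g x c) * h c b') = (\<Sum>c\<in>S. if c = b' then u * g x c else 0)"
          using h 2 by (intro sum.cong) auto
        then show ?thesis using 2 insert.hyps(1) by (simp add: hh_def)
      next
        case 3
        then show ?thesis using hx by (simp add: hh_def)
      next
        case 4
        then show ?thesis using h by (simp add: hh_def)
      qed
    next
      fix W b assume W: "linear_space W" "\<forall>b\<in>insert x S. g b \<in> W" and b: "b \<in> insert x S"
      have g'W: "g' b \<in> W" if "b \<in> S" for b
        unfolding g'_def using W that by (intro linear_spaceD(3,4)[OF W(1)]) auto
      have hS: "h b \<in> W" if "b \<in> S" for b using hW[OF W(1) g'W that] .
      show "hh b \<in> W"
      proof (cases "b = x")
        case True
        then show ?thesis unfolding hh_def using W hS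
          by (simp, intro linear_spaceD(4)[OF W(1)] linear_spaceD(3,5)[OF W(1)]) auto
      next
        case False
        then show ?thesis using b hS by (simp add: hh_def)
      qed
    qed
  qed
qed

text \<open>Positions of leading units: the largest index, in the order given by \<open>rk\<close>,
  at which a vector of \<open>W\<close> has a unit. They are the leading positions of
  \<open>W\<close> reduced modulo the maximal ideal.\<close>

definition pivots :: "('i => 'o::linorder) => ('i => 'v::comm_ring_1) set => 'i set" where
  "pivots rk W = {b. \<exists>w\<in>W. w b dvd 1 \<and> (\<forall>b'. rk b < rk b' \<longrightarrow> \<not> w b' dvd 1)}"

text \<open>Removing from a vector its part along the basis \<open>h\<close> leaves some
  \<open>v\<close> that vanishes at all pivots. If \<open>v\<close> were nonzero, division by a
  coordinate dividing all others would give a vector of \<open>W\<close>, by saturation, with a unit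
  coordinate. The leading one is a pivot, where the vector vanishes. So vectors of \<open>W\<close>
  are determined by their pivot coordinates, which splits \<open>W\<close> off.\<close>

lemma saturated_basis:
  fixes W :: "('i => 'v::valuation_domain) set" and rk :: "'i => 'o::linorder"
  assumes fin: "finite B" and inj: "inj_on rk B" and W: "linear_space W"
    and supp: "!!w i. w \<in> W ==> i \<notin> B ==> w i = 0"
    and sat: "!!c w. c \<noteq> 0 ==> (%i. c * w i) \<in> W ==> w \<in> W"
    and g: "!!b. b \<in> pivots rk W ==> g b \<in> W"
    and gu: "!!b. b \<in> pivots rk W ==> g b b dvd 1"
    and gn: "!!b b'. b \<in> pivots rk W ==> rk b < rk b' ==> \<not> g b b' dvd 1"
  shows "\<exists>h. finite (pivots rk W) \<and>
    (\<forall>b\<in>pivots rk W. \<forall>b'\<in>pivots rk W. h b b' = (if b = b' then 1 else 0)) \<and>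
    (\<forall>Y. linear_space Y \<longrightarrow> (\<forall>b\<in>pivots rk W. g b \<in> Y) \<longrightarrow> (\<forall>b\<in>pivots rk W. h b \<in> Y)) \<and>
    (\<forall>w\<in>W. w = (%i. \<Sum>b\<in>pivots rk W. w b * h b i))"
proof -
  let ?L = "pivots rk W"
  have LB: "?L \<subseteq> B" unfolding pivots_def using supp by force
  have finL: "finite ?L" using LB fin by (rule finite_subset)
  have "\<exists>h. (\<forall>b\<in>?L. \<forall>b'\<in>?L. h b b' = (if b = b' then 1 else 0)) \<and>
    (\<forall>W. linear_space W \<longrightarrow> (\<forall>b\<in>?L. g b \<in> W) \<longrightarrow> (\<forall>b\<in>?L. h b \<in> W))"
    by (rule unitriangular_reduce[OF finL gu gn inj_on_subset[OF inj LB]])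
  then obtain h where h0: "\<forall>b\<in>?L. \<forall>b'\<in>?L. h b b' = (if b = b' then 1 else 0)"
    and hY0: "\<forall>W. linear_space W \<longrightarrow> (\<forall>b\<in>?L. g b \<in> W) \<longrightarrow> (\<forall>b\<in>?L. h b \<in> W)" by blast
  have h: "h b b' = (if b = b' then 1 else 0)" if "b \<in> ?L" "b' \<in> ?L" for b b'
    using h0 that by blast
  have hY: "h b \<in> Y" if "linear_space Y" "!!b. b \<in> ?L ==> g b \<in> Y" "b \<in> ?L" for Y b
    using hY0 that by blast
  have hW: "h b \<in> W" if "b \<in> ?L" for b using hY[OF W g that] .
  have "w = (%i. \<Sum>b\<in>?L. w b * h b i)" if w: "w \<in> W" for w
  proof -
    define v where "v = (%i. w i - (\<Sum>b\<in>?L. w b * h b i))"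
    have vW: "v \<in> W" unfolding v_def using hW
      by (intro linear_spaceD(4)[OF W w] linear_spaceD(5)[OF W] linear_spaceD(3)[OF W]) auto
    have v0: "v b = 0" if "b \<in> ?L" for b
    proof -
      have "(\<Sum>c\<in>?L. w c * h c b) = (\<Sum>c\<in>?L. if c = b then w c else 0)"
        using h that by (intro sum.cong) auto
      then show ?thesis using that finL by (simp add: v_def)
    qed
    have "v i = 0" for i
    proof (rule ccontr)
      assume vi: "v i \<noteq> 0"
      then have "i \<in> B" using supp[OF vW] by blast
      define B' where "B' = {b\<in>B. v b \<noteq> 0}"
      have "finite (v ` B')" "v ` B' \<noteq> {}" using fin \<open>i \<in> B\<close> vi by (auto simp: B'_def)
      then have "\<exists>b\<in>v ` B'. \<forall>a\<in>v ` B'. b dvd a" by (rule dvd_least)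
      then obtain i0 where i0: "i0 \<in> B'" "\<forall>b\<in>B'. v i0 dvd v b" by blast
      have nz: "v i0 \<noteq> 0" using i0 by (simp add: B'_def)
      have "v i0 dvd v b" for b using i0 supp[OF vW] by (cases "b \<in> B'") (auto simp: B'_def)
      then have "\<forall>b. \<exists>u. v b = v i0 * u" by (simp add: dvd_def)
      then obtain u where u: "!!b. v b = v i0 * u b" by metis
      have "v = (%i. v i0 * u i)" using u by blast
      then have uW: "u \<in> W" using sat[OF nz, of u] vW by simp
      have u1: "u i0 = 1" using u[of i0] nz by simp
      define U where "U = {b\<in>B. u b dvd 1}"
      have "finite U" "i0 \<in> U" using fin u1 i0 by (auto simp: U_def B'_def)
      then have "Max (rk ` U) \<in> rk ` U" by (intro Max_in) auto
      then obtain b where b0: "b \<in> U" "Max (rk ` U) = rk b" by blast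
      have b: "b \<in> U" "rk b' \<le> rk b" if "b' \<in> U" for b'
        using b0 Max_ge[of "rk ` U" "rk b'"] \<open>finite U\<close> that by auto
      have "\<not> u b' dvd 1" if "rk b < rk b'" for b'
      proof (cases "b' \<in> B")
        case True
        have "b' \<notin> U" using b(2)[of b'] that by auto
        with True show ?thesis by (auto simp: U_def)
      next
        case False
        then show ?thesis using supp[OF uW] by simp
      qed
      then have "b \<in> ?L" using b0(1) uW by (auto simp: pivots_def U_def)
      then have "u b = 0" using v0[of b] u[of b] nz by simp
      then show False using b0(1) by (simp add: U_def)
    qed
    then show ?thesis unfolding v_def by (rule ext[OF iffD1[OF right_minus_eq]])
  qed
  then show ?thesis by (intro exI[of _ h] conjI finL h0 hY0 ballI)
qed

section \<open>Dickson's lemma\<close>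

lemma nat_seq_incseq_subseq: "\<exists>r. strict_mono r \<and> incseq (%n. u (r n))" for u :: "nat => nat"
proof -
  obtain f where f: "strict_mono f" "monoseq (%n. u (f n))" using seq_monosub by blast
  show ?thesis
  proof (cases "incseq (%n. u (f n))")
    case True
    with f show ?thesis by blast
  next
    case False
    then have dec: "decseq (%n. u (f n))" using f(2) by (auto simp: monoseq_def incseq_def decseq_def)
    \<comment> \<open>A decreasing sequence of natural numbers is constant from the place of its
      minimum on.\<close>
    define k where "k = (ARG_MIN (%n. u (f n)) n. True)"
    have k: "u (f k) \<le> u (f n)" for n unfolding k_def by (rule arg_min_nat_le) simp
    have "u (f (k + n)) = u (f k)" for n
      using k[of "k + n"] decseqD[OF dec, of k "k + n"] by simp
    then have "incseq (%n. u (f (k + n)))" by (simp add: incseq_def)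
    moreover have "strict_mono (%n. f (k + n))" using f(1) by (simp add: strict_mono_def)
    ultimately show ?thesis by blast
  qed
qed

text \<open>Each function of \<open>F\<close> costs one more passage to a subsequence, which
  preserves the monotonicity obtained before.\<close>

lemma dickson:
  fixes F :: "('e => nat) set" and s :: "nat => 'e"
  assumes "finite F"
  shows "\<exists>r. strict_mono r \<and> (\<forall>f\<in>F. incseq (%n. f (s (r n))))"
  using assms
proof (induction F)
  case empty
  have "strict_mono (%n::nat. n)" by (simp add: strict_mono_def)
  then show ?case by (intro exI[of _ "%n. n"]) simp
next
  case (insert f F)
  then obtain r where r: "strict_mono r" "\<forall>f\<in>F. incseq (%n. f (s (r n)))" by blast
  obtain q where q: "strict_mono q" "incseq (%n. f (s (r (q n))))"
    using nat_seq_incseq_subseq[of "%n. f (s (r n))"] by blast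
  have "strict_mono (%n. r (q n))" using r(1) q(1) by (simp add: strict_mono_def)
  moreover have "incseq (%n. f' (s (r (q n))))" if "f' \<in> F" for f'
    using r(2) that q(1) by (auto simp: incseq_def strict_mono_less_eq)
  ultimately show ?case using q(2) by (intro exI[of _ "%n. r (q n)"]) auto
qed

text \<open>If no \<open>D\<close> works, then for each \<open>D\<close> some element
  \<open>e D\<close> dominates no element of level at most \<open>D\<close>. Raising
  \<open>D\<close> past the levels already used gives a sequence in which no term dominates an
  earlier one.\<close>

lemma dickson_bounded:
  fixes F :: "('e => nat) set" and level :: "'e => nat"
  assumes "finite F"
  shows "\<exists>D. \<forall>e\<in>E. \<exists>e'\<in>E. level e' \<le> D \<and> (\<forall>f\<in>F. f e' \<le> f e)"
proof (rule ccontr)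
  assume "\<not> ?thesis"
  then have "\<forall>D. \<exists>e\<in>E. \<forall>e'\<in>E. level e' \<le> D \<longrightarrow> (\<exists>f\<in>F. \<not> f e' \<le> f e)" by metis
  then obtain e where e: "!!D. e D \<in> E"
    and ne: "!!D e'. e' \<in> E ==> level e' \<le> D ==> \<exists>f\<in>F. \<not> f e' \<le> f (e D)" by metis
  \<comment> \<open>\<open>t k\<close> bounds the levels of all elements \<open>e (t a)\<close>
    chosen before it.\<close>
  define t where "t = rec_nat 0 (%_ D. max D (level (e D)))"
  have tS: "t (Suc k) = max (t k) (level (e (t k)))" for k by (simp add: t_def)
  have tm: "a \<le> b ==> t a \<le> t b" for a b by (rule lift_Suc_mono_le) (simp_all add: tS)
  have lev: "level (e (t a)) \<le> t b" if "a < b" for a b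
    using tm[of "Suc a" b] that tS[of a] by simp
  obtain r where r: "strict_mono r" "\<forall>f\<in>F. incseq (%n. f (e (t (r n))))"
    using dickson[OF assms, of "%n. e (t n)"] by blast
  have "r 0 < r 1" using r(1) by (simp add: strict_mono_def)
  then obtain f where "f \<in> F" "\<not> f (e (t (r 0))) \<le> f (e (t (r 1)))" using ne[OF e lev] by blast
  moreover have "f (e (t (r 0))) \<le> f (e (t (r 1)))" using r(2) \<open>f \<in> F\<close> by (auto simp: incseq_def)
  ultimately show False by blast
qed

section \<open>Polynomial rings over a valuation domain\<close>

text \<open>One type for all numbers of indeterminates; \<open>polys j\<close> singles out the
  polynomials in the first \<open>j\<close>.\<close>

type_synonym 'v pl = "nat multiset \<Rightarrow>\<^sub>0 'v"

abbreviation lookup :: "('a \<Rightarrow>\<^sub>0 'b::zero) => 'a => 'b" where "lookup \<equiv> Poly_Mapping.lookup"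
abbreviation monom :: "'a => 'b::zero => 'a \<Rightarrow>\<^sub>0 'b" where "monom \<equiv> Poly_Mapping.single"
abbreviation supp :: "('a \<Rightarrow>\<^sub>0 'b::zero) => 'a set" where "supp \<equiv> Poly_Mapping.keys"

lemma lookup_monom_mult:
  "lookup (monom \<sigma> c * p) \<nu> = (if \<sigma> \<subseteq># \<nu> then c * lookup p (\<nu> - \<sigma>) else 0)"
  for p :: "'v::comm_ring_1 pl"
proof -
  have 1: "lookup (monom \<sigma> c * p) \<nu> = (\<Sum>l. (c when \<sigma> = l) * (\<Sum>q. lookup p q when \<nu> = l + q))"
    by (simp add: lookup_mult lookup_single)
  also have "\<dots> = c * (\<Sum>q. lookup p q when \<nu> = \<sigma> + q)"
    by (simp add: when_mult)
  also have "\<dots> = (if \<sigma> \<subseteq># \<nu> then c * lookup p (\<nu> - \<sigma>) else 0)"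
  proof (cases "\<sigma> \<subseteq># \<nu>")
    case True
    then have "(\<nu> = \<sigma> + q) = (q = \<nu> - \<sigma>)" for q by (auto simp: subset_mset.add_diff_inverse)
    then show ?thesis using True by simp
  next
    case False
    then have "(\<nu> = \<sigma> + q) = False" for q by auto
    then show ?thesis using False by simp
  qed
  finally show ?thesis .
qed

lemma finite_submsets: "finite {\<mu>. \<mu> \<subseteq># \<nu>}"
proof (induction \<nu>)
  case (add x \<nu>)
  have "{\<mu>. \<mu> \<subseteq># add_mset x \<nu>} \<subseteq> {\<mu>. \<mu> \<subseteq># \<nu>} \<union> add_mset x ` {\<mu>. \<mu> \<subseteq># \<nu>}"
  proof
    fix \<mu> assume "\<mu> \<in> {\<mu>. \<mu> \<subseteq># add_mset x \<nu>}"
    then have le: "\<mu> \<subseteq># add_mset x \<nu>" by simp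
    show "\<mu> \<in> {\<mu>. \<mu> \<subseteq># \<nu>} \<union> add_mset x ` {\<mu>. \<mu> \<subseteq># \<nu>}"
    proof (cases "x \<in># \<mu>")
      case True
      then obtain \<kappa> where "\<mu> = add_mset x \<kappa>" by (metis insert_DiffM)
      with le show ?thesis by auto
    next
      case False
      have "count \<mu> a \<le> count \<nu> a" for a
        using mset_subset_eq_count[OF le, of a] False by (cases "a = x") (auto simp: not_in_iff)
      then show ?thesis by (auto simp: subseteq_mset_def)
    qed
  qed
  then show ?case by (rule finite_subset) (use add in simp)
qed simp

lemma sum_monoms: "p = (\<Sum>\<mu>\<in>supp p. monom \<mu> (lookup p \<mu>))"
  by (rule poly_mapping_eqI) (simp add: lookup_sum lookup_single when_def in_keys_iff)

lemma lookup_times: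
  "lookup (p * q) \<nu> = (\<Sum>\<mu> | \<mu> \<subseteq># \<nu>. lookup p \<mu> * lookup q (\<nu> - \<mu>))"
  for p q :: "'v::comm_ring_1 pl"
proof -
  have fin: "finite {\<mu>. \<mu> \<subseteq># \<nu>}" by (rule finite_submsets)
  have "p * q = (\<Sum>\<mu>\<in>supp p. monom \<mu> (lookup p \<mu>) * q)"
    by (subst sum_monoms[of p]) (simp add: sum_distrib_right)
  then have "lookup (p * q) \<nu> = (\<Sum>\<mu>\<in>supp p. if \<mu> \<subseteq># \<nu> then lookup p \<mu> * lookup q (\<nu> - \<mu>) else 0)"
    by (simp add: lookup_sum lookup_monom_mult)
  also have "\<dots> = (\<Sum>\<mu>\<in>supp p \<inter> {\<mu>. \<mu> \<subseteq># \<nu>}. lookup p \<mu> * lookup q (\<nu> - \<mu>))"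
    by (subst sum.inter_restrict) auto
  also have "\<dots> = (\<Sum>\<mu> | \<mu> \<subseteq># \<nu>. lookup p \<mu> * lookup q (\<nu> - \<mu>))"
    using fin by (intro sum.mono_neutral_left) (auto simp: in_keys_iff)
  finally show ?thesis .
qed

definition polys :: "nat => 'v::comm_ring_1 pl set" where
  "polys j = {p. \<forall>\<mu>\<in>supp p. set_mset \<mu> \<subseteq> {..<j}}"

lemma polys_subring: "unital_subring (polys j :: 'v::comm_ring_1 pl set)"
proof
  show "p + q \<in> polys j" if "p \<in> polys j" "q \<in> polys j" for p q :: "'v pl"
    using that keys_add[of p q] by (auto simp: polys_def)
  show "p * q \<in> polys j" if "p \<in> polys j" "q \<in> polys j" for p q :: "'v pl"
    using that keys_mult[of p q] by (fastforce simp: polys_def)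
qed (auto simp: polys_def)

lemma monom_polys: "set_mset \<sigma> \<subseteq> {..<j} ==> monom \<sigma> c \<in> polys j"
  by (auto simp: polys_def)

text \<open>The coefficient of \<open>x_j^i\<close> as a polynomial free of \<open>x_j\<close>: a
  monomial without \<open>x_j\<close> is looked up after the factor \<open>x_j^i\<close> has been
  restored.\<close>

definition coef_at :: "nat => 'v::comm_ring_1 pl => nat => 'v pl" where
  "coef_at j p i = Abs_poly_mapping (%\<mu>. if j \<in># \<mu> then 0 else lookup p (\<mu> + replicate_mset i j))"

lemma lookup_coef_at:
  "lookup (coef_at j p i) \<mu> = (if j \<in># \<mu> then 0 else lookup p (\<mu> + replicate_mset i j))"
proof -
  have "{\<mu>. (if j \<in># \<mu> then 0 else lookup p (\<mu> + replicate_mset i j)) \<noteq> 0}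
      \<subseteq> (%\<nu>. \<nu> - replicate_mset i j) ` supp p"
    by (auto simp: in_keys_iff image_iff intro!: bexI[of _ "_ + replicate_mset i j"] split: if_splits)
  then have "finite {\<mu>. (if j \<in># \<mu> then 0 else lookup p (\<mu> + replicate_mset i j)) \<noteq> 0}"
    by (rule finite_subset) simp
  then show ?thesis unfolding coef_at_def by (simp add: lookup_Abs_poly_mapping)
qed

lemma coef_at_add: "coef_at j (p + q) i = coef_at j p i + coef_at j q i"
  by (rule poly_mapping_eqI) (simp add: lookup_coef_at lookup_add)

lemma coef_at_sum: "coef_at j (\<Sum>a\<in>I. f a) i = (\<Sum>a\<in>I. coef_at j (f a) i)"
  by (rule poly_mapping_eqI) (simp add: lookup_coef_at lookup_sum)

abbreviation indet :: "nat => 'v::comm_ring_1 pl" where "indet j \<equiv> monom {#j#} 1"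

lemma indet_power: "indet j ^ i = (monom (replicate_mset i j) 1 :: 'v::comm_ring_1 pl)"
  by (induction i) (simp_all add: mult_single)

lemma replicate_subseteq: "replicate_mset i j \<subseteq># \<mu> \<longleftrightarrow> i \<le> count \<mu> j"
  by (simp add: count_le_replicate_mset_subset_eq)

lemma polys_extension:
  "polynomial_extension (polys j :: 'v::comm_ring_1 pl set) (polys (Suc j)) (indet j) (coef_at j)"
proof (intro polynomial_extension.intro polys_subring polynomial_extension_axioms.intro)
  show "polys j \<subseteq> (polys (Suc j) :: 'v pl set)" by (fastforce simp: polys_def)
  show "(indet j :: 'v pl) \<in> polys (Suc j)" by (rule monom_polys) simp
  show "coef_at j a i \<in> polys j" if "a \<in> polys (Suc j)" for a :: "'v pl" and i
  proof -
    have "set_mset \<mu> \<subseteq> {..<j}" if "\<mu> \<in> supp (coef_at j a i)" for \<mu>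
    proof -
      have "j \<notin># \<mu>" "\<mu> + replicate_mset i j \<in> supp a"
        using that by (auto simp: in_keys_iff lookup_coef_at split: if_splits)
      then have "set_mset (\<mu> + replicate_mset i j) \<subseteq> {..<Suc j}"
        using \<open>a \<in> polys (Suc j)\<close> by (simp only: polys_def mem_Collect_eq)
      with \<open>j \<notin># \<mu>\<close> show ?thesis by (auto simp: less_Suc_eq dest!: subsetD)
    qed
    then show ?thesis by (simp add: polys_def)
  qed
  show "coef_at j (a + b) i = coef_at j a i + coef_at j b i" for a b :: "'v pl" and i
    by (rule coef_at_add)
  \<comment> \<open>A monomial without \<open>x_j\<close> passes through the coefficient map; a
    general factor in \<open>polys j\<close> is a sum of such monomials.\<close>
  have mono: "coef_at j (monom \<sigma> c * b) i = monom \<sigma> c * coef_at j b i" if "j \<notin># \<sigma>" for \<sigma> c i and b :: "'v pl"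
  proof (rule poly_mapping_eqI)
    fix \<mu>
    have 1: "\<sigma> \<subseteq># \<mu> + replicate_mset i j \<longleftrightarrow> \<sigma> \<subseteq># \<mu>"
    proof
      assume h: "\<sigma> \<subseteq># \<mu> + replicate_mset i j"
      show "\<sigma> \<subseteq># \<mu>"
      proof (rule mset_subset_eqI)
        fix a
        show "count \<sigma> a \<le> count \<mu> a"
          using mset_subset_eq_count[OF h, of a] that by (cases "a = j") (auto simp: not_in_iff)
      qed
    qed (simp add: subset_mset.add_increasing2)
    have 2: "\<mu> + replicate_mset i j - \<sigma> = \<mu> - \<sigma> + replicate_mset i j" if "\<sigma> \<subseteq># \<mu>"
      using that by (simp add: subset_mset.add_diff_assoc2)
    have 3: "j \<in># \<mu> - \<sigma> \<longleftrightarrow> j \<in># \<mu>"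
      using that by (simp add: in_diff_count not_in_iff)
    show "lookup (coef_at j (monom \<sigma> c * b) i) \<mu> = lookup (monom \<sigma> c * coef_at j b i) \<mu>"
      using 1 2 3 by (simp add: lookup_coef_at lookup_monom_mult)
  qed
  show "coef_at j (a * b) i = a * coef_at j b i" if "a \<in> polys j" for a b :: "'v pl" and i
  proof -
    have n: "j \<notin># \<sigma>" if "\<sigma> \<in> supp a" for \<sigma> using \<open>a \<in> polys j\<close> that by (fastforce simp: polys_def)
    have "a * b = (\<Sum>\<sigma>\<in>supp a. monom \<sigma> (lookup a \<sigma>) * b)"
      by (subst sum_monoms[of a]) (simp add: sum_distrib_right)
    then have "coef_at j (a * b) i = (\<Sum>\<sigma>\<in>supp a. monom \<sigma> (lookup a \<sigma>) * coef_at j b i)"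
      by (simp add: coef_at_sum mono n)
    also have "\<dots> = a * coef_at j b i"
      by (subst (3) sum_monoms[of a]) (simp add: sum_distrib_right)
    finally show ?thesis .
  qed
  show "coef_at j (indet j * b) i = (case i of 0 => 0 | Suc k => coef_at j b k)" for b :: "'v pl" and i
  proof (rule poly_mapping_eqI)
    fix \<mu>
    show "lookup (coef_at j (indet j * b) i) \<mu> = lookup (case i of 0 => 0 | Suc k => coef_at j b k) \<mu>"
      by (cases i) (auto simp: lookup_coef_at lookup_monom_mult)
  qed
  show "coef_at j a i = (if i = 0 then a else 0)" if "a \<in> polys j" for a :: "'v pl" and i
  proof (rule poly_mapping_eqI)
    fix \<mu>
    have "lookup a \<nu> = 0" if "j \<in># \<nu>" for \<nu>
      using \<open>a \<in> polys j\<close> that by (fastforce simp: polys_def in_keys_iff)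
    then show "lookup (coef_at j a i) \<mu> = lookup (if i = 0 then a else 0) \<mu>"
      by (auto simp: lookup_coef_at)
  qed
  show "\<exists>d. \<forall>i\<ge>d. coef_at j a i = 0" for a :: "'v pl"
  proof -
    have "coef_at j a i = 0" if "i \<ge> Suc (\<Sum>\<mu>\<in>supp a. count \<mu> j)" for i
    proof (rule poly_mapping_eqI)
      fix \<mu>
      have "\<mu> + replicate_mset i j \<notin> supp a"
      proof
        assume h: "\<mu> + replicate_mset i j \<in> supp a"
        have "count (\<mu> + replicate_mset i j) j \<le> (\<Sum>\<mu>\<in>supp a. count \<mu> j)"
          by (rule member_le_sum[OF h]) auto
        then show False using that by simp
      qed
      then show "lookup (coef_at j a i) \<mu> = lookup 0 \<mu>" by (simp add: lookup_coef_at in_keys_iff)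
    qed
    then show ?thesis by blast
  qed
  show "a = (\<Sum>i<d. indet j ^ i * coef_at j a i)" if "!!i. i \<ge> d ==> coef_at j a i = 0" for a :: "'v pl" and d
  proof (rule poly_mapping_eqI)
    fix \<mu>
    let ?\<nu> = "\<mu> - replicate_mset (count \<mu> j) j"
    have \<nu>: "?\<nu> + replicate_mset (count \<mu> j) j = \<mu>"
      by (simp add: replicate_subseteq subset_mset.diff_add)
    have "lookup (indet j ^ i * coef_at j a i) \<mu> = (if i = count \<mu> j then lookup a \<mu> else 0)" for i
    proof (cases "i \<le> count \<mu> j")
      case True
      have "j \<in># \<mu> - replicate_mset i j \<longleftrightarrow> i < count \<mu> j"
        by (simp add: in_diff_count)
      moreover have "\<mu> - replicate_mset i j + replicate_mset i j = \<mu>"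
        using True by (simp add: replicate_subseteq subset_mset.diff_add)
      ultimately show ?thesis using True
        by (simp add: indet_power lookup_monom_mult lookup_coef_at replicate_subseteq)
    next
      case False
      then show ?thesis by (simp add: indet_power lookup_monom_mult replicate_subseteq)
    qed
    then have "lookup (\<Sum>i<d. indet j ^ i * coef_at j a i) \<mu> = (if count \<mu> j < d then lookup a \<mu> else 0)"
      by (simp add: lookup_sum)
    moreover have "lookup a \<mu> = 0" if "\<not> count \<mu> j < d"
    proof -
      have "lookup (coef_at j a (count \<mu> j)) ?\<nu> = 0" using \<open>!!i. i \<ge> d ==> coef_at j a i = 0\<close> that by simp
      moreover have "j \<notin># ?\<nu>" by (simp add: in_diff_count)
      ultimately show ?thesis by (simp add: lookup_coef_at \<nu>)
    qed
    ultimately show "lookup a \<mu> = lookup (\<Sum>i<d. indet j ^ i * coef_at j a i) \<mu>" by simp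
  qed
qed

section \<open>Saturated modules of polynomial vectors\<close>

definition submod :: "'b::comm_ring_1 set => (nat => 'b) set => bool" where
  "submod A N \<longleftrightarrow> (%_. 0) \<in> N \<and> (\<forall>v\<in>N. \<forall>w\<in>N. (%i. v i + w i) \<in> N) \<and> (\<forall>a\<in>A. \<forall>v\<in>N. (%i. a * v i) \<in> N)"

lemma submodD:
  assumes "submod A N"
  shows "(%_. 0) \<in> N" "v \<in> N ==> w \<in> N ==> (%i. v i + w i) \<in> N"
    "a \<in> A ==> v \<in> N ==> (%i. a * v i) \<in> N"
    "(!!b. b \<in> L ==> f b \<in> N) ==> (%i. \<Sum>b\<in>L. f b i) \<in> N"
proof -
  show 1: "(%_. 0) \<in> N" and 2: "!!v w. v \<in> N ==> w \<in> N ==> (%i. v i + w i) \<in> N"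
    and "!!a v. a \<in> A ==> v \<in> N ==> (%i. a * v i) \<in> N"
    using assms by (auto simp: submod_def)
  show "(!!b. b \<in> L ==> f b \<in> N) ==> (%i. \<Sum>b\<in>L. f b i) \<in> N"
    by (induction L rule: infinite_finite_induct) (auto intro: 1 2)
qed

text \<open>The quotient by \<open>N\<close> is free of torsion with respect to the constants
  \<open>c\<close> of the valuation domain.\<close>

definition saturated :: "(nat => 'v::comm_ring_1 pl) set => bool" where
  "saturated N \<longleftrightarrow> (\<forall>c v. c \<noteq> 0 \<longrightarrow> (%i. monom {#} c * v i) \<in> N \<longrightarrow> v \<in> N)"

text \<open>A vector of polynomials becomes a function on pairs of component and monomial, the
  format in which elimination over \<open>V\<close> is available.\<close>

definition coords :: "(nat => 'v::comm_ring_1 pl) => nat \<times> nat multiset => 'v" where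
  "coords v = (%(i, \<mu>). lookup (v i) \<mu>)"

lemma coords_inject: "coords v = coords w \<longleftrightarrow> v = w"
  by (auto simp: coords_def fun_eq_iff intro: poly_mapping_eqI)

lemma lookup_const_mult: "lookup (monom {#} c * p) \<mu> = c * lookup p \<mu>" for p :: "'v::comm_ring_1 pl"
  by (simp add: lookup_monom_mult)

lemma coords_linear_space:
  fixes N :: "(nat => 'v::comm_ring_1 pl) set"
  assumes "submod (polys j) N"
  shows "linear_space (coords ` N)"
proof -
  have "coords (%_. 0 :: 'v pl) = (%_. 0)" by (auto simp: coords_def)
  then have "(%_. 0) \<in> coords ` N"
    using submodD(1)[OF assms] by (intro image_eqI[of _ _ "%_. 0"]) simp_all
  moreover have "(%i. coords v i + coords w i) \<in> coords ` N" if "v \<in> N" "w \<in> N" for v w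
  proof -
    have "(%i. coords v i + coords w i) = coords (%i. v i + w i)" by (auto simp: coords_def lookup_add)
    then show ?thesis using submodD(2)[OF assms that] by (simp only: imageI)
  qed
  moreover have "(%i. c * coords v i) \<in> coords ` N" if "v \<in> N" for v c
  proof -
    have "(%i. c * coords v i) = coords (%i. monom {#} c * v i)" by (auto simp: coords_def lookup_const_mult)
    then show ?thesis using submodD(3)[OF assms monom_polys that, of "{#}" c] by (simp only: imageI set_mset_empty empty_subsetI)
  qed
  ultimately show ?thesis by (auto simp: linear_space_def)
qed

lemma coords_saturated:
  fixes N :: "(nat => 'v::idom pl) set"
  assumes N: "saturated N" and c: "c \<noteq> 0" "(%i. c * w i) \<in> coords ` N"
  shows "w \<in> coords ` N"
proof -
  obtain u where u: "u \<in> N" "(%i. c * w i) = coords u" using c by blast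
  have uw: "lookup (u i) \<mu> = c * w (i, \<mu>)" for i \<mu>
    using fun_cong[OF u(2), of "(i, \<mu>)"] by (simp add: coords_def)
  \<comment> \<open>Multiplication by \<open>c\<close> does not change supports, so \<open>w\<close>
    is finitely supported in each component and comes from a vector of polynomials.\<close>
  define v where "v = (%i. Abs_poly_mapping (%\<mu>. w (i, \<mu>)))"
  have "{\<mu>. w (i, \<mu>) \<noteq> 0} = supp (u i)" for i using c(1) by (auto simp: in_keys_iff uw)
  then have "finite {\<mu>. w (i, \<mu>) \<noteq> 0}" for i by simp
  then have v: "lookup (v i) = (%\<mu>. w (i, \<mu>))" for i unfolding v_def by (simp add: lookup_Abs_poly_mapping)
  have "u = (%i. monom {#} c * v i)"
    by (intro ext poly_mapping_eqI) (simp add: lookup_const_mult uw v)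
  then have "v \<in> N" using N c(1) u(1) by (auto simp: saturated_def)
  moreover have "w = coords v" by (auto simp: coords_def v)
  ultimately show ?thesis by blast
qed

lemma finite_bounded_monoms: "finite {\<mu> :: nat multiset. set_mset \<mu> \<subseteq> {..<m} \<and> size \<mu> \<le> d}"
proof -
  have "{\<mu> :: nat multiset. set_mset \<mu> \<subseteq> {..<m} \<and> size \<mu> \<le> d}
      \<subseteq> mset ` {xs. set xs \<subseteq> {..<m} \<and> length xs \<le> d}"
  proof
    fix \<mu> :: "nat multiset" assume "\<mu> \<in> {\<mu>. set_mset \<mu> \<subseteq> {..<m} \<and> size \<mu> \<le> d}"
    moreover obtain xs where "mset xs = \<mu>" using ex_mset by blast
    ultimately show "\<mu> \<in> mset ` {xs. set xs \<subseteq> {..<m} \<and> length xs \<le> d}" by auto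
  qed
  then show ?thesis by (rule finite_subset) (simp add: finite_lists_length_le)
qed

text \<open>Component \<open>i\<close> is encoded as an extra indeterminate \<open>m + i\<close>.
  Positions become multisets and inherit a total order compatible with multiplication by monomials;
  they stay distinct as long as the monomials use indeterminates below \<open>m\<close>
  only.\<close>

definition monom_rank :: "nat => nat \<times> nat multiset => nat multiset" where
  "monom_rank m = (%(i, \<mu>). \<mu> + {#m + i#})"

lemma inj_on_monom_rank: "inj_on (monom_rank m) {(i, \<mu>). set_mset \<mu> \<subseteq> {..<m}}"
proof (rule inj_onI, clarify)
  fix i \<mu> k \<nu>
  assume s: "set_mset \<mu> \<subseteq> {..<m}" "set_mset \<nu> \<subseteq> {..<m}" and eq: "monom_rank m (i, \<mu>) = monom_rank m (k, \<nu>)"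
  have eq': "\<mu> + {#m + i#} = \<nu> + {#m + k#}" using eq by (simp only: monom_rank_def prod.case)
  have "m + i \<notin># \<nu>" using s by auto
  moreover have "m + i \<in># \<nu> + {#m + k#}" unfolding eq'[symmetric] by simp
  ultimately have "i = k" by simp
  with eq' show "i = k \<and> \<mu> = \<nu>" by simp
qed

text \<open>The indeterminates below \<open>j\<close> are treated as scalars and left unbounded; the
  bound \<open>M\<close> on the others is what makes the rank over \<open>polys j\<close>
  finite.\<close>

definition bounded_vecs :: "nat => nat => nat => nat => (nat => 'v::comm_ring_1 pl) set" where
  "bounded_vecs j n m M = {v. (\<forall>i\<ge>n. v i = 0) \<and>
     (\<forall>i. \<forall>\<mu>\<in>supp (v i). set_mset \<mu> \<subseteq> {..<m} \<and> (\<forall>k\<ge>j. count \<mu> k \<le> M))}"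

definition size_le :: "nat => (nat => 'v::comm_ring_1 pl) set" where
  "size_le d = {v. \<forall>i. \<forall>\<mu>\<in>supp (v i). size \<mu> \<le> d}"

text \<open>Bounded degree leaves finitely many positions, so \<open>saturated_basis\<close> applies
  to the coordinates.\<close>

lemma saturated_basis_vecs:
  fixes N :: "(nat => 'v::valuation_domain pl) set"
  assumes sub: "submod (polys 0) N" and sat: "saturated N"
    and bd: "N \<subseteq> bounded_vecs 0 n m M" and sz: "N \<subseteq> size_le d"
    and g: "!!b. b \<in> pivots (monom_rank m) (coords ` N) ==> g b \<in> coords ` N"
    and gu: "!!b. b \<in> pivots (monom_rank m) (coords ` N) ==> g b b dvd 1"
    and gn: "!!b b'. b \<in> pivots (monom_rank m) (coords ` N) ==> monom_rank m b < monom_rank m b' ==> \<not> g b b' dvd 1"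
  shows "\<exists>h. finite (pivots (monom_rank m) (coords ` N)) \<and>
    (\<forall>b\<in>pivots (monom_rank m) (coords ` N). \<forall>b'\<in>pivots (monom_rank m) (coords ` N).
       h b b' = (if b = b' then 1 else 0)) \<and>
    (\<forall>Y. linear_space Y \<longrightarrow> (\<forall>b\<in>pivots (monom_rank m) (coords ` N). g b \<in> Y) \<longrightarrow>
       (\<forall>b\<in>pivots (monom_rank m) (coords ` N). h b \<in> Y)) \<and>
    (\<forall>w\<in>coords ` N. w = (%i. \<Sum>b\<in>pivots (monom_rank m) (coords ` N). w b * h b i))"
proof (rule saturated_basis[where B = "{..<n} \<times> {\<mu>. set_mset \<mu> \<subseteq> {..<m} \<and> size \<mu> \<le> d}"
      and rk = "monom_rank m" and W = "coords ` N" and g = g])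
  show "finite ({..<n} \<times> {\<mu>. set_mset \<mu> \<subseteq> {..<m} \<and> size \<mu> \<le> d})"
    using finite_bounded_monoms by simp
  show "inj_on (monom_rank m) ({..<n} \<times> {\<mu>. set_mset \<mu> \<subseteq> {..<m} \<and> size \<mu> \<le> d})"
    by (rule inj_on_subset[OF inj_on_monom_rank]) auto
  show "linear_space (coords ` N)" using coords_linear_space[OF sub] .
  show "w b = 0" if w: "w \<in> coords ` N" and b: "b \<notin> {..<n} \<times> {\<mu>. set_mset \<mu> \<subseteq> {..<m} \<and> size \<mu> \<le> d}" for w b
  proof -
    obtain v where v: "v \<in> N" "w = coords v" using w by blast
    obtain i \<mu> where [simp]: "b = (i, \<mu>)" by (cases b)
    have vb: "v \<in> bounded_vecs 0 n m M" "v \<in> size_le d" using v(1) bd sz by blast+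
    have "lookup (v i) \<mu> = 0"
    proof (rule ccontr)
      assume nz: "lookup (v i) \<mu> \<noteq> 0"
      then have k: "\<mu> \<in> supp (v i)" by (simp add: in_keys_iff)
      have "i < n" using nz vb(1) by (cases "i < n") (auto simp: bounded_vecs_def)
      moreover have "set_mset \<mu> \<subseteq> {..<m}" using k vb(1) by (simp add: bounded_vecs_def)
      moreover have "size \<mu> \<le> d" using k vb(2) by (simp add: size_le_def)
      ultimately show False using b by simp
    qed
    then show ?thesis by (simp add: v(2) coords_def)
  qed
  show "w \<in> coords ` N" if "c \<noteq> 0" "(%i. c * w i) \<in> coords ` N" for c w
    using coords_saturated[OF sat that] .
qed (erule g gu gn, assumption?)+

lemma supp_indet_mult: "supp (monom \<sigma> 1 * p) \<subseteq> (%\<nu>. \<sigma> + \<nu>) ` supp p" for p :: "'v::comm_ring_1 pl"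
proof
  fix \<nu> assume "\<nu> \<in> supp (monom \<sigma> 1 * p)"
  then have "\<sigma> \<subseteq># \<nu>" "\<nu> - \<sigma> \<in> supp p" by (auto simp: in_keys_iff lookup_monom_mult split: if_splits)
  then show "\<nu> \<in> (%\<nu>. \<sigma> + \<nu>) ` supp p"
    by (intro image_eqI[of _ _ "\<nu> - \<sigma>"]) (simp_all add: subset_mset.add_diff_inverse)
qed

lemma submod_Int: "submod A N ==> submod A Y ==> submod A (N \<inter> Y)"
  by (simp add: submod_def)

lemma submod_mono: "submod A N ==> A' \<subseteq> A ==> submod A' N"
  by (auto simp: submod_def)

lemma polys_mono: "j \<le> k ==> polys j \<subseteq> polys k"
  by (fastforce simp: polys_def)

lemma submod_polys_0:
  fixes N :: "(nat => 'v::comm_ring_1 pl) set"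
  assumes z: "(%_. 0) \<in> N" and a: "!!v w. v \<in> N ==> w \<in> N ==> (%i. v i + w i) \<in> N"
    and c: "!!c v. v \<in> N ==> (%i. monom {#} c * v i) \<in> N"
  shows "submod (polys 0) N"
proof -
  have "p = monom {#} (lookup p {#})" if "p \<in> polys 0" for p :: "'v pl"
  proof (rule poly_mapping_eqI)
    fix \<mu>
    show "lookup p \<mu> = lookup (monom {#} (lookup p {#})) \<mu>"
      using that by (auto simp: polys_def in_keys_iff lookup_single when_def)
  qed
  then have "(%i. p * v i) \<in> N" if "p \<in> polys 0" "v \<in> N" for p v
    using c[of v "lookup p {#}"] that by simp
  with z a show ?thesis by (simp add: submod_def)
qed

lemma supp_const_mult: "supp (monom {#} c * p) \<subseteq> supp p" for p :: "'v::comm_ring_1 pl"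
  by (auto simp: in_keys_iff lookup_const_mult)

lemma supp_const_mult_eq: "c \<noteq> 0 ==> supp (monom {#} c * p) = supp p" for p :: "'v::idom pl"
  by (auto simp: in_keys_iff lookup_const_mult)

lemma submod_size_le: "submod (polys 0) (size_le d :: (nat => 'v::comm_ring_1 pl) set)"
proof (rule submod_polys_0)
  show "(%_. 0) \<in> (size_le d :: (nat => 'v pl) set)" by (simp add: size_le_def)
  show "(%i. v i + w i) \<in> size_le d" if "v \<in> size_le d" "w \<in> size_le d" for v w :: "nat => 'v pl"
    unfolding size_le_def
  proof (intro CollectI allI ballI)
    fix i \<mu> assume "\<mu> \<in> supp (v i + w i)"
    then have "\<mu> \<in> supp (v i) \<or> \<mu> \<in> supp (w i)" using keys_add[of "v i" "w i"] by blast
    then show "size \<mu> \<le> d" using that by (auto simp: size_le_def)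
  qed
  show "(%i. monom {#} c * v i) \<in> size_le d" if "v \<in> size_le d" for c and v :: "nat => 'v pl"
    unfolding size_le_def
  proof (intro CollectI allI ballI)
    fix i \<mu> assume "\<mu> \<in> supp (monom {#} c * v i)"
    then have "\<mu> \<in> supp (v i)" using supp_const_mult[of c "v i"] by blast
    then show "size \<mu> \<le> d" using that by (auto simp: size_le_def)
  qed
qed

lemma saturated_size_le: "saturated (size_le d :: (nat => 'v::idom pl) set)"
  by (simp add: saturated_def size_le_def supp_const_mult_eq)

text \<open>A submodule over the first \<open>j\<close> indeterminates is generated in bounded degree: the pivots
  of its truncations form an up-set for divisibility by these indeterminates, and elements with
  a given pivot are obtained from those with a smaller one by multiplying with a monomial.\<close>

lemma bounded_generation:
  fixes N :: "(nat => 'v::valuation_domain pl) set"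
  assumes sub: "submod (polys j) N" and sat: "saturated N" and bd: "N \<subseteq> bounded_vecs j n m M"
  obtains D where "!!Y. submod (polys j) Y ==> N \<inter> size_le D \<subseteq> Y ==> N \<subseteq> Y"
proof -
  define P where "P d = pivots (monom_rank m) (coords ` (N \<inter> size_le d))" for d
  define E where "E = {(b, d). b \<in> P d}"
  \<comment> \<open>Monotonicity in all these functions forces equal components, through
    \<open>i\<close> and \<open>n - i\<close>, and equal exponents from \<open>j\<close> on, through
    \<open>count\<close> and \<open>M - count\<close>. The exponents below \<open>j\<close> and the
    slack between degree bound and monomial may grow.\<close>
  define F where "F = (%k ((i, \<mu>), d). count \<mu> k) ` {..<m} \<union> (%k ((i, \<mu>), d). M - count \<mu> k) ` {j..<m}
     \<union> {%((i, \<mu>), d). i, %((i, \<mu>), d). n - i, %((i, \<mu>), d). d - size \<mu>}"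
  have "finite F" by (simp add: F_def)
  then obtain D where D: "\<forall>e\<in>E. \<exists>e'\<in>E. snd e' \<le> D \<and> (\<forall>f\<in>F. f e' \<le> f e)"
    using dickson_bounded[of F E snd] by blast
  have Pb: "i < n \<and> set_mset \<mu> \<subseteq> {..<m} \<and> (\<forall>k\<ge>j. count \<mu> k \<le> M) \<and> size \<mu> \<le> d" if iP: "(i, \<mu>) \<in> P d" for i \<mu> d
  proof -
    obtain v where v: "v \<in> N" "v \<in> size_le d" "coords v (i, \<mu>) dvd 1" using iP by (auto simp: P_def pivots_def)
    have nz: "lookup (v i) \<mu> \<noteq> 0" using v(3) by (auto simp: coords_def)
    then have k: "\<mu> \<in> supp (v i)" by (simp add: in_keys_iff)
    have vb: "v \<in> bounded_vecs j n m M" using v(1) bd by blast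
    have "i < n" using nz vb by (cases "i < n") (auto simp: bounded_vecs_def)
    with k vb v(2) show ?thesis by (simp add: bounded_vecs_def size_le_def)
  qed
  have main: "v \<in> Y" if Y: "submod (polys j) Y" and NY: "N \<inter> size_le D \<subseteq> Y" and v: "v \<in> N" for Y v
  proof -
    define d where "d = (\<Sum>i<n. \<Sum>\<mu>\<in>supp (v i). size \<mu>)"
    have "size \<mu> \<le> d" if "\<mu> \<in> supp (v i)" for i \<mu>
    proof -
      have "i < n" using that v bd by (cases "i < n") (auto simp: bounded_vecs_def)
      have "size \<mu> \<le> (\<Sum>\<mu>\<in>supp (v i). size \<mu>)" by (rule member_le_sum[OF that]) auto
      also have "\<dots> \<le> d" unfolding d_def by (rule member_le_sum[of i]) (use \<open>i < n\<close> in auto)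
      finally show ?thesis .
    qed
    then have vd: "v \<in> N \<inter> size_le d" using v by (simp add: size_le_def)
    \<comment> \<open>A vector of \<open>Y\<close> with leading unit at \<open>b\<close> arises from
      one of degree at most \<open>D\<close>, whose pivot divides that of \<open>b\<close>, by
      multiplication with the quotient monomial \<open>\<sigma>\<close>.\<close>
    have ex: "\<exists>w. w \<in> coords ` (N \<inter> size_le d) \<and> w \<in> coords ` Y \<and> w b dvd 1 \<and>
        (\<forall>b'. monom_rank m b < monom_rank m b' \<longrightarrow> \<not> w b' dvd 1)" if b: "b \<in> P d" for b
    proof -
      obtain i \<mu> where bi: "b = (i, \<mu>)" by (cases b)
      have "((i, \<mu>), d) \<in> E" using b by (simp add: E_def bi)
      then obtain e where e: "e \<in> E" "snd e \<le> D" "\<forall>f\<in>F. f e \<le> f ((i, \<mu>), d)" using D by blast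
      obtain i' \<mu>' d' where ee: "e = ((i', \<mu>'), d')" by (metis surj_pair)
      have e': "((i', \<mu>'), d') \<in> E" "d' \<le> D"
        and le: "!!f. f \<in> F ==> f ((i', \<mu>'), d') \<le> f ((i, \<mu>), d)"
        using e by (auto simp: ee)
      have P': "(i', \<mu>') \<in> P d'" using e'(1) by (simp add: E_def)
      note bnd = Pb[OF P'] Pb[OF b[unfolded bi]]
      have "i' \<le> i" "n - i' \<le> n - i" using le[of "%((i, \<mu>), d). i"] le[of "%((i, \<mu>), d). n - i"] by (auto simp: F_def)
      then have ii: "i' = i" using bnd by linarith
      have cnt: "count \<mu>' k \<le> count \<mu> k" for k
      proof (cases "k < m")
        case True
        then show ?thesis using le[of "%((i, \<mu>), d). count \<mu> k"] by (auto simp: F_def)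
      next
        case False
        then have "k \<notin># \<mu>'" using bnd by auto
        then show ?thesis by (simp add: not_in_iff)
      qed
      have cnt': "count \<mu>' k = count \<mu> k" if "k \<ge> j" for k
      proof (cases "k < m")
        case True
        then have "M - count \<mu>' k \<le> M - count \<mu> k"
          using le[of "%((i, \<mu>), d). M - count \<mu> k"] that by (auto simp: F_def)
        moreover have "count \<mu>' k \<le> M" "count \<mu> k \<le> M" using bnd that by auto
        ultimately show ?thesis using cnt[of k] by linarith
      next
        case False
        then have "k \<notin># \<mu>'" "k \<notin># \<mu>" using bnd by auto
        then show ?thesis by (simp add: not_in_iff)
      qed
      have slack: "d' - size \<mu>' \<le> d - size \<mu>"
        using le[of "%((i, \<mu>), d). d - size \<mu>"] by (auto simp: F_def)
      have sub\<mu>: "\<mu>' \<subseteq># \<mu>" using cnt by (simp add: subseteq_mset_def)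
      define \<sigma> where "\<sigma> = \<mu> - \<mu>'"
      have \<sigma>: "\<mu> = \<mu>' + \<sigma>" using sub\<mu> by (simp add: \<sigma>_def subset_mset.add_diff_inverse)
      have \<sigma>j: "set_mset \<sigma> \<subseteq> {..<j}"
      proof
        fix k assume "k \<in># \<sigma>"
        then have "count \<mu>' k < count \<mu> k" by (simp add: \<sigma>_def in_diff_count)
        then show "k \<in> {..<j}" using cnt'[of k] by (cases "k < j") auto
      qed
      obtain v' where v': "v' \<in> N" "v' \<in> size_le d'" "coords v' (i, \<mu>') dvd 1"
        and v'n: "!!b'. monom_rank m (i, \<mu>') < monom_rank m b' ==> \<not> coords v' b' dvd 1"
        using P' unfolding P_def pivots_def ii by auto
      define w where "w = (%i. monom \<sigma> 1 * v' i)"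
      have "size \<kappa> \<le> D" if "\<kappa> \<in> supp (v' a)" for a \<kappa>
      proof -
        have "size \<kappa> \<le> d'" using that v'(2) by (simp add: size_le_def)
        then show ?thesis using e'(2) by simp
      qed
      then have "v' \<in> size_le D" by (simp add: size_le_def)
      then have v'Y: "v' \<in> Y" using NY v'(1) by blast
      have wN: "w \<in> N" "w \<in> Y" unfolding w_def
        using submodD(3)[OF sub monom_polys[OF \<sigma>j] v'(1)] submodD(3)[OF Y monom_polys[OF \<sigma>j] v'Y] by auto
      \<comment> \<open>This is the use of the slack:
        \<open>d' - size \<mu>' \<le> d - size \<mu>\<close> gives
        \<open>size \<sigma> + d' \<le> d\<close>.\<close>
      have "w \<in> size_le d"
      proof -
        have "size \<nu> \<le> d" if "\<nu> \<in> supp (w a)" for a \<nu>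
        proof -
          obtain \<kappa> where k: "\<nu> = \<sigma> + \<kappa>" "\<kappa> \<in> supp (v' a)" using \<open>\<nu> \<in> supp (w a)\<close> supp_indet_mult unfolding w_def by blast
          have "size \<kappa> \<le> d'" using k(2) v'(2) by (simp add: size_le_def)
          moreover have "size \<mu> = size \<mu>' + size \<sigma>" by (simp add: \<sigma>)
          moreover have "size \<mu>' \<le> d'" "size \<mu> \<le> d" using bnd by auto
          ultimately have "size \<sigma> + size \<kappa> \<le> d" using slack by linarith
          then show ?thesis by (simp add: k(1))
        qed
        then show ?thesis by (simp add: size_le_def)
      qed
      moreover have cw: "coords w (a, \<nu>) = (if \<sigma> \<subseteq># \<nu> then coords v' (a, \<nu> - \<sigma>) else 0)" for a \<nu>
        by (simp add: coords_def w_def lookup_monom_mult)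
      then have "coords w (i, \<mu>) dvd 1" using v'(3) by (simp add: \<sigma>)
      moreover have "\<not> coords w b' dvd 1" if lt: "monom_rank m (i, \<mu>) < monom_rank m b'" for b'
      proof -
        obtain a \<nu> where b': "b' = (a, \<nu>)" by (cases b')
        show ?thesis
        proof (cases "\<sigma> \<subseteq># \<nu>")
          case True
          then obtain \<kappa> where \<kappa>: "\<nu> = \<sigma> + \<kappa>" by (metis subset_mset.add_diff_inverse)
          \<comment> \<open>The multiset order is cancellative, so the shift by
            \<open>\<sigma>\<close> takes leading positions to leading positions.\<close>
          have "\<sigma> + (\<mu>' + {#m + i#}) < \<sigma> + (\<kappa> + {#m + a#})"
            using lt unfolding b' monom_rank_def prod.case \<sigma> \<kappa> by (simp add: ac_simps)
          then have "monom_rank m (i, \<mu>') < monom_rank m (a, \<kappa>)"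
            unfolding monom_rank_def prod.case by (simp only: add_less_cancel_left)
          from v'n[OF this] show ?thesis by (simp add: b' cw \<kappa>)
        next
          case False
          then show ?thesis by (simp add: b' cw)
        qed
      qed
      ultimately show ?thesis using wN unfolding bi by blast
    qed
    define g where "g b = (SOME w. w \<in> coords ` (N \<inter> size_le d) \<and> w \<in> coords ` Y \<and> w b dvd 1 \<and>
        (\<forall>b'. monom_rank m b < monom_rank m b' \<longrightarrow> \<not> w b' dvd 1))" for b
    have gg: "g b \<in> coords ` (N \<inter> size_le d) \<and> g b \<in> coords ` Y \<and> g b b dvd 1 \<and>
        (\<forall>b'. monom_rank m b < monom_rank m b' \<longrightarrow> \<not> g b b' dvd 1)" if "b \<in> P d" for b
      unfolding g_def by (rule someI_ex[OF ex[OF that]])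
    have g: "!!b. b \<in> P d ==> g b \<in> coords ` (N \<inter> size_le d)" "!!b. b \<in> P d ==> g b \<in> coords ` Y"
      "!!b. b \<in> P d ==> g b b dvd 1"
      "!!b b'. b \<in> P d ==> monom_rank m b < monom_rank m b' ==> \<not> g b b' dvd 1"
      using gg by auto
    have lY: "linear_space (coords ` Y)" by (rule coords_linear_space[OF Y])
    have sub0: "submod (polys 0) (N \<inter> size_le d)"
      using submod_Int[OF submod_mono[OF sub polys_mono] submod_size_le] by simp
    have sat0: "saturated (N \<inter> size_le d)"
      using sat saturated_size_le[of d] by (auto simp: saturated_def)
    have bd0: "N \<inter> size_le d \<subseteq> bounded_vecs 0 n m (M + d)"
    proof
      fix w assume w: "w \<in> N \<inter> size_le d"
      have "count \<mu> k \<le> M + d" if "\<mu> \<in> supp (w i)" for i \<mu> k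
      proof -
        have "count \<mu> k \<le> size \<mu>" by (rule count_le_size)
        also have "\<dots> \<le> d" using w that by (simp add: size_le_def)
        finally show ?thesis by simp
      qed
      moreover have "w \<in> bounded_vecs j n m M" using w bd by blast
      ultimately show "w \<in> bounded_vecs 0 n m (M + d)" by (auto simp: bounded_vecs_def)
    qed
    have "\<exists>h. finite (P d) \<and> (\<forall>b\<in>P d. \<forall>b'\<in>P d. h b b' = (if b = b' then 1 else 0)) \<and>
      (\<forall>Y. linear_space Y \<longrightarrow> (\<forall>b\<in>P d. g b \<in> Y) \<longrightarrow> (\<forall>b\<in>P d. h b \<in> Y)) \<and>
      (\<forall>w\<in>coords ` (N \<inter> size_le d). w = (%i. \<Sum>b\<in>P d. w b * h b i))"
      unfolding P_def by (rule saturated_basis_vecs[OF sub0 sat0 bd0]) (use g(1,3,4) in \<open>auto simp: P_def\<close>)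
    then obtain h where h1: "\<forall>Y. linear_space Y \<longrightarrow> (\<forall>b\<in>P d. g b \<in> Y) \<longrightarrow> (\<forall>b\<in>P d. h b \<in> Y)"
      and h2: "\<forall>w\<in>coords ` (N \<inter> size_le d). w = (%i. \<Sum>b\<in>P d. w b * h b i)" by (elim exE conjE) (rule that)
    have hY: "h b \<in> coords ` Y" if "b \<in> P d" for b using h1 lY g(2) that by blast
    have "coords v = (%i. \<Sum>b\<in>P d. coords v b * h b i)" using h2 imageI[OF vd] by (rule bspec)
    also have "\<dots> \<in> coords ` Y"
      by (intro linear_spaceD(5)[OF lY] linear_spaceD(3)[OF lY] hY)
    finally show "v \<in> Y" by (auto simp: coords_inject)
  qed
  then show ?thesis by (intro that[of D]) blast
qed

lemma saturated_Int: "saturated N ==> saturated N' ==> saturated (N \<inter> N')"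
  by (auto simp: saturated_def)

definition count_lt :: "nat => nat => (nat => 'v::comm_ring_1 pl) set" where
  "count_lt j d = {v. \<forall>i. \<forall>\<mu>\<in>supp (v i). count \<mu> j < d}"

lemma saturated_count_lt: "saturated (count_lt j d :: (nat => 'v::idom pl) set)"
  by (simp add: saturated_def count_lt_def supp_const_mult_eq)

lemma submod_count_lt: "submod (polys j) (count_lt j d :: (nat => 'v::comm_ring_1 pl) set)"
  unfolding submod_def
proof (intro conjI ballI)
  show "(%_. 0) \<in> (count_lt j d :: (nat => 'v pl) set)" by (simp add: count_lt_def)
next
  fix v w :: "nat => 'v pl" assume vw: "v \<in> count_lt j d" "w \<in> count_lt j d"
  show "(%i. v i + w i) \<in> count_lt j d"
    unfolding count_lt_def
  proof (intro CollectI allI ballI)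
    fix i \<mu> assume "\<mu> \<in> supp (v i + w i)"
    then have "\<mu> \<in> supp (v i) \<or> \<mu> \<in> supp (w i)" using keys_add[of "v i" "w i"] by blast
    then show "count \<mu> j < d" using vw by (auto simp: count_lt_def)
  qed
next
  fix a :: "'v pl" and v :: "nat => 'v pl" assume a: "a \<in> polys j" and v: "v \<in> count_lt j d"
  show "(%i. a * v i) \<in> count_lt j d"
    unfolding count_lt_def
  proof (intro CollectI allI ballI)
    fix i \<mu> assume "\<mu> \<in> supp (a * v i)"
    then obtain \<sigma> \<nu> where m: "\<mu> = \<sigma> + \<nu>" "\<sigma> \<in> supp a" "\<nu> \<in> supp (v i)" using keys_mult[of a "v i"] by blast
    have "j \<notin># \<sigma>" using m(2) a by (fastforce simp: polys_def)
    moreover have "count \<nu> j < d" using m(3) v by (auto simp: count_lt_def)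
    ultimately show "count \<mu> j < d" by (simp add: m(1) not_in_iff)
  qed
qed

lemma indet_power_supp:
  fixes p :: "'v::comm_ring_1 pl"
  assumes "\<mu> \<in> supp p"
  shows "\<mu> + replicate_mset i j \<in> supp (indet j ^ i * p)"
  using assms by (simp add: indet_power in_keys_iff lookup_monom_mult)

lemma indet_power_supp_count:
  fixes p :: "'v::comm_ring_1 pl"
  assumes "\<mu> \<in> supp (indet j ^ i * p)"
  shows "\<exists>\<nu>\<in>supp p. count \<mu> j = i + count \<nu> j"
  using subsetD[OF supp_indet_mult assms[unfolded indet_power]] by auto

text \<open>Without indeterminates the ring is \<open>V\<close>, embedded as constants, and only
  finitely many positions occur; the reduced echelon basis then generates \<open>N\<close> without
  relations.\<close>

lemma ffr_saturated_0:
  fixes N :: "(nat => 'v::valuation_domain pl) set"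
  assumes sub: "submod (polys 0) N" and sat: "saturated N" and bd: "N \<subseteq> bounded_vecs 0 n m M"
  shows "ffr (polys 0) N"
proof -
  let ?L = "pivots (monom_rank m) (coords ` N)"
  \<comment> \<open>Each of the \<open>m\<close> exponents is at most \<open>M\<close>.\<close>
  have sz: "N \<subseteq> size_le (m * M)"
  proof
    fix v assume "v \<in> N"
    then have v: "v \<in> bounded_vecs 0 n m M" using bd by blast
    have "size \<mu> \<le> m * M" if "\<mu> \<in> supp (v i)" for i \<mu>
    proof -
      have s: "set_mset \<mu> \<subseteq> {..<m}" "\<forall>k. count \<mu> k \<le> M" using v that by (auto simp: bounded_vecs_def)
      have "size \<mu> = (\<Sum>k\<in>set_mset \<mu>. count \<mu> k)" by (rule size_multiset_overloaded_eq)
      also have "\<dots> \<le> (\<Sum>k<m. count \<mu> k)" using s(1) by (intro sum_mono2) auto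
      also have "\<dots> \<le> (\<Sum>k<m. M)" using s(2) by (intro sum_mono) auto
      finally show ?thesis by simp
    qed
    then show "v \<in> size_le (m * M)" by (simp add: size_le_def)
  qed
  define g where "g b = (SOME w. w \<in> coords ` N \<and> w b dvd 1 \<and>
    (\<forall>b'. monom_rank m b < monom_rank m b' \<longrightarrow> \<not> w b' dvd 1))" for b
  have gg: "g b \<in> coords ` N \<and> g b b dvd 1 \<and>
    (\<forall>b'. monom_rank m b < monom_rank m b' \<longrightarrow> \<not> g b b' dvd 1)" if "b \<in> ?L" for b
  proof -
    have "\<exists>w. w \<in> coords ` N \<and> w b dvd 1 \<and> (\<forall>b'. monom_rank m b < monom_rank m b' \<longrightarrow> \<not> w b' dvd 1)"
      using that unfolding pivots_def by blast
    then show ?thesis unfolding g_def by (rule someI_ex)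
  qed
  have "\<exists>h. finite ?L \<and> (\<forall>b\<in>?L. \<forall>b'\<in>?L. h b b' = (if b = b' then 1 else 0)) \<and>
    (\<forall>Y. linear_space Y \<longrightarrow> (\<forall>b\<in>?L. g b \<in> Y) \<longrightarrow> (\<forall>b\<in>?L. h b \<in> Y)) \<and>
    (\<forall>w\<in>coords ` N. w = (%i. \<Sum>b\<in>?L. w b * h b i))"
    by (rule saturated_basis_vecs[OF sub sat bd sz]) (use gg in auto)
  then obtain h where finL: "finite ?L" and h: "\<forall>b\<in>?L. \<forall>b'\<in>?L. h b b' = (if b = b' then 1 else 0)"
    and hY: "\<forall>Y. linear_space Y \<longrightarrow> (\<forall>b\<in>?L. g b \<in> Y) \<longrightarrow> (\<forall>b\<in>?L. h b \<in> Y)"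
    and hN: "\<forall>w\<in>coords ` N. w = (%i. \<Sum>b\<in>?L. w b * h b i)" by (elim exE conjE) (rule that)
  have "\<forall>b\<in>?L. h b \<in> coords ` N" using hY coords_linear_space[OF sub] gg by blast
  then have "\<forall>b\<in>?L. \<exists>v. v \<in> N \<and> h b = coords v" by blast
  from bchoice[OF this] obtain u where u: "\<forall>b\<in>?L. u b \<in> N \<and> h b = coords (u b)" ..
  obtain f where f: "bij_betw f {..<card ?L} ?L"
    using ex_bij_betw_nat_finite[OF finL] by (auto simp: atLeast0LessThan)
  let ?r = "card ?L"
  define \<gamma> where "\<gamma> = (%k. u (f k))"
  have fL: "f k \<in> ?L" if "k < ?r" for k using f that by (auto simp: bij_betw_def)
  have finj: "f k = f l \<longleftrightarrow> k = l" if "k < ?r" "l < ?r" for k l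
    using f that by (auto simp: bij_betw_def inj_on_def)
  have coords_comb: "coords (lincomb ?r c \<gamma>) b = (\<Sum>k<?r. lookup (c k) {#} * h (f k) b)"
    if "!!k. c k = monom {#} (lookup (c k) {#})" for c b
  proof -
    obtain i \<mu> where b: "b = (i, \<mu>)" by (cases b)
    have "lookup (c k * \<gamma> k i) \<mu> = lookup (c k) {#} * h (f k) b" if "k < ?r" for k
    proof -
      have "lookup (c k * \<gamma> k i) \<mu> = lookup (monom {#} (lookup (c k) {#}) * \<gamma> k i) \<mu>"
        using \<open>!!k. c k = monom {#} (lookup (c k) {#})\<close>[of k] by simp
      also have "\<dots> = lookup (c k) {#} * lookup (\<gamma> k i) \<mu>" by (rule lookup_const_mult)
      also have "lookup (\<gamma> k i) \<mu> = h (f k) b"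
        using u fL[OF that] by (simp add: \<gamma>_def coords_def b)
      finally show ?thesis .
    qed
    then show ?thesis by (simp add: coords_def b lincomb_def lookup_sum)
  qed
  have const: "p = monom {#} (lookup p {#})" if "p \<in> polys 0" for p :: "'v pl"
  proof (rule poly_mapping_eqI)
    fix \<mu>
    show "lookup p \<mu> = lookup (monom {#} (lookup p {#})) \<mu>"
      using that by (auto simp: polys_def in_keys_iff lookup_single when_def)
  qed
  have vconst: "c k = monom {#} (lookup (c k) {#})" if "c \<in> vecs (polys 0) ?r" for c :: "nat => 'v pl" and k
    using that const by (simp add: vecs_def)
  have "N = (%c. lincomb ?r c \<gamma>) ` vecs (polys 0) ?r"
  proof (intro Set.set_eqI iffI)
    fix v assume v: "v \<in> N"
    define c :: "nat => 'v pl" where "c k = (if k < ?r then monom {#} (coords v (f k)) else 0)" for k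
    have cv: "c \<in> vecs (polys 0) ?r" by (auto simp: vecs_def c_def monom_polys unital_subring.zero_mem[OF polys_subring])
    have "coords (lincomb ?r c \<gamma>) = coords v"
    proof
      fix b
      have "coords (lincomb ?r c \<gamma>) b = (\<Sum>k<?r. coords v (f k) * h (f k) b)"
        using coords_comb[of c b, OF vconst[OF cv]] by (simp add: c_def)
      also have "\<dots> = (\<Sum>b'\<in>?L. coords v b' * h b' b)"
        by (rule sum.reindex_bij_betw[OF f])
      also have "\<dots> = coords v b" using fun_cong[OF bspec[OF hN imageI[OF v]], of b] by simp
      finally show "coords (lincomb ?r c \<gamma>) b = coords v b" .
    qed
    then have "v = lincomb ?r c \<gamma>" by (simp add: coords_inject)
    with cv show "v \<in> (%c. lincomb ?r c \<gamma>) ` vecs (polys 0) ?r" by blast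
  next
    fix v assume "v \<in> (%c. lincomb ?r c \<gamma>) ` vecs (polys 0) ?r"
    then obtain c where c: "c \<in> vecs (polys 0) ?r" "v = lincomb ?r c \<gamma>" by blast
    show "v \<in> N" unfolding c(2) lincomb_def
    proof (rule submodD(4)[OF sub])
      fix k assume "k \<in> {..<?r}"
      then have "\<gamma> k \<in> N" using u fL by (simp add: \<gamma>_def)
      moreover have "c k \<in> polys 0" using c(1) by (simp add: vecs_def)
      ultimately show "(%i. c k * \<gamma> k i) \<in> N" by (intro submodD(3)[OF sub])
    qed
  qed
  moreover have "rels (polys 0) ?r \<gamma> = {%_. 0}"
  proof (intro Set.set_eqI iffI)
    fix c assume c: "c \<in> rels (polys 0) ?r \<gamma>"
    then have cv: "c \<in> vecs (polys 0) ?r" and c0: "lincomb ?r c \<gamma> = (%_. 0)" by (auto simp: rels_def)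
    have "c k = 0" for k
    proof (cases "k < ?r")
      case True
      have "coords (%_. 0 :: 'v pl) (f k) = 0" by (simp add: coords_def split: prod.split)
      then have "0 = coords (lincomb ?r c \<gamma>) (f k)" by (simp only: c0)
      also have "\<dots> = (\<Sum>l<?r. lookup (c l) {#} * h (f l) (f k))" by (rule coords_comb[OF vconst[OF cv]])
      also have "\<dots> = (\<Sum>l<?r. if l = k then lookup (c l) {#} else 0)"
        using h fL True finj by (intro sum.cong) auto
      also have "\<dots> = lookup (c k) {#}" using True by simp
      finally show ?thesis using vconst[OF cv, of k] by simp
    next
      case False
      then show ?thesis using cv by (simp add: vecs_def)
    qed
    then show "c \<in> {%_. 0}" by auto
  qed (simp add: unital_subring.zero_rels[OF polys_subring])
  ultimately show ?thesis by (intro ffr.step[of N ?r \<gamma>]) (simp_all add: ffr.zero)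
qed

text \<open>Induction on the number of indeterminates. The part \<open>T d\<close> of degree below
  \<open>d\<close> in \<open>x_j\<close> is saturated over the smaller ring, with the exponent of
  \<open>x_j\<close> now among the bounded ones. \<open>ffr_step\<close> is applied to
  \<open>T D\<close> and \<open>T (Suc D)\<close>, with \<open>D\<close> the bound from
  \<open>bounded_generation\<close>.\<close>

lemma ffr_saturated:
  fixes N :: "(nat => 'v::valuation_domain pl) set"
  assumes "submod (polys j) N" "saturated N" "N \<subseteq> bounded_vecs j n m M"
  shows "ffr (polys j) N"
  using assms
proof (induction j arbitrary: N M)
  case 0
  then show ?case by (rule ffr_saturated_0)
next
  case (Suc j)
  interpret polynomial_extension "polys j :: 'v pl set" "polys (Suc j)" "indet j" "coef_at j"
    by (rule polys_extension)
  note sub = Suc.prems(1) and sat = Suc.prems(2) and bd = Suc.prems(3)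
  obtain D where D: "!!Y. submod (polys (Suc j)) Y ==> N \<inter> size_le D \<subseteq> Y ==> N \<subseteq> Y"
    using bounded_generation[OF sub sat bd] by blast
  have subj: "submod (polys j) N" by (rule submod_mono[OF sub polys_mono]) simp
  define T where "T d = N \<inter> count_lt j d" for d
  have T_sub: "submod (polys j) (T d)" for d
    unfolding T_def by (rule submod_Int[OF subj submod_count_lt])
  have T_ffr: "ffr (polys j) (T d)" for d
  proof (rule Suc.IH[OF T_sub])
    show "saturated (T d)" unfolding T_def by (rule saturated_Int[OF sat saturated_count_lt])
    show "T d \<subseteq> bounded_vecs j n m (M + d)"
    proof
      fix v assume v: "v \<in> T d"
      have vb: "v \<in> bounded_vecs (Suc j) n m M" "v \<in> count_lt j d" using v bd by (auto simp: T_def)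
      have "count \<mu> k \<le> M + d" if "\<mu> \<in> supp (v i)" "k \<ge> j" for i \<mu> k
      proof (cases "k = j")
        case True
        have "count \<mu> j < d" using vb(2) that(1) by (auto simp: count_lt_def)
        with True show ?thesis by simp
      next
        case False
        then have "count \<mu> k \<le> M" using vb(1) that by (auto simp: bounded_vecs_def)
        then show ?thesis by simp
      qed
      then show "v \<in> bounded_vecs j n m (M + d)" using vb(1) by (auto simp: bounded_vecs_def)
    qed
  qed
  have x_N: "(%i. indet j ^ l * v i) \<in> N" if "v \<in> N" for v l
    using that by (intro submodD(3)[OF sub] top.power_mem x_mem)
  show ?case
  proof (rule ffr_step[OF T_ffr[of "Suc D"] T_ffr[of D]])
    show "T D \<subseteq> T (Suc D)" by (auto simp: T_def count_lt_def less_Suc_eq)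
    show "(%i. indet j * v i) \<in> T (Suc D)" if "v \<in> T D" for v
    proof -
      have "count \<mu> j < Suc D" if m: "\<mu> \<in> supp (indet j * v i)" for \<mu> i
      proof -
        obtain \<nu> where "\<nu> \<in> supp (v i)" "count \<mu> j = 1 + count \<nu> j"
          using indet_power_supp_count[of \<mu> j 1 "v i"] m by auto
        then show ?thesis using \<open>v \<in> T D\<close> by (auto simp: T_def count_lt_def)
      qed
      then show ?thesis using x_N[of v 1] that by (auto simp: T_def count_lt_def)
    qed
    show "(%k. \<Sum>i<d. indet j ^ i * G i k) \<in> N" if "!!i. G i \<in> T (Suc D)" for d and G :: "nat => nat => 'v pl"
    proof (rule submodD(4)[OF sub])
      fix i
      have "G i \<in> N" using that by (simp add: T_def)
      then show "(%k. indet j ^ i * G i k) \<in> N" by (rule x_N)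
    qed
    show "\<exists>d G. (\<forall>i. G i \<in> T (Suc D)) \<and> v = (%k. \<Sum>i<d. indet j ^ i * G i k)" if v: "v \<in> N" for v
    proof -
      \<comment> \<open>The module generated by \<open>T (Suc D)\<close>, written as sums of powers
        of \<open>x_j\<close> times elements of it. It contains all vectors of \<open>N\<close> of
        degree at most \<open>D\<close>, hence \<open>N\<close>.\<close>
      define Y where "Y = {v. \<exists>d G. (\<forall>i. G i \<in> T (Suc D)) \<and> v = (%k. \<Sum>i<d. indet j ^ i * G i k)}"
      have Z: "(%_. 0) \<in> T (Suc D)" by (rule submodD(1)[OF T_sub])
      have Y0: "(%_. 0) \<in> Y" unfolding Y_def
        by (rule CollectI, rule exI[of _ 0], rule exI[of _ "%_ _. 0"]) (use Z in simp)
      have Yadd: "(%i. v i + w i) \<in> Y" if "v \<in> Y" "w \<in> Y" for v w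
      proof -
        obtain d G where G: "\<forall>i. G i \<in> T (Suc D)" "v = (%k. \<Sum>i<d. indet j ^ i * G i k)"
          using \<open>v \<in> Y\<close> unfolding Y_def by blast
        obtain e H where H: "\<forall>i. H i \<in> T (Suc D)" "w = (%k. \<Sum>i<e. indet j ^ i * H i k)"
          using \<open>w \<in> Y\<close> unfolding Y_def by blast
        define K where "K i = (%k. (if i < d then G i else (%_. 0)) k + (if i < e then H i else (%_. 0)) k)" for i
        have "K i \<in> T (Suc D)" for i
          unfolding K_def using G(1) H(1) Z by (intro submodD(2)[OF T_sub]) auto
        moreover have "(%k. v k + w k) = (%k. \<Sum>i<max d e. indet j ^ i * K i k)"
        proof
          fix k
          have "v k = (\<Sum>i<max d e. indet j ^ i * (if i < d then G i else (%_. 0)) k)"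
            unfolding G(2) by (rule sum.mono_neutral_cong_left) auto
          moreover have "w k = (\<Sum>i<max d e. indet j ^ i * (if i < e then H i else (%_. 0)) k)"
            unfolding H(2) by (rule sum.mono_neutral_cong_left) auto
          ultimately show "v k + w k = (\<Sum>i<max d e. indet j ^ i * K i k)"
            by (simp only: K_def distrib_left sum.distrib)
        qed
        ultimately show ?thesis unfolding Y_def by blast
      qed
      have Yx: "(%i. indet j * v i) \<in> Y" if "v \<in> Y" for v
      proof -
        obtain d G where G: "\<forall>i. G i \<in> T (Suc D)" "v = (%k. \<Sum>i<d. indet j ^ i * G i k)"
          using \<open>v \<in> Y\<close> unfolding Y_def by blast
        define K where "K i = (case i of 0 => (%_. 0) | Suc i => G i)" for i
        have "K i \<in> T (Suc D)" for i using G(1) Z by (simp add: K_def split: nat.split)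
        moreover have "(%k. indet j * v k) = (%k. \<Sum>i<Suc d. indet j ^ i * K i k)"
          unfolding G(2) by (simp only: sum.lessThan_Suc_shift K_def nat.case sum_distrib_left
              power_Suc mult.assoc mult_zero_right add_0)
        ultimately show ?thesis unfolding Y_def by blast
      qed
      have Ya: "(%i. a * v i) \<in> Y" if a: "a \<in> polys j" and "v \<in> Y" for a :: "'v pl" and v
      proof -
        obtain d G where G: "\<forall>i. G i \<in> T (Suc D)" "v = (%k. \<Sum>i<d. indet j ^ i * G i k)"
          using \<open>v \<in> Y\<close> unfolding Y_def by blast
        have "(%k. a * G i k) \<in> T (Suc D)" for i using G(1) by (intro submodD(3)[OF T_sub a]) simp
        moreover have "(%k. a * v k) = (%k. \<Sum>i<d. indet j ^ i * (a * G i k))"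
          unfolding G(2) by (simp only: sum_distrib_left mult.left_commute)
        ultimately show ?thesis unfolding Y_def by (intro CollectI exI[of _ d] exI[of _ "%i k. a * G i k"]) simp
      qed
      have Yp: "(%k. indet j ^ i * v k) \<in> Y" if "v \<in> Y" for v i
      proof (induction i)
        case (Suc i)
        then show ?case using Yx[OF Suc] by (simp add: mult.assoc)
      qed (use that in simp)
      have "submod (polys (Suc j)) Y"
        unfolding submod_def
      proof (intro conjI ballI Y0 Yadd)
        fix a :: "'v pl" and v :: "nat => 'v pl" assume a: "a \<in> polys (Suc j)" and v: "v \<in> Y"
        obtain d where d: "\<forall>i\<ge>d. coef_at j a i = 0" using cf_fin by blast
        have s: "(%k. \<Sum>i<e. indet j ^ i * (coef_at j a i * v k)) \<in> Y" for e
        proof (induction e)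
          case (Suc e)
          then show ?case using Yadd[OF Suc Yp[OF Ya[OF cf_in[OF a] v]], of e] by simp
        qed (simp add: Y0)
        have "a = (\<Sum>i<d. indet j ^ i * coef_at j a i)" using cf_sum[OF a, of d] d by simp
        then have "(%k. a * v k) = (%k. (\<Sum>i<d. indet j ^ i * coef_at j a i) * v k)" by simp
        also have "\<dots> = (%k. \<Sum>i<d. indet j ^ i * (coef_at j a i * v k))"
          by (simp only: sum_distrib_right mult.assoc)
        finally show "(%k. a * v k) \<in> Y" using s by simp
      qed
      moreover have "N \<inter> size_le D \<subseteq> Y"
      proof
        fix w assume w: "w \<in> N \<inter> size_le D"
        have "count \<mu> j < Suc D" if "\<mu> \<in> supp (w i)" for i \<mu>
        proof -
          have "count \<mu> j \<le> size \<mu>" by (rule count_le_size)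
          also have "\<dots> \<le> D" using w that by (simp add: size_le_def)
          finally show ?thesis by simp
        qed
        then have "w \<in> T (Suc D)" using w by (simp add: T_def count_lt_def)
        then show "w \<in> Y" unfolding Y_def
          by (intro CollectI exI[of _ 1] exI[of _ "%_. w"]) simp
      qed
      ultimately have "v \<in> Y" using D v by blast
      then show ?thesis unfolding Y_def by blast
    qed
    show "\<exists>H. (\<forall>i. H i \<in> T D) \<and> (\<forall>i\<ge>d. H i = (%_. 0)) \<and>
        (\<forall>i. G i = (%k. indet j * H i k - (case i of 0 => 0 | Suc j => H j k)))"
      if G: "!!i. G i \<in> T (Suc D)" and Gd: "!!i. i \<ge> d ==> G i = (%_. 0)"
        and s0: "(%k. \<Sum>i<d. indet j ^ i * G i k) = (%_. 0)" for d and G :: "nat => nat => 'v pl"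
    proof -
      \<comment> \<open>Synthetic division: as the sum of all \<open>x_j^l G_l\<close> is zero,
        \<open>x_j^(i+1) H_i\<close> is the sum of the terms with \<open>l \<le> i\<close>.\<close>
      define H where "H i = (%k. \<Sum>l\<in>{i<..<d}. - (indet j ^ (l - Suc i)) * G l k)" for i
      have GN: "G i \<in> N" for i using G by (simp add: T_def)
      have pw: "- (indet j ^ l :: 'v pl) \<in> polys (Suc j)" for l by (intro top.uminus_mem top.power_mem x_mem)
      have HN: "H i \<in> N" for i
        unfolding H_def by (intro submodD(4)[OF sub] submodD(3)[OF sub pw] GN)
      have split: "(\<Sum>l\<le>i. indet j ^ l * G l k) = indet j ^ Suc i * H i k" for i k
      proof -
        have "0 = (\<Sum>l<max d (Suc i). indet j ^ l * G l k)"
        proof -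
          have "(\<Sum>l<max d (Suc i). indet j ^ l * G l k) = (\<Sum>l<d. indet j ^ l * G l k)"
            using Gd by (intro sum.mono_neutral_right) auto
          then show ?thesis using fun_cong[OF s0, of k] by simp
        qed
        also have "{..<max d (Suc i)} = {..i} \<union> {i<..<d}" by auto
        also have "(\<Sum>l\<in>{..i} \<union> {i<..<d}. indet j ^ l * G l k) =
            (\<Sum>l\<le>i. indet j ^ l * G l k) + (\<Sum>l\<in>{i<..<d}. indet j ^ l * G l k)"
          by (rule sum.union_disjoint) auto
        also have "(\<Sum>l\<in>{i<..<d}. indet j ^ l * G l k) = - (indet j ^ Suc i * H i k)"
          unfolding H_def sum_distrib_left sum_negf[symmetric]
        proof (rule sum.cong[OF refl])
          fix l assume "l \<in> {i<..<d}"
          then have "(indet j ^ l :: 'v pl) = indet j ^ Suc i * indet j ^ (l - Suc i)"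
            by (simp only: power_add[symmetric]) simp
          then show "indet j ^ l * G l k = - (indet j ^ Suc i * (- (indet j ^ (l - Suc i)) * G l k))"
            by (simp only: mult_minus_left mult_minus_right minus_minus mult.assoc)
        qed
        finally show ?thesis by (simp only: add_uminus_conv_diff right_minus_eq eq_commute[of 0])
      qed
      \<comment> \<open>By \<open>split\<close>, \<open>x_j^(i+1) H_i\<close> has degree at most
        \<open>i + D\<close> in \<open>x_j\<close>, so the degree of \<open>H_i\<close> is below
        \<open>D\<close>.\<close>
      have HD: "H i \<in> T D" for i
      proof -
        have "count \<mu> j < D" if m: "\<mu> \<in> supp (H i k)" for \<mu> k
        proof -
          have "\<mu> + replicate_mset (Suc i) j \<in> supp (\<Sum>l\<le>i. indet j ^ l * G l k)"
            using indet_power_supp[OF m, of "Suc i" j] unfolding split .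
          then have "\<mu> + replicate_mset (Suc i) j \<in> (\<Union>l\<in>{..i}. supp (indet j ^ l * G l k))"
            by (rule subsetD[OF keys_sum])
          then obtain l where l: "l \<le> i" "\<mu> + replicate_mset (Suc i) j \<in> supp (indet j ^ l * G l k)"
            by (elim UN_E) simp
          from indet_power_supp_count[OF l(2)] obtain \<nu>
            where n: "\<nu> \<in> supp (G l k)" "count (\<mu> + replicate_mset (Suc i) j) j = l + count \<nu> j" ..
          have "count \<nu> j < Suc D" using n(1) G[of l] by (auto simp: T_def count_lt_def)
          with n(2) l(1) show ?thesis by simp
        qed
        then show ?thesis using HN by (simp add: T_def count_lt_def)
      qed
      have Hd: "H i = (%_. 0)" if "i \<ge> d" for i using that by (simp add: H_def)
      have H_rec: "indet j * H (Suc i) k - H i k = G (Suc i) k" for i k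
      proof (cases "Suc i < d")
        case True
        have "{i<..<d} = insert (Suc i) {Suc i<..<d}" using True by auto
        then have "H i k = - G (Suc i) k + (\<Sum>l\<in>{Suc i<..<d}. - (indet j ^ (l - Suc i)) * G l k)"
          by (simp add: H_def)
        also have "(\<Sum>l\<in>{Suc i<..<d}. - (indet j ^ (l - Suc i)) * G l k) = indet j * H (Suc i) k"
          unfolding H_def sum_distrib_left
        proof (rule sum.cong[OF refl])
          fix l assume "l \<in> {Suc i<..<d}"
          then have "(indet j ^ (l - Suc i) :: 'v pl) = indet j * indet j ^ (l - Suc (Suc i))"
            by (simp only: power_Suc[symmetric]) (simp add: Suc_diff_Suc)
          then show "- (indet j ^ (l - Suc i)) * G l k = indet j * (- (indet j ^ (l - Suc (Suc i))) * G l k)"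
            by (simp only: mult_minus_left mult_minus_right mult.assoc)
        qed
        finally show ?thesis by simp
      next
        case False
        then have "{i<..<d} = {}" "{Suc i<..<d} = {}" by auto
        then show ?thesis using Gd[of "Suc i"] False by (simp add: H_def)
      qed
      have "G i k = indet j * H i k - (case i of 0 => 0 | Suc j => H j k)" for i k
      proof (cases i)
        case 0
        then show ?thesis using split[where i = 0 and k = k] by simp
      next
        case (Suc l)
        then show ?thesis using H_rec[where i = l and k = k] by simp
      qed
      with HD Hd show ?thesis by (intro exI[of _ H]) auto
    qed
  qed
qed

section \<open>Stable freeness\<close>

definition mm :: "nat => (nat => nat => 'b::comm_ring_1) => (nat => nat => 'b) => nat => nat => 'b" where
  "mm n a b = (%i j. \<Sum>k<n. a i k * b k j)"

definition idm :: "nat => nat => nat => 'b::comm_ring_1" where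
  "idm n = (%i j. if i = j \<and> i < n then 1 else 0)"

text \<open>Matrices are zero outside their range, so that their equality is equality of
  functions.\<close>

definition mats :: "'b::comm_ring_1 set => nat => nat => (nat => nat => 'b) set" where
  "mats A p q = {a. (\<forall>i j. a i j \<in> A) \<and> (\<forall>i j. \<not> (i < p \<and> j < q) \<longrightarrow> a i j = 0)}"

lemma mm_assoc: "mm k (mm l a b) c = mm l a (mm k b c)"
proof (intro ext)
  fix i j
  have "mm k (mm l a b) c i j = (\<Sum>r<k. \<Sum>s<l. a i s * (b s r * c r j))"
    by (simp add: mm_def sum_distrib_right mult.assoc)
  also have "\<dots> = (\<Sum>s<l. \<Sum>r<k. a i s * (b s r * c r j))" by (rule sum.swap)
  finally show "mm k (mm l a b) c i j = mm l a (mm k b c) i j"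
    by (simp add: mm_def sum_distrib_left)
qed

lemma mm_diff_right: "mm n a (%i j. b i j - c i j) = (%i j. mm n a b i j - mm n a c i j)"
  by (simp add: mm_def right_diff_distrib sum_subtractf)

lemma mm_diff_left: "mm n (%i j. a i j - b i j) c = (%i j. mm n a c i j - mm n b c i j)"
  by (simp add: mm_def left_diff_distrib sum_subtractf)

lemma mm_add_right: "mm n a (%i j. b i j + c i j) = (%i j. mm n a b i j + mm n a c i j)"
  by (simp add: mm_def distrib_left sum.distrib)

lemma mm_add_left: "mm n (%i j. a i j + b i j) c = (%i j. mm n a c i j + mm n b c i j)"
  by (simp add: mm_def distrib_right sum.distrib)

lemma mm_idm_left: "a \<in> mats A n q ==> mm n (idm n) a = a"
proof (intro ext)
  fix i j assume a: "a \<in> mats A n q"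
  have "mm n (idm n) a i j = (\<Sum>k<n. if k = i then a k j else 0)"
    unfolding mm_def idm_def by (intro sum.cong) auto
  also have "\<dots> = a i j" using a by (auto simp: mats_def)
  finally show "mm n (idm n) a i j = a i j" .
qed

lemma mm_idm_right: "a \<in> mats A p n ==> mm n a (idm n) = a"
proof (intro ext)
  fix i j assume a: "a \<in> mats A p n"
  have "mm n a (idm n) i j = (\<Sum>k<n. if k = j then a i k else 0)"
    unfolding mm_def idm_def by (intro sum.cong) auto
  also have "\<dots> = a i j" using a by (auto simp: mats_def)
  finally show "mm n a (idm n) i j = a i j" .
qed

lemma (in unital_subring) mm_mats: "a \<in> mats A p n ==> b \<in> mats A n q ==> mm n a b \<in> mats A p q"
  unfolding mats_def mm_def mem_Collect_eq by (intro conjI allI impI sum_mem mult_mem sum.neutral ballI) auto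

lemma (in unital_subring) idm_mats: "idm n \<in> mats A n n"
  by (auto simp: mats_def idm_def)

lemma (in unital_subring) diff_mats: "a \<in> mats A p q ==> b \<in> mats A p q ==> (%i j. a i j - b i j) \<in> mats A p q"
  by (auto simp: mats_def)

lemma mm_zero [simp]: "mm n a (%_ _. 0) = (%_ _. 0)" "mm n (%_ _. 0) a = (%_ _. 0)"
  by (simp_all add: mm_def)

text \<open>The four blocks form mutually inverse isomorphisms between \<open>im e \<oplus> A\<^sup>b\<close> and \<open>A\<^sup>c\<close>.\<close>

definition stably_free :: "'b::comm_ring_1 set => nat => (nat => nat => 'b) => bool" where
  "stably_free A n e \<longleftrightarrow> (\<exists>b c a1 a2 a3 a4. a1 \<in> mats A n c \<and> a2 \<in> mats A b c \<and> a3 \<in> mats A c n \<and> a4 \<in> mats A c b \<and>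
     mm c a1 a3 = e \<and> mm c a1 a4 = (%_ _. 0) \<and> mm c a2 a3 = (%_ _. 0) \<and> mm c a2 a4 = idm b \<and>
     (%i j. mm n a3 a1 i j + mm b a4 a2 i j) = idm c)"

definition fixed_vecs :: "'b::comm_ring_1 set => nat => (nat => nat => 'b) => (nat => 'b) set" where
  "fixed_vecs A n e = {v \<in> vecs A n. (%i. \<Sum>j<n. e i j * v j) = v}"

text \<open>Induction on the resolution. The map from \<open>A^r\<close> onto the image of
  \<open>e\<close> splits, and its kernel is the image of a complementary idempotent
  \<open>e1\<close>. By induction \<open>im e1 \<oplus> A^b\<close> is isomorphic to
  \<open>A^c\<close>, so \<open>im e \<oplus> A^c\<close> is isomorphic to
  \<open>im e \<oplus> im e1 \<oplus> A^b\<close>, that is to \<open>A^(r+b)\<close>.\<close>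

lemma (in unital_subring) ffr_stably_free:
  assumes "ffr A N"
  shows "e \<in> mats A n n ==> mm n e e = e ==> N = fixed_vecs A n e ==> stably_free A n e"
  using assms
proof (induction arbitrary: n e rule: ffr.induct)
  case zero
  have "e i j = 0" for i j
  proof (cases "j < n")
    case True
    have "(%i. \<Sum>k<n. e i k * e k j) = (%i. e i j)"
      by (rule ext) (use fun_cong[OF fun_cong[OF zero(2)]] in \<open>simp add: mm_def\<close>)
    then have "(%i. e i j) \<in> fixed_vecs A n e"
      using zero(1) by (simp add: fixed_vecs_def vecs_def mats_def)
    then have "(%i. e i j) = (%_. 0)" using zero(3) by auto
    then show ?thesis by (rule fun_cong)
  next
    case False
    then show ?thesis using zero(1) by (simp add: mats_def)
  qed
  then have e: "e = (%_ _. 0)" by blast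
  show ?case unfolding stably_free_def
    by (rule exI[of _ 0], rule exI[of _ 0], rule exI[of _ "%_ _. 0"], rule exI[of _ "%_ _. 0"],
        rule exI[of _ "%_ _. 0"], rule exI[of _ "%_ _. 0"])
      (auto simp: e mats_def mm_def idm_def)
next
  case (step N r g)
  note e = step.prems(1) and ee = step.prems(2) and Ne = step.prems(3)
  define gm where "gm = (%i k. if k < r then g k i else 0)"
  have lin_gm: "lincomb r c g i = (\<Sum>k<r. gm i k * c k)" for c i
    by (simp add: lincomb_def gm_def mult.commute)
  have gN: "g k \<in> N" if "k < r" for k
  proof -
    have "(%i. if i = k then 1 else 0) \<in> vecs A r" using that by (auto simp: vecs_def)
    moreover have "g k = lincomb r (%i. if i = k then 1 else 0) g"
      using that by (simp add: lincomb_def if_distrib[where f = "%x. x * _"] cong: if_cong)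
    ultimately show ?thesis unfolding step.hyps(1) by blast
  qed
  have gm: "gm \<in> mats A n r"
    using gN Ne by (auto simp: gm_def mats_def fixed_vecs_def vecs_def)
  have egm: "mm n e gm = gm"
  proof (intro ext)
    fix i k
    show "mm n e gm i k = gm i k"
    proof (cases "k < r")
      case True
      then have "(%i. \<Sum>j<n. e i j * g k j) = g k" using gN Ne by (simp add: fixed_vecs_def)
      from fun_cong[OF this, of i] show ?thesis using True by (simp add: mm_def gm_def)
    qed (simp add: mm_def gm_def)
  qed
  have "\<exists>s. s \<in> vecs A r \<and> (%i. e i j) = lincomb r s g" if "j < n" for j
  proof -
    have "(%i. \<Sum>k<n. e i k * e k j) = (%i. e i j)"
      by (rule ext) (use fun_cong[OF fun_cong[OF ee]] in \<open>simp add: mm_def\<close>)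
    then have "(%i. e i j) \<in> fixed_vecs A n e"
      using e by (simp add: fixed_vecs_def vecs_def mats_def)
    then show ?thesis using Ne step.hyps(1) by auto
  qed
  then obtain s where s: "!!j. j < n ==> s j \<in> vecs A r" "!!j. j < n ==> (%i. e i j) = lincomb r (s j) g" by metis
  define sm where "sm = (%k j. if j < n then s j k else 0)"
  have sm: "sm \<in> mats A r n" using s(1) by (auto simp: sm_def mats_def vecs_def)
  have gs: "mm r gm sm = e"
  proof (intro ext)
    fix i j
    show "mm r gm sm i j = e i j"
    proof (cases "j < n")
      case True
      then show ?thesis using fun_cong[OF s(2)[OF True], of i] by (simp add: mm_def sm_def lin_gm)
    next
      case False
      then show ?thesis using e by (simp add: mm_def sm_def mats_def)
    qed
  qed
  \<comment> \<open>The section \<open>sm\<close>, made to factor through \<open>e\<close>: then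
    \<open>gm t = e\<close> and \<open>t e = t\<close>, which makes \<open>t gm\<close>
    idempotent.\<close>
  define t where "t = mm n sm e"
  have t: "t \<in> mats A r n" unfolding t_def by (rule mm_mats[OF sm e])
  have te: "mm n t e = t" by (simp add: t_def mm_assoc ee)
  have gt: "mm r gm t = e" by (simp add: t_def mm_assoc[symmetric] gs ee)
  define f where "f = mm n t gm"
  have f: "f \<in> mats A r r" unfolding f_def by (rule mm_mats[OF t gm])
  have ft: "mm r f t = t" by (simp add: f_def mm_assoc gt te)
  have gf: "mm r gm f = gm" by (simp add: f_def mm_assoc[symmetric] gt egm)
  have ff: "mm r f f = f" using ft by (simp add: f_def mm_assoc[symmetric])
  define e1 where "e1 = (%i j. idm r i j - f i j)"
  have e1: "e1 \<in> mats A r r" unfolding e1_def by (rule diff_mats[OF idm_mats f])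
  have e1e1: "mm r e1 e1 = e1"
    unfolding e1_def mm_diff_left mm_diff_right
    by (simp add: mm_idm_left[OF f] mm_idm_right[OF f] mm_idm_left[OF idm_mats] ff)
  have ge1: "mm r gm e1 = (%_ _. 0)"
    unfolding e1_def mm_diff_right by (simp add: mm_idm_right[OF gm] gf)
  have e1t: "mm r e1 t = (%_ _. 0)"
    unfolding e1_def mm_diff_left by (simp add: mm_idm_left[OF t] ft)
  have "rels A r g = fixed_vecs A r e1"
  proof (intro Set.set_eqI iffI)
    have e1v: "(\<Sum>j<r. e1 i j * c j) = c i - (\<Sum>j<r. f i j * c j)" if "c \<in> vecs A r" for c i
    proof -
      have "(\<Sum>j<r. idm r i j * c j) = (\<Sum>j<r. if j = i then c j else 0)"
        by (intro sum.cong) (auto simp: idm_def)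
      also have "\<dots> = c i" using that by (auto simp: vecs_def)
      finally show ?thesis by (simp add: e1_def left_diff_distrib sum_subtractf)
    qed
    fix c
    { assume "c \<in> rels A r g"
      then have c: "c \<in> vecs A r" and c0: "!!i. (\<Sum>k<r. gm i k * c k) = 0"
        by (auto simp: rels_def fun_eq_iff lin_gm)
      have "(\<Sum>j<r. f i j * c j) = 0" for i
      proof -
        have "(\<Sum>j<r. f i j * c j) = (\<Sum>j<r. \<Sum>k<n. t i k * (gm k j * c j))"
          by (simp add: f_def mm_def sum_distrib_right mult.assoc)
        also have "\<dots> = (\<Sum>k<n. \<Sum>j<r. t i k * (gm k j * c j))" by (rule sum.swap)
        also have "\<dots> = 0" by (simp add: sum_distrib_left[symmetric] c0)
        finally show ?thesis .
      qed
      then show "c \<in> fixed_vecs A r e1" using c by (simp add: fixed_vecs_def e1v) }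
    { assume "c \<in> fixed_vecs A r e1"
      then have c: "c \<in> vecs A r" and c0: "!!i. (\<Sum>j<r. f i j * c j) = 0"
        using e1v[of c] by (auto simp: fixed_vecs_def fun_eq_iff)
      have "(\<Sum>k<r. gm i k * c k) = 0" for i
      proof -
        have "(\<Sum>k<r. gm i k * c k) = (\<Sum>k<r. \<Sum>j<r. gm i j * (f j k * c k))"
          using fun_cong[OF fun_cong[OF gf, of i]] by (simp add: mm_def sum_distrib_right[symmetric] mult.assoc[symmetric])
        also have "\<dots> = (\<Sum>j<r. \<Sum>k<r. gm i j * (f j k * c k))" by (rule sum.swap)
        also have "\<dots> = 0" by (simp add: sum_distrib_left[symmetric] c0)
        finally show ?thesis .
      qed
      then show "c \<in> rels A r g" using c by (simp add: rels_def fun_eq_iff lin_gm) }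
  qed
  from step.IH[OF e1 e1e1 this] obtain b c a1 a2 a3 a4 where a: "a1 \<in> mats A r c" "a2 \<in> mats A b c"
      "a3 \<in> mats A c r" "a4 \<in> mats A c b"
    and a13: "mm c a1 a3 = e1" and a14: "mm c a1 a4 = (%_ _. 0)" and a23: "mm c a2 a3 = (%_ _. 0)"
    and a24: "mm c a2 a4 = idm b" and a31: "(%i j. mm r a3 a1 i j + mm b a4 a2 i j) = idm c"
    unfolding stably_free_def by (elim exE conjE) (rule that)
  \<comment> \<open>The columns of \<open>a1\<close> lie in the image of \<open>e1\<close>, which
    \<open>gm\<close> kills.\<close>
  have ga1: "mm r gm a1 = (%_ _. 0)"
  proof -
    have "a1 = mm c a1 (idm c)" by (simp add: mm_idm_right[OF a(1)])
    also have "\<dots> = mm r e1 a1" unfolding a31[symmetric] mm_add_right mm_assoc[symmetric] a13 a14 by simp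
    finally have "mm r gm a1 = mm r (mm r gm e1) a1" by (metis mm_assoc)
    then show ?thesis by (simp add: ge1)
  qed
  have a3t: "mm r a3 t = (%_ _. 0)"
  proof -
    have "a3 = mm c (idm c) a3" by (simp add: mm_idm_left[OF a(3)])
    also have "\<dots> = mm r a3 e1" unfolding a31[symmetric] mm_add_left mm_assoc a13 a23 by simp
    finally have "mm r a3 t = mm r a3 (mm r e1 t)" by (metis mm_assoc)
    then show ?thesis by (simp add: e1t)
  qed
  \<comment> \<open>The summands trade places: what the induction gave as
    \<open>im e1 \<oplus> A^b\<close> becomes the free part of rank \<open>c\<close> of the new
    isomorphism.\<close>
  define A2 where "A2 = (%i k. if k < r then a3 i k else a4 i (k - r))"
  define A4 where "A4 = (%k j. if k < r then a1 k j else a2 (k - r) j)"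
  have sum_split: "mm (r + b) x y i j = mm r x y i j + (\<Sum>k<b. x i (r + k) * y (r + k) j)" for x y :: "nat => nat => 'b" and i j
    by (simp add: mm_def sum_lessThan_add)
  have gm0: "gm i (r + k) = 0" and t0: "t (r + k) j = 0" for i j k using t by (simp_all add: gm_def mats_def)
  have cong_r: "mm r x y = mm r x' y'" if "!!i k. k < r ==> x i k = x' i k" "!!j k. k < r ==> y k j = y' k j"
    for x y x' y' :: "nat => nat => 'b" using that by (simp add: mm_def)
  show ?case unfolding stably_free_def
  proof (intro exI conjI)
    show "gm \<in> mats A n (r + b)" using gm by (auto simp: mats_def)
    have "A2 i j = 0" if "\<not> (i < c \<and> j < r + b)" for i j
    proof (cases "j < r")
      case True
      then show ?thesis using a(3) that by (simp add: A2_def mats_def)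
    next
      case False
      then have "\<not> (i < c \<and> j - r < b)" using that by auto
      then show ?thesis using a(4) False by (simp add: A2_def mats_def)
    qed
    moreover have "A2 i j \<in> A" for i j using a(3,4) by (simp add: mats_def A2_def)
    ultimately show "A2 \<in> mats A c (r + b)" by (simp add: mats_def)
    show "t \<in> mats A (r + b) n" using t by (auto simp: mats_def)
    have "A4 i j = 0" if "\<not> (i < r + b \<and> j < c)" for i j
    proof (cases "i < r")
      case True
      then show ?thesis using a(1) that by (simp add: A4_def mats_def)
    next
      case False
      then have "\<not> (i - r < b \<and> j < c)" using that by auto
      then show ?thesis using a(2) False by (simp add: A4_def mats_def)
    qed
    moreover have "A4 i j \<in> A" for i j using a(1,2) by (simp add: mats_def A4_def)
    ultimately show "A4 \<in> mats A (r + b) c" by (simp add: mats_def)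
    show "mm (r + b) gm t = e"
      by (intro ext) (simp add: sum_split gm0 fun_cong[OF fun_cong[OF gt]])
    have "mm r gm A4 = mm r gm a1" by (rule cong_r) (simp_all add: A4_def)
    then show "mm (r + b) gm A4 = (%_ _. 0)" by (intro ext) (simp add: sum_split gm0 ga1)
    have "mm r A2 t = mm r a3 t" by (rule cong_r) (simp_all add: A2_def)
    then show "mm (r + b) A2 t = (%_ _. 0)" by (intro ext) (simp add: sum_split t0 a3t)
    have "mm r A2 A4 = mm r a3 a1" by (rule cong_r) (simp_all add: A2_def A4_def)
    then have "mm (r + b) A2 A4 = (%i j. mm r a3 a1 i j + mm b a4 a2 i j)"
      by (intro ext) (simp only: sum_split, simp add: A2_def A4_def mm_def[of b])
    then show "mm (r + b) A2 A4 = idm c" by (simp add: a31)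
    show "(%i j. mm n t gm i j + mm c A4 A2 i j) = idm (r + b)"
    proof (intro ext)
      fix i j
      have f_0: "f i j = 0" if "\<not> (i < r \<and> j < r)" using f that by (simp add: mats_def)
      consider "i < r" "j < r" | "i < r" "j \<ge> r" | "i \<ge> r" "j < r" | "i \<ge> r" "j \<ge> r" by linarith
      then show "mm n t gm i j + mm c A4 A2 i j = idm (r + b) i j"
      proof cases
        case 1
        then have "mm c A4 A2 i j = mm c a1 a3 i j" by (simp add: mm_def A4_def A2_def)
        then show ?thesis using 1 by (simp add: a13 e1_def f_def[symmetric] idm_def)
      next
        case 2
        then have "mm c A4 A2 i j = mm c a1 a4 i (j - r)" by (simp add: mm_def A4_def A2_def)
        then show ?thesis using 2 f_0 by (simp add: a14 f_def[symmetric] idm_def)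
      next
        case 3
        then have "mm c A4 A2 i j = mm c a2 a3 (i - r) j" by (simp add: mm_def A4_def A2_def)
        then show ?thesis using 3 f_0 by (simp add: a23 f_def[symmetric] idm_def)
      next
        case 4
        then have "mm c A4 A2 i j = mm c a2 a4 (i - r) (j - r)" by (simp add: mm_def A4_def A2_def)
        then show ?thesis using 4 f_0 by (auto simp: a24 f_def[symmetric] idm_def)
      qed
    qed
  qed
qed

text \<open>The image of \<open>e\<close> is the solution set of a linear system, and nonzero
  constants cancel, so it is saturated. No indeterminate from \<open>m\<close> on occurs, so the
  exponents there are bounded by zero.\<close>

lemma idempotent_stably_free:
  fixes e :: "nat => nat => 'v::valuation_domain pl"
  assumes e: "e \<in> mats (polys m) n n" and ee: "mm n e e = e"
  shows "stably_free (polys m) n e"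
proof -
  interpret unital_subring "polys m :: 'v pl set" by (rule polys_subring)
  let ?N = "fixed_vecs (polys m) n e"
  have "ffr (polys m) ?N"
  proof (rule ffr_saturated)
    show "submod (polys m) ?N"
      unfolding submod_def
    proof (intro conjI ballI)
      show "(%_. 0) \<in> ?N" by (simp add: fixed_vecs_def)
      show "(%i. v i + w i) \<in> ?N" if "v \<in> ?N" "w \<in> ?N" for v w
        using that by (auto simp: fixed_vecs_def vecs_def distrib_left sum.distrib fun_eq_iff)
      show "(%i. a * v i) \<in> ?N" if "a \<in> polys m" "v \<in> ?N" for a v
        using that by (auto simp: fixed_vecs_def vecs_def mult.left_commute[of _ a] sum_distrib_left[symmetric] fun_eq_iff)
    qed
    show "saturated ?N"
      unfolding saturated_def
    proof (intro allI impI)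
      fix c :: 'v and v assume c: "c \<noteq> 0" and "(%i. monom {#} c * v i) \<in> ?N"
      then have vv: "!!i. monom {#} c * v i \<in> polys m" "!!i. i \<ge> n ==> monom {#} c * v i = 0"
        and ev: "!!i. (\<Sum>j<n. e i j * (monom {#} c * v j)) = monom {#} c * v i"
        by (auto simp: fixed_vecs_def vecs_def fun_eq_iff)
      have cancel: "p = q" if "monom {#} c * p = monom {#} c * q" for p q :: "'v pl"
      proof (rule poly_mapping_eqI)
        fix \<mu>
        have "c * lookup p \<mu> = c * lookup q \<mu>" unfolding lookup_const_mult[symmetric] that ..
        then show "lookup p \<mu> = lookup q \<mu>" using c by simp
      qed
      have "v i \<in> polys m" for i using vv(1)[of i] c by (simp add: polys_def supp_const_mult_eq)
      moreover have "v i = 0" if "i \<ge> n" for i by (rule cancel) (use vv(2)[OF that] in simp)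
      moreover have "(\<Sum>j<n. e i j * v j) = v i" for i
        by (rule cancel) (use ev[of i] in \<open>simp add: sum_distrib_left mult.left_commute\<close>)
      ultimately show "v \<in> ?N" by (auto simp: fixed_vecs_def vecs_def)
    qed
    show "?N \<subseteq> bounded_vecs m n m 0"
    proof
      fix v assume "v \<in> ?N"
      then have v: "!!i. v i \<in> polys m" "!!i. i \<ge> n ==> v i = 0" by (auto simp: fixed_vecs_def vecs_def)
      have "count \<mu> k \<le> 0" if "\<mu> \<in> supp (v i)" "k \<ge> m" for i \<mu> k
        using v(1)[of i] that by (fastforce simp: polys_def not_in_iff[symmetric])
      then show "v \<in> bounded_vecs m n m 0" using v by (auto simp: bounded_vecs_def polys_def)
    qed
  qed
  from ffr_stably_free[OF this e ee refl] show ?thesis .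
qed

section \<open>Polynomials over rings of continuous functions\<close>

text \<open>Homomorphisms from a ring record to a ring given by a type class; evaluation at a point
  and passage to germs both have this form.\<close>

definition type_hom :: "('r, 'k) ring_scheme => ('r => 'w::comm_ring_1) => bool" where
  "type_hom R \<phi> \<longleftrightarrow> (\<forall>a\<in>carrier R. \<forall>b\<in>carrier R. \<phi> (a \<oplus>\<^bsub>R\<^esub> b) = \<phi> a + \<phi> b \<and> \<phi> (a \<otimes>\<^bsub>R\<^esub> b) = \<phi> a * \<phi> b) \<and>
     \<phi> \<zero>\<^bsub>R\<^esub> = 0 \<and> \<phi> \<one>\<^bsub>R\<^esub> = 1"

lemma type_homD:
  assumes "type_hom R \<phi>"
  shows "a \<in> carrier R ==> b \<in> carrier R ==> \<phi> (a \<oplus>\<^bsub>R\<^esub> b) = \<phi> a + \<phi> b"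
    "a \<in> carrier R ==> b \<in> carrier R ==> \<phi> (a \<otimes>\<^bsub>R\<^esub> b) = \<phi> a * \<phi> b"
    "\<phi> \<zero>\<^bsub>R\<^esub> = 0" "\<phi> \<one>\<^bsub>R\<^esub> = 1"
  using assms by (auto simp: type_hom_def)

lemma type_hom_finsum:
  assumes "abelian_monoid R" "type_hom R \<phi>" "finite I" "!!i. i \<in> I ==> f i \<in> carrier R"
  shows "\<phi> (finsum R f I) = (\<Sum>i\<in>I. \<phi> (f i))"
  using assms(3,4)
proof (induction I)
  case empty
  then show ?case using type_homD(3)[OF assms(2)] by (simp add: abelian_monoid.finsum_empty[OF assms(1)])
next
  case (insert i I)
  interpret abelian_monoid R by fact
  have "finsum R f I \<in> carrier R" using insert.prems by (intro finsum_closed) auto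
  then show ?case using insert type_homD[OF assms(2)] by (simp add: Pi_def)
qed

text \<open>The ring laws are tested under a jointly injective family of homomorphisms; closure and
  the existence of negatives are left to be verified in \<open>S\<close>.\<close>

lemma cring_by_homs:
  fixes S :: "('s, 'l) ring_scheme" and H :: "'i => 's => 'w::comm_ring_1"
  assumes closed: "\<zero>\<^bsub>S\<^esub> \<in> carrier S" "\<one>\<^bsub>S\<^esub> \<in> carrier S"
    "!!a b. a \<in> carrier S ==> b \<in> carrier S ==> a \<oplus>\<^bsub>S\<^esub> b \<in> carrier S"
    "!!a b. a \<in> carrier S ==> b \<in> carrier S ==> a \<otimes>\<^bsub>S\<^esub> b \<in> carrier S"
    "!!a. a \<in> carrier S ==> \<exists>b\<in>carrier S. b \<oplus>\<^bsub>S\<^esub> a = \<zero>\<^bsub>S\<^esub>"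
    and H: "!!k. k \<in> K ==> type_hom S (H k)"
    and inj: "!!a b. a \<in> carrier S ==> b \<in> carrier S ==> (!!k. k \<in> K ==> H k a = H k b) ==> a = b"
  shows "cring S"
proof (rule cringI)
  note hom = type_homD[OF H]
  show "abelian_group S"
    by (rule abelian_groupI) (use closed in \<open>auto intro!: inj simp: hom algebra_simps\<close>)
  show "Group.comm_monoid S"
    by (rule comm_monoidI) (use closed in \<open>auto intro!: inj simp: hom algebra_simps\<close>)
  show "(x \<oplus>\<^bsub>S\<^esub> y) \<otimes>\<^bsub>S\<^esub> z = x \<otimes>\<^bsub>S\<^esub> z \<oplus>\<^bsub>S\<^esub> y \<otimes>\<^bsub>S\<^esub> z"
    if "x \<in> carrier S" "y \<in> carrier S" "z \<in> carrier S" for x y z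
    by (rule inj) (use that closed in \<open>auto simp: hom algebra_simps\<close>)
qed

section \<open>Polynomial records as finitely supported coefficient functions\<close>

context cring
begin

text \<open>Single monomials arise from constants by repeated multiplication with indeterminates,
  and a function with finite support is reached by adding one monomial at a time.\<close>

lemma indexed_pset_iff:
  "p \<in> indexed_pset I (carrier R) \<longleftrightarrow>
    (\<forall>\<mu>. p \<mu> \<in> carrier R) \<and> finite {\<mu>. p \<mu> \<noteq> \<zero>} \<and> (\<forall>\<mu>. p \<mu> \<noteq> \<zero> \<longrightarrow> set_mset \<mu> \<subseteq> I)"
proof
  assume "p \<in> indexed_pset I (carrier R)"
  then show "(\<forall>\<mu>. p \<mu> \<in> carrier R) \<and> finite {\<mu>. p \<mu> \<noteq> \<zero>} \<and> (\<forall>\<mu>. p \<mu> \<noteq> \<zero> \<longrightarrow> set_mset \<mu> \<subseteq> I)"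
  proof induction
    case (indexed_const k)
    have "{\<mu>. indexed_const k \<mu> \<noteq> \<zero>} \<subseteq> {{#}}" by (auto simp: indexed_const_def)
    then have "finite {\<mu>. indexed_const k \<mu> \<noteq> \<zero>}" by (rule finite_subset) simp
    then show ?case using indexed_const by (auto simp: indexed_const_def)
  next
    case (indexed_padd P Q)
    have "{\<mu>. indexed_padd P Q \<mu> \<noteq> \<zero>} \<subseteq> {\<mu>. P \<mu> \<noteq> \<zero>} \<union> {\<mu>. Q \<mu> \<noteq> \<zero>}"
      by (auto simp: indexed_padd_def)
    then have "finite {\<mu>. indexed_padd P Q \<mu> \<noteq> \<zero>}"
      by (rule finite_subset) (use indexed_padd.IH in blast)
    moreover have "set_mset \<mu> \<subseteq> I" if "indexed_padd P Q \<mu> \<noteq> \<zero>" for \<mu>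
    proof -
      have "P \<mu> \<noteq> \<zero> \<or> Q \<mu> \<noteq> \<zero>" using that by (auto simp: indexed_padd_def)
      then show ?thesis using indexed_padd.IH by blast
    qed
    moreover have "indexed_padd P Q \<mu> \<in> carrier R" for \<mu> using indexed_padd.IH by (simp add: indexed_padd_def)
    ultimately show ?case by blast
  next
    case (indexed_pmult P i)
    have "{\<mu>. indexed_pmult P i \<mu> \<noteq> \<zero>} \<subseteq> add_mset i ` {\<mu>. P \<mu> \<noteq> \<zero>}"
    proof
      fix \<mu> assume "\<mu> \<in> {\<mu>. indexed_pmult P i \<mu> \<noteq> \<zero>}"
      then have "i \<in># \<mu>" "P (\<mu> - {#i#}) \<noteq> \<zero>" by (auto simp: indexed_pmult_def split: if_splits)
      then show "\<mu> \<in> add_mset i ` {\<mu>. P \<mu> \<noteq> \<zero>}" by (intro image_eqI[of _ _ "\<mu> - {#i#}"]) simp_all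
    qed
    then have "finite {\<mu>. indexed_pmult P i \<mu> \<noteq> \<zero>}"
      by (rule finite_subset) (use indexed_pmult.IH in blast)
    moreover have "set_mset \<mu> \<subseteq> I" if "indexed_pmult P i \<mu> \<noteq> \<zero>" for \<mu>
    proof -
      have i: "i \<in># \<mu>" "P (\<mu> - {#i#}) \<noteq> \<zero>" using that by (auto simp: indexed_pmult_def split: if_splits)
      then have "set_mset (\<mu> - {#i#}) \<subseteq> I" using indexed_pmult.IH by blast
      moreover have "\<mu> = add_mset i (\<mu> - {#i#})" using i by simp
      ultimately show ?thesis using indexed_pmult.hyps(2) by (metis insert_subset set_mset_add_mset_insert)
    qed
    moreover have "indexed_pmult P i \<mu> \<in> carrier R" for \<mu> using indexed_pmult.IH by (simp add: indexed_pmult_def)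
    ultimately show ?case by blast
  qed
next
  have mono: "(%\<nu>. if \<nu> = \<mu> then k else \<zero>) \<in> indexed_pset I (carrier R)"
    if "k \<in> carrier R" "set_mset \<mu> \<subseteq> I" for k \<mu>
    using that(2)
  proof (induction \<mu>)
    case empty
    have "indexed_const k \<in> indexed_pset I (carrier R)" using that(1) by (rule indexed_pset.indexed_const)
    then show ?case by (simp add: indexed_const_def)
  next
    case (add i \<mu>)
    have "(%\<nu>. if \<nu> = add_mset i \<mu> then k else \<zero>) = indexed_pmult (%\<nu>. if \<nu> = \<mu> then k else \<zero>) i"
      by (auto simp: indexed_pmult_def fun_eq_iff)
    then show ?case using add by (auto intro!: indexed_pset.indexed_pmult)
  qed
  have fin: "\<forall>p. (\<forall>\<mu>. p \<mu> \<in> carrier R) \<and> {\<mu>. p \<mu> \<noteq> \<zero>} \<subseteq> M \<and> (\<forall>\<mu>\<in>M. set_mset \<mu> \<subseteq> I) \<longrightarrow> p \<in> indexed_pset I (carrier R)"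
    if "finite M" for M
    using that
  proof (induction M)
    case empty
    have "indexed_const \<zero> \<in> indexed_pset I (carrier R)" by (rule indexed_pset.indexed_const) simp
    then have "(%_. \<zero>) \<in> indexed_pset I (carrier R)" by (simp only: indexed_zero_def)
    moreover have "p = (%_. \<zero>)" if "{\<mu>. p \<mu> \<noteq> \<zero>} \<subseteq> {}" for p :: "'c multiset => 'a" using that by blast
    ultimately show ?case by auto
  next
    case (insert \<mu> M)
    show ?case
    proof (intro allI impI)
      fix p assume p: "(\<forall>\<mu>. p \<mu> \<in> carrier R) \<and> {\<mu>. p \<mu> \<noteq> \<zero>} \<subseteq> insert \<mu> M \<and> (\<forall>\<mu>\<in>insert \<mu> M. set_mset \<mu> \<subseteq> I)"
      let ?q = "%\<nu>. if \<nu> = \<mu> then \<zero> else p \<nu>"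
      have q1: "?q \<in> indexed_pset I (carrier R)"
        by (rule insert.IH[rule_format]) (use p in auto)
      have q2: "(%\<nu>. if \<nu> = \<mu> then p \<mu> else \<zero>) \<in> indexed_pset I (carrier R)" using p by (intro mono) auto
      have eq: "indexed_padd ?q (%\<nu>. if \<nu> = \<mu> then p \<mu> else \<zero>) = p"
        using p by (auto simp: indexed_padd_def fun_eq_iff)
      show "p \<in> indexed_pset I (carrier R)"
        using indexed_pset.indexed_padd[OF q1 q2] unfolding eq .
    qed
  qed
  assume "(\<forall>\<mu>. p \<mu> \<in> carrier R) \<and> finite {\<mu>. p \<mu> \<noteq> \<zero>} \<and> (\<forall>\<mu>. p \<mu> \<noteq> \<zero> \<longrightarrow> set_mset \<mu> \<subseteq> I)"
  then show "p \<in> indexed_pset I (carrier R)" using fin[of "{\<mu>. p \<mu> \<noteq> \<zero>}"] by simp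
qed

lemma mpoly_simps:
  "\<zero>\<^bsub>mpoly_ring R m\<^esub> = (%_. \<zero>)" "\<one>\<^bsub>mpoly_ring R m\<^esub> = (%\<mu>. if \<mu> = {#} then \<one> else \<zero>)"
  "p \<oplus>\<^bsub>mpoly_ring R m\<^esub> q = (%\<mu>. p \<mu> \<oplus> q \<mu>)"
  "p \<otimes>\<^bsub>mpoly_ring R m\<^esub> q = (%\<mu>. \<Oplus>\<nu>\<in>{\<nu>. \<nu> \<subseteq># \<mu>}. p \<nu> \<otimes> q (\<mu> - \<nu>))"
  by (simp_all add: mpoly_ring_def indexed_zero_def indexed_const_def[abs_def] indexed_padd_def)

lemma mpoly_carrier_iff:
  "p \<in> carrier (mpoly_ring R m) \<longleftrightarrow>
    (\<forall>\<mu>. p \<mu> \<in> carrier R) \<and> finite {\<mu>. p \<mu> \<noteq> \<zero>} \<and> (\<forall>\<mu>. p \<mu> \<noteq> \<zero> \<longrightarrow> set_mset \<mu> \<subseteq> {..<m})"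
  by (simp add: mpoly_ring_def indexed_pset_iff)

lemma mpoly_carrierD:
  assumes "p \<in> carrier (mpoly_ring R m)"
  shows "p \<mu> \<in> carrier R" "finite {\<mu>. p \<mu> \<noteq> \<zero>}" "p \<mu> \<noteq> \<zero> ==> set_mset \<mu> \<subseteq> {..<m}"
  using assms by (auto simp: mpoly_carrier_iff)

lemma mpoly_const: "a \<in> carrier R ==> indexed_const a \<in> carrier (mpoly_ring R m)"
  by (simp add: mpoly_ring_def indexed_pset.indexed_const)

lemma mpoly_add_closed:
  assumes p: "p \<in> carrier (mpoly_ring R m)" and q: "q \<in> carrier (mpoly_ring R m)"
  shows "p \<oplus>\<^bsub>mpoly_ring R m\<^esub> q \<in> carrier (mpoly_ring R m)"
  using assms indexed_pset.indexed_padd[of p "{..<m}" "carrier R" q] by (simp add: mpoly_ring_def)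

lemma mpoly_mult_closed:
  assumes p: "p \<in> carrier (mpoly_ring R m)" and q: "q \<in> carrier (mpoly_ring R m)"
  shows "p \<otimes>\<^bsub>mpoly_ring R m\<^esub> q \<in> carrier (mpoly_ring R m)"
proof -
  let ?r = "p \<otimes>\<^bsub>mpoly_ring R m\<^esub> q"
  note pD = mpoly_carrierD[OF p] and qD = mpoly_carrierD[OF q]
  have nz: "\<exists>\<nu>. \<nu> \<subseteq># \<mu> \<and> p \<nu> \<noteq> \<zero> \<and> q (\<mu> - \<nu>) \<noteq> \<zero>" if "?r \<mu> \<noteq> \<zero>" for \<mu>
  proof (rule ccontr)
    assume "\<not> ?thesis"
    then have "p \<nu> \<otimes> q (\<mu> - \<nu>) = \<zero>" if "\<nu> \<subseteq># \<mu>" for \<nu>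
      using that pD(1)[of \<nu>] qD(1)[of "\<mu> - \<nu>"] by (cases "p \<nu> = \<zero>") auto
    then have "?r \<mu> = (\<Oplus>\<nu>\<in>{\<nu>. \<nu> \<subseteq># \<mu>}. \<zero>)" unfolding mpoly_simps by (intro finsum_cong') auto
    also have "\<dots> = \<zero>" by (rule finsum_zero)
    finally show False using that by contradiction
  qed
  have "{\<mu>. ?r \<mu> \<noteq> \<zero>} \<subseteq> (%(a, b). a + b) ` ({\<mu>. p \<mu> \<noteq> \<zero>} \<times> {\<mu>. q \<mu> \<noteq> \<zero>})"
  proof
    fix \<mu> assume "\<mu> \<in> {\<mu>. ?r \<mu> \<noteq> \<zero>}"
    then obtain \<nu> where "\<nu> \<subseteq># \<mu>" "p \<nu> \<noteq> \<zero>" "q (\<mu> - \<nu>) \<noteq> \<zero>" using nz by blast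
    then show "\<mu> \<in> (%(a, b). a + b) ` ({\<mu>. p \<mu> \<noteq> \<zero>} \<times> {\<mu>. q \<mu> \<noteq> \<zero>})"
      by (intro image_eqI[of _ _ "(\<nu>, \<mu> - \<nu>)"]) (auto simp: subset_mset.add_diff_inverse)
  qed
  then have "finite {\<mu>. ?r \<mu> \<noteq> \<zero>}" by (rule finite_subset) (use pD(2) qD(2) in simp)
  moreover have "set_mset \<mu> \<subseteq> {..<m}" if r: "?r \<mu> \<noteq> \<zero>" for \<mu>
  proof -
    obtain \<nu> where n: "\<nu> \<subseteq># \<mu>" "p \<nu> \<noteq> \<zero>" "q (\<mu> - \<nu>) \<noteq> \<zero>" using nz[OF r] by blast
    have "\<mu> = \<nu> + (\<mu> - \<nu>)" using n(1) by (simp add: subset_mset.add_diff_inverse)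
    then have "set_mset \<mu> = set_mset \<nu> \<union> set_mset (\<mu> - \<nu>)" by (metis set_mset_union)
    then show ?thesis using pD(3)[OF n(2)] qD(3)[OF n(3)] by simp
  qed
  moreover have "?r \<mu> \<in> carrier R" for \<mu> unfolding mpoly_simps using pD(1) qD(1) by (intro finsum_closed) auto
  ultimately show ?thesis by (simp add: mpoly_carrier_iff)
qed

end

definition mlift :: "('r => 'w::comm_ring_1) => (nat multiset => 'r) => 'w pl" where
  "mlift \<phi> p = Abs_poly_mapping (%\<mu>. \<phi> (p \<mu>))"

lemma lookup_mlift:
  assumes "cring R" "type_hom R \<phi>" "p \<in> carrier (mpoly_ring R m)"
  shows "lookup (mlift \<phi> p) \<mu> = \<phi> (p \<mu>)"
proof -
  have "{\<mu>. \<phi> (p \<mu>) \<noteq> 0} \<subseteq> {\<mu>. p \<mu> \<noteq> \<zero>\<^bsub>R\<^esub>}" using type_homD(3)[OF assms(2)] by auto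
  then have "finite {\<mu>. \<phi> (p \<mu>) \<noteq> 0}"
    using finite_subset cring.mpoly_carrierD(2)[OF assms(1,3)] by blast
  then show ?thesis by (simp add: mlift_def lookup_Abs_poly_mapping)
qed

lemma mlift_polys:
  assumes "cring R" "type_hom R \<phi>" "p \<in> carrier (mpoly_ring R m)"
  shows "mlift \<phi> p \<in> polys m"
proof -
  have "set_mset \<mu> \<subseteq> {..<m}" if "\<mu> \<in> supp (mlift \<phi> p)" for \<mu>
  proof -
    have "\<phi> (p \<mu>) \<noteq> 0" using that by (simp add: in_keys_iff lookup_mlift[OF assms])
    then have "p \<mu> \<noteq> \<zero>\<^bsub>R\<^esub>" using type_homD(3)[OF assms(2)] by auto
    then show ?thesis by (rule cring.mpoly_carrierD(3)[OF assms(1,3)])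
  qed
  then show ?thesis by (simp add: polys_def)
qed

lemma mlift_hom:
  assumes R: "cring R" and \<phi>: "type_hom R \<phi>"
  shows "type_hom (mpoly_ring R m) (mlift \<phi>)"
proof -
  interpret cring R by fact
  note lk = lookup_mlift[OF R \<phi>, of _ m]
  have z: "(%_. \<zero>\<^bsub>R\<^esub>) \<in> carrier (mpoly_ring R m)" using mpoly_const[of "\<zero>\<^bsub>R\<^esub>" m] by (simp add: indexed_zero_def)
  have o: "(%\<mu>. if \<mu> = {#} then \<one>\<^bsub>R\<^esub> else \<zero>\<^bsub>R\<^esub>) \<in> carrier (mpoly_ring R m)"
    using mpoly_const[of "\<one>\<^bsub>R\<^esub>" m] by (simp add: indexed_const_def[abs_def])
  show ?thesis
    unfolding type_hom_def
  proof (intro conjI ballI)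
    show "mlift \<phi> \<zero>\<^bsub>mpoly_ring R m\<^esub> = 0"
      by (rule poly_mapping_eqI) (simp add: mpoly_simps lk[OF z] type_homD[OF \<phi>])
    show "mlift \<phi> \<one>\<^bsub>mpoly_ring R m\<^esub> = 1"
      by (rule poly_mapping_eqI) (simp add: mpoly_simps lk[OF o] type_homD[OF \<phi>] lookup_one when_def)
    fix p q assume p: "p \<in> carrier (mpoly_ring R m)" and q: "q \<in> carrier (mpoly_ring R m)"
    show "mlift \<phi> (p \<oplus>\<^bsub>mpoly_ring R m\<^esub> q) = mlift \<phi> p + mlift \<phi> q"
      using mpoly_carrierD(1)[OF p] mpoly_carrierD(1)[OF q]
      by (intro poly_mapping_eqI) (simp add: lk[OF mpoly_add_closed[OF p q]] lookup_add lk[OF p] lk[OF q],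
          simp add: mpoly_simps type_homD[OF \<phi>])
    show "mlift \<phi> (p \<otimes>\<^bsub>mpoly_ring R m\<^esub> q) = mlift \<phi> p * mlift \<phi> q"
    proof (rule poly_mapping_eqI)
      fix \<mu>
      have "lookup (mlift \<phi> (p \<otimes>\<^bsub>mpoly_ring R m\<^esub> q)) \<mu> = \<phi> (\<Oplus>\<^bsub>R\<^esub>\<nu>\<in>{\<nu>. \<nu> \<subseteq># \<mu>}. p \<nu> \<otimes>\<^bsub>R\<^esub> q (\<mu> - \<nu>))"
        by (simp add: lk[OF mpoly_mult_closed[OF p q]]) (simp add: mpoly_simps)
      also have "\<dots> = (\<Sum>\<nu>\<in>{\<nu>. \<nu> \<subseteq># \<mu>}. \<phi> (p \<nu> \<otimes>\<^bsub>R\<^esub> q (\<mu> - \<nu>)))"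
        using mpoly_carrierD(1)[OF p] mpoly_carrierD(1)[OF q] finite_submsets
        by (intro type_hom_finsum abelian_monoid_axioms \<phi>) auto
      also have "\<dots> = lookup (mlift \<phi> p * mlift \<phi> q) \<mu>"
        using mpoly_carrierD(1)[OF p] mpoly_carrierD(1)[OF q]
        by (simp add: lookup_times lk[OF p] lk[OF q] type_homD[OF \<phi>])
      finally show "lookup (mlift \<phi> (p \<otimes>\<^bsub>mpoly_ring R m\<^esub> q)) \<mu> = lookup (mlift \<phi> p * mlift \<phi> q) \<mu>" .
    qed
  qed
qed

text \<open>Coefficients are lifted one by one, with zero lifted to zero so that the support stays
  finite.\<close>

lemma mlift_surj:
  assumes R: "cring R" and \<phi>: "type_hom R \<phi>" and surj: "\<phi> ` carrier R = UNIV" and P: "P \<in> polys m"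
  shows "\<exists>p\<in>carrier (mpoly_ring R m). mlift \<phi> p = P \<and> (P = 0 \<longrightarrow> p = \<zero>\<^bsub>mpoly_ring R m\<^esub>)"
proof -
  interpret cring R by fact
  have "\<forall>c. \<exists>a\<in>carrier R. \<phi> a = c" using surj by (metis UNIV_I imageE)
  then obtain r where r: "!!c. r c \<in> carrier R" "!!c. \<phi> (r c) = c" by metis
  define p where "p \<mu> = (if lookup P \<mu> = 0 then \<zero>\<^bsub>R\<^esub> else r (lookup P \<mu>))" for \<mu>
  have "{\<mu>. p \<mu> \<noteq> \<zero>\<^bsub>R\<^esub>} \<subseteq> supp P" by (auto simp: p_def in_keys_iff)
  then have "finite {\<mu>. p \<mu> \<noteq> \<zero>\<^bsub>R\<^esub>}" by (rule finite_subset) simp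
  moreover have "set_mset \<mu> \<subseteq> {..<m}" if "p \<mu> \<noteq> \<zero>\<^bsub>R\<^esub>" for \<mu>
    using P that by (auto simp: p_def polys_def in_keys_iff split: if_splits)
  moreover have "p \<mu> \<in> carrier R" for \<mu> using r by (simp add: p_def)
  ultimately have pc: "p \<in> carrier (mpoly_ring R m)" by (simp add: mpoly_carrier_iff)
  moreover have "mlift \<phi> p = P"
    using type_homD(3)[OF \<phi>] r(2) by (intro poly_mapping_eqI) (simp add: lookup_mlift[OF R \<phi> pc] p_def)
  moreover have "p = \<zero>\<^bsub>mpoly_ring R m\<^esub>" if "P = 0" using that by (simp add: p_def[abs_def] mpoly_simps)
  ultimately show ?thesis by blast
qed

section \<open>Evaluation of functions and polynomials at points\<close>

lemma cont_ring_simps: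
  "\<zero>\<^bsub>cont_ring T\<^esub> = (\<lambda>x\<in>topspace T. 0)" "\<one>\<^bsub>cont_ring T\<^esub> = (\<lambda>x\<in>topspace T. 1)"
  "f \<oplus>\<^bsub>cont_ring T\<^esub> g = (\<lambda>x\<in>topspace T. f x + g x)" "f \<otimes>\<^bsub>cont_ring T\<^esub> g = (\<lambda>x\<in>topspace T. f x * g x)"
  "carrier (cont_ring T) = {f. continuous_map T euclideanreal f \<and> f \<in> extensional (topspace T)}"
  by (simp_all add: cont_ring_def)

lemma cont_ring_eqI:
  "f \<in> carrier (cont_ring T) ==> g \<in> carrier (cont_ring T) ==> (!!x. x \<in> topspace T ==> f x = g x) ==> f = g"
  by (auto simp: cont_ring_simps intro: extensionalityI)

lemma restrict_cont_ring: "continuous_map T euclideanreal f ==> restrict f (topspace T) \<in> carrier (cont_ring T)"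
  using continuous_map_eq[of T euclideanreal f "restrict f (topspace T)"] by (simp add: cont_ring_simps)

lemma eval_type_hom: "x \<in> topspace T ==> type_hom (cont_ring T) (%f. f x)"
  by (auto simp: type_hom_def cont_ring_simps)

lemma cont_ring_cring: "cring (cont_ring T)"
proof (rule cring_by_homs[where K = "topspace T" and H = "%x f. f x"])
  show "\<exists>g\<in>carrier (cont_ring T). g \<oplus>\<^bsub>cont_ring T\<^esub> f = \<zero>\<^bsub>cont_ring T\<^esub>" if f: "f \<in> carrier (cont_ring T)" for f
  proof (rule bexI[of _ "restrict (%x. - f x) (topspace T)"])
    show "restrict (%x. - f x) (topspace T) \<in> carrier (cont_ring T)"
      using f by (intro restrict_cont_ring continuous_intros) (simp add: cont_ring_simps)
  qed (auto simp: cont_ring_simps restrict_def)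
  show "f \<oplus>\<^bsub>cont_ring T\<^esub> g \<in> carrier (cont_ring T)" "f \<otimes>\<^bsub>cont_ring T\<^esub> g \<in> carrier (cont_ring T)"
    if "f \<in> carrier (cont_ring T)" "g \<in> carrier (cont_ring T)" for f g
    unfolding cont_ring_simps(3,4) using that
    by (auto intro!: restrict_cont_ring continuous_map_add continuous_map_real_mult simp: cont_ring_simps(5))
  show "\<zero>\<^bsub>cont_ring T\<^esub> \<in> carrier (cont_ring T)" "\<one>\<^bsub>cont_ring T\<^esub> \<in> carrier (cont_ring T)"
    unfolding cont_ring_simps(1,2) by (intro restrict_cont_ring; simp)+
qed (auto intro: eval_type_hom cont_ring_eqI)

abbreviation ev :: "'x => (nat multiset => 'x => real) => real pl" where
  "ev x \<equiv> mlift (%f. f x)"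

lemma ev_hom: "x \<in> topspace T ==> type_hom (mpoly_ring (cont_ring T) m) (ev x)"
  by (intro mlift_hom cont_ring_cring eval_type_hom)

lemma lookup_ev:
  "x \<in> topspace T ==> p \<in> carrier (mpoly_ring (cont_ring T) m) ==> lookup (ev x p) \<mu> = p \<mu> x"
  by (rule lookup_mlift[OF cont_ring_cring eval_type_hom])

lemma ev_inject:
  assumes "p \<in> carrier (mpoly_ring (cont_ring T) m)" "q \<in> carrier (mpoly_ring (cont_ring T) m)"
    "!!x. x \<in> topspace T ==> ev x p = ev x q"
  shows "p = q"
proof
  fix \<mu>
  note D = cring.mpoly_carrierD(1)[OF cont_ring_cring]
  show "p \<mu> = q \<mu>"
    using assms(3) lookup_ev[OF _ assms(1), of _ \<mu>] lookup_ev[OF _ assms(2), of _ \<mu>]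
    by (intro cont_ring_eqI[OF D[OF assms(1)] D[OF assms(2)]]) metis
qed

lemma mpoly_cring: "cring (mpoly_ring (cont_ring T) m)"
proof -
  interpret R: cring "cont_ring T" by (rule cont_ring_cring)
  show ?thesis
  proof (rule cring_by_homs[where K = "topspace T" and H = ev])
    show "\<zero>\<^bsub>mpoly_ring (cont_ring T) m\<^esub> \<in> carrier (mpoly_ring (cont_ring T) m)"
      "\<one>\<^bsub>mpoly_ring (cont_ring T) m\<^esub> \<in> carrier (mpoly_ring (cont_ring T) m)"
      using R.mpoly_const[of "\<zero>\<^bsub>cont_ring T\<^esub>" m] R.mpoly_const[of "\<one>\<^bsub>cont_ring T\<^esub>" m] by (simp_all add: mpoly_ring_def)
    fix p assume p: "p \<in> carrier (mpoly_ring (cont_ring T) m)"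
    show "\<exists>q\<in>carrier (mpoly_ring (cont_ring T) m). q \<oplus>\<^bsub>mpoly_ring (cont_ring T) m\<^esub> p = \<zero>\<^bsub>mpoly_ring (cont_ring T) m\<^esub>"
    proof (rule bexI[of _ "%\<mu>. \<ominus>\<^bsub>cont_ring T\<^esub> p \<mu>"])
      have "{\<mu>. \<ominus>\<^bsub>cont_ring T\<^esub> p \<mu> \<noteq> \<zero>\<^bsub>cont_ring T\<^esub>} \<subseteq> {\<mu>. p \<mu> \<noteq> \<zero>\<^bsub>cont_ring T\<^esub>}" by auto
      then have "finite {\<mu>. \<ominus>\<^bsub>cont_ring T\<^esub> p \<mu> \<noteq> \<zero>\<^bsub>cont_ring T\<^esub>}"
        using finite_subset R.mpoly_carrierD(2)[OF p] by blast
      moreover have "set_mset \<mu> \<subseteq> {..<m}" if "\<ominus>\<^bsub>cont_ring T\<^esub> p \<mu> \<noteq> \<zero>\<^bsub>cont_ring T\<^esub>" for \<mu>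
      proof -
        have "p \<mu> \<noteq> \<zero>\<^bsub>cont_ring T\<^esub>" using that R.minus_zero by metis
        then show ?thesis by (rule R.mpoly_carrierD(3)[OF p])
      qed
      ultimately show "(%\<mu>. \<ominus>\<^bsub>cont_ring T\<^esub> p \<mu>) \<in> carrier (mpoly_ring (cont_ring T) m)"
        using R.mpoly_carrierD(1)[OF p] by (simp add: R.mpoly_carrier_iff)
    qed (use R.mpoly_carrierD(1)[OF p] in \<open>simp add: R.mpoly_simps R.l_neg\<close>)
  qed (auto intro: R.mpoly_add_closed R.mpoly_mult_closed ev_hom ev_inject)
qed

section \<open>Germs of continuous functions on F-spaces\<close>

definition germ_eq :: "'x topology => 'x => ('x => real) => ('x => real) => bool" where
  "germ_eq T p f g \<longleftrightarrow> (\<exists>U. openin T U \<and> p \<in> U \<and> (\<forall>x\<in>U. f x = g x))"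

text \<open>Germs are represented by global functions; the condition is total divisibility in the
  ring of germs at \<open>p\<close>.\<close>

definition valuation_point :: "'x topology => 'x => bool" where
  "valuation_point T p \<longleftrightarrow> p \<in> topspace T \<and>
     (\<forall>f\<in>carrier (cont_ring T). \<forall>g\<in>carrier (cont_ring T). \<exists>h\<in>carrier (cont_ring T).
        germ_eq T p f (h \<otimes>\<^bsub>cont_ring T\<^esub> g) \<or> germ_eq T p g (h \<otimes>\<^bsub>cont_ring T\<^esub> f))"

lemma germ_eq_refl: "p \<in> topspace T ==> germ_eq T p f f"
  unfolding germ_eq_def by blast

lemma germ_eq_sym: "germ_eq T p f g ==> germ_eq T p g f"
  unfolding germ_eq_def by (metis)

lemma germ_eq_trans: "germ_eq T p f g ==> germ_eq T p g h ==> germ_eq T p f h"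
proof -
  assume "germ_eq T p f g" "germ_eq T p g h"
  then obtain U V where "openin T U" "p \<in> U" "\<forall>x\<in>U. f x = g x" "openin T V" "p \<in> V" "\<forall>x\<in>V. g x = h x"
    unfolding germ_eq_def by blast
  then show ?thesis unfolding germ_eq_def by (intro exI[of _ "U \<inter> V"]) auto
qed

lemma germ_eq_cong2:
  assumes "germ_eq T p f f'" "germ_eq T p g g'"
    and "!!x. x \<in> topspace T ==> f x = f' x ==> g x = g' x ==> k x = k' x"
  shows "germ_eq T p k k'"
proof -
  obtain U V where "openin T U" "p \<in> U" "\<forall>x\<in>U. f x = f' x" "openin T V" "p \<in> V" "\<forall>x\<in>V. g x = g' x"
    using assms(1,2) unfolding germ_eq_def by blast
  then show ?thesis unfolding germ_eq_def using assms(3) openin_subset[of T U]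
    by (intro exI[of _ "U \<inter> V"]) auto
qed

text \<open>The function \<open>f / max (f^2) c\<close> is continuous everywhere and equals
  \<open>1 / f\<close> where \<open>f^2 > c\<close>. The value \<open>c = f(p)^2 / 4\<close> is
  positive and makes \<open>p\<close> such a point.\<close>

lemma local_inverse:
  assumes f: "f \<in> carrier (cont_ring T)" and p: "p \<in> topspace T" "f p \<noteq> 0"
  shows "\<exists>g\<in>carrier (cont_ring T). germ_eq T p (%x. f x * g x) (%x. 1)"
proof -
  let ?c = "(f p)\<^sup>2 / 4"
  have c: "?c > 0" using p by simp
  have fc: "continuous_map T euclideanreal f" using f by (simp add: cont_ring_simps)
  define g where "g = restrict (%x. f x / max ((f x)\<^sup>2) ?c) (topspace T)"
  have "g \<in> carrier (cont_ring T)" unfolding g_def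
  proof (rule restrict_cont_ring)
    have "max ((f x)\<^sup>2) ?c \<noteq> 0" for x using c by (metis max.strict_coboundedI2 less_irrefl)
    then show "continuous_map T euclideanreal (%x. f x / max ((f x)\<^sup>2) ?c)"
      by (intro continuous_map_real_divide fc continuous_map_real_max continuous_map_real_pow) auto
  qed
  moreover have "germ_eq T p (%x. f x * g x) (%x. 1)"
    unfolding germ_eq_def
  proof (intro exI conjI ballI)
    have "continuous_map T euclideanreal (%x. (f x)\<^sup>2)" by (intro continuous_map_real_pow fc)
    then have "openin T {x \<in> topspace T. (f x)\<^sup>2 \<in> {?c<..}}"
      by (rule openin_continuous_map_preimage) simp
    then show "openin T {x \<in> topspace T. (f x)\<^sup>2 > ?c}" by simp
    show "p \<in> {x \<in> topspace T. (f x)\<^sup>2 > ?c}" using p c by simp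
    fix x assume x: "x \<in> {x \<in> topspace T. (f x)\<^sup>2 > ?c}"
    then have "max ((f x)\<^sup>2) ?c = (f x)\<^sup>2" "(f x)\<^sup>2 \<noteq> 0" using c by auto
    then show "f x * g x = 1" using x by (simp add: g_def power2_eq_square)
  qed
  ultimately show ?thesis by blast
qed

text \<open>If \<open>h\<close> generates the ideal of \<open>f\<close> and \<open>g\<close>, then
  \<open>f = a h\<close>, \<open>g = b h\<close> and \<open>h = s f + t g\<close>. If
  \<open>a\<close> or \<open>b\<close> does not vanish at \<open>p\<close>, it is invertible nearby,
  and one of \<open>f\<close>, \<open>g\<close> is a multiple of the other. If both vanish,
  \<open>1 - s a - t b\<close> is invertible near \<open>p\<close> and annihilates \<open>h\<close>,
  so \<open>f\<close> is zero there.\<close>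

lemma F_space_valuation_point:
  assumes "F_space T" "p \<in> topspace T"
  shows "valuation_point T p"
  unfolding valuation_point_def
proof (intro conjI ballI assms(2))
  let ?R = "cont_ring T"
  interpret R: cring ?R by (rule cont_ring_cring)
  fix f g assume fg: "f \<in> carrier ?R" "g \<in> carrier ?R"
  have "principalideal (genideal ?R {f, g}) ?R"
    using assms(1) fg unfolding F_space_def bezout_ring_def by auto
  then obtain h where h: "h \<in> carrier ?R" "genideal ?R {f, g} = genideal ?R {h}"
    using principalideal.generate by blast
  have cg: "genideal ?R {h} = {u \<otimes>\<^bsub>?R\<^esub> h | u. u \<in> carrier ?R}"
    using R.cgenideal_eq_genideal[OF h(1)] by (simp add: cgenideal_def)
  have "f \<in> genideal ?R {f, g}" "g \<in> genideal ?R {f, g}"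
    using fg R.genideal_self[of "{f, g}"] by auto
  then obtain a b where a: "a \<in> carrier ?R" "f = a \<otimes>\<^bsub>?R\<^esub> h" and b: "b \<in> carrier ?R" "g = b \<otimes>\<^bsub>?R\<^esub> h"
    unfolding h(2) cg by blast
  have "genideal ?R ({f} \<union> {g}) = genideal ?R {f} <+>\<^bsub>?R\<^esub> genideal ?R {g}"
  proof -
    have "genideal ?R (genideal ?R {f} \<union> genideal ?R {g}) = genideal ?R {f} <+>\<^bsub>?R\<^esub> genideal ?R {g}"
      using fg by (intro R.union_genideal R.genideal_ideal) auto
    moreover have "genideal ?R ({f} \<union> {g}) = genideal ?R (genideal ?R {f} \<union> genideal ?R {g})"
    proof (rule equalityI)
      have c: "genideal ?R {f} \<union> genideal ?R {g} \<subseteq> carrier ?R"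
        using fg ideal.Icarr[OF R.genideal_ideal[of "{f}"]] ideal.Icarr[OF R.genideal_ideal[of "{g}"]] by auto
      show "genideal ?R ({f} \<union> {g}) \<subseteq> genideal ?R (genideal ?R {f} \<union> genideal ?R {g})"
        using fg R.genideal_self[OF c] R.genideal_self[of "{f}"] R.genideal_self[of "{g}"]
        by (intro R.genideal_minimal R.genideal_ideal[OF c]) auto
      have i: "ideal (genideal ?R ({f} \<union> {g})) ?R" using fg by (intro R.genideal_ideal) auto
      have s: "{f} \<union> {g} \<subseteq> genideal ?R ({f} \<union> {g})" using fg by (intro R.genideal_self) auto
      show "genideal ?R (genideal ?R {f} \<union> genideal ?R {g}) \<subseteq> genideal ?R ({f} \<union> {g})"
        using s by (intro R.genideal_minimal[OF i] Un_least R.genideal_minimal[OF i]) auto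
    qed
    ultimately show ?thesis by simp
  qed
  moreover have "h \<in> genideal ?R ({f} \<union> {g})"
  proof -
    have "{f} \<union> {g} = {f, g}" by auto
    then show ?thesis using R.genideal_self[of "{h}"] h by simp
  qed
  ultimately have "h \<in> genideal ?R {f} <+>\<^bsub>?R\<^esub> genideal ?R {g}" by simp
  moreover have "genideal ?R {f} = {u \<otimes>\<^bsub>?R\<^esub> f | u. u \<in> carrier ?R}" "genideal ?R {g} = {u \<otimes>\<^bsub>?R\<^esub> g | u. u \<in> carrier ?R}"
    using R.cgenideal_eq_genideal[OF fg(1)] R.cgenideal_eq_genideal[OF fg(2)] by (simp_all add: cgenideal_def)
  ultimately obtain s t where st: "s \<in> carrier ?R" "t \<in> carrier ?R" "h = s \<otimes>\<^bsub>?R\<^esub> f \<oplus>\<^bsub>?R\<^esub> t \<otimes>\<^bsub>?R\<^esub> g"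
    by (auto simp: set_add_def' )
  have fx: "f x = a x * h x" if "x \<in> topspace T" for x
    using fun_cong[OF a(2), of x] that by (simp add: cont_ring_simps)
  have gx: "g x = b x * h x" if "x \<in> topspace T" for x
    using fun_cong[OF b(2), of x] that by (simp add: cont_ring_simps)
  have hx: "h x = s x * f x + t x * g x" if "x \<in> topspace T" for x
    using fun_cong[OF st(3), of x] that by (simp add: cont_ring_simps)
  show "\<exists>h\<in>carrier ?R. germ_eq T p f (h \<otimes>\<^bsub>?R\<^esub> g) \<or> germ_eq T p g (h \<otimes>\<^bsub>?R\<^esub> f)"
  proof -
    consider "a p \<noteq> 0" | "b p \<noteq> 0" | "a p = 0" "b p = 0" by blast
    then show ?thesis
    proof cases
      case 1
      then obtain a' where a': "a' \<in> carrier ?R" "germ_eq T p (%x. a x * a' x) (%x. 1)"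
        using local_inverse[OF a(1) assms(2)] by blast
      have "germ_eq T p g ((b \<otimes>\<^bsub>?R\<^esub> a') \<otimes>\<^bsub>?R\<^esub> f)"
      proof (rule germ_eq_cong2[OF a'(2) a'(2)])
        fix x assume x: "x \<in> topspace T" and "a x * a' x = 1"
        then have "b x * h x * (a x * a' x) = b x * h x" by simp
        then show "g x = ((b \<otimes>\<^bsub>?R\<^esub> a') \<otimes>\<^bsub>?R\<^esub> f) x"
          using x fx[OF x] gx[OF x] by (simp add: cont_ring_simps mult_ac)
      qed
      then show ?thesis using a' b by blast
    next
      case 2
      then obtain b' where b': "b' \<in> carrier ?R" "germ_eq T p (%x. b x * b' x) (%x. 1)"
        using local_inverse[OF b(1) assms(2)] by blast
      have "germ_eq T p f ((a \<otimes>\<^bsub>?R\<^esub> b') \<otimes>\<^bsub>?R\<^esub> g)"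
      proof (rule germ_eq_cong2[OF b'(2) b'(2)])
        fix x assume x: "x \<in> topspace T" and "b x * b' x = 1"
        then have "a x * h x * (b x * b' x) = a x * h x" by simp
        then show "f x = ((a \<otimes>\<^bsub>?R\<^esub> b') \<otimes>\<^bsub>?R\<^esub> g) x"
          using x fx[OF x] gx[OF x] by (simp add: cont_ring_simps mult_ac)
      qed
      then show ?thesis using a b' by blast
    next
      case 3
      let ?k = "restrict (%x. 1 - s x * a x - t x * b x) (topspace T)"
      have cts: "continuous_map T euclideanreal a" "continuous_map T euclideanreal b" "continuous_map T euclideanreal s"
        "continuous_map T euclideanreal t" using a(1) b(1) st(1,2) by (simp_all add: cont_ring_simps)
      have k: "?k \<in> carrier ?R"
        using cts by (intro restrict_cont_ring continuous_map_diff continuous_map_real_mult) auto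
      have "?k p \<noteq> 0" using 3 assms(2) by simp
      then obtain k' where k': "k' \<in> carrier ?R" "germ_eq T p (%x. ?k x * k' x) (%x. 1)"
        using local_inverse[OF k assms(2)] by blast
      have "germ_eq T p f (\<zero>\<^bsub>?R\<^esub> \<otimes>\<^bsub>?R\<^esub> g)"
      proof (rule germ_eq_cong2[OF k'(2) k'(2)])
        fix x assume x: "x \<in> topspace T" and k1: "?k x * k' x = 1"
        have "h x = s x * (a x * h x) + t x * (b x * h x)" using hx[OF x] unfolding fx[OF x] gx[OF x] .
        moreover have "?k x * h x = h x - (s x * (a x * h x) + t x * (b x * h x))"
          using x by (simp add: algebra_simps)
        ultimately have "?k x * h x = 0" by linarith
        moreover have "?k x \<noteq> 0" using k1 by auto
        ultimately have "h x = 0" by simp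
        then show "f x = (\<zero>\<^bsub>?R\<^esub> \<otimes>\<^bsub>?R\<^esub> g) x" using x fx[OF x] by (simp add: cont_ring_simps)
      qed
      then show ?thesis by blast
    qed
  qed
qed

definition lift_mats :: "('r => 'w::comm_ring_1) => (nat => nat => nat multiset => 'r) => nat => nat => 'w pl" where
  "lift_mats \<phi> a = (%i j. mlift \<phi> (a i j))"

text \<open>The identities of \<open>stably_free\<close>, restricted to the ranges of the indices,
  since representatives of germs are not controlled elsewhere.\<close>

definition stabilizes :: "nat => (nat => nat => 'b::comm_ring_1) => nat => nat =>
    (nat => nat => 'b) => (nat => nat => 'b) => (nat => nat => 'b) => (nat => nat => 'b) => bool" where
  "stabilizes n e b c a1 a2 a3 a4 \<longleftrightarrow>
     (\<forall>i<n. \<forall>j<n. mm c a1 a3 i j = e i j) \<and> (\<forall>i<n. \<forall>j<b. mm c a1 a4 i j = 0) \<and>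
     (\<forall>i<b. \<forall>j<n. mm c a2 a3 i j = 0) \<and> (\<forall>i<b. \<forall>j<b. mm c a2 a4 i j = idm b i j) \<and>
     (\<forall>i<c. \<forall>j<c. mm n a3 a1 i j + mm b a4 a2 i j = idm c i j)"

text \<open>The property \<open>split_kernels\<close> near one point, stated with functions in place
  of germs.\<close>

definition locally_split :: "'x topology => 'x => bool" where
  "locally_split T p \<longleftrightarrow> (\<forall>(n::nat) (k::nat) (q::nat) (D :: nat => nat => 'x => real) (w :: nat => nat => 'x => real).
     (\<forall>i j. D i j \<in> carrier (cont_ring T)) \<longrightarrow> (\<forall>l j. w l j \<in> carrier (cont_ring T)) \<longrightarrow>
     (\<forall>l<q. \<forall>i<n. \<forall>x\<in>topspace T. (\<Sum>j<k. D i j x * w l j x) = 0) \<longrightarrow>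
     (\<exists>(Pm :: nat => nat => 'x => real) U. (\<forall>i j. Pm i j \<in> carrier (cont_ring T)) \<and> openin T U \<and> p \<in> U \<and>
        (\<forall>x\<in>U. \<forall>i<n. \<forall>j<k. (\<Sum>l<k. D i l x * Pm l j x) = 0) \<and>
        (\<forall>x\<in>U. \<forall>l<q. \<forall>i<k. (\<Sum>j<k. Pm i j x * w l j x) = w l i x)))"

definition locally_stably_free :: "'x topology => 'x => bool" where
  "locally_stably_free T p \<longleftrightarrow> (\<forall>m n e. (\<forall>i j. e i j \<in> carrier (mpoly_ring (cont_ring T) m)) \<longrightarrow>
     (\<forall>x\<in>topspace T. \<forall>i<n. \<forall>j<n. mm n (lift_mats (%f. f x) e) (lift_mats (%f. f x) e) i j = ev x (e i j)) \<longrightarrow>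
     (\<exists>b c a1 a2 a3 a4 U. (\<forall>i j. a1 i j \<in> carrier (mpoly_ring (cont_ring T) m)) \<and>
        (\<forall>i j. a2 i j \<in> carrier (mpoly_ring (cont_ring T) m)) \<and> (\<forall>i j. a3 i j \<in> carrier (mpoly_ring (cont_ring T) m)) \<and>
        (\<forall>i j. a4 i j \<in> carrier (mpoly_ring (cont_ring T) m)) \<and> openin T U \<and> p \<in> U \<and>
        (\<forall>x\<in>U. stabilizes n (lift_mats (%f. f x) e) b c (lift_mats (%f. f x) a1) (lift_mats (%f. f x) a2)
            (lift_mats (%f. f x) a3) (lift_mats (%f. f x) a4))))"

text \<open>The local statements are about the ring of germs at a point, which is a valuation domain.
  To have this ring as a type, whose definition cannot depend on \<open>T\<close> and \<open>p\<close>, we fix a point at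
  which one of the statements fails, if there is one.\<close>

definition bad_point :: "'x topology \<times> 'x => bool" where
  "bad_point = (%(T, p). valuation_point T p \<and> \<not> (locally_split T p \<and> locally_stably_free T p))"

text \<open>The fallback is a one-point space, where germs are real numbers; so the type below is a
  valuation domain in every case.\<close>

definition base_point :: "'x topology \<times> 'x" where
  "base_point = (if \<exists>z :: 'x topology \<times> 'x. bad_point z then SOME z. bad_point z
     else (discrete_topology {undefined}, undefined))"

text \<open>A germ at an isolated point is determined by its value, and nonzero real numbers are
  invertible.\<close>

lemma discrete_valuation_point: "valuation_point (discrete_topology {p}) p"
  unfolding valuation_point_def
proof (intro conjI ballI)
  let ?T = "discrete_topology {p}" let ?R = "cont_ring ?T"
  fix f g assume fg: "f \<in> carrier ?R" "g \<in> carrier ?R"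
  have ge: "germ_eq ?T p u v" if "u p = v p" for u v
    unfolding germ_eq_def using that by (intro exI[of _ "{p}"]) auto
  define k where "k = restrict (%x. if g p = 0 then 0 else f p / g p) {p}"
  have k: "k \<in> carrier ?R" by (auto simp: cont_ring_simps k_def)
  show "\<exists>h\<in>carrier ?R. germ_eq ?T p f (h \<otimes>\<^bsub>?R\<^esub> g) \<or> germ_eq ?T p g (h \<otimes>\<^bsub>?R\<^esub> f)"
  proof (cases "g p = 0")
    case True
    then have "germ_eq ?T p g (k \<otimes>\<^bsub>?R\<^esub> f)" by (intro ge) (simp add: cont_ring_simps k_def)
    with k show ?thesis by blast
  next
    case False
    then have "germ_eq ?T p f (k \<otimes>\<^bsub>?R\<^esub> g)" by (intro ge) (simp add: cont_ring_simps k_def)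
    with k show ?thesis by blast
  qed
qed simp

lemma base_point: "valuation_point (fst base_point) (snd base_point)"
proof (cases "\<exists>z :: 'a topology \<times> 'a. bad_point z")
  case True
  then have "bad_point (SOME z :: 'a topology \<times> 'a. bad_point z)" by (rule someI_ex)
  with True show ?thesis unfolding base_point_def bad_point_def by (auto split: prod.splits)
qed (simp add: base_point_def discrete_valuation_point)

section \<open>The ring of germs as a type\<close>

abbreviation "BT \<equiv> fst base_point"
abbreviation "BR \<equiv> cont_ring (fst base_point)"
abbreviation "bp \<equiv> snd base_point"

lemma base_in: "bp \<in> topspace BT"
  by (rule base_point[unfolded valuation_point_def, THEN conjunct1])

interpretation BR: cring "cont_ring (fst base_point)"
  by (rule cont_ring_cring)

\<comment> \<open>The quotient is partial because only elements of the carrier, that is continuous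
  functions, represent germs.\<close>
quotient_type 'x germ = "'x => real" / partial: "%f g. f \<in> carrier BR \<and> g \<in> carrier BR \<and> germ_eq BT bp f g"
proof (rule part_equivpI)
  show "\<exists>f. f \<in> carrier BR \<and> f \<in> carrier BR \<and> germ_eq BT bp f f"
    using germ_eq_refl[OF base_in] BR.zero_closed by blast
qed (auto simp: symp_def transp_def intro: germ_eq_sym germ_eq_trans)

lemma germ_eq_add: "germ_eq T p f f' ==> germ_eq T p g g' ==>
    germ_eq T p (f \<oplus>\<^bsub>cont_ring T\<^esub> g) (f' \<oplus>\<^bsub>cont_ring T\<^esub> g')"
  by (erule (1) germ_eq_cong2) (simp add: cont_ring_simps)

lemma germ_eq_mult: "germ_eq T p f f' ==> germ_eq T p g g' ==>
    germ_eq T p (f \<otimes>\<^bsub>cont_ring T\<^esub> g) (f' \<otimes>\<^bsub>cont_ring T\<^esub> g')"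
  by (erule (1) germ_eq_cong2) (simp add: cont_ring_simps)

lemma germ_eq_uminus:
  assumes "germ_eq T p f f'"
  shows "germ_eq T p (restrict (%x. - f x) (topspace T)) (restrict (%x. - f' x) (topspace T))"
  by (rule germ_eq_cong2[OF assms assms]) simp

lemma cont_ring_uminus: "f \<in> carrier (cont_ring T) ==> restrict (%x. - f x) (topspace T) \<in> carrier (cont_ring T)"
  by (intro restrict_cont_ring continuous_map_minus) (simp add: cont_ring_simps)

instantiation germ :: (type) comm_ring_1
begin

lift_definition zero_germ :: "'a germ" is "\<zero>\<^bsub>BR\<^esub>"
  by (simp add: germ_eq_refl[OF base_in])

lift_definition one_germ :: "'a germ" is "\<one>\<^bsub>BR\<^esub>"
  by (simp add: germ_eq_refl[OF base_in])

lift_definition plus_germ :: "'a germ => 'a germ => 'a germ" is "%f g. f \<oplus>\<^bsub>BR\<^esub> g"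
  by (simp add: germ_eq_add)

lift_definition times_germ :: "'a germ => 'a germ => 'a germ" is "%f g. f \<otimes>\<^bsub>BR\<^esub> g"
  by (simp add: germ_eq_mult)

lift_definition uminus_germ :: "'a germ => 'a germ" is "%f. restrict (%x. - f x) (topspace BT)"
  by (simp only: cont_ring_uminus germ_eq_uminus simp_thms)

definition minus_germ :: "'a germ => 'a germ => 'a germ" where "minus_germ a b = a + - b"

instance
proof
  fix a b c :: "'a germ"
  show "a * b * c = a * (b * c)"
    by transfer (simp add: BR.m_assoc germ_eq_refl[OF base_in])
  show "a * b = b * a"
    by transfer (simp add: BR.m_comm germ_eq_refl[OF base_in])
  show "1 * a = a"
    by transfer simp
  show "(a + b) * c = a * c + b * c"
    by transfer (simp add: BR.l_distr germ_eq_refl[OF base_in])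
  show "a + b + c = a + (b + c)"
    by transfer (simp add: BR.a_assoc germ_eq_refl[OF base_in])
  show "a + b = b + a"
    by transfer (simp add: BR.a_comm germ_eq_refl[OF base_in])
  show "0 + a = a"
    by transfer simp
  show "- a + a = 0"
  proof transfer
    fix f :: "'a => real" assume f: "f \<in> carrier BR \<and> f \<in> carrier BR \<and> germ_eq BT bp f f"
    have "germ_eq BT bp (restrict (%x. - f x) (topspace BT) \<oplus>\<^bsub>BR\<^esub> f) \<zero>\<^bsub>BR\<^esub>"
      by (rule germ_eq_cong2[OF germ_eq_refl[OF base_in, of f] germ_eq_refl[OF base_in, of f]]) (simp add: cont_ring_simps)
    with f cont_ring_uminus[of f BT]
    show "restrict (%x. - f x) (topspace BT) \<oplus>\<^bsub>BR\<^esub> f \<in> carrier BR \<and> \<zero>\<^bsub>BR\<^esub> \<in> carrier BR \<and>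
        germ_eq BT bp (restrict (%x. - f x) (topspace BT) \<oplus>\<^bsub>BR\<^esub> f) \<zero>\<^bsub>BR\<^esub>"
      using BR.a_closed BR.zero_closed by blast
  qed
  show "a - b = a + - b" by (rule minus_germ_def)
  show "(0 :: 'a germ) \<noteq> 1"
    by transfer (auto simp: germ_eq_def cont_ring_simps dest: openin_subset)
qed

end

lemma germ_dvd_total: "a dvd b \<or> b dvd a" for a b :: "'x germ"
proof -
  have "\<exists>c. a = c * b \<or> b = c * a"
  proof (transfer, elim conjE)
    fix f g :: "'x => real" assume "f \<in> carrier BR" "g \<in> carrier BR"
    then obtain h where "h \<in> carrier BR" "germ_eq BT bp f (h \<otimes>\<^bsub>BR\<^esub> g) \<or> germ_eq BT bp g (h \<otimes>\<^bsub>BR\<^esub> f)"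
      using base_point unfolding valuation_point_def by blast
    then show "\<exists>c\<in>{c. c \<in> carrier BR \<and> c \<in> carrier BR \<and> germ_eq BT bp c c}.
        (f \<in> carrier BR \<and> c \<otimes>\<^bsub>BR\<^esub> g \<in> carrier BR \<and> germ_eq BT bp f (c \<otimes>\<^bsub>BR\<^esub> g)) \<or>
        (g \<in> carrier BR \<and> c \<otimes>\<^bsub>BR\<^esub> f \<in> carrier BR \<and> germ_eq BT bp g (c \<otimes>\<^bsub>BR\<^esub> f))"
      using \<open>f \<in> carrier BR\<close> \<open>g \<in> carrier BR\<close> germ_eq_refl[OF base_in] BR.m_closed by blast
  qed
  then show ?thesis by (metis dvd_triv_right)
qed

text \<open>Values are real numbers: where \<open>f^2 g\<close> vanishes, so does
  \<open>f g\<close>.\<close>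

lemma germ_reduced: "a * a * b = 0 ==> a * b = 0" for a b :: "'x germ"
proof (transfer, elim conjE)
  fix f g :: "'x => real" assume fg: "f \<in> carrier BR" "g \<in> carrier BR"
    and z: "germ_eq BT bp (f \<otimes>\<^bsub>BR\<^esub> f \<otimes>\<^bsub>BR\<^esub> g) \<zero>\<^bsub>BR\<^esub>"
  have "germ_eq BT bp (f \<otimes>\<^bsub>BR\<^esub> g) \<zero>\<^bsub>BR\<^esub>"
    by (rule germ_eq_cong2[OF z z]) (simp add: cont_ring_simps)
  then show "f \<otimes>\<^bsub>BR\<^esub> g \<in> carrier BR \<and> \<zero>\<^bsub>BR\<^esub> \<in> carrier BR \<and> germ_eq BT bp (f \<otimes>\<^bsub>BR\<^esub> g) \<zero>\<^bsub>BR\<^esub>"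
    using fg BR.m_closed BR.zero_closed by blast
qed

text \<open>Total divisibility and reducedness exclude zero divisors: if \<open>b = a c\<close>,
  then \<open>a b = 0\<close> reads \<open>a^2 c = 0\<close>, whence
  \<open>b = a c = 0\<close>.\<close>

instance germ :: (type) valuation_domain
proof
  fix a b :: "'a germ"
  show "a \<noteq> 0 ==> b \<noteq> 0 ==> a * b \<noteq> 0"
  proof
    assume "a \<noteq> 0" "b \<noteq> 0" "a * b = 0"
    consider c where "b = a * c" | c where "a = b * c" using germ_dvd_total[of a b] by (auto simp: dvd_def)
    then show False
    proof cases
      case 1
      then show False using \<open>a * b = 0\<close> \<open>b \<noteq> 0\<close> germ_reduced[of a c] by (simp add: mult.assoc)
    next
      case 2
      then show False using \<open>a * b = 0\<close> \<open>a \<noteq> 0\<close> germ_reduced[of b c] by (simp add: mult_ac)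
    qed
  qed
  show "a dvd b \<or> b dvd a" by (rule germ_dvd_total)
qed

definition germ :: "('x => real) => 'x germ" where "germ = abs_germ"

lemma germ_type_hom: "type_hom BR germ"
  unfolding type_hom_def germ_def
proof (intro conjI ballI)
  fix f g :: "'a => real" assume fg: "f \<in> carrier BR" "g \<in> carrier BR"
  show "abs_germ (f \<oplus>\<^bsub>BR\<^esub> g) = abs_germ f + abs_germ g"
    using fg by (simp add: plus_germ.abs_eq germ_eq_refl[OF base_in])
  show "abs_germ (f \<otimes>\<^bsub>BR\<^esub> g) = abs_germ f * abs_germ g"
    using fg by (simp add: times_germ.abs_eq germ_eq_refl[OF base_in])
qed (simp_all add: zero_germ_def one_germ_def)

lemma germ_eq_iff:
  "f \<in> carrier BR ==> g \<in> carrier BR ==> germ f = germ g \<longleftrightarrow> germ_eq BT bp f g"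
  unfolding germ_def using Quotient_rel[OF Quotient_germ, of f g] germ_eq_refl[OF base_in] by auto

lemma germ_surj: "germ ` carrier BR = UNIV"
proof -
  have "\<exists>f\<in>carrier BR. germ f = a" for a :: "'x germ"
    unfolding germ_def by (induction a rule: germ.abs_induct) blast
  then show ?thesis by (metis UNIV_eq_I imageI)
qed

lemma germ_eq_eventually: "p \<in> topspace T ==> germ_eq T p f g \<longleftrightarrow> (\<forall>\<^sub>F x in nhdsin T p. f x = g x)"
  by (simp add: germ_eq_def eventually_nhdsin)

lemma germ_near:
  "f \<in> carrier BR ==> g \<in> carrier BR ==> germ f = germ g \<longleftrightarrow> (\<forall>\<^sub>F x in nhdsin BT bp. f x = g x)"
  by (simp add: germ_eq_iff germ_eq_eventually[OF base_in])

lemma nhdsinD: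
  "\<forall>\<^sub>F x in nhdsin T p. P x ==> p \<in> topspace T ==> \<exists>U. openin T U \<and> p \<in> U \<and> (\<forall>x\<in>U. P x)"
  by (simp add: eventually_nhdsin)

lemma near_topspace: "\<forall>\<^sub>F x in nhdsin T p. x \<in> topspace T"
  unfolding eventually_nhdsin using openin_topspace by blast

definition germ_rep :: "'x germ => 'x => real" where
  "germ_rep a = (SOME f. f \<in> carrier BR \<and> germ f = a)"

lemma germ_rep: "germ_rep a \<in> carrier BR" "germ (germ_rep a) = a"
proof -
  have "a \<in> germ ` carrier BR" by (simp add: germ_surj)
  then have "\<exists>f. f \<in> carrier BR \<and> germ f = a" by blast
  from someI_ex[OF this] show "germ_rep a \<in> carrier BR" "germ (germ_rep a) = a"
    unfolding germ_rep_def by auto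
qed

section \<open>From identities of germs to neighbourhoods\<close>

lemma cont_finsum_eval:
  assumes "x \<in> topspace T" "!!l. l < k ==> f l \<in> carrier (cont_ring T)" "!!l. l < k ==> g l \<in> carrier (cont_ring T)"
  shows "(\<Oplus>\<^bsub>cont_ring T\<^esub>l\<in>{..<k::nat}. f l \<otimes>\<^bsub>cont_ring T\<^esub> g l) x = (\<Sum>l<k. f l x * g l x)"
proof -
  interpret R: cring "cont_ring T" by (rule cont_ring_cring)
  show ?thesis
    using type_hom_finsum[OF R.abelian_monoid_axioms eval_type_hom[OF assms(1)], of "{..<k}" "%l. f l \<otimes>\<^bsub>cont_ring T\<^esub> g l"]
      assms by (simp add: type_homD(2)[OF eval_type_hom[OF assms(1)]])
qed

text \<open>A finite sum of products of germs is the germ of the pointwise sum, and equal germs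
  agree near the base point.\<close>

lemma germ_sum_near:
  assumes f: "!!l. l < k ==> f l \<in> carrier BR" and g: "!!l. l < k ==> g l \<in> carrier BR" and u: "u \<in> carrier BR"
    and eq: "(\<Sum>l<k. germ (f l) * germ (g l)) = germ u"
  shows "\<forall>\<^sub>F x in nhdsin BT bp. (\<Sum>l<k::nat. f l x * g l x) = u x"
proof -
  let ?s = "\<Oplus>\<^bsub>BR\<^esub>l\<in>{..<k}. f l \<otimes>\<^bsub>BR\<^esub> g l"
  have s: "?s \<in> carrier BR" using f g by (intro BR.finsum_closed) auto
  have "germ ?s = (\<Sum>l<k. germ (f l) * germ (g l))"
    using type_hom_finsum[OF BR.abelian_monoid_axioms germ_type_hom, of "{..<k}" "%l. f l \<otimes>\<^bsub>BR\<^esub> g l"] f g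
    by (simp add: type_homD(2)[OF germ_type_hom])
  then have "germ ?s = germ u" using eq by simp
  then have "\<forall>\<^sub>F x in nhdsin BT bp. ?s x = u x" using germ_near[OF s u] by blast
  then show ?thesis using near_topspace
  proof eventually_elim
    case (elim x)
    then show ?case using cont_finsum_eval[of x BT k f g] f g by simp
  qed
qed

text \<open>The kernel \<open>W\<close> of the matrix of germs is saturated because germs form a
  domain. The columns of \<open>Pm\<close> at pivots represent the basis \<open>h\<close>, the other
  columns zero; so \<open>Pm\<close> reassembles a vector of \<open>W\<close> from its pivot
  coordinates. Only finitely many identities of germs are involved, and they hold on a common
  neighbourhood.\<close>

lemma base_locally_split: "locally_split BT (bp :: 'x)"
  unfolding locally_split_def
proof (intro allI impI)
  fix n k q :: nat and D w :: "nat => nat => 'x => real"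
  assume D: "\<forall>i j. D i j \<in> carrier BR" and w: "\<forall>l j. w l j \<in> carrier BR"
    and Dw: "\<forall>l<q. \<forall>i<n. \<forall>x\<in>topspace BT. (\<Sum>j<k. D i j x * w l j x) = 0"
  define W :: "(nat => 'x germ) set" where
    "W = {v. (\<forall>j. \<not> j < k \<longrightarrow> v j = 0) \<and> (\<forall>i<n. (\<Sum>j<k. germ (D i j) * v j) = 0)}"
  have W: "linear_space W"
    unfolding linear_space_def W_def
    by (auto simp: distrib_left sum.distrib mult.left_commute sum_distrib_left[symmetric])
  define g where "g b = (SOME v. v \<in> W \<and> v b dvd 1 \<and> (\<forall>b'. b < b' \<longrightarrow> \<not> v b' dvd 1))" for b
  have g: "g b \<in> W \<and> g b b dvd 1 \<and> (\<forall>b'. b < b' \<longrightarrow> \<not> g b b' dvd 1)" if "b \<in> pivots id W" for b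
  proof -
    have "\<exists>v. v \<in> W \<and> v b dvd 1 \<and> (\<forall>b'. b < b' \<longrightarrow> \<not> v b' dvd 1)" using that by (auto simp: pivots_def)
    from someI_ex[OF this] show ?thesis unfolding g_def .
  qed
  have "\<exists>h. finite (pivots id W) \<and>
    (\<forall>b\<in>pivots id W. \<forall>b'\<in>pivots id W. h b b' = (if b = b' then 1 else 0)) \<and>
    (\<forall>Y. linear_space Y \<longrightarrow> (\<forall>b\<in>pivots id W. g b \<in> Y) \<longrightarrow> (\<forall>b\<in>pivots id W. h b \<in> Y)) \<and>
    (\<forall>w\<in>W. w = (%i. \<Sum>b\<in>pivots id W. w b * h b i))"
  proof (rule saturated_basis[where B = "{..<k}"])
    show "v \<in> W" if "c \<noteq> 0" "(%i. c * v i) \<in> W" for c v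
      using that by (simp add: W_def mult.left_commute sum_distrib_left[symmetric])
  qed (use W g in \<open>auto simp: W_def\<close>)
  then obtain h where hY: "\<forall>Y. linear_space Y \<longrightarrow> (\<forall>b\<in>pivots id W. g b \<in> Y) \<longrightarrow> (\<forall>b\<in>pivots id W. h b \<in> Y)"
    and hw: "\<forall>v\<in>W. v = (%i. \<Sum>b\<in>pivots id W. v b * h b i)" by (elim exE conjE) (rule that)
  have hW: "\<forall>b\<in>pivots id W. h b \<in> W" using hY[rule_format, OF W] g by blast
  have pk: "pivots id W \<subseteq> {..<k}"
  proof
    fix b assume "b \<in> pivots id W"
    then obtain v where v: "v \<in> W" "v b dvd 1" by (auto simp: pivots_def)
    have "v b \<noteq> 0" using v(2) by auto
    then show "b \<in> {..<k}" using v(1) by (auto simp: W_def)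
  qed
  define P where "P i j = (if j \<in> pivots id W then h j i else 0)" for i j
  define Pm where "Pm i j = germ_rep (P i j)" for i j
  have Pm: "Pm i j \<in> carrier BR" "germ (Pm i j) = P i j" for i j by (simp_all add: Pm_def germ_rep)
  have "\<forall>\<^sub>F x in nhdsin BT bp. \<forall>i\<in>{..<n}. \<forall>j\<in>{..<k}. (\<Sum>l<k. D i l x * Pm l j x) = \<zero>\<^bsub>BR\<^esub> x"
  proof (intro eventually_ball_finite ballI finite_lessThan germ_sum_near)
    fix i j assume i: "i \<in> {..<n}" "j \<in> {..<k}"
    have "(\<Sum>l<k. germ (D i l) * h j l) = 0" if "j \<in> pivots id W"
    proof -
      have "h j \<in> W" using hW that by blast
      then show ?thesis using i by (simp add: W_def)
    qed
    then show "(\<Sum>l<k. germ (D i l) * germ (Pm l j)) = germ \<zero>\<^bsub>BR\<^esub>"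
      by (cases "j \<in> pivots id W") (simp_all add: Pm P_def type_homD(3)[OF germ_type_hom])
  qed (use D Pm in auto)
  moreover have "\<forall>\<^sub>F x in nhdsin BT bp. \<forall>l\<in>{..<q}. \<forall>i\<in>{..<k}. (\<Sum>j<k. Pm i j x * w l j x) = w l i x"
  proof (intro eventually_ball_finite ballI finite_lessThan germ_sum_near)
    fix l i assume l: "l \<in> {..<q}" and i: "i \<in> {..<k}"
    let ?v = "%j. if j < k then germ (w l j) else 0"
    have "(\<Sum>j<k. germ (D a j) * germ (w l j)) = 0" if a: "a < n" for a
    proof -
      let ?s = "\<Oplus>\<^bsub>BR\<^esub>j\<in>{..<k}. D a j \<otimes>\<^bsub>BR\<^esub> w l j"
      have "?s = \<zero>\<^bsub>BR\<^esub>"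
        using D w Dw a l by (intro cont_ring_eqI[of _ BT]) (auto simp: cont_finsum_eval intro!: BR.finsum_closed, simp add: cont_ring_simps)
      moreover have "germ ?s = (\<Sum>j<k. germ (D a j) * germ (w l j))"
        using type_hom_finsum[OF BR.abelian_monoid_axioms germ_type_hom, of "{..<k}" "%j. D a j \<otimes>\<^bsub>BR\<^esub> w l j"] D w
        by (simp add: type_homD(2)[OF germ_type_hom])
      ultimately show ?thesis by (simp add: type_homD(3)[OF germ_type_hom])
    qed
    then have "?v \<in> W" by (simp add: W_def)
    then have "?v = (%i. \<Sum>b\<in>pivots id W. ?v b * h b i)" using hw by blast
    then have "?v i = (\<Sum>b\<in>pivots id W. ?v b * h b i)" by (rule fun_cong)
    also have "\<dots> = (\<Sum>b<k. P i b * germ (w l b))"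
      using pk by (intro sum.mono_neutral_cong_left) (auto simp: P_def mult.commute)
    finally show "(\<Sum>j<k. germ (Pm i j) * germ (w l j)) = germ (w l i)" using i by (simp add: Pm)
  qed (use w Pm in auto)
  ultimately have "\<forall>\<^sub>F x in nhdsin BT bp. (\<forall>i<n. \<forall>j<k. (\<Sum>l<k. D i l x * Pm l j x) = 0) \<and>
      (\<forall>l<q. \<forall>i<k. (\<Sum>j<k. Pm i j x * w l j x) = w l i x)"
    using near_topspace by eventually_elim (simp add: cont_ring_simps)
  from nhdsinD[OF this base_in] obtain U where "openin BT U" "bp \<in> U" "\<forall>x\<in>U. (\<forall>i<n. \<forall>j<k. (\<Sum>l<k. D i l x * Pm l j x) = 0) \<and>
      (\<forall>l<q. \<forall>i<k. (\<Sum>j<k. Pm i j x * w l j x) = w l i x)"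
    by (elim exE conjE) (rule that)
  then show "\<exists>Pm U. (\<forall>i j. Pm i j \<in> carrier BR) \<and> openin BT U \<and> bp \<in> U \<and>
        (\<forall>x\<in>U. \<forall>i<n. \<forall>j<k. (\<Sum>l<k. D i l x * Pm l j x) = 0) \<and>
        (\<forall>x\<in>U. \<forall>l<q. \<forall>i<k. (\<Sum>j<k. Pm i j x * w l j x) = w l i x)"
    using Pm by (intro exI[of _ Pm] exI[of _ U]) blast
qed

text \<open>Finitely many coefficients are nonzero, so the neighbourhoods on which they agree can be
  intersected.\<close>

lemma mlift_germ_near:
  assumes p: "p \<in> carrier (mpoly_ring BR m)" and q: "q \<in> carrier (mpoly_ring BR m)"
    and eq: "mlift germ p = mlift germ q"
  shows "\<forall>\<^sub>F x in nhdsin BT bp. ev x p = ev x q"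
proof -
  have l: "germ (p \<mu>) = germ (q \<mu>)" for \<mu>
    using lookup_mlift[OF cont_ring_cring germ_type_hom p, of \<mu>] lookup_mlift[OF cont_ring_cring germ_type_hom q, of \<mu>] eq by simp
  note pD = BR.mpoly_carrierD[OF p] and qD = BR.mpoly_carrierD[OF q]
  let ?M = "{\<mu>. p \<mu> \<noteq> \<zero>\<^bsub>BR\<^esub>} \<union> {\<mu>. q \<mu> \<noteq> \<zero>\<^bsub>BR\<^esub>}"
  have "\<forall>\<^sub>F x in nhdsin BT bp. \<forall>\<mu>\<in>?M. p \<mu> x = q \<mu> x"
  proof (intro eventually_ball_finite ballI)
    show "finite ?M" using pD(2) qD(2) by simp
    show "\<forall>\<^sub>F x in nhdsin BT bp. p \<mu> x = q \<mu> x" for \<mu> using germ_near[OF pD(1) qD(1)] l by blast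
  qed
  then show ?thesis using near_topspace
  proof eventually_elim
    case (elim x)
    have "p \<mu> x = q \<mu> x" for \<mu> using elim(1) by (cases "\<mu> \<in> ?M") auto
    then show ?case by (intro poly_mapping_eqI) (simp add: lookup_ev[OF elim(2) p] lookup_ev[OF elim(2) q])
  qed
qed

lemma mlift_sum_mult:
  assumes R: "cring R" and S: "cring (mpoly_ring R m)" and \<phi>: "type_hom R \<phi>"
    and a: "!!k. k < n ==> a i k \<in> carrier (mpoly_ring R m)" and b: "!!k. k < n ==> b k j \<in> carrier (mpoly_ring R m)"
  shows "mlift \<phi> (\<Oplus>\<^bsub>mpoly_ring R m\<^esub>k\<in>{..<n}. a i k \<otimes>\<^bsub>mpoly_ring R m\<^esub> b k j) = mm n (lift_mats \<phi> a) (lift_mats \<phi> b) i j"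
proof -
  interpret S: cring "mpoly_ring R m" by (rule S)
  note h = mlift_hom[OF R \<phi>, of m]
  show ?thesis
    using type_hom_finsum[OF S.abelian_monoid_axioms h, of "{..<n}" "%k. a i k \<otimes>\<^bsub>mpoly_ring R m\<^esub> b k j"] a b
    by (simp add: type_homD(2)[OF h] mm_def lift_mats_def)
qed

text \<open>Two products are treated at once because the last identity of \<open>stabilizes\<close>
  is a sum of two.\<close>

lemma mm_near:
  assumes "!!i j. a i j \<in> carrier (mpoly_ring BR m)" "!!i j. b i j \<in> carrier (mpoly_ring BR m)"
    "!!i j. a' i j \<in> carrier (mpoly_ring BR m)" "!!i j. b' i j \<in> carrier (mpoly_ring BR m)"
    and u: "u \<in> carrier (mpoly_ring BR m)"
    and eq: "mm k (lift_mats germ a) (lift_mats germ b) i j + mm k' (lift_mats germ a') (lift_mats germ b') i j = mlift germ u"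
  shows "\<forall>\<^sub>F x in nhdsin BT bp. mm k (lift_mats (%f. f x) a) (lift_mats (%f. f x) b) i j +
      mm k' (lift_mats (%f. f x) a') (lift_mats (%f. f x) b') i j = ev x u"
proof -
  let ?S = "mpoly_ring BR m"
  interpret S: cring ?S by (rule mpoly_cring)
  let ?s = "(\<Oplus>\<^bsub>?S\<^esub>k\<in>{..<k}. a i k \<otimes>\<^bsub>?S\<^esub> b k j) \<oplus>\<^bsub>?S\<^esub> (\<Oplus>\<^bsub>?S\<^esub>k\<in>{..<k'}. a' i k \<otimes>\<^bsub>?S\<^esub> b' k j)"
  have s1: "(\<Oplus>\<^bsub>?S\<^esub>k\<in>{..<k}. a i k \<otimes>\<^bsub>?S\<^esub> b k j) \<in> carrier ?S" "(\<Oplus>\<^bsub>?S\<^esub>k\<in>{..<k'}. a' i k \<otimes>\<^bsub>?S\<^esub> b' k j) \<in> carrier ?S"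
    using assms(1-4) by (auto intro!: S.finsum_closed)
  have sum: "mlift \<phi> ?s = mm k (lift_mats \<phi> a) (lift_mats \<phi> b) i j + mm k' (lift_mats \<phi> a') (lift_mats \<phi> b') i j"
    if "type_hom BR \<phi>" for \<phi> :: "('a => real) => 'w::comm_ring_1"
    using type_homD(1)[OF mlift_hom[OF cont_ring_cring that] s1] assms(1-4)
    by (simp add: mlift_sum_mult[OF cont_ring_cring mpoly_cring that])
  have "\<forall>\<^sub>F x in nhdsin BT bp. ev x ?s = ev x u"
    using sum[OF germ_type_hom] eq s1 u by (intro mlift_germ_near[where m = m]) auto
  then show ?thesis using near_topspace
  proof eventually_elim
    case (elim x)
    then show ?case using sum[OF eval_type_hom[OF elim(2)]] by simp
  qed
qed

text \<open>Over polynomials with germs as coefficients the idempotent is stably free. The four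
  blocks are lifted to polynomials over the ring of continuous functions, and each of the finitely
  many identities persists nearby.\<close>

lemma base_locally_stably_free: "locally_stably_free BT (bp :: 'x)"
  unfolding locally_stably_free_def
proof (intro allI impI)
  fix m n and e :: "nat => nat => nat multiset => 'x => real"
  let ?S = "mpoly_ring BR m"
  assume e: "\<forall>i j. e i j \<in> carrier ?S"
    and ee: "\<forall>x\<in>topspace BT. \<forall>i<n. \<forall>j<n. mm n (lift_mats (%f. f x) e) (lift_mats (%f. f x) e) i j = ev x (e i j)"
  interpret S: cring ?S by (rule mpoly_cring)
  have hom: "type_hom ?S (mlift (germ :: ('x => real) => 'x germ))"
    by (rule mlift_hom[OF cont_ring_cring germ_type_hom])
  \<comment> \<open>Cut off outside the \<open>n\<close> by \<open>n\<close> range so as to belong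
    to \<open>mats\<close>.\<close>
  define E where "E i j = (if i < n \<and> j < n then mlift germ (e i j) else 0)" for i j
  have mp: "mlift (germ :: ('x => real) => 'x germ) p \<in> polys m" if "p \<in> carrier ?S" for p
    by (rule mlift_polys[OF cont_ring_cring germ_type_hom that])
  have z: "(0 :: 'x germ pl) \<in> polys m"
    using mp[OF S.zero_closed] type_homD(3)[OF hom] by simp
  have E: "E \<in> mats (polys m) n n"
    using e z mp by (auto simp: mats_def E_def)
  have "mm n E E i j = E i j" for i j
  proof (cases "i < n \<and> j < n")
    case True
    have "(\<Oplus>\<^bsub>?S\<^esub>k\<in>{..<n}. e i k \<otimes>\<^bsub>?S\<^esub> e k j) = e i j"
    proof (rule ev_inject)
      fix x :: 'x assume "x \<in> topspace BT"
      then show "ev x (\<Oplus>\<^bsub>?S\<^esub>k\<in>{..<n}. e i k \<otimes>\<^bsub>?S\<^esub> e k j) = ev x (e i j)"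
        using ee True e by (subst mlift_sum_mult[OF cont_ring_cring mpoly_cring eval_type_hom]) auto
    qed (use e in \<open>auto intro!: S.finsum_closed\<close>)
    moreover have "mm n E E i j = mm n (lift_mats germ e) (lift_mats germ e) i j"
      using True by (simp add: mm_def E_def lift_mats_def)
    ultimately show ?thesis
      using True e mlift_sum_mult[OF cont_ring_cring mpoly_cring germ_type_hom, of n e i m e j] by (simp add: E_def)
  next
    case False
    then show ?thesis by (auto simp: mm_def E_def)
  qed
  then have "stably_free (polys m) n E" by (intro idempotent_stably_free E ext)
  then obtain b c A1 A2 A3 A4 where A: "A1 \<in> mats (polys m) n c" "A2 \<in> mats (polys m) b c"
      "A3 \<in> mats (polys m) c n" "A4 \<in> mats (polys m) c b"
    and eqs: "mm c A1 A3 = E" "mm c A1 A4 = (%_ _. 0)" "mm c A2 A3 = (%_ _. 0)" "mm c A2 A4 = idm b"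
     "(%i j. mm n A3 A1 i j + mm b A4 A2 i j) = idm c"
    unfolding stably_free_def by (elim exE conjE) (rule that)
  define rep :: "'x germ pl => nat multiset => 'x => real" where "rep P = (SOME p. p \<in> carrier ?S \<and> mlift germ p = P)" for P
  have rep: "rep P \<in> carrier ?S \<and> mlift germ (rep P) = P" if "P \<in> polys m" for P
  proof -
    have "\<exists>p. p \<in> carrier ?S \<and> mlift germ p = P"
      using mlift_surj[OF cont_ring_cring germ_type_hom germ_surj that] by blast
    from someI_ex[OF this] show ?thesis unfolding rep_def .
  qed
  define a1 a2 a3 a4 where "a1 i j = rep (A1 i j)" and "a2 i j = rep (A2 i j)" and "a3 i j = rep (A3 i j)" and "a4 i j = rep (A4 i j)" for i j
  have aS: "a1 i j \<in> carrier ?S" "a2 i j \<in> carrier ?S" "a3 i j \<in> carrier ?S" "a4 i j \<in> carrier ?S" for i j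
    using A rep by (auto simp: mats_def a1_def a2_def a3_def a4_def)
  have lA: "lift_mats germ a1 = A1" "lift_mats germ a2 = A2" "lift_mats germ a3 = A3" "lift_mats germ a4 = A4"
    using A rep by (auto simp: mats_def lift_mats_def a1_def a2_def a3_def a4_def intro!: ext)
  have mm0: "mm 0 M N i j = 0" for M N :: "nat => nat => 'b::comm_ring_1" and i j by (simp add: mm_def)
  define ids :: "nat => nat => nat => nat multiset => 'x => real" where "ids k i j = (if i = j \<and> i < k then \<one>\<^bsub>?S\<^esub> else \<zero>\<^bsub>?S\<^esub>)" for k i j :: nat
  have ids: "ids k i j \<in> carrier ?S" for k i j by (simp add: ids_def)
  have idg: "mlift germ (ids k i j) = idm k i j" for k i j
    using type_homD(3,4)[OF hom] by (simp add: ids_def idm_def)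
  let ?l = "%x. lift_mats (%f. f x)"
  \<comment> \<open>An inner dimension of zero removes the second product of
    \<open>mm_near\<close>.\<close>
  note near = mm_near[where m = m and k' = 0 and a' = a1 and b' = a1, unfolded mm0 add_0_right]
  have n1: "\<forall>\<^sub>F x in nhdsin BT bp. \<forall>i\<in>{..<n}. \<forall>j\<in>{..<n}. mm c (?l x a1) (?l x a3) i j = ev x (e i j)"
    by (intro eventually_ball_finite ballI finite_lessThan near) (use aS e eqs in \<open>auto simp: lA E_def\<close>)
  have n2: "\<forall>\<^sub>F x in nhdsin BT bp. \<forall>i\<in>{..<n}. \<forall>j\<in>{..<b}. mm c (?l x a1) (?l x a4) i j = ev x (\<zero>\<^bsub>?S\<^esub>)"
    by (intro eventually_ball_finite ballI finite_lessThan near) (use aS eqs type_homD(3)[OF hom] in \<open>auto simp: lA\<close>)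
  have n3: "\<forall>\<^sub>F x in nhdsin BT bp. \<forall>i\<in>{..<b}. \<forall>j\<in>{..<n}. mm c (?l x a2) (?l x a3) i j = ev x (\<zero>\<^bsub>?S\<^esub>)"
    by (intro eventually_ball_finite ballI finite_lessThan near) (use aS eqs type_homD(3)[OF hom] in \<open>auto simp: lA\<close>)
  have n4: "\<forall>\<^sub>F x in nhdsin BT bp. \<forall>i\<in>{..<b}. \<forall>j\<in>{..<b}. mm c (?l x a2) (?l x a4) i j = ev x (ids b i j)"
    by (intro eventually_ball_finite ballI finite_lessThan near) (use aS eqs ids idg in \<open>auto simp: lA\<close>)
  have n5: "\<forall>\<^sub>F x in nhdsin BT bp. \<forall>i\<in>{..<c}. \<forall>j\<in>{..<c}. mm n (?l x a3) (?l x a1) i j + mm b (?l x a4) (?l x a2) i j = ev x (ids c i j)"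
    by (intro eventually_ball_finite ballI finite_lessThan mm_near[where m = m])
      (use aS fun_cong[OF fun_cong[OF eqs(5)]] ids idg in \<open>auto simp: lA\<close>)
  have "\<forall>\<^sub>F x in nhdsin BT bp. stabilizes n (?l x e) b c (?l x a1) (?l x a2) (?l x a3) (?l x a4)"
    using n1 n2 n3 n4 n5 near_topspace
  proof eventually_elim
    case (elim x)
    note hx = ev_hom[OF elim(6), of m]
    have "ev x (ids k i j) = idm k i j" for k i j using type_homD(3,4)[OF hx] by (simp add: ids_def idm_def)
    then show ?case using elim type_homD(3)[OF hx] by (simp add: stabilizes_def lift_mats_def)
  qed
  from nhdsinD[OF this base_in] obtain U where U: "openin BT U" "bp \<in> U"
      "\<forall>x\<in>U. stabilizes n (?l x e) b c (?l x a1) (?l x a2) (?l x a3) (?l x a4)"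
    by (elim exE conjE) (rule that)
  show "\<exists>b c a1 a2 a3 a4 U. (\<forall>i j. a1 i j \<in> carrier ?S) \<and> (\<forall>i j. a2 i j \<in> carrier ?S) \<and> (\<forall>i j. a3 i j \<in> carrier ?S) \<and>
      (\<forall>i j. a4 i j \<in> carrier ?S) \<and> openin BT U \<and> bp \<in> U \<and>
      (\<forall>x\<in>U. stabilizes n (?l x e) b c (?l x a1) (?l x a2) (?l x a3) (?l x a4))"
    by (intro exI conjI allI) (use aS U in auto)
qed

text \<open>\<open>base_point\<close> is a counterexample as soon as any exists on the given type,
  yet both statements have been proved for it.\<close>

lemma valuation_point_local:
  assumes "valuation_point T p"
  shows "locally_split T p \<and> locally_stably_free T p"
proof (rule ccontr)
  assume "\<not> ?thesis"
  with assms have ex: "\<exists>z :: 'a topology \<times> 'a. bad_point z" unfolding bad_point_def by auto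
  then have "bad_point (base_point :: 'a topology \<times> 'a)" unfolding base_point_def by (simp add: someI_ex)
  then show False
    using base_locally_split[where 'x = 'a] base_locally_stably_free[where 'x = 'a] by (simp add: bad_point_def case_prod_beta)
qed

text \<open>A path of functions from \<open>0\<close> to \<open>1\<close> on a compact Hausdorff space, each step of which moves
  only inside a set on which a given local property holds.\<close>

lemma partition_functions:
  fixes T :: "'x topology" and Q :: "'z => 'x => bool"
  assumes T: "compact_space T" "Hausdorff_space T"
    and loc: "\<forall>p\<in>topspace T. \<exists>z U. C z \<and> openin T U \<and> p \<in> U \<and> (\<forall>x\<in>U. Q z x)"
  shows "\<exists>k (z :: nat => 'z) \<phi> \<theta>. (\<forall>i<k. C (z i)) \<and> (\<forall>i. continuous_map T euclideanreal (\<phi> i)) \<and>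
    (\<forall>i<k. continuous_map T euclideanreal (\<theta> i)) \<and> (\<forall>x. \<phi> 0 x = 0) \<and> (\<forall>x\<in>topspace T. \<phi> k x = 1) \<and>
    (\<forall>i<k. \<forall>x\<in>topspace T. \<phi> (Suc i) x = \<phi> i x \<or> \<theta> i x = 1) \<and>
    (\<forall>i<k. \<forall>x\<in>topspace T. \<theta> i x \<noteq> 0 \<longrightarrow> Q (z i) x)"
proof -
  have "\<exists>z f. C z \<and> continuous_map T euclideanreal f \<and> f p = (1::real) \<and> (\<forall>x\<in>topspace T. f x \<noteq> 0 \<longrightarrow> Q z x)"
    if p: "p \<in> topspace T" for p
  proof -
    obtain z U where z: "C z" and U: "openin T U" "p \<in> U" "\<forall>x\<in>U. Q z x" using loc p by blast
    have "normal_space T" using T compact_Hausdorff_or_regular_imp_normal_space by blast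
    moreover have "closedin T (topspace T - U)" using U by blast
    moreover have "closedin T {p}" using T p by (simp add: closedin_Hausdorff_sing_eq)
    ultimately obtain f where f: "continuous_map T euclideanreal f" "f ` (topspace T - U) \<subseteq> {0}" "f ` {p} \<subseteq> {1}"
      using U by (elim Urysohn_lemma_alt[of T "topspace T - U" "{p}" "0::real" 1]) auto
    then have "\<forall>x\<in>topspace T. f x \<noteq> 0 \<longrightarrow> Q z x" using U by auto
    with z f show ?thesis by (intro exI[of _ z] exI[of _ f]) auto
  qed
  then obtain z f where zf: "!!p. p \<in> topspace T ==> C (z p) \<and> continuous_map T euclideanreal (f p) \<and> f p p = (1::real) \<and>
      (\<forall>x\<in>topspace T. f p x \<noteq> 0 \<longrightarrow> Q (z p) x)" by metis
  \<comment> \<open>An open cover, since \<open>f p\<close> is one at \<open>p\<close>; the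
    threshold \<open>3/4\<close> leaves room for the ramp between \<open>1/2\<close> and
    \<open>3/4\<close> used below.\<close>
  define V where "V p = {x \<in> topspace T. f p x \<in> {3/4<..}}" for p
  have V: "openin T (V p)" if "p \<in> topspace T" for p
    unfolding V_def by (rule openin_continuous_map_preimage[where Y = euclideanreal]) (use zf[OF that] in auto)
  have "topspace T \<subseteq> \<Union> (V ` topspace T)" using zf by (auto simp: V_def)
  then obtain F where "finite F" "F \<subseteq> V ` topspace T" "topspace T \<subseteq> \<Union> F"
    using T(1) V unfolding compact_space_alt by (metis (no_types, lifting) imageE)
  then obtain P where P: "finite P" "P \<subseteq> topspace T" "topspace T \<subseteq> \<Union> (V ` P)"
    by (metis finite_subset_image)
  obtain g where g: "bij_betw g {..<card P} P" using ex_bij_betw_nat_finite[OF P(1)] by (auto simp: atLeast0LessThan)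
  let ?k = "card P"
  have gT: "g i \<in> topspace T" if "i < ?k" for i using bij_betwE[OF g] P(2) that by auto
  \<comment> \<open>\<open>t i\<close> is positive only where \<open>f (g i) > 1/2\<close> and is at
    least one where \<open>f (g i) > 3/4\<close>, while \<open>\<theta> i\<close> is already one
    where \<open>f (g i) \<ge> 1/2\<close>. So step \<open>i\<close> moves \<open>\<phi>\<close>
    only where \<open>\<theta> i = 1\<close>, and the full sum reaches one everywhere.\<close>
  define t where "t i x = 2 * max 0 (2 * f (g i) x - 1)" for i x
  \<comment> \<open>The truncated index makes \<open>\<phi> i\<close> continuous for every
    \<open>i\<close>, also beyond \<open>?k\<close>.\<close>
  define \<phi> where "\<phi> i x = min 1 (\<Sum>j<min i ?k. t j x)" for i x
  define \<theta> where "\<theta> i x = min 1 (2 * f (g i) x)" for i x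
  have ct: "continuous_map T euclideanreal (t i)" if "i < ?k" for i
    unfolding t_def using zf[OF gT[OF that]]
    by (intro continuous_map_real_mult_left continuous_map_real_max continuous_map_diff) auto
  have cs: "continuous_map T euclideanreal (%x. \<Sum>j<i. t j x)" if "i \<le> ?k" for i
    using that by (induction i) (auto intro!: continuous_map_add ct)
  have t0: "t j x \<ge> 0" for j x by (simp add: t_def)
  show ?thesis
  proof (rule exI[of _ ?k], rule exI[of _ "%i. z (g i)"], rule exI[of _ \<phi>], rule exI[of _ \<theta>], intro conjI allI impI ballI)
    fix i
    show "continuous_map T euclideanreal (\<phi> i)"
      unfolding \<phi>_def by (intro continuous_map_real_min cs) auto
    assume i: "i < ?k"
    show "C (z (g i))" using zf[OF gT[OF i]] by blast
    show "continuous_map T euclideanreal (\<theta> i)"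
      unfolding \<theta>_def using zf[OF gT[OF i]] by (intro continuous_map_real_min continuous_map_real_mult_left) auto
    fix x assume x: "x \<in> topspace T"
    show "\<phi> (Suc i) x = \<phi> i x \<or> \<theta> i x = 1"
      using i by (auto simp: \<phi>_def \<theta>_def t_def max_def min_def)
    assume "\<theta> i x \<noteq> 0"
    then have "f (g i) x \<noteq> 0" by (auto simp: \<theta>_def)
    then show "Q (z (g i)) x" using zf[OF gT[OF i]] x by blast
  next
    fix x assume "x \<in> topspace T"
    then obtain p where "p \<in> P" "x \<in> V p" using P(3) by blast
    then obtain i where i: "i < ?k" "p = g i" using bij_betw_imp_surj_on[OF g] by auto
    have "1 \<le> t i x" using \<open>x \<in> V p\<close> i by (simp add: t_def V_def)
    also have "\<dots> \<le> (\<Sum>j<?k. t j x)" using i t0 by (intro member_le_sum) auto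
    finally show "\<phi> ?k x = 1" by (simp add: \<phi>_def)
  qed (simp add: \<phi>_def)
qed

text \<open>The weights are the increments \<open>\<phi> (Suc a) - \<phi> a\<close>: they telescope
  to one, and the one with index \<open>a\<close> vanishes wherever \<open>z a\<close> fails to be a
  solution.\<close>

lemma global_split:
  fixes T :: "'x topology" and n k q :: nat and D w :: "nat => nat => 'x => real"
  assumes F: "F_space T" and D: "\<forall>i j. D i j \<in> carrier (cont_ring T)" and w: "\<forall>l j. w l j \<in> carrier (cont_ring T)"
    and Dw: "\<forall>l<q. \<forall>i<n. \<forall>x\<in>topspace T. (\<Sum>j<k. D i j x * w l j x) = 0"
  shows "\<exists>Pm. (\<forall>i j. Pm i j \<in> carrier (cont_ring T)) \<and>
    (\<forall>x\<in>topspace T. \<forall>i<n. \<forall>j<k. (\<Sum>l<k. D i l x * Pm l j x) = 0) \<and>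
    (\<forall>x\<in>topspace T. \<forall>l<q. \<forall>i<k. (\<Sum>j<k. Pm i j x * w l j x) = w l i x)"
proof -
  let ?R = "cont_ring T"
  have T: "compact_space T" "Hausdorff_space T" using F by (auto simp: F_space_def)
  let ?C = "%Pm :: nat => nat => 'x => real. \<forall>i j. Pm i j \<in> carrier ?R"
  let ?Q = "%Pm x. (\<forall>i<n. \<forall>j<k. (\<Sum>l<k. D i l x * Pm l j x) = 0) \<and> (\<forall>l<q. \<forall>i<k. (\<Sum>j<k. Pm i j x * w l j x) = w l i x)"
  have loc: "\<forall>p\<in>topspace T. \<exists>Pm U. ?C Pm \<and> openin T U \<and> p \<in> U \<and> (\<forall>x\<in>U. ?Q Pm x)"
  proof
    fix p assume p: "p \<in> topspace T"
    have "locally_split T p" using valuation_point_local[OF F_space_valuation_point[OF F p]] by blast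
    from this[unfolded locally_split_def, rule_format, of D w q n k] D w Dw
    obtain Pm U where "?C Pm" "openin T U" "p \<in> U" "\<forall>x\<in>U. \<forall>i<n. \<forall>j<k. (\<Sum>l<k. D i l x * Pm l j x) = 0"
      "\<forall>x\<in>U. \<forall>l<q. \<forall>i<k. (\<Sum>j<k. Pm i j x * w l j x) = w l i x" by auto
    then show "\<exists>Pm U. ?C Pm \<and> openin T U \<and> p \<in> U \<and> (\<forall>x\<in>U. ?Q Pm x)" by (intro exI[of _ Pm] exI[of _ U]) blast
  qed
  from partition_functions[of T ?C ?Q, OF T loc]
  obtain K z \<phi> \<theta> where z: "\<forall>a<K. ?C (z a)" and c\<phi>: "\<forall>a. continuous_map T euclideanreal (\<phi> a)"
    and \<phi>0: "\<forall>x. \<phi> 0 x = (0::real)" and \<phi>1: "\<forall>x\<in>topspace T. \<phi> K x = 1"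
    and step: "\<forall>a<K. \<forall>x\<in>topspace T. \<phi> (Suc a) x = \<phi> a x \<or> \<theta> a x = (1::real)"
    and Q: "\<forall>a<K. \<forall>x\<in>topspace T. \<theta> a x \<noteq> 0 \<longrightarrow> ?Q (z a) x"
    by (elim exE conjE) (rule that)
  define Pm where "Pm i j = restrict (%x. \<Sum>a<K. (\<phi> (Suc a) x - \<phi> a x) * z a i j x) (topspace T)" for i j
  have "Pm i j \<in> carrier ?R" for i j
    unfolding Pm_def
  proof (rule restrict_cont_ring)
    have "continuous_map T euclideanreal (%x. \<Sum>a<b. (\<phi> (Suc a) x - \<phi> a x) * z a i j x)" if "b \<le> K" for b
      using that
    proof (induction b)
      case (Suc b)
      then show ?case using z c\<phi> by (auto simp: cont_ring_simps intro!: continuous_map_add continuous_map_real_mult continuous_map_diff)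
    qed simp
    then show "continuous_map T euclideanreal (%x. \<Sum>a<K. (\<phi> (Suc a) x - \<phi> a x) * z a i j x)" by blast
  qed
  moreover have "(\<Sum>l<k. D i l x * Pm l j x) = 0" if x: "x \<in> topspace T" and "i < n" "j < k" for x i j
  proof -
    have "(\<Sum>l<k. D i l x * Pm l j x) = (\<Sum>a<K. (\<phi> (Suc a) x - \<phi> a x) * (\<Sum>l<k. D i l x * z a l j x))"
      using x by (simp add: Pm_def sum_distrib_left mult.left_commute) (rule sum.swap)
    also have "\<dots> = 0"
    proof (intro sum.neutral ballI)
      fix a assume "a \<in> {..<K}"
      then show "(\<phi> (Suc a) x - \<phi> a x) * (\<Sum>l<k. D i l x * z a l j x) = 0"
        using step[rule_format, of a x] Q[rule_format, of a x] x that by (cases "\<phi> (Suc a) x = \<phi> a x") auto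
    qed
    finally show ?thesis .
  qed
  moreover have "(\<Sum>j<k. Pm i j x * w l j x) = w l i x" if x: "x \<in> topspace T" and "l < q" "i < k" for x l i
  proof -
    have "(\<Sum>j<k. Pm i j x * w l j x) = (\<Sum>a<K. (\<phi> (Suc a) x - \<phi> a x) * (\<Sum>j<k. z a i j x * w l j x))"
      using x by (simp add: Pm_def sum_distrib_left sum_distrib_right mult.assoc) (rule sum.swap)
    also have "\<dots> = (\<Sum>a<K. (\<phi> (Suc a) x - \<phi> a x) * w l i x)"
    proof (intro sum.cong refl)
      fix a assume "a \<in> {..<K}"
      then show "(\<phi> (Suc a) x - \<phi> a x) * (\<Sum>j<k. z a i j x * w l j x) = (\<phi> (Suc a) x - \<phi> a x) * w l i x"
        using step[rule_format, of a x] Q[rule_format, of a x] x that by (cases "\<phi> (Suc a) x = \<phi> a x") auto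
    qed
    also have "\<dots> = (\<phi> K x - \<phi> 0 x) * w l i x"
      by (simp add: sum_distrib_right[symmetric] sum_lessThan_telescope[of "%a. \<phi> a x" K])
    finally show ?thesis using \<phi>0 \<phi>1 x by simp
  qed
  ultimately show ?thesis by (intro exI[of _ Pm]) blast
qed

section \<open>Scaling the variables of a polynomial\<close>

text \<open>The substitution of \<open>r x\<close> for every indeterminate \<open>x\<close>;
  \<open>scale\<close> does the same with a function of the point in place of
  \<open>r\<close>.\<close>

definition pscale :: "real => real pl => real pl" where
  "pscale r P = Abs_poly_mapping (%\<mu>. r ^ size \<mu> * lookup P \<mu>)"

lemma lookup_pscale: "lookup (pscale r P) \<mu> = r ^ size \<mu> * lookup P \<mu>"
proof -
  have "{\<mu>. r ^ size \<mu> * lookup P \<mu> \<noteq> 0} \<subseteq> {\<mu>. lookup P \<mu> \<noteq> 0}" by auto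
  then have "finite {\<mu>. r ^ size \<mu> * lookup P \<mu> \<noteq> 0}" by (rule finite_subset) (rule finite_lookup)
  then show ?thesis unfolding pscale_def by simp
qed

lemma pscale_simps: "pscale r (P + Q) = pscale r P + pscale r Q" "pscale r 0 = 0" "pscale r 1 = 1"
  by (rule poly_mapping_eqI; simp add: lookup_pscale lookup_add distrib_left lookup_one when_def)+

lemma pscale_mult: "pscale r (P * Q) = pscale r P * pscale r Q"
proof (rule poly_mapping_eqI)
  fix \<mu>
  show "lookup (pscale r (P * Q)) \<mu> = lookup (pscale r P * pscale r Q) \<mu>"
    unfolding lookup_pscale lookup_times sum_distrib_left
  proof (intro sum.cong refl)
    fix \<nu> assume "\<nu> \<in> {\<nu>. \<nu> \<subseteq># \<mu>}"
    then have "\<nu> + (\<mu> - \<nu>) = \<mu>" by simp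
    then have "size \<mu> = size \<nu> + size (\<mu> - \<nu>)" by (metis size_union)
    then show "r ^ size \<mu> * (lookup P \<nu> * lookup Q (\<mu> - \<nu>)) = r ^ size \<nu> * lookup P \<nu> * (r ^ size (\<mu> - \<nu>) * lookup Q (\<mu> - \<nu>))"
      by (simp add: power_add)
  qed
qed

lemma pscale_sum: "pscale r (\<Sum>i\<in>I. f i) = (\<Sum>i\<in>I. pscale r (f i))"
  by (induction I rule: infinite_finite_induct) (simp_all add: pscale_simps)

lemma pscale_mm: "pscale r (mm k a b i j) = mm k (%i j. pscale r (a i j)) (%i j. pscale r (b i j)) i j"
  by (simp add: mm_def pscale_sum pscale_mult)

definition scale :: "'x topology => ('x => real) => (nat multiset => 'x => real) => nat multiset => 'x => real" where
  "scale T \<psi> p = (%\<mu>. restrict (%x. \<psi> x ^ size \<mu> * p \<mu> x) (topspace T))"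

lemma scale_closed:
  assumes \<psi>: "continuous_map T euclideanreal \<psi>" and p: "p \<in> carrier (mpoly_ring (cont_ring T) m)"
  shows "scale T \<psi> p \<in> carrier (mpoly_ring (cont_ring T) m)"
proof -
  interpret R: cring "cont_ring T" by (rule cont_ring_cring)
  note pD = R.mpoly_carrierD[OF p]
  have c: "scale T \<psi> p \<mu> \<in> carrier (cont_ring T)" for \<mu>
    unfolding scale_def using pD(1)[of \<mu>] \<psi>
    by (intro restrict_cont_ring continuous_map_real_mult continuous_map_real_pow) (auto simp: cont_ring_simps)
  have nz: "p \<mu> \<noteq> \<zero>\<^bsub>cont_ring T\<^esub>" if "scale T \<psi> p \<mu> \<noteq> \<zero>\<^bsub>cont_ring T\<^esub>" for \<mu>
  proof
    assume "p \<mu> = \<zero>\<^bsub>cont_ring T\<^esub>"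
    then have "scale T \<psi> p \<mu> = \<zero>\<^bsub>cont_ring T\<^esub>" unfolding scale_def cont_ring_simps by (auto simp: fun_eq_iff)
    with that show False ..
  qed
  have "finite {\<mu>. scale T \<psi> p \<mu> \<noteq> \<zero>\<^bsub>cont_ring T\<^esub>}" by (rule finite_subset[OF _ pD(2)]) (use nz in blast)
  then show ?thesis unfolding R.mpoly_carrier_iff using c nz pD(3) by blast
qed

lemma ev_scale:
  assumes \<psi>: "continuous_map T euclideanreal \<psi>" and p: "p \<in> carrier (mpoly_ring (cont_ring T) m)" and x: "x \<in> topspace T"
  shows "ev x (scale T \<psi> p) = pscale (\<psi> x) (ev x p)"
  by (rule poly_mapping_eqI)
    (simp add: lookup_pscale lookup_ev[OF x p] lookup_ev[OF x scale_closed[OF \<psi> p]], simp add: scale_def x)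

lemma ev_const:
  assumes f: "f \<in> carrier (cont_ring T)" and x: "x \<in> topspace T"
  shows "lookup (ev x (ring.indexed_const (cont_ring T) f)) \<mu> = (if \<mu> = {#} then f x else 0)"
proof -
  interpret R: cring "cont_ring T" by (rule cont_ring_cring)
  show ?thesis using lookup_ev[OF x R.mpoly_const[OF f, of 0]] x
    by (simp add: R.indexed_const_def cont_ring_simps)
qed

section \<open>Patching\<close>

text \<open>The matrix \<open>e \<oplus> 1\<close>, with an identity block as large as the size in
  use demands.\<close>

definition block :: "('r, 'k) ring_scheme => nat => (nat => nat => 'r) => nat => nat => 'r" where
  "block R n e = (%i j. if i < n \<and> j < n then e i j else if i = j \<and> n \<le> i then \<one>\<^bsub>R\<^esub> else \<zero>\<^bsub>R\<^esub>)"

abbreviation eblock :: "nat => (nat => nat => real pl) => nat => nat => real pl" where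
  "eblock n e \<equiv> (%i j. if i < n \<and> j < n then e i j else if i = j \<and> n \<le> i then 1 else 0)"

lemma sum_split_add: "(\<Sum>k<n + b. f k) = (\<Sum>k<n. f k) + (\<Sum>k<b. f (n + k))" for f :: "nat => 'b::comm_monoid_add"
  by (induction b) (simp_all add: ac_simps)

lemma eblock_idempotent:
  assumes "!!i j. i < n ==> j < n ==> mm n e e i j = e i j" and "i < n + b" "j < n + b"
  shows "mm (n + b) (eblock n e) (eblock n e) i j = eblock n e i j"
proof (cases "i < n")
  case True
  have "mm (n + b) (eblock n e) (eblock n e) i j = (\<Sum>k<n. e i k * eblock n e k j)"
    unfolding mm_def sum_split_add using True by (simp cong: sum.cong_simp)
  also have "\<dots> = eblock n e i j"
    using assms(1)[of i j] True by (cases "j < n") (auto simp: mm_def cong: sum.cong_simp)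
  finally show ?thesis .
next
  case False
  have "mm (n + b) (eblock n e) (eblock n e) i j = (\<Sum>k<n + b. if k = i then eblock n e k j else 0)"
    unfolding mm_def using False by (intro sum.cong) auto
  also have "\<dots> = eblock n e i j" using assms(2) by simp
  finally show ?thesis .
qed

text \<open>Together with \<open>row_join\<close> this merges the four blocks of
  \<open>stabilizes\<close> into a pair \<open>\<alpha>\<close>, \<open>\<beta>\<close> with
  \<open>\<alpha> \<beta> = e \<oplus> 1\<close> and \<open>\<beta> \<alpha> = 1\<close>.\<close>

definition col_join :: "nat => (nat => nat => 'b) => (nat => nat => 'b) => nat => nat => 'b" where
  "col_join n a1 a2 = (%i j. if i < n then a1 i j else a2 (i - n) j)"

definition row_join :: "nat => (nat => nat => 'b) => (nat => nat => 'b) => nat => nat => 'b" where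
  "row_join n a3 a4 = (%i j. if j < n then a3 i j else a4 i (j - n))"

lemma stabilizes_join:
  assumes "stabilizes n e b c a1 a2 a3 a4"
  shows "i < n + b ==> j < n + b ==> mm c (col_join n a1 a2) (row_join n a3 a4) i j = eblock n e i j"
    and "i < c ==> j < c ==> mm (n + b) (row_join n a3 a4) (col_join n a1 a2) i j = idm c i j"
proof -
  show "mm c (col_join n a1 a2) (row_join n a3 a4) i j = eblock n e i j" if "i < n + b" "j < n + b"
  proof -
    have "mm c (col_join n a1 a2) (row_join n a3 a4) i j =
      mm c (if i < n then a1 else a2) (if j < n then a3 else a4) (if i < n then i else i - n) (if j < n then j else j - n)"
      by (simp add: mm_def col_join_def row_join_def)
    then show ?thesis using assms that by (auto simp: stabilizes_def idm_def)
  qed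
  show "mm (n + b) (row_join n a3 a4) (col_join n a1 a2) i j = idm c i j" if "i < c" "j < c"
    using assms that by (simp add: stabilizes_def mm_def sum_split_add col_join_def row_join_def cong: sum.cong_simp)
qed

text \<open>At a point where the path is stationary the interpolated matrix is the idempotent itself; at all
  other points it is the isomorphism built from the local trivializations.\<close>

lemma glue_pointwise:
  fixes \<alpha> \<beta> :: "nat => nat => real pl"
  assumes ee: "!!i j. i < N ==> j < N ==> mm N E E i j = E i j" and kk: "k1 + k2 = 1"
    and cases: "k1 = 0 \<and> k2 = 1 \<and> (\<forall>i<N. \<forall>j<N. mm c \<alpha> \<beta> i j = E i j) \<and> (\<forall>i<c. \<forall>j<c. mm N \<beta> \<alpha> i j = idm c i j) \<or>
      u = v \<and> (k2 = 0 \<or> (\<forall>i<N. \<forall>j<N. mm c \<alpha> \<beta> i j = E i j))"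
    and V: "!!i j. V i j = k1 * pscale u (E i j) + k2 * mm c (%i j. pscale u (\<alpha> i j)) (%i j. pscale v (\<beta> i j)) i j"
    and W: "!!i j. W i j = k1 * pscale v (E i j) + k2 * mm c (%i j. pscale v (\<alpha> i j)) (%i j. pscale u (\<beta> i j)) i j"
    and i: "i < N" and j: "j < N"
  shows "mm N V W i j = pscale u (E i j)"
  using cases
proof
  assume k: "k1 = 0 \<and> k2 = 1 \<and> (\<forall>i<N. \<forall>j<N. mm c \<alpha> \<beta> i j = E i j) \<and> (\<forall>i<c. \<forall>j<c. mm N \<beta> \<alpha> i j = idm c i j)"
  let ?a = "%r i j. pscale r (\<alpha> i j)" and ?b = "%r i j. pscale r (\<beta> i j)"
  have "V = mm c (?a u) (?b v)" "W = mm c (?a v) (?b u)" using k by (auto simp: V W intro!: ext)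
  \<comment> \<open>The inner factors \<open>\<beta>(v x)\<close> and \<open>\<alpha>(v x)\<close>
    cancel to the identity, which leaves \<open>\<alpha>(u x) \<beta>(u x)\<close>.\<close>
  then have "mm N V W i j = mm c (?a u) (mm c (mm N (?b v) (?a v)) (?b u)) i j" by (simp add: mm_assoc)
  also have "\<dots> = (\<Sum>l<c. ?a u i l * ?b u l j)"
    unfolding mm_def[of c "?a u"]
  proof (intro sum.cong refl)
    fix l assume l: "l \<in> {..<c}"
    have "mm N (?b v) (?a v) l t = (if t = l then 1 else 0)" if "t < c" for t
      using k l that by (simp add: pscale_mm[symmetric] idm_def pscale_simps)
    then have "mm c (mm N (?b v) (?a v)) (?b u) l j = (\<Sum>t<c. if t = l then ?b u t j else 0)"
      unfolding mm_def[of c "mm N (?b v) (?a v)"] by (intro sum.cong refl) auto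
    then show "?a u i l * mm c (mm N (?b v) (?a v)) (?b u) l j = ?a u i l * ?b u l j" using l by simp
  qed
  also have "\<dots> = pscale u (mm c \<alpha> \<beta> i j)" by (simp add: mm_def pscale_sum pscale_mult)
  finally show ?thesis using k i j by simp
next
  assume a: "u = v \<and> (k2 = 0 \<or> (\<forall>i<N. \<forall>j<N. mm c \<alpha> \<beta> i j = E i j))"
  have kk': "k1 * P + k2 * P = P" for P using kk by (simp add: distrib_right[symmetric])
  have k0: "k2 = 0 ==> k1 = 1" using kk by simp
  \<comment> \<open>Either both terms contain the same matrix, with weights adding up to one, or the
    second has weight zero.\<close>
  have V': "V i j = pscale u (E i j)" and W': "W i j = pscale u (E i j)" if "i < N" "j < N" for i j
    using a that kk' k0 by (auto simp: V W pscale_mm[symmetric])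
  have "mm N V W i j = mm N (%i j. pscale u (E i j)) (%i j. pscale u (E i j)) i j"
    unfolding mm_def using i j by (intro sum.cong refl) (simp add: V' W')
  then show ?thesis using ee[OF i j] by (simp add: pscale_mm[symmetric])
qed

text \<open>\<open>\<epsilon> a\<close> is \<open>e\<close> with its indeterminates scaled by
  \<open>\<phi> a\<close>: for \<open>a = 0\<close> only constant terms survive, for
  \<open>a = K\<close> it is \<open>e\<close>. Neighbours, enlarged by an identity of size
  \<open>b a\<close>, are equivalent through the interpolated matrices \<open>P\<close>. Every
  identity is verified under all evaluations \<open>ev x\<close>.\<close>

lemma idempotent_homotopy:
  fixes T :: "'x topology" and m n :: nat
  defines "S \<equiv> mpoly_ring (cont_ring T) m"
  assumes F: "F_space T" and e: "!!i j. e i j \<in> carrier S"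
    and ee: "!!i j. i < n ==> j < n ==> (\<Oplus>\<^bsub>S\<^esub>k\<in>{..<n}. e i k \<otimes>\<^bsub>S\<^esub> e k j) = e i j"
  shows "\<exists>K \<epsilon> b. (\<forall>a i j. \<epsilon> a i j \<in> carrier S) \<and>
    (\<forall>a. \<forall>i<n. \<forall>j<n. (\<Oplus>\<^bsub>S\<^esub>k\<in>{..<n}. \<epsilon> a i k \<otimes>\<^bsub>S\<^esub> \<epsilon> a k j) = \<epsilon> a i j) \<and>
    (\<forall>i j. \<epsilon> (0::nat) i j = ring.indexed_const (cont_ring T) (e i j {#})) \<and> (\<forall>i j. \<epsilon> K i j = e i j) \<and>
    (\<forall>a<K. \<exists>V W. (\<forall>i j. V i j \<in> carrier S) \<and> (\<forall>i j. W i j \<in> carrier S) \<and>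
       (\<forall>i<n + b a. \<forall>j<n + b a. (\<Oplus>\<^bsub>S\<^esub>k\<in>{..<n + b a}. V i k \<otimes>\<^bsub>S\<^esub> W k j) = block S n (\<epsilon> (Suc a)) i j \<and>
          (\<Oplus>\<^bsub>S\<^esub>k\<in>{..<n + b a}. W i k \<otimes>\<^bsub>S\<^esub> V k j) = block S n (\<epsilon> a) i j))"
proof -
  let ?R = "cont_ring T"
  interpret R: cring ?R by (rule cont_ring_cring)
  interpret S: cring S unfolding S_def by (rule mpoly_cring)
  let ?l = "%x. lift_mats (%f :: 'x => real. f x)"
  have T: "compact_space T" "Hausdorff_space T" using F by (auto simp: F_space_def)
  have hx: "type_hom S (ev x)" if "x \<in> topspace T" for x unfolding S_def by (rule ev_hom[OF that])
  have eqS: "p = q" if "p \<in> carrier S" "q \<in> carrier S" "!!x. x \<in> topspace T ==> ev x p = ev x q" for p q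
    using ev_inject[of p T m q] that unfolding S_def by blast
  have ev_mm: "ev x (\<Oplus>\<^bsub>S\<^esub>k\<in>{..<N}. a i k \<otimes>\<^bsub>S\<^esub> b k j) = mm N (?l x a) (?l x b) i j"
    if "x \<in> topspace T" "!!i j. a i j \<in> carrier S" "!!i j. b i j \<in> carrier S" for x N a b i j
    using mlift_sum_mult[OF cont_ring_cring mpoly_cring eval_type_hom[OF that(1)], of N a i m b j] that(2,3)
    unfolding S_def by simp
  have sumS: "(\<Oplus>\<^bsub>S\<^esub>k\<in>{..<N}. a i k \<otimes>\<^bsub>S\<^esub> b k j) \<in> carrier S"
    if "!!i j. a i j \<in> carrier S" "!!i j. b i j \<in> carrier S" for N :: nat and a b i j
    using that by (intro S.finsum_closed) auto
  have ex: "mm n (?l x e) (?l x e) i j = ?l x e i j" if "x \<in> topspace T" "i < n" "j < n" for x i j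
  proof -
    have "ev x (\<Oplus>\<^bsub>S\<^esub>k\<in>{..<n}. e i k \<otimes>\<^bsub>S\<^esub> e k j) = mm n (?l x e) (?l x e) i j" by (rule ev_mm[OF that(1) e e])
    then show ?thesis using ee[OF that(2,3)] by (simp add: lift_mats_def)
  qed
  let ?C = "%(b :: nat, c :: nat, a1, a2, a3, a4). (\<forall>i j :: nat. a1 i j \<in> carrier S) \<and> (\<forall>i j :: nat. a2 i j \<in> carrier S) \<and>
      (\<forall>i j :: nat. a3 i j \<in> carrier S) \<and> (\<forall>i j :: nat. a4 i j \<in> carrier S)"
  let ?Q = "%(b, c, a1, a2, a3, a4) x. stabilizes n (?l x e) b c (?l x a1) (?l x a2) (?l x a3) (?l x a4)"
  have loc: "\<forall>p\<in>topspace T. \<exists>z U. ?C z \<and> openin T U \<and> p \<in> U \<and> (\<forall>x\<in>U. ?Q z x)"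
  proof
    fix p assume p: "p \<in> topspace T"
    have "locally_stably_free T p" using valuation_point_local[OF F_space_valuation_point[OF F p]] by blast
    from this[unfolded locally_stably_free_def, rule_format, of e m n]
    have "\<exists>b c a1 a2 a3 a4 U. (\<forall>i j. a1 i j \<in> carrier S) \<and> (\<forall>i j. a2 i j \<in> carrier S) \<and> (\<forall>i j. a3 i j \<in> carrier S) \<and>
      (\<forall>i j. a4 i j \<in> carrier S) \<and> openin T U \<and> p \<in> U \<and>
      (\<forall>x\<in>U. stabilizes n (?l x e) b c (?l x a1) (?l x a2) (?l x a3) (?l x a4))"
      using e ex unfolding S_def lift_mats_def by auto
    then show "\<exists>z U. ?C z \<and> openin T U \<and> p \<in> U \<and> (\<forall>x\<in>U. ?Q z x)" by auto
  qed
  from partition_functions[of T ?C ?Q, OF T loc]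
  obtain K z \<phi> \<theta> where z: "\<forall>a<K. ?C (z a)" and c\<phi>: "\<forall>a. continuous_map T euclideanreal (\<phi> a)"
    and c\<theta>: "\<forall>a<K. continuous_map T euclideanreal (\<theta> a)"
    and \<phi>0: "\<forall>x. \<phi> 0 x = (0::real)" and \<phi>1: "\<forall>x\<in>topspace T. \<phi> K x = 1"
    and step: "\<forall>a<K. \<forall>x\<in>topspace T. \<phi> (Suc a) x = \<phi> a x \<or> \<theta> a x = (1::real)"
    and Q: "\<forall>a<K. \<forall>x\<in>topspace T. \<theta> a x \<noteq> 0 \<longrightarrow> ?Q (z a) x"
    by (elim exE conjE) (rule that)
  have sc: "scale T (\<phi> a) p \<in> carrier S" if "p \<in> carrier S" for a p
    unfolding S_def by (rule scale_closed) (use c\<phi> that in \<open>auto simp: S_def\<close>)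
  have evs: "ev x (scale T (\<phi> a) p) = pscale (\<phi> a x) (ev x p)" if "p \<in> carrier S" "x \<in> topspace T" for a p x
    by (rule ev_scale[where m = m]) (use c\<phi> that in \<open>auto simp: S_def\<close>)
  define \<epsilon> where "\<epsilon> a i j = scale T (\<phi> a) (e i j)" for a i j
  have \<epsilon>S: "\<epsilon> a i j \<in> carrier S" for a i j unfolding \<epsilon>_def by (rule sc[OF e])
  have l\<epsilon>: "?l x (\<epsilon> a) = (%i j. pscale (\<phi> a x) (?l x e i j))" if "x \<in> topspace T" for x a
    using evs[OF e that] by (simp add: lift_mats_def \<epsilon>_def)
  have \<epsilon>\<epsilon>: "(\<Oplus>\<^bsub>S\<^esub>k\<in>{..<n}. \<epsilon> a i k \<otimes>\<^bsub>S\<^esub> \<epsilon> a k j) = \<epsilon> a i j" if ij: "i < n" "j < n" for a i j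
  proof (rule eqS[OF sumS[OF \<epsilon>S \<epsilon>S] \<epsilon>S])
    fix x assume x: "x \<in> topspace T"
    have "ev x (\<Oplus>\<^bsub>S\<^esub>k\<in>{..<n}. \<epsilon> a i k \<otimes>\<^bsub>S\<^esub> \<epsilon> a k j) = pscale (\<phi> a x) (mm n (?l x e) (?l x e) i j)"
    proof -
      have "ev x (\<Oplus>\<^bsub>S\<^esub>k\<in>{..<n}. \<epsilon> a i k \<otimes>\<^bsub>S\<^esub> \<epsilon> a k j) = mm n (?l x (\<epsilon> a)) (?l x (\<epsilon> a)) i j"
        by (rule ev_mm[OF x]) (rule \<epsilon>S)+
      then show ?thesis by (simp only: l\<epsilon>[OF x] pscale_mm)
    qed
    also have "\<dots> = ev x (\<epsilon> a i j)" unfolding ex[OF x ij] using evs[OF e x] by (simp add: lift_mats_def \<epsilon>_def)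
    finally show "ev x (\<Oplus>\<^bsub>S\<^esub>k\<in>{..<n}. \<epsilon> a i k \<otimes>\<^bsub>S\<^esub> \<epsilon> a k j) = ev x (\<epsilon> a i j)" .
  qed
  have eR: "e i j {#} \<in> carrier ?R" for i j using R.mpoly_carrierD(1)[OF e[unfolded S_def]] .
  have \<epsilon>0: "\<epsilon> 0 i j = ring.indexed_const ?R (e i j {#})" for i j
  proof (rule eqS[OF \<epsilon>S])
    show "ring.indexed_const ?R (e i j {#}) \<in> carrier S" unfolding S_def by (rule R.mpoly_const[OF eR])
    fix x assume x: "x \<in> topspace T"
    show "ev x (\<epsilon> 0 i j) = ev x (ring.indexed_const ?R (e i j {#}))"
      by (rule poly_mapping_eqI)
        (simp add: \<epsilon>_def evs[OF e x] lookup_pscale \<phi>0 ev_const[OF eR x] lookup_ev[OF x e[unfolded S_def]] nonempty_has_size)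
  qed
  have \<epsilon>K: "\<epsilon> K i j = e i j" for i j
  proof (rule eqS[OF \<epsilon>S e])
    fix x assume x: "x \<in> topspace T"
    then show "ev x (\<epsilon> K i j) = ev x (e i j)"
      using \<phi>1 by (intro poly_mapping_eqI) (simp add: \<epsilon>_def evs[OF e x] lookup_pscale)
  qed
  define b where "b a = fst (z a)" for a
  have "\<exists>V W. (\<forall>i j. V i j \<in> carrier S) \<and> (\<forall>i j. W i j \<in> carrier S) \<and>
       (\<forall>i<n + b a. \<forall>j<n + b a. (\<Oplus>\<^bsub>S\<^esub>k\<in>{..<n + b a}. V i k \<otimes>\<^bsub>S\<^esub> W k j) = block S n (\<epsilon> (Suc a)) i j \<and>
          (\<Oplus>\<^bsub>S\<^esub>k\<in>{..<n + b a}. W i k \<otimes>\<^bsub>S\<^esub> V k j) = block S n (\<epsilon> a) i j)" if a: "a < K" for a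
  proof -
    let ?N = "n + b a"
    obtain c a1 a2 a3 a4 where za: "z a = (b a, c, a1, a2, a3, a4)" unfolding b_def by (metis prod.collapse)
    have aS: "a1 i j \<in> carrier S" "a2 i j \<in> carrier S" "a3 i j \<in> carrier S" "a4 i j \<in> carrier S" for i j
      using z[rule_format, OF a] by (simp_all add: za)
    have st: "stabilizes n (?l x e) (b a) c (?l x a1) (?l x a2) (?l x a3) (?l x a4)"
      if "x \<in> topspace T" "\<theta> a x \<noteq> 0" for x using Q[rule_format, OF a that] by (simp add: za)
    define \<alpha> where "\<alpha> = col_join n a1 a2"
    define \<beta> where "\<beta> = row_join n a3 a4"
    have abS: "\<alpha> i j \<in> carrier S" "\<beta> i j \<in> carrier S" for i j
      by (simp_all add: \<alpha>_def \<beta>_def col_join_def row_join_def aS)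
    have lab: "?l x \<alpha> = col_join n (?l x a1) (?l x a2)" "?l x \<beta> = row_join n (?l x a3) (?l x a4)" for x
      by (intro ext; simp add: lift_mats_def \<alpha>_def \<beta>_def col_join_def row_join_def)+
    \<comment> \<open>The weights \<open>1 - \<theta> a\<close> and \<open>\<theta> a\<close>, to be
      used as constant polynomials. Where \<open>\<theta> a\<close> vanishes, the local blocks need
      not satisfy any equation, and their weight is zero.\<close>
    define f1 where "f1 = restrict (%x. 1 - \<theta> a x) (topspace T)"
    define f2 where "f2 = restrict (\<theta> a) (topspace T)"
    have f12: "f1 \<in> carrier ?R" "f2 \<in> carrier ?R"
      unfolding f1_def f2_def using c\<theta> a by (intro restrict_cont_ring continuous_map_diff; simp)+
    define h1 :: "nat multiset => 'x => real" where "h1 = R.indexed_const f1"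
    define h2 :: "nat multiset => 'x => real" where "h2 = R.indexed_const f2"
    have h12: "h1 \<in> carrier S" "h2 \<in> carrier S"
      unfolding h1_def h2_def S_def by (rule R.mpoly_const[OF f12(1)], rule R.mpoly_const[OF f12(2)])
    have lh: "lookup (ev x h1) \<mu> = (if \<mu> = {#} then 1 - \<theta> a x else 0)" "lookup (ev x h2) \<mu> = (if \<mu> = {#} then \<theta> a x else 0)"
      if "x \<in> topspace T" for x \<mu>
      using ev_const[OF f12(1) that] ev_const[OF f12(2) that] that by (simp_all add: h1_def h2_def f1_def f2_def)
    \<comment> \<open>The two matrices of the equivalence are \<open>P (Suc a) a\<close> and
      \<open>P a (Suc a)\<close>. At points where \<open>\<phi> (Suc a)\<close> and
      \<open>\<phi> a\<close> agree they evaluate to the scaled matrix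
      \<open>e \<oplus> 1\<close>.\<close>
    define P where "P s t i j = h1 \<otimes>\<^bsub>S\<^esub> block S n (\<epsilon> s) i j \<oplus>\<^bsub>S\<^esub>
      h2 \<otimes>\<^bsub>S\<^esub> (\<Oplus>\<^bsub>S\<^esub>k\<in>{..<c}. scale T (\<phi> s) (\<alpha> i k) \<otimes>\<^bsub>S\<^esub> scale T (\<phi> t) (\<beta> k j))" for s t i j
    have bS: "block S n (\<epsilon> s) i j \<in> carrier S" for s i j by (simp add: block_def \<epsilon>S)
    have PS: "P s t i j \<in> carrier S" for s t i j
      unfolding P_def by (intro S.a_closed S.m_closed h12 bS sumS sc abS)
    have evb: "ev x (block S n (\<epsilon> s) i j) = pscale (\<phi> s x) (eblock n (?l x e) i j)" if x: "x \<in> topspace T" for x s i j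
      using evs[OF e x] type_homD(3,4)[OF hx[OF x]] by (simp add: block_def \<epsilon>_def lift_mats_def pscale_simps)
    have evP: "?l x (P s t) i j = ev x h1 * pscale (\<phi> s x) (eblock n (?l x e) i j) +
        ev x h2 * mm c (%i j. pscale (\<phi> s x) (?l x \<alpha> i j)) (%i j. pscale (\<phi> t x) (?l x \<beta> i j)) i j"
      if x: "x \<in> topspace T" for x s t i j
    proof -
      let ?s = "\<Oplus>\<^bsub>S\<^esub>k\<in>{..<c}. scale T (\<phi> s) (\<alpha> i k) \<otimes>\<^bsub>S\<^esub> scale T (\<phi> t) (\<beta> k j)"
      have sS: "?s \<in> carrier S" by (intro sumS sc abS)
      have "ev x ?s = mm c (%i j. pscale (\<phi> s x) (?l x \<alpha> i j)) (%i j. pscale (\<phi> t x) (?l x \<beta> i j)) i j"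
      proof -
        have "ev x ?s = mm c (?l x (%i k. scale T (\<phi> s) (\<alpha> i k))) (?l x (%k j. scale T (\<phi> t) (\<beta> k j))) i j"
          by (rule ev_mm[OF x]) (intro sc abS)+
        then show ?thesis by (simp add: lift_mats_def evs[OF abS(1) x] evs[OF abS(2) x])
      qed
      moreover have "ev x (P s t i j) = ev x h1 * ev x (block S n (\<epsilon> s) i j) + ev x h2 * ev x ?s"
        unfolding P_def using h12 bS sS by (simp add: type_homD(1,2)[OF hx[OF x]])
      moreover have "?l x (P s t) i j = ev x (P s t i j)" by (simp add: lift_mats_def)
      ultimately show ?thesis by (simp only: evb[OF x])
    qed
    have prod: "(\<Oplus>\<^bsub>S\<^esub>k\<in>{..<?N}. P s t i k \<otimes>\<^bsub>S\<^esub> P t s k j) = block S n (\<epsilon> s) i j"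
      if ij: "i < ?N" "j < ?N" and st': "s = Suc a \<and> t = a \<or> s = a \<and> t = Suc a" for s t i j
    proof (rule eqS[OF sumS[OF PS PS] bS])
      fix x assume x: "x \<in> topspace T"
      have one: "ev x h1 = 0 \<and> ev x h2 = 1" if "\<theta> a x = 1"
        using that by (auto intro!: poly_mapping_eqI simp: lh[OF x] lookup_one when_def)
      have zero: "ev x h2 = 0" if "\<theta> a x = 0" using that by (auto intro!: poly_mapping_eqI simp: lh[OF x])
      have "mm ?N (?l x (P s t)) (?l x (P t s)) i j = pscale (\<phi> s x) (eblock n (?l x e) i j)"
      proof (rule glue_pointwise[where c = c and \<alpha> = "?l x \<alpha>" and \<beta> = "?l x \<beta>" and ?k1.0 = "ev x h1" and ?k2.0 = "ev x h2"
            and v = "\<phi> t x"])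
        show "mm ?N (eblock n (?l x e)) (eblock n (?l x e)) i j = eblock n (?l x e) i j" if "i < ?N" "j < ?N" for i j
          by (rule eblock_idempotent[OF ex[OF x] that])
        show "ev x h1 + ev x h2 = 1"
          by (rule poly_mapping_eqI) (simp add: lh[OF x] lookup_one lookup_add when_def)
        have tr: "\<theta> a x \<noteq> 0 ==> \<forall>i<?N. \<forall>j<?N. mm c (?l x \<alpha>) (?l x \<beta>) i j = eblock n (?l x e) i j"
          "\<theta> a x \<noteq> 0 ==> \<forall>i<c. \<forall>j<c. mm ?N (?l x \<beta>) (?l x \<alpha>) i j = idm c i j"
          unfolding lab using stabilizes_join[OF st[OF x]] by blast+
        show "ev x h1 = 0 \<and> ev x h2 = 1 \<and> (\<forall>i<?N. \<forall>j<?N. mm c (?l x \<alpha>) (?l x \<beta>) i j = eblock n (?l x e) i j) \<and>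
            (\<forall>i<c. \<forall>j<c. mm ?N (?l x \<beta>) (?l x \<alpha>) i j = idm c i j) \<or>
          \<phi> s x = \<phi> t x \<and> (ev x h2 = 0 \<or> (\<forall>i<?N. \<forall>j<?N. mm c (?l x \<alpha>) (?l x \<beta>) i j = eblock n (?l x e) i j))"
        proof (cases "\<theta> a x = 1")
          case True
          then show ?thesis using one tr by simp
        next
          case False
          then have "\<phi> s x = \<phi> t x" using step[rule_format, OF a x] st' by auto
          then show ?thesis using zero tr by blast
        qed
      qed (use evP[OF x] ij in simp_all)
      moreover have "ev x (\<Oplus>\<^bsub>S\<^esub>k\<in>{..<?N}. P s t i k \<otimes>\<^bsub>S\<^esub> P t s k j) = mm ?N (?l x (P s t)) (?l x (P t s)) i j"
        by (rule ev_mm[OF x]) (rule PS)+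
      ultimately show "ev x (\<Oplus>\<^bsub>S\<^esub>k\<in>{..<?N}. P s t i k \<otimes>\<^bsub>S\<^esub> P t s k j) = ev x (block S n (\<epsilon> s) i j)"
        by (simp only: evb[OF x])
    qed
    show ?thesis
      by (rule exI[of _ "P (Suc a) a"], rule exI[of _ "P a (Suc a)"]) (auto simp: PS prod)
  qed
  note steps = this
  show ?thesis
    by (rule exI[of _ K], rule exI[of _ \<epsilon>], rule exI[of _ b]) (intro conjI allI impI \<epsilon>S \<epsilon>\<epsilon> \<epsilon>0 \<epsilon>K steps)
qed

section \<open>Rings of continuous functions on F-spaces\<close>

text \<open>Sums in the ring of continuous functions evaluate pointwise, which translates between
  \<open>global_split\<close> and identities of ring elements.\<close>

lemma F_space_split_kernels:
  assumes F: "F_space T"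
  shows "split_kernels (cont_ring T)"
  unfolding split_kernels_def
proof (intro allI impI)
  let ?R = "cont_ring T"
  interpret R: cring ?R by (rule cont_ring_cring)
  fix n k q :: nat and D w :: "nat => nat => 'a => real"
  assume D: "\<forall>i j. D i j \<in> carrier ?R" and w: "\<forall>l j. w l j \<in> carrier ?R"
    and Dw: "\<forall>l<q. \<forall>i<n. (\<Oplus>\<^bsub>?R\<^esub>j\<in>{..<k}. D i j \<otimes>\<^bsub>?R\<^esub> w l j) = \<zero>\<^bsub>?R\<^esub>"
  have pw: "(\<Sum>j<k. D i j x * w l j x) = 0" if "l < q" "i < n" "x \<in> topspace T" for l i x
  proof -
    have "(\<Oplus>\<^bsub>?R\<^esub>j\<in>{..<k}. D i j \<otimes>\<^bsub>?R\<^esub> w l j) x = (\<Sum>j<k. D i j x * w l j x)"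
      by (rule cont_finsum_eval[OF that(3)]) (use D w in auto)
    then show ?thesis using Dw that by (simp add: cont_ring_simps)
  qed
  obtain Pm where P: "\<forall>i j. Pm i j \<in> carrier ?R"
    and DP: "\<forall>x\<in>topspace T. \<forall>i<n. \<forall>j<k. (\<Sum>l<k. D i l x * Pm l j x) = 0"
    and Pw: "\<forall>x\<in>topspace T. \<forall>l<q. \<forall>i<k. (\<Sum>j<k. Pm i j x * w l j x) = w l i x"
    using global_split[OF F D w, of q n k] pw by (elim exE conjE meta_impE) (simp, rule that)
  have "mat_mult ?R k D Pm i j = \<zero>\<^bsub>?R\<^esub>" if "i < n" "j < k" for i j
    unfolding mat_mult_def
  proof (rule cont_ring_eqI[of _ T])
    fix x assume x: "x \<in> topspace T"
    have "(\<Oplus>\<^bsub>?R\<^esub>l\<in>{..<k}. D i l \<otimes>\<^bsub>?R\<^esub> Pm l j) x = (\<Sum>l<k. D i l x * Pm l j x)"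
      by (rule cont_finsum_eval[OF x]) (use D P in auto)
    then show "(\<Oplus>\<^bsub>?R\<^esub>l\<in>{..<k}. D i l \<otimes>\<^bsub>?R\<^esub> Pm l j) x = \<zero>\<^bsub>?R\<^esub> x" using DP x that by (simp add: cont_ring_simps)
  qed (use D P in \<open>auto intro!: R.finsum_closed\<close>)
  moreover have "(\<Oplus>\<^bsub>?R\<^esub>j\<in>{..<k}. Pm i j \<otimes>\<^bsub>?R\<^esub> w l j) = w l i" if "l < q" "i < k" for l i
  proof (rule cont_ring_eqI[of _ T])
    fix x assume x: "x \<in> topspace T"
    have "(\<Oplus>\<^bsub>?R\<^esub>j\<in>{..<k}. Pm i j \<otimes>\<^bsub>?R\<^esub> w l j) x = (\<Sum>j<k. Pm i j x * w l j x)"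
      by (rule cont_finsum_eval[OF x]) (use w P in auto)
    then show "(\<Oplus>\<^bsub>?R\<^esub>j\<in>{..<k}. Pm i j \<otimes>\<^bsub>?R\<^esub> w l j) x = w l i x" using Pw x that by simp
  qed (use w P in \<open>auto intro!: R.finsum_closed\<close>)
  ultimately show "\<exists>Pm. (\<forall>i j. Pm i j \<in> carrier ?R) \<and> (\<forall>i<n. \<forall>j<k. mat_mult ?R k D Pm i j = \<zero>\<^bsub>?R\<^esub>) \<and>
      (\<forall>l<q. \<forall>i<k. (\<Oplus>\<^bsub>?R\<^esub>j\<in>{..<k}. Pm i j \<otimes>\<^bsub>?R\<^esub> w l j) = w l i)"
    using P by (intro exI[of _ Pm]) blast
qed

lemma (in cring) indexed_const_hom: "indexed_const \<in> ring_hom R (mpoly_ring R m)"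
proof (rule ring_hom_memI)
  fix a b assume a: "a \<in> carrier R" and b: "b \<in> carrier R"
  show "indexed_const a \<in> carrier (mpoly_ring R m)" by (rule mpoly_const[OF a])
  show "indexed_const (a \<otimes> b) = indexed_const a \<otimes>\<^bsub>mpoly_ring R m\<^esub> indexed_const b"
  proof
    fix \<mu> :: "nat multiset"
    have "(\<Oplus>\<nu>\<in>{\<nu>. \<nu> \<subseteq># \<mu>}. indexed_const a \<nu> \<otimes> indexed_const b (\<mu> - \<nu>)) = indexed_const (a \<otimes> b) \<mu>"
    proof (cases "\<mu> = {#}")
      case True
      then have "{\<nu>. \<nu> \<subseteq># \<mu>} = {{#}}" by auto
      then show ?thesis using True a b by (simp add: indexed_const_def)
    next
      case False
      then have "indexed_const a \<nu> \<otimes> indexed_const b (\<mu> - \<nu>) = \<zero>" for \<nu>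
        using a b by (auto simp: indexed_const_def)
      then show ?thesis using False by (simp add: indexed_const_def)
    qed
    then show "indexed_const (a \<otimes> b) \<mu> = (indexed_const a \<otimes>\<^bsub>mpoly_ring R m\<^esub> indexed_const b) \<mu>"
      by (simp add: mpoly_simps)
  qed
  show "indexed_const (a \<oplus> b) = indexed_const a \<oplus>\<^bsub>mpoly_ring R m\<^esub> indexed_const b"
    by (auto simp: mpoly_simps indexed_const_def)
qed (simp add: mpoly_ring_def)

text \<open>Evaluation at zero, which serves as the retraction \<open>g\<close> in
  \<open>K0_map_iso\<close>.\<close>

lemma (in cring) const_coeff_hom: "(%p. p {#}) \<in> ring_hom (mpoly_ring R m) R"
proof (rule ring_hom_memI)
  fix p q assume p: "p \<in> carrier (mpoly_ring R m)" and q: "q \<in> carrier (mpoly_ring R m)"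
  show "p {#} \<in> carrier R" by (rule mpoly_carrierD(1)[OF p])
  have "{\<nu>. \<nu> \<subseteq># {#}} = {{#} :: nat multiset}" by auto
  then show "(p \<otimes>\<^bsub>mpoly_ring R m\<^esub> q) {#} = p {#} \<otimes> q {#}"
    using mpoly_carrierD(1)[OF p, of "{#}"] mpoly_carrierD(1)[OF q, of "{#}"] by (simp add: mpoly_simps)
qed (simp_all add: mpoly_simps)

lemma block_gram_sum: "block S n e = gram_sum S n e (%i j. if i = j then \<one>\<^bsub>S\<^esub> else \<zero>\<^bsub>S\<^esub>)"
  by (intro ext) (auto simp: block_def gram_sum_def)

text \<open>The two matrices of each homotopy step are the data of \<open>mat_equiv\<close>. The
  types of coefficients are infinite because the reals are.\<close>

lemma F_space_K0_regular:
  fixes T :: "'x topology"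
  assumes F: "F_space T"
  shows "K0_regular (cont_ring T)"
  unfolding K0_regular_def
proof (intro allI impI)
  fix m :: nat
  let ?R = "cont_ring T" and ?S = "mpoly_ring (cont_ring T) m"
  interpret R: cring ?R by (rule cont_ring_cring)
  interpret S: cring ?S by (rule mpoly_cring)
  have inf: "infinite (UNIV :: ('x => real) set)"
    using finite_fun_UNIVD2[where 'a = 'x and 'b = real] infinite_UNIV_char_0 by blast
  have infR: "infinite (UNIV :: (nat => 'x => real) set)"
    using finite_fun_UNIVD2[where 'a = nat and 'b = "'x => real"] inf by blast
  have infS: "infinite (UNIV :: (nat => nat multiset => 'x => real) set)"
    using finite_fun_UNIVD2[where 'a = nat and 'b = "nat multiset => 'x => real"]
      finite_fun_UNIVD2[where 'a = "nat multiset" and 'b = "'x => real"] inf by blast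
  have K: "K0_change ?R ?S R.indexed_const"
    by (rule K0_change.intro[OF large_cring.intro[OF R.cring_axioms large_cring_axioms.intro[OF infR]]
        large_cring.intro[OF S.cring_axioms large_cring_axioms.intro[OF infS]]
        K0_change_axioms.intro[OF R.indexed_const_hom]])
  show "K0_map ?R ?S R.indexed_const \<in> iso (K0 ?R) (K0 ?S)"
  proof (rule K0_change.K0_map_iso[OF K R.const_coeff_hom])
    show "R.indexed_const a {#} = a" for a by (simp add: R.indexed_const_def)
    fix n :: nat and e :: "nat => nat => nat multiset => 'x => real"
    assume e: "\<forall>i j. e i j \<in> carrier ?S" and ee: "\<forall>i<n. \<forall>j<n. mat_mult ?S n e e i j = e i j"
    have "\<exists>K \<epsilon> b. (\<forall>a i j. \<epsilon> a i j \<in> carrier ?S) \<and>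
      (\<forall>a. \<forall>i<n. \<forall>j<n. mat_mult ?S n (\<epsilon> a) (\<epsilon> a) i j = \<epsilon> a i j) \<and>
      (\<forall>i j. \<epsilon> (0::nat) i j = R.indexed_const (e i j {#})) \<and> (\<forall>i j. \<epsilon> K i j = e i j) \<and>
      (\<forall>a<K. \<exists>V W. (\<forall>i j. V i j \<in> carrier ?S) \<and> (\<forall>i j. W i j \<in> carrier ?S) \<and>
       (\<forall>i<n + b a. \<forall>j<n + b a. mat_mult ?S (n + b a) V W i j = block ?S n (\<epsilon> (Suc a)) i j \<and>
          mat_mult ?S (n + b a) W V i j = block ?S n (\<epsilon> a) i j))"
      unfolding mat_mult_def by (rule idempotent_homotopy[OF F]) (use e ee in \<open>auto simp: mat_mult_def\<close>)
    then obtain K \<epsilon> b where \<epsilon>: "\<forall>a i j. \<epsilon> a i j \<in> carrier ?S"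
        "\<forall>a. \<forall>i<n. \<forall>j<n. mat_mult ?S n (\<epsilon> a) (\<epsilon> a) i j = \<epsilon> a i j"
        "\<forall>i j. \<epsilon> (0::nat) i j = R.indexed_const (e i j {#})" "\<forall>i j. \<epsilon> K i j = e i j"
      and VW: "\<forall>a<K. \<exists>V W. (\<forall>i j. V i j \<in> carrier ?S) \<and> (\<forall>i j. W i j \<in> carrier ?S) \<and>
       (\<forall>i<n + b a. \<forall>j<n + b a. mat_mult ?S (n + b a) V W i j = block ?S n (\<epsilon> (Suc a)) i j \<and>
          mat_mult ?S (n + b a) W V i j = block ?S n (\<epsilon> a) i j)"
      by (elim exE conjE) (rule that)
    have "mat_equiv ?S (n + b a) (block ?S n (\<epsilon> (Suc a))) (n + b a) (block ?S n (\<epsilon> a))" if a: "a < K" for a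
    proof -
      obtain V W where VW: "(\<forall>i j. V i j \<in> carrier ?S) \<and> (\<forall>i j. W i j \<in> carrier ?S) \<and>
       (\<forall>i<n + b a. \<forall>j<n + b a. mat_mult ?S (n + b a) V W i j = block ?S n (\<epsilon> (Suc a)) i j \<and>
          mat_mult ?S (n + b a) W V i j = block ?S n (\<epsilon> a) i j)" using VW[rule_format, OF a] by (elim exE)
      show ?thesis unfolding mat_equiv_def by (rule exI[of _ V], rule exI[of _ W]) (use VW in simp)
    qed
    then have eq: "\<forall>a<K. mat_equiv ?S (n + b a) (gram_sum ?S n (\<epsilon> (Suc a)) (%i j. if i = j then \<one>\<^bsub>?S\<^esub> else \<zero>\<^bsub>?S\<^esub>))
        (n + b a) (gram_sum ?S n (\<epsilon> a) (%i j. if i = j then \<one>\<^bsub>?S\<^esub> else \<zero>\<^bsub>?S\<^esub>))"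
      unfolding block_gram_sum by blast
    show "\<exists>K \<epsilon> b. (\<forall>a i j. \<epsilon> a i j \<in> carrier ?S) \<and> (\<forall>a. \<forall>i<n. \<forall>j<n. mat_mult ?S n (\<epsilon> a) (\<epsilon> a) i j = \<epsilon> a i j) \<and>
        (\<forall>i j. \<epsilon> (0::nat) i j = R.indexed_const (e i j {#})) \<and> (\<forall>i j. \<epsilon> K i j = e i j) \<and>
        (\<forall>a<K. mat_equiv ?S (n + b a) (gram_sum ?S n (\<epsilon> (Suc a)) (%i j. if i = j then \<one>\<^bsub>?S\<^esub> else \<zero>\<^bsub>?S\<^esub>))
           (n + b a) (gram_sum ?S n (\<epsilon> a) (%i j. if i = j then \<one>\<^bsub>?S\<^esub> else \<zero>\<^bsub>?S\<^esub>)))"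
      by (rule exI[of _ K], rule exI[of _ \<epsilon>], rule exI[of _ b], intro conjI; fact)
  qed
qed

theorem proposition8p11:
  fixes T :: "'x topology"
  assumes "F_space T"
  shows "two_coherent_regular TYPE('m) (cont_ring T) \<and> K0_regular (cont_ring T)"
proof -
  \<comment> \<open>\<open>split_kernels_regular\<close> asks for an infinite type of ring elements;
    functions into the reals form one.\<close>
  have inf: "infinite (UNIV :: ('x => real) set)"
    using finite_fun_UNIVD2[where 'a = 'x and 'b = real] infinite_UNIV_char_0 by blast
  show ?thesis
    unfolding two_coherent_regular_def
    using split_kernels_two_coherent[OF cont_ring_cring F_space_split_kernels[OF assms]]
      split_kernels_regular[OF cont_ring_cring F_space_split_kernels[OF assms] inf] F_space_K0_regular[OF assms] by blast
qed

end
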